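(* Let $\alpha\in(1,2)$, let $L^{(\alpha)}$ be the strictly $\alpha$-stable Lévy process without negative jumps, starting from one, normalized as in the context, let $T=\inf\{t>0:\ L^{(\alpha)}_t=0\}$ and $\mathcal{A}_\alpha=\int_0^T L^{(\alpha)}_s\,ds$. Then $\mathcal{A}_\alpha$ has a density $f_{\mathcal{A}_\alpha}$ on $(0,\infty)$ given by the convergent series $$f_{\mathcal{A}_\alpha}(x)=\Gamma\left(\frac{\alpha}{\alpha+1}\right)\times\sum_{n=0}^\infty\frac{(-1)^n(\alpha+1)^{\frac{n+1}{\alpha+1}-1}\,x^{-\frac{n+1}{\alpha+1}-1}}{n!\,\Gamma\left(1-\frac{n+1}{\alpha+1}\right)\Gamma\left(1-\frac{n+2}{\alpha+1}\right)},\qquad x>0.$$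
   Context: For $\alpha\in(1,2)$, $\{L^{(\alpha)}_t,\ t\ge 0\}$ denotes a strictly $\alpha$-stable Lévy process without negative jumps (spectrally positive), started from $L^{(\alpha)}_0=1$, with the normalization $\mathbb{E}[e^{-\lambda (L^{(\alpha)}_1-L^{(\alpha)}_0)}]=e^{\lambda^\alpha}$ for all $\lambda\ge 0$. Convention: $1/\Gamma(z)=0$ when $z$ is a non-positive integer. *)

theory Defs
  imports "HOL-Probability.Probability"
begin

text \<open>
  A process is a family \<open>X :: real \<Rightarrow> 'a \<Rightarrow> real\<close> of random variables on \<open>M\<close>; only
  the times \<open>t \<ge> 0\<close> matter.
\<close>

definition cadlag :: "(real \<Rightarrow> real) \<Rightarrow> bool" where
  "cadlag w \<longleftrightarrow>
     (\<forall>t\<ge>0. continuous (at_right t) w) \<and>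
     (\<forall>t>0. \<exists>l. (w \<longlongrightarrow> l) (at_left t))"

definition no_negative_jumps :: "(real \<Rightarrow> real) \<Rightarrow> bool" where
  "no_negative_jumps w \<longleftrightarrow> (\<forall>t>0. \<forall>l. (w \<longlongrightarrow> l) (at_left t) \<longrightarrow> l \<le> w t)"

text \<open>
  Stochastic continuity is not listed because it follows from right-continuity and the
  stationarity of the increments.
\<close>

definition levy_process :: "'a measure \<Rightarrow> real \<Rightarrow> (real \<Rightarrow> 'a \<Rightarrow> real) \<Rightarrow> bool" where
  "levy_process M x X \<longleftrightarrow>
     prob_space M \<and>
     (\<forall>t\<ge>0. X t \<in> borel_measurable M) \<and>
     (AE \<omega> in M. X 0 \<omega> = x) \<and>
     (\<forall>t :: nat \<Rightarrow> real. 0 \<le> t 0 \<longrightarrow> incseq t \<longrightarrow>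
        (\<forall>n. prob_space.indep_vars M (\<lambda>_. borel) (\<lambda>i \<omega>. X (t (Suc i)) \<omega> - X (t i) \<omega>) {..<n})) \<and>
     (\<forall>s\<ge>0. \<forall>h\<ge>0.
        distr M borel (\<lambda>\<omega>. X (s + h) \<omega> - X s \<omega>) = distr M borel (\<lambda>\<omega>. X h \<omega> - X 0 \<omega>)) \<and>
     (AE \<omega> in M. cadlag (\<lambda>t. X t \<omega>))"

text \<open>
  Self-similarity of the process shifted to start at the origin, as an equality of laws on
  path space with the product \<open>\<sigma>\<close>-algebra.
\<close>

definition strictly_stable :: "real \<Rightarrow> 'a measure \<Rightarrow> (real \<Rightarrow> 'a \<Rightarrow> real) \<Rightarrow> bool" where
  "strictly_stable \<alpha> M X \<longleftrightarrow>
     (\<forall>c>0.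
        distr M (Pi\<^sub>M {0..} (\<lambda>_. borel)) (\<lambda>\<omega>. \<lambda>t\<in>{0..}. X (c * t) \<omega> - X 0 \<omega>) =
        distr M (Pi\<^sub>M {0..} (\<lambda>_. borel)) (\<lambda>\<omega>. \<lambda>t\<in>{0..}. c powr (1 / \<alpha>) * (X t \<omega> - X 0 \<omega>)))"

text \<open>
  \<open>has_bochner_integral\<close> includes the finiteness of the exponential moments.
\<close>

definition spectrally_positive_stable_from ::
    "real \<Rightarrow> 'a measure \<Rightarrow> real \<Rightarrow> (real \<Rightarrow> 'a \<Rightarrow> real) \<Rightarrow> bool" where
  "spectrally_positive_stable_from \<alpha> M x L \<longleftrightarrow>
     levy_process M x L \<and>
     strictly_stable \<alpha> M L \<and>
     (AE \<omega> in M. no_negative_jumps (\<lambda>t. L t \<omega>)) \<and>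
     (\<forall>q\<ge>0. has_bochner_integral M (\<lambda>\<omega>. exp (- q * (L 1 \<omega> - L 0 \<omega>))) (exp (q powr \<alpha>)))"

text \<open>The value is \<open>\<infinity>\<close> if the path never hits zero.\<close>

definition hitting_time_zero :: "(real \<Rightarrow> real) \<Rightarrow> ereal" where
  "hitting_time_zero w = (INF t\<in>{t. 0 < t \<and> w t = 0}. ereal t)"

text \<open>
  Path properties are only required almost surely, so the area functional below is in
  general measurable only with respect to the completion of \<open>M\<close>; its law is therefore to be taken under
  \<open>completion M\<close>.
\<close>

definition area_until_zero :: "(real \<Rightarrow> real) \<Rightarrow> real" where
  "area_until_zero w = (LBINT s=0..hitting_time_zero w. w s)"

text \<open>
  \<open>rGamma\<close> is the entire function \<open>1 / \<Gamma>\<close>, which vanishes at the non-positive integers.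
\<close>

definition area_density_term :: "real \<Rightarrow> real \<Rightarrow> nat \<Rightarrow> real" where
  "area_density_term \<alpha> x n =
     (- 1) ^ n * (\<alpha> + 1) powr ((real n + 1) / (\<alpha> + 1) - 1)
       * x powr (- ((real n + 1) / (\<alpha> + 1)) - 1) / fact n
       * rGamma (1 - (real n + 1) / (\<alpha> + 1)) * rGamma (1 - (real n + 2) / (\<alpha> + 1))"

definition area_density :: "real \<Rightarrow> real \<Rightarrow> real" where
  "area_density \<alpha> x = Gamma (\<alpha> / (\<alpha> + 1)) * (\<Sum>n. area_density_term \<alpha> x n)"

end

theory Submission
  imports Defs "HOL-Complex_Analysis.Complex_Analysis" "HOL-Real_Asymp.Real_Asymp"
begin

text \<open>
  Put \<open>p = \<alpha> + 1\<close> and let \<open>V z\<close> be the sum of \<open>rGamma (1 - (n + 1) / p) * (- z) ^ n / n!\<close>. Up to a constant,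
  \<open>V (y * (p * q) powr (1 / p))\<close> is the integral of \<open>exp (w powr p / (p * q) - y * w)\<close> over the imaginary axis.
  In the joint transform of the process and its area, time \<open>t\<close> shifts \<open>w\<close> to \<open>w + q * t\<close>, and moving the
  contour back shows that \<open>exp (- q * area t) * V (L t * (p * q) powr (1 / p))\<close> is a martingale.
  As \<open>L\<close> has no negative jumps it is zero when it first reaches the negative half-line, and optional stopping
  yields the Laplace transform \<open>V ((p * q) powr (1 / p)) / V 0\<close> of the area.

  Integrating \<open>(1 - V z / V 0) / (z * (q - z powr p / p))\<close> around the sector \<open>\<bar>arg z\<bar> \<le> pi / 4\<close>, with a
  residue at \<open>z = (p * q) powr (1 / p)\<close>, exhibits the Laplace transform of the tail of the area as that of an
  explicit power series in \<open>x powr (- 1 / p)\<close>. By uniqueness of Laplace transforms this series is the tail,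
  and its derivative gives the density.
\<close>

text \<open>Everything rests on \<open>2 < p < 3\<close>: then \<open>w powr p\<close> has negative
  real part on the imaginary axis, where the kernel must decay, and on the rays at angles
  \<open>pi / 4\<close> and \<open>- pi / 4\<close>, where \<open>1 / (q - z powr p / p)\<close>
  must decay, while inside that sector the denominator has a single zero. The reciprocal Gammas come
  from integrating term by term along such rays and from the reflection formula.

  The data are a real Laplace exponent and independence of increments along a grid. So the
  martingale identity is proved for Riemann sums and carried to the limit. Between grid times the
  path may be negative, \<open>exp (- q * area)\<close> is unbounded, and the limits over
  refinements rely on bounds for second moments.

  The stopping time here is the passage to the negative half-line seen at dyadic times, whereas the
  statement integrates up to the first zero, which might come earlier. The two areas are identified
  almost surely only at the end: the area of \<open>L - y\<close> up to its own passage is a lower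
  bound for both, and its Laplace transform tends to that of the larger one as \<open>y\<close>
  tends to 0.\<close>

lemma norm_exp_minus_one_le: "norm (exp w - 1) \<le> norm w * exp (norm w)" for w :: complex
proof -
  have "norm (exp w - exp 0) \<le> exp (norm w) * norm (w - 0)"
  proof (rule field_differentiable_bound[of "cball 0 (norm w)" exp exp])
    fix z :: complex assume z: "z \<in> cball 0 (norm w)"
    show "(exp has_field_derivative exp z) (at z within cball 0 (norm w))"
      by (rule DERIV_subset[OF DERIV_exp]) auto
    have "norm (exp z) \<le> exp (norm z)" by (rule norm_exp)
    also have "\<dots> \<le> exp (norm w)" using z by simp
    finally show "norm (exp z) \<le> exp (norm w)" .
  qed auto
  then show ?thesis by (simp add: mult.commute)
qed

lemma laplace_integrable_complex:
  fixes X :: "'a \<Rightarrow> real" and z :: complex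
  assumes [measurable]: "X \<in> borel_measurable N" and int: "integrable N (\<lambda>\<omega>. exp (- Re z * X \<omega>))"
  shows "integrable N (\<lambda>\<omega>. exp (- z * X \<omega>))"
  by (rule Bochner_Integration.integrable_bound[OF int]) (auto simp: norm_exp_eq_Re)

text \<open>Differentiation under the integral: near \<open>z\<close> the difference quotients have
  a common integrable bound. Two exponentials are needed in that bound because \<open>X\<close> may
  take both signs.\<close>

lemma laplace_holomorphic:
  fixes X :: "'a \<Rightarrow> real"
  assumes X[measurable]: "X \<in> borel_measurable N"
    and int: "\<And>q. q > 0 \<Longrightarrow> integrable N (\<lambda>\<omega>. exp (- q * X \<omega>))"
  shows "(\<lambda>z::complex. \<integral>\<omega>. exp (- z * X \<omega>) \<partial>N) holomorphic_on {z. 0 < Re z}"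
proof (subst holomorphic_on_open)
  show "open {z. 0 < Re z}" by (rule open_halfspace_Re_gt)
  show "\<forall>z\<in>{z. 0 < Re z}. \<exists>f'. ((\<lambda>z::complex. \<integral>\<omega>. exp (- z * X \<omega>) \<partial>N) has_field_derivative f') (at z)"
  proof
    fix z :: complex assume "z \<in> {z. 0 < Re z}"
    define c where "c = Re z"
    have c: "c > 0" using \<open>z \<in> _\<close> by (simp add: c_def)
    define r where "r = c / 4"
    have r: "r > 0" using c by (simp add: r_def)
    have intz: "integrable N (\<lambda>\<omega>. exp (- z' * X \<omega>))" if "Re z' > 0" for z' :: complex
      by (rule laplace_integrable_complex[OF X int[OF that]])
    \<comment> \<open>Each of the factors \<open>\<bar>X\<bar>\<close> and
      \<open>exp (norm h * \<bar>X\<bar>)\<close> costs one \<open>exp (r * \<bar>X\<bar>)\<close>,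
      and the sum of the two exponentials covers both signs of \<open>X\<close>. With
      \<open>r = c / 4\<close> the exponents \<open>c - 2 * r\<close> and \<open>c + 2 * r\<close>
      stay positive, so both terms are integrable.\<close>
    define w where "w = (\<lambda>\<omega>. (1/r) * (exp (- (c - 2*r) * X \<omega>) + exp (- (c + 2*r) * X \<omega>)))"
    have wint: "integrable N w"
      unfolding w_def using c by (intro integrable_mult_right Bochner_Integration.integrable_add int) (auto simp: r_def)
    have bound: "norm ((exp (- (z + h) * X \<omega>) - exp (- z * X \<omega>)) / h) \<le> w \<omega>"
      if h: "h \<noteq> 0" "norm h < r" for h :: complex and \<omega>
    proof -
      let ?x = "X \<omega>"
      have "(exp (- (z + h) * ?x) - exp (- z * ?x)) = exp (- z * ?x) * (exp (- h * ?x) - 1)"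
        by (simp add: algebra_simps mult_exp_exp)
      then have "norm ((exp (- (z + h) * ?x) - exp (- z * ?x)) / h)
           = exp (- c * ?x) * norm (exp (- h * ?x) - 1) / norm h"
        by (simp add: norm_mult norm_divide norm_exp_eq_Re c_def)
      also have "\<dots> \<le> exp (- c * ?x) * (norm (- h * ?x) * exp (norm (- h * ?x))) / norm h"
        by (intro divide_right_mono mult_left_mono norm_exp_minus_one_le) auto
      also have "\<dots> = exp (- c * ?x) * \<bar>?x\<bar> * exp (norm h * \<bar>?x\<bar>)"
        using h by (simp add: norm_mult)
      also have "\<dots> \<le> exp (- c * ?x) * (exp (r * \<bar>?x\<bar>) / r) * exp (r * \<bar>?x\<bar>)"
      proof (intro mult_mono)
        have "r * \<bar>?x\<bar> \<le> exp (r * \<bar>?x\<bar>)" using exp_ge_add_one_self[of "r * \<bar>?x\<bar>"] by linarith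
        then show "\<bar>?x\<bar> \<le> exp (r * \<bar>?x\<bar>) / r" using r by (simp add: field_simps)
        show "exp (norm h * \<bar>?x\<bar>) \<le> exp (r * \<bar>?x\<bar>)" using h by (simp add: mult_right_mono)
      qed (use r in auto)
      also have "\<dots> = (1/r) * exp (- c * ?x + 2 * r * \<bar>?x\<bar>)"
        by (simp add: exp_add[symmetric] exp_diff[symmetric] field_simps)
      also have "\<dots> \<le> w \<omega>"
      proof -
        have "- c * ?x + 2 * r * \<bar>?x\<bar> = - (c - 2*r) * ?x \<or> - c * ?x + 2 * r * \<bar>?x\<bar> = - (c + 2*r) * ?x"
          by (auto simp: abs_if algebra_simps)
        then have "exp (- c * ?x + 2 * r * \<bar>?x\<bar>) \<le> exp (- (c - 2*r) * ?x) + exp (- (c + 2*r) * ?x)"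
          by (metis add.commute exp_ge_zero le_add_same_cancel2)
        then show ?thesis unfolding w_def using r by (intro mult_left_mono) auto
      qed
      finally show ?thesis .
    qed
    have "((\<lambda>h. ((\<integral>\<omega>. exp (- (z + h) * X \<omega>) \<partial>N) - (\<integral>\<omega>. exp (- z * X \<omega>) \<partial>N)) / h) \<longlongrightarrow>
             (\<integral>\<omega>. - of_real (X \<omega>) * exp (- z * X \<omega>) \<partial>N)) (at 0)"
      unfolding tendsto_at_iff_sequentially
    proof (intro allI impI, unfold o_def)
      fix h :: "nat \<Rightarrow> complex"
      assume h0: "\<forall>i. h i \<in> UNIV - {0}" and h: "h \<longlonglongrightarrow> 0"
      have "\<forall>\<^sub>F n in sequentially. norm (h n) < r"
        using h r by (metis (full_types) tendsto_norm_zero order_tendstoD(2))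
      then obtain n0 where n0: "\<And>n. n \<ge> n0 \<Longrightarrow> norm (h n) < r"
        by (auto simp: eventually_sequentially)
      have "(\<lambda>n. \<integral>\<omega>. (exp (- (z + h (n + n0)) * X \<omega>) - exp (- z * X \<omega>)) / h (n + n0) \<partial>N) \<longlonglongrightarrow>
             (\<integral>\<omega>. - of_real (X \<omega>) * exp (- z * X \<omega>) \<partial>N)"
      proof (rule integral_dominated_convergence[where w = w])
        show "AE \<omega> in N. (\<lambda>n. (exp (- (z + h (n + n0)) * X \<omega>) - exp (- z * X \<omega>)) / h (n + n0)) \<longlonglongrightarrow>
            - of_real (X \<omega>) * exp (- z * X \<omega>)"
        proof (intro AE_I2)
          fix \<omega>
          have "((\<lambda>z. exp (- z * X \<omega>)) has_field_derivative (- of_real (X \<omega>) * exp (- z * X \<omega>))) (at z)"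
            by (auto intro!: derivative_eq_intros)
          then have "((\<lambda>h. (exp (- (z + h) * X \<omega>) - exp (- z * X \<omega>)) / h) \<longlongrightarrow> - of_real (X \<omega>) * exp (- z * X \<omega>)) (at 0)"
            unfolding DERIV_def .
          then show "(\<lambda>n. (exp (- (z + h (n + n0)) * X \<omega>) - exp (- z * X \<omega>)) / h (n + n0)) \<longlonglongrightarrow> - of_real (X \<omega>) * exp (- z * X \<omega>)"
            unfolding tendsto_at_iff_sequentially o_def
            using h0 LIMSEQ_ignore_initial_segment[OF h, of n0] by auto
        qed
        show "AE \<omega> in N. norm ((exp (- (z + h (n + n0)) * X \<omega>) - exp (- z * X \<omega>)) / h (n + n0)) \<le> w \<omega>" for n
          using h0 n0 by (intro AE_I2 bound) auto
      qed (use wint in auto)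
      moreover have "(\<integral>\<omega>. (exp (- (z + h (n + n0)) * X \<omega>) - exp (- z * X \<omega>)) / h (n + n0) \<partial>N)
         = ((\<integral>\<omega>. exp (- (z + h (n + n0)) * X \<omega>) \<partial>N) - (\<integral>\<omega>. exp (- z * X \<omega>) \<partial>N)) / h (n + n0)" for n
      proof -
        have "Re (z + h (n + n0)) > 0"
          using n0[of "n + n0"] abs_Re_le_cmod[of "h (n + n0)"] c by (auto simp: r_def c_def)
        then show ?thesis
          using intz[of "z + h (n + n0)"] intz[of z] c by (simp add: c_def)
      qed
      ultimately show "(\<lambda>n. ((\<integral>\<omega>. exp (- (z + h n) * X \<omega>) \<partial>N) - (\<integral>\<omega>. exp (- z * X \<omega>) \<partial>N)) / h n) \<longlonglongrightarrow>
             (\<integral>\<omega>. - of_real (X \<omega>) * exp (- z * X \<omega>) \<partial>N)"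
        by - (rule LIMSEQ_offset[of _ n0], simp only:)
    qed
    then show "\<exists>f'. ((\<lambda>z::complex. \<integral>\<omega>. exp (- z * X \<omega>) \<partial>N) has_field_derivative f') (at z)"
      unfolding DERIV_def by blast
  qed
qed

text \<open>Identity theorem: both sides are holomorphic on the right half-plane and agree on the
  positive reals, which accumulate at 1. It turns real transforms into complex ones twice, for
  weighted Lebesgue measure in the Gamma integral and for the increments of
  \<open>L\<close>.\<close>

lemma laplace_analytic_continuation:
  fixes X :: "'a \<Rightarrow> real" and G :: "complex \<Rightarrow> complex"
  assumes X[measurable]: "X \<in> borel_measurable N"
    and int: "\<And>q. q > 0 \<Longrightarrow> has_bochner_integral N (\<lambda>\<omega>. exp (- q * X \<omega>)) (F q)"
    and G: "G holomorphic_on {z. 0 < Re z}"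
    and FG: "\<And>q. q > 0 \<Longrightarrow> G (of_real q) = of_real (F q)"
    and z: "Re z > 0"
  shows "has_bochner_integral N (\<lambda>\<omega>. exp (- z * X \<omega>)) (G z)"
proof -
  have int': "integrable N (\<lambda>\<omega>. exp (- q * X \<omega>))" if "q > 0" for q
    using int[OF that] by (simp add: has_bochner_integral_iff)
  let ?H = "\<lambda>z::complex. \<integral>\<omega>. exp (- z * X \<omega>) \<partial>N"
  have 1: "(\<lambda>z. ?H z - G z) holomorphic_on {z. 0 < Re z}"
    by (intro holomorphic_intros laplace_holomorphic G X int')
  have 2: "?H w - G w = 0" if "w \<in> complex_of_real ` {0<..}" for w
  proof -
    obtain q where q: "w = of_real q" "q > 0" using \<open>w \<in> _\<close> by auto
    have "?H w = (\<integral>\<omega>. complex_of_real (exp (- q * X \<omega>)) \<partial>N)"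
      by (simp add: q exp_of_real[symmetric])
    also have "\<dots> = of_real (F q)"
      using int[OF q(2)] by (simp add: has_bochner_integral_iff)
    finally show ?thesis using FG[OF q(2)] q by simp
  qed
  have 3: "(1::complex) islimpt complex_of_real ` {0<..}"
    unfolding islimpt_sequential
  proof (intro exI conjI allI)
    have "(\<lambda>n. complex_of_real (1 + inverse (real (Suc n)))) \<longlonglongrightarrow> of_real (1 + 0)"
      by (intro tendsto_intros LIMSEQ_inverse_real_of_nat)
    then show "(\<lambda>n. complex_of_real (1 + inverse (real (Suc n)))) \<longlonglongrightarrow> 1" by simp
    fix n show "complex_of_real (1 + inverse (real (Suc n))) \<in> complex_of_real ` {0<..} - {1}"
      by (auto simp del: of_nat_Suc of_real_add intro!: imageI add_pos_pos)
  qed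
  have "?H z - G z = 0"
    by (rule analytic_continuation[OF 1 open_halfspace_Re_gt _ _ _ 3 2])
       (use z in \<open>auto intro!: convex_connected convex_halfspace_Re_gt\<close>)
  then show ?thesis
    using laplace_integrable_complex[OF X int'[OF z]] by (simp add: has_bochner_integral_iff)
qed

section \<open>Gamma integrals and the growth of the Gamma function\<close>

lemma has_bochner_integral_Gamma_real:
  fixes x :: real assumes x: "x > 0"
  shows "has_bochner_integral lborel (\<lambda>t. indicator {0<..} t *\<^sub>R (t powr (x - 1) * exp (- t))) (Gamma x)"
proof -
  have "(\<integral>\<^sup>+t. ennreal (indicator {0..} t * t powr (x - 1) / exp t) \<partial>lborel) = ennreal (Gamma x)"
    by (rule Gamma_conv_nn_integral_real[OF x, symmetric])
  also have "(\<integral>\<^sup>+t. ennreal (indicator {0..} t * t powr (x - 1) / exp t) \<partial>lborel) =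
     (\<integral>\<^sup>+t. ennreal (indicator {0<..} t *\<^sub>R (t powr (x - 1) * exp (- t))) \<partial>lborel)"
    by (intro nn_integral_cong) (auto simp: indicator_def exp_minus field_simps)
  finally show ?thesis
    by (intro has_bochner_integral_nn_integral) (use Gamma_real_pos[OF x] in auto)
qed

text \<open>The substitution \<open>t = q * r powr m\<close> in Euler's integral for
  \<open>Gamma (p / m)\<close>.\<close>

lemma has_bochner_integral_powr_exp_real:
  fixes p m q :: real assumes p: "p > 0" and m: "m > 0" and q: "q > 0"
  shows "has_bochner_integral lborel (\<lambda>r. indicator {0<..} r *\<^sub>R (r powr (p - 1) * exp (- q * r powr m)))
           (Gamma (p / m) / m * q powr (- p / m))"
proof -
  let ?g = "\<lambda>r::real. q * r powr m" and ?g' = "\<lambda>r::real. q * (m * r powr (m - 1))"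
  let ?f = "\<lambda>t::real. t powr (p / m - 1) * exp (- t)"
  have pm: "p / m > 0" using p m by simp
  have der: "(?g has_field_derivative ?g' r) (at r within {0<..})" if "r \<in> {0<..}" for r
    using that
    by (auto intro!: derivative_eq_intros simp: powr_diff)
  have inj: "inj_on ?g {0<..}"
  proof (rule inj_onI)
    fix r s :: real assume rs: "r \<in> {0<..}" "s \<in> {0<..}" "q * r powr m = q * s powr m"
    then have "(r powr m) powr (1/m) = (s powr m) powr (1/m)" using q by simp
    then show "r = s" using rs m by (simp add: powr_powr)
  qed
  have img: "?g ` {0<..} = {0<..}"
  proof (safe)
    fix t :: real assume "t > 0"
    then have "t = ?g ((t/q) powr (1/m))" using q m by (simp add: powr_powr)
    then show "t \<in> ?g ` {0<..}" using \<open>t > 0\<close> q by (intro image_eqI[of _ _ "(t/q) powr (1/m)"]) auto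
  qed (use q in auto)
  have B: "set_integrable lborel {0<..} ?f" "(\<integral>t\<in>{0<..}. ?f t \<partial>lborel) = Gamma (p/m)"
    using has_bochner_integral_Gamma_real[OF pm]
    by (auto simp: has_bochner_integral_iff set_integrable_def set_lebesgue_integral_def)
  have C: "?f absolutely_integrable_on {0<..} \<and> integral {0<..} ?f = Gamma (p/m)"
    using B by (auto simp: set_integrable_def integrable_completion set_borel_integral_eq_integral)
  have "(\<lambda>r. \<bar>?g' r\<bar> * ?f (?g r)) absolutely_integrable_on {0<..} \<and>
        integral {0<..} (\<lambda>r. \<bar>?g' r\<bar> * ?f (?g r)) = Gamma (p/m)"
    by (subst has_absolute_integral_change_of_variables_1'[OF _ der inj]) (use C img in auto)
  note A = this
  have eq: "\<bar>?g' r\<bar> * ?f (?g r) = (m * q powr (p/m)) * (r powr (p - 1) * exp (- q * r powr m))"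
    if "r \<in> {0<..}" for r
  proof -
    have "r > 0" using that by simp
    have e1: "(q * r powr m) powr (p / m - 1) = q powr (p/m - 1) * r powr (p - m)"
      using \<open>r > 0\<close> q m by (simp add: powr_mult powr_powr right_diff_distrib)
    have e2: "r powr (m - 1) * r powr (p - m) = r powr (p - 1)"
      by (simp add: powr_add[symmetric])
    have e3: "q * q powr (p/m - 1) = q powr (p/m)"
      using q by (simp add: powr_diff)
    have e4: "\<bar>?g' r\<bar> = q * m * r powr (m - 1)" using m q by (simp add: abs_mult)
    have "\<bar>?g' r\<bar> * ?f (?g r) =
       m * (q * q powr (p/m - 1)) * (r powr (m - 1) * r powr (p - m)) * exp (- (q * r powr m))"
      unfolding e1 e4 by (simp only: mult_ac)
    then show ?thesis unfolding e2 e3 by (simp only: mult_ac mult_minus_left)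
  qed
  let ?F = "\<lambda>r. (m * q powr (p/m)) * (r powr (p - 1) * exp (- q * r powr m))"
  have "?F absolutely_integrable_on {0<..}"
    by (rule iffD1[OF set_integrable_cong[OF refl refl eq] conjunct1[OF A]])
  moreover have "integral {0<..} ?F = Gamma (p/m)"
    by (rule trans[OF Henstock_Kurzweil_Integration.integral_cong[OF eq, symmetric] conjunct2[OF A]])
  ultimately have D: "?F absolutely_integrable_on {0<..}" "integral {0<..} ?F = Gamma (p/m)" .
  have pos: "m * q powr (p/m) > 0" using m q by simp
  have E: "(\<lambda>r. r powr (p - 1) * exp (- q * r powr m)) absolutely_integrable_on {0<..}"
    using D(1) pos by (subst (asm) set_integrable_mult_right_iff) auto
  then have F: "set_integrable lborel {0<..} (\<lambda>r. r powr (p - 1) * exp (- q * r powr m))"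
    unfolding set_integrable_def by (subst (asm) integrable_completion) auto
  have "m * q powr (p/m) * integral {0<..} (\<lambda>r. r powr (p - 1) * exp (- q * r powr m)) = Gamma (p/m)"
    using D(2) by simp
  then have I: "integral {0<..} (\<lambda>r. r powr (p - 1) * exp (- q * r powr m)) = Gamma (p/m) / (m * q powr (p/m))"
    by (metis pos less_irrefl nonzero_mult_div_cancel_left)
  have "(\<integral>r\<in>{0<..}. r powr (p - 1) * exp (- q * r powr m) \<partial>lborel) = Gamma (p/m) / (m * q powr (p/m))"
    unfolding set_borel_integral_eq_integral(2)[OF F] by (rule I)
  also have "\<dots> = Gamma (p / m) / m * q powr (- p / m)"
    by (simp add: powr_minus_divide)
  finally show ?thesis
    using F by (simp add: has_bochner_integral_iff set_integrable_def set_lebesgue_integral_def)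
qed

text \<open>Analytic continuation of the real case in \<open>q\<close>: the variable is
  \<open>r powr m\<close>, and the weight \<open>r powr (p - 1)\<close> is moved into the
  measure.\<close>

lemma has_bochner_integral_powr_exp:
  fixes p m :: real and w :: complex assumes p: "p > 0" and m: "m > 0" and w: "Re w > 0"
  shows "has_bochner_integral lborel (\<lambda>r. indicator {0<..} r *\<^sub>R (r powr (p - 1) *\<^sub>R exp (- w * r powr m)))
           (Gamma (p / m) / m * w powr (- p / m))"
proof -
  define g where "g = (\<lambda>r::real. indicator {0<..} r * r powr (p - 1))"
  have g[measurable]: "g \<in> borel_measurable borel" and g0: "g r \<ge> 0" for r unfolding g_def by auto
  define N where "N = density lborel (\<lambda>r. ennreal (g r))"
  have "has_bochner_integral N (\<lambda>r. exp (- w * (r powr m))) (of_real (Gamma (p / m) / m) * w powr (- p / m))"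
  proof (rule laplace_analytic_continuation[where F = "\<lambda>q. Gamma (p / m) / m * q powr (- p / m)"])
    show "(\<lambda>r. r powr m) \<in> borel_measurable N" unfolding N_def by simp
    show "has_bochner_integral N (\<lambda>r. exp (- q * r powr m)) (Gamma (p / m) / m * q powr (- p / m))" if "q > 0" for q
      unfolding N_def
      using has_bochner_integral_powr_exp_real[OF p m that] g0
      by (intro has_bochner_integral_density) (auto simp: g_def mult.assoc)
    show "(\<lambda>w. complex_of_real (Gamma (p / m) / m) * w powr (- p / m)) holomorphic_on {z. 0 < Re z}"
      by (intro holomorphic_intros) (auto simp: complex_nonpos_Reals_iff)
    show "complex_of_real (Gamma (p / m) / m) * complex_of_real q powr complex_of_real (- p / m) = of_real (Gamma (p / m) / m * q powr (- p / m))"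
      if "q > 0" for q using that powr_of_real[of q "- p / m"] by simp
  qed (rule w)
  then have "has_bochner_integral lborel (\<lambda>r. g r *\<^sub>R exp (- w * (r powr m))) (of_real (Gamma (p / m) / m) * w powr (- p / m))"
    unfolding N_def has_bochner_integral_iff using g0
    by (simp add: integrable_density integral_density)
  then show ?thesis by (simp add: g_def)
qed

text \<open>Log-convexity of Gamma between \<open>x\<close> and \<open>x + 1\<close>. This bounds
  the ratio of neighbouring coefficients by a power of \<open>n\<close>, which is all that the ratio
  tests below use.\<close>

lemma Gamma_add_le:
  fixes x s :: real assumes x: "x > 0" and s: "0 \<le> s" "s \<le> 1"
  shows "Gamma (x + s) \<le> Gamma x * x powr s"
proof -
  have "(ln \<circ> Gamma) ((1 - s) *\<^sub>R x + s *\<^sub>R (x + 1)) \<le> (1 - s) * (ln \<circ> Gamma) x + s * (ln \<circ> Gamma) (x + 1)"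
    using x s by (intro convex_onD[OF log_convex_Gamma_real]) auto
  moreover have "(1 - s) *\<^sub>R x + s *\<^sub>R (x + 1) = x + s" by (simp add: algebra_simps)
  moreover have "Gamma (x + 1) = x * Gamma x" using x by (intro Gamma_plus1) (auto elim!: nonpos_Ints_cases)
  then have "ln (Gamma (x + 1)) = ln x + ln (Gamma x)"
    by (simp only: ln_mult_pos[OF x Gamma_real_pos[OF x]])
  ultimately have "ln (Gamma (x + s)) \<le> ln (Gamma x) + s * ln x"
    by (simp add: algebra_simps)
  also have "\<dots> = ln (Gamma x * x powr s)"
    using x by (subst ln_mult_pos[OF Gamma_real_pos[OF x]]) (auto simp: ln_powr)
  finally show ?thesis
    using x s Gamma_real_pos[of "x + s"] Gamma_real_pos[OF x] by (subst (asm) ln_le_cancel_iff) auto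
qed

lemma summable_ratio_tendsto_0:
  fixes f :: "nat \<Rightarrow> real"
  assumes pos: "\<And>n. f n \<ge> 0" and le: "\<And>n. f (Suc n) \<le> g n * f n" and g: "g \<longlonglongrightarrow> 0"
  shows "summable f"
proof -
  have "\<forall>\<^sub>F n in sequentially. g n < 1/2" using g by (rule order_tendstoD) simp
  then obtain N where N: "\<And>n. n \<ge> N \<Longrightarrow> g n < 1/2" by (auto simp: eventually_sequentially)
  show ?thesis
  proof (rule summable_ratio_test[of "1/2" N])
    fix n assume "N \<le> n"
    have "f (Suc n) \<le> g n * f n" by (rule le)
    also have "\<dots> \<le> 1/2 * f n" using N[OF \<open>N \<le> n\<close>] pos[of n] by (intro mult_right_mono) auto
    finally show "norm (f (Suc n)) \<le> 1/2 * norm (f n)" using pos by simp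
  qed simp
qed

lemma powr_over_nat_tendsto_0:
  fixes s a b :: real assumes "0 \<le> s" "s < 1" "a > 0" "b \<ge> 0"
  shows "(\<lambda>n. C * (real n * a + b) powr s / (real n + 1)) \<longlonglongrightarrow> 0"
  using assms by real_asymp

text \<open>One Gamma factor grows by at most \<open>n powr a\<close> per step and the factorial by
  \<open>n + 1\<close>, so the ratio tends to 0 for \<open>a < 1\<close>.\<close>

lemma summable_Gamma_fact:
  fixes a b x :: real assumes a: "0 < a" "a < 1" and b: "b > 0" and x: "x \<ge> 0"
  shows "summable (\<lambda>n. x ^ n / fact n * Gamma (real n * a + b))"
proof (rule summable_ratio_tendsto_0)
  fix n
  show "0 \<le> x ^ n / fact n * Gamma (real n * a + b)"
    using a b x Gamma_real_pos[of "real n * a + b"] by (simp add: add_nonneg_pos)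
  have S: "real (Suc n) * a + b = real n * a + b + a" by (simp add: algebra_simps)
  have "Gamma (real n * a + b + a) \<le> Gamma (real n * a + b) * (real n * a + b) powr a"
    using a b by (intro Gamma_add_le add_nonneg_pos) auto
  from this[folded S] have "x ^ Suc n / fact (Suc n) * Gamma (real (Suc n) * a + b)
     \<le> x ^ Suc n / fact (Suc n) * (Gamma (real n * a + b) * (real n * a + b) powr a)"
    using x by (intro mult_left_mono) auto
  also have "\<dots> = (x * (real n * a + b) powr a / (real n + 1)) * (x ^ n / fact n * Gamma (real n * a + b))"
    by (simp add: field_simps)
  finally show "x ^ Suc n / fact (Suc n) * Gamma (real (Suc n) * a + b) \<le> \<dots>" .
qed (use a b in \<open>intro powr_over_nat_tendsto_0; simp\<close>)

text \<open>Two Gamma factors contribute \<open>n powr (2 * a)\<close> to the ratio, whence the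
  condition \<open>2 * a < 1\<close>. For \<open>a = 1 / p\<close> this reads \<open>2 < p\<close>,
  and it is the reason why the series for the density converges everywhere.\<close>

lemma summable_Gamma_Gamma_fact:
  fixes a b c x :: real assumes a: "0 < a" "2 * a < 1" and b: "b > 0" "c > 0" and x: "x \<ge> 0"
  shows "summable (\<lambda>n. x ^ n / fact n * (Gamma (real n * a + b) * Gamma (real n * a + c)))"
proof (rule summable_ratio_tendsto_0)
  fix n
  define B where "B = max b c"
  note G = less_imp_le[OF Gamma_real_pos]
  show "0 \<le> x ^ n / fact n * (Gamma (real n * a + b) * Gamma (real n * a + c))"
    using a b x Gamma_real_pos[of "real n * a + b"] Gamma_real_pos[of "real n * a + c"] by (simp add: add_nonneg_pos)
  have 1: "Gamma (real n * a + d + a) \<le> Gamma (real n * a + d) * (real n * a + B) powr a" if "d > 0" "d \<le> B" for d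
  proof -
    have "Gamma (real n * a + d + a) \<le> Gamma (real n * a + d) * (real n * a + d) powr a"
      using a that by (intro Gamma_add_le add_nonneg_pos) auto
    also have "\<dots> \<le> Gamma (real n * a + d) * (real n * a + B) powr a"
      using a that by (intro mult_left_mono powr_mono2 G add_nonneg_pos) auto
    finally show ?thesis .
  qed
  have "Gamma (real n * a + b + a) * Gamma (real n * a + c + a) \<le>
    (Gamma (real n * a + b) * (real n * a + B) powr a) * (Gamma (real n * a + c) * (real n * a + B) powr a)"
    using a b by (intro mult_mono 1 G mult_nonneg_nonneg add_nonneg_pos add_pos_pos) (auto simp: B_def)
  also have "\<dots> = Gamma (real n * a + b) * Gamma (real n * a + c) * (real n * a + B) powr (2 * a)"
    by (simp add: powr_add[symmetric] mult_ac)
  finally have fin: "Gamma (real n * a + b + a) * Gamma (real n * a + c + a) \<le> \<dots>" .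
  have S: "real (Suc n) * a + d = real n * a + d + a" for d by (simp add: algebra_simps)
  have "x ^ Suc n / fact (Suc n) * (Gamma (real (Suc n) * a + b) * Gamma (real (Suc n) * a + c))
     \<le> x ^ Suc n / fact (Suc n) * (Gamma (real n * a + b) * Gamma (real n * a + c) * (real n * a + B) powr (2 * a))"
    unfolding S using x fin by (intro mult_left_mono) auto
  also have "\<dots> = (x * (real n * a + B) powr (2*a) / (real n + 1)) * (x ^ n / fact n * (Gamma (real n * a + b) * Gamma (real n * a + c)))"
    by (simp add: field_simps)
  finally show "x ^ Suc n / fact (Suc n) * (Gamma (real (Suc n) * a + b) * Gamma (real (Suc n) * a + c)) \<le>
     (x * (real n * a + max b c) powr (2*a) / (real n + 1)) * (x ^ n / fact n * (Gamma (real n * a + b) * Gamma (real n * a + c)))"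
    by (simp add: B_def)
qed (use a b in \<open>intro powr_over_nat_tendsto_0; simp\<close>)

text \<open>Written with \<open>rGamma\<close>, the reflection formula also covers integer
  \<open>x\<close>, where both sides vanish. It turns the sines left over from a pair of conjugate
  rays into the reciprocal Gammas of the series.\<close>

lemma rGamma_reflection_real:
  fixes x :: real assumes "x > 0"
  shows "rGamma (1 - x) = Gamma x * sin (pi * x) / pi"
proof -
  have "rGamma (complex_of_real x) * rGamma (1 - complex_of_real x) = sin (of_real pi * of_real x) / of_real pi"
    by (rule rGamma_reflection_complex)
  then have "complex_of_real (rGamma x * rGamma (1 - x)) = of_real (sin (pi * x) / pi)"
    by (simp add: rGamma_complex_of_real[symmetric] sin_of_real[symmetric] del: sin_of_real)
  then have "rGamma x * rGamma (1 - x) = sin (pi * x) / pi" unfolding of_real_eq_iff .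
  moreover have "Gamma x * rGamma x = 1"
    using Gamma_real_pos[OF assms] by (simp add: rGamma_inverse_Gamma)
  ultimately show ?thesis by (metis mult.assoc mult.left_neutral times_divide_eq_right)
qed

lemma abs_rGamma_one_minus_le: "x > 0 \<Longrightarrow> \<bar>rGamma (1 - x)\<bar> \<le> Gamma (x::real)"
proof -
  assume x: "x > 0"
  have "\<bar>sin (pi * x)\<bar> \<le> pi" using abs_sin_le_one[of "pi * x"] pi_gt3 by linarith
  then have "Gamma x * \<bar>sin (pi * x)\<bar> / pi \<le> Gamma x" using Gamma_real_pos[OF x] by (simp add: field_simps)
  then show ?thesis using Gamma_real_pos[OF x] by (simp add: rGamma_reflection_real[OF x] abs_mult)
qed

text \<open>Expand \<open>exp (- \<zeta> * r)\<close> and integrate term by term. The integrals of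
  the absolute values form a series of the type \<open>Gamma (n / m) / n!\<close>, summable because
  \<open>m > 1\<close>.\<close>

lemma ray_integral:
  fixes m :: real and w \<zeta> :: complex
  assumes m: "m > 1" and w: "Re w > 0"
  shows "integrable lborel (\<lambda>r. indicator {0<..} r *\<^sub>R exp (- w * r powr m - \<zeta> * r))" (is ?I)
    and "(\<lambda>n. (- \<zeta>) ^ n / fact n * (Gamma ((real n + 1) / m) / m * w powr (- (real n + 1) / m))) sums
           (\<integral>r. indicator {0<..} r *\<^sub>R exp (- w * r powr m - \<zeta> * r) \<partial>lborel)" (is ?S)
proof -
  \<comment> \<open>The exponent \<open>real n + 1 - 1\<close> is left unsimplified so that it
    matches \<open>p - 1\<close> in \<open>has_bochner_integral_powr_exp\<close>.\<close>
  define f :: "nat \<Rightarrow> real \<Rightarrow> complex" where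
    "f = (\<lambda>n r. (- \<zeta>) ^ n / fact n * (indicator {0<..} r *\<^sub>R (r powr (real n + 1 - 1) *\<^sub>R exp (- w * r powr m))))"
  have hf: "has_bochner_integral lborel (f n) ((- \<zeta>) ^ n / fact n * (Gamma ((real n + 1) / m) / m * w powr (- (real n + 1) / m)))" for n
    unfolding f_def using m w
    by (intro has_bochner_integral_mult_right has_bochner_integral_powr_exp) auto
  have nf: "has_bochner_integral lborel (\<lambda>r. norm (f n r))
      (norm \<zeta> ^ n / fact n * (Gamma ((real n + 1) / m) / m * Re w powr (- (real n + 1) / m)))" for n
  proof -
    have "(\<lambda>r. norm (f n r)) = (\<lambda>r. norm \<zeta> ^ n / fact n * (indicator {0<..} r *\<^sub>R (r powr (real n + 1 - 1) * exp (- Re w * r powr m))))"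
      by (auto simp: f_def norm_mult norm_divide norm_power fun_eq_iff indicator_def)
    then show ?thesis
      using m w has_bochner_integral_powr_exp_real[of "real n + 1" m "Re w"] by (simp only:) (intro has_bochner_integral_mult_right, auto)
  qed
  have sumf: "summable (\<lambda>n. norm (f n r)) \<and> (\<lambda>n. f n r) sums (indicator {0<..} r *\<^sub>R exp (- w * r powr m - \<zeta> * r))" for r
  proof (cases "r > 0")
    case True
    have 1: "f n r = (- \<zeta> * r) ^ n / fact n * exp (- w * r powr m)" for n
      using True unfolding f_def power_mult_distrib by (simp add: powr_realpow scaleR_conv_of_real)
    have "(\<lambda>n. (- \<zeta> * r) ^ n /\<^sub>R fact n) sums exp (- \<zeta> * r)" by (rule exp_converges)
    then have "(\<lambda>n. (- \<zeta> * r) ^ n / fact n * exp (- w * r powr m)) sums (exp (- \<zeta> * r) * exp (- w * r powr m))"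
      by (intro sums_mult2) (simp add: scaleR_conv_of_real field_simps)
    moreover have "exp (- \<zeta> * r) * exp (- w * r powr m) = exp (- w * r powr m - \<zeta> * r)"
      unfolding mult_exp_exp by (rule arg_cong[where f = exp]) simp
    moreover have "summable (\<lambda>n. norm ((- \<zeta> * r) ^ n /\<^sub>R fact n) * norm (exp (- w * r powr m)))"
      by (intro summable_mult2 summable_norm_exp)
    then have "summable (\<lambda>n. norm (f n r))"
      by (simp add: 1 norm_mult norm_divide norm_power norm_inverse divide_inverse mult_ac)
    ultimately show ?thesis using True by (simp add: 1)
  qed (simp add: f_def)
  have "summable (\<lambda>n. norm \<zeta> ^ n / fact n * (Gamma ((real n + 1) / m) / m * Re w powr (- (real n + 1) / m)))"
  proof -
    define x where "x = norm \<zeta> * Re w powr (- 1 / m)"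
    have "summable (\<lambda>n. x ^ n / fact n * Gamma (real n * (1/m) + 1/m) * (Re w powr (- 1 / m) / m))"
      using m by (intro summable_mult2 summable_Gamma_fact) (auto simp: x_def)
    also have "(\<lambda>n. x ^ n / fact n * Gamma (real n * (1/m) + 1/m) * (Re w powr (- 1 / m) / m)) =
       (\<lambda>n. norm \<zeta> ^ n / fact n * (Gamma ((real n + 1) / m) / m * Re w powr (- (real n + 1) / m)))"
    proof
      fix n
      have "Re w powr (- (real n + 1) / m) = Re w powr (real n * (- 1 / m) + (- 1 / m))"
        using m by (intro arg_cong[where f = "(powr) (Re w)"]) (simp add: field_simps)
      also have "\<dots> = (Re w powr (- 1 / m)) ^ n * Re w powr (- 1 / m)"
        using w by (simp only: powr_add) (simp add: powr_powr powr_realpow[symmetric])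
      finally show "x ^ n / fact n * Gamma (real n * (1/m) + 1/m) * (Re w powr (- 1 / m) / m) =
         norm \<zeta> ^ n / fact n * (Gamma ((real n + 1) / m) / m * Re w powr (- (real n + 1) / m))"
        by (simp add: x_def power_mult_distrib add_divide_distrib)
    qed
    finally show ?thesis .
  qed
  then have sumint: "summable (\<lambda>n. \<integral>r. norm (f n r) \<partial>lborel)"
    using has_bochner_integral_integral_eq[OF nf] by simp
  have fi: "integrable lborel (f n)" for n using hf[of n] by (simp add: has_bochner_integral_iff)
  have eq: "(\<lambda>r. \<Sum>n. f n r) = (\<lambda>r. indicator {0<..} r *\<^sub>R exp (- w * r powr m - \<zeta> * r))"
    using sumf by (auto simp: sums_iff)
  show ?I using integrable_suminf[OF fi _ sumint] sumf unfolding eq by auto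
  have "(\<lambda>n. integral\<^sup>L lborel (f n)) sums (\<integral>r. (\<Sum>n. f n r) \<partial>lborel)"
    using sums_integral[OF fi _ sumint] sumf by auto
  then show ?S unfolding eq has_bochner_integral_integral_eq[OF hf] .
qed

section \<open>An Airy-type function\<close>

locale stable_airy =
  fixes p :: real
  assumes p_gt_2: "2 < p" and p_lt_3: "p < 3"
begin

definition airy_coeff :: "nat \<Rightarrow> real" where "airy_coeff n = (- 1) ^ n * rGamma (1 - (real n + 1) / p) / fact n"

text \<open>This is the M-Wright function of order \<open>1 / p\<close>. At the excluded value
  \<open>p = 3\<close> it would be a rescaled Airy function Ai, hence the name.\<close>

definition airy :: "complex \<Rightarrow> complex" where "airy z = (\<Sum>n. of_real (airy_coeff n) * z ^ n)"

text \<open>The integral of \<open>exp (\<kappa> * w powr p - z * w)\<close> along the ray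
  \<open>w = r * cis \<theta>\<close>, with \<open>w powr p\<close> written out as
  \<open>r powr p * cis (p * \<theta>)\<close>. The leading factor \<open>cis \<theta>\<close> is
  that of the differential.\<close>

definition ray :: "real \<Rightarrow> real \<Rightarrow> complex \<Rightarrow> complex" where
  "ray \<kappa> \<theta> z = cis \<theta> * (\<integral>r. indicator {0<..} r *\<^sub>R exp (\<kappa> * cis (p * \<theta>) * r powr p - z * cis \<theta> * r) \<partial>lborel)"

lemma p_pos: "p > 0" "p > 1" "p \<noteq> 0" using p_gt_2 by auto

text \<open>Since \<open>p * \<theta>\<close> lies within \<open>pi / 2\<close> of
  \<open>pi\<close>, the number \<open>- \<kappa> * cis (p * \<theta>)\<close> is in the right
  half-plane with argument \<open>p * \<theta> - pi\<close>. In its powers \<open>\<theta>\<close>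
  cancels against the powers of \<open>cis \<theta>\<close> and only \<open>pi / p\<close> remains.
  Thus ray integrals do not depend on the admissible angle, and contours are rotated without
  Cauchy's theorem. The sign \<open>s\<close> treats a ray and its mirror image together.\<close>

lemma ray_exponent:
  fixes \<kappa> \<theta> s :: real
  assumes \<kappa>: "\<kappa> > 0" and \<theta>: "pi / 2 < p * \<theta>" "p * \<theta> < 3 * pi / 2" and s: "s = 1 \<or> s = -1"
  obtains w :: complex where "Re w > 0" "- w = \<kappa> * cis (p * (s * \<theta>))"
    "\<And>n. w powr (- (real n + 1) / p) * cis (s * \<theta>) ^ n * cis (s * \<theta>) = \<kappa> powr (- (real n + 1) / p) * cis (s * ((real n + 1) * pi / p))"
proof -
  define \<phi> where "\<phi> = s * (p * \<theta> - pi)"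
  have \<phi>: "- pi / 2 < \<phi>" "\<phi> < pi / 2" using \<theta> s by (auto simp: \<phi>_def)
  define w where "w = of_real \<kappa> * cis \<phi>"
  have w: "- w = \<kappa> * cis (p * (s * \<theta>))"
    using s by (auto simp: w_def \<phi>_def cis_conv_exp complex_eq_iff Re_exp Im_exp algebra_simps cos_diff sin_diff)
  have Rew: "Re w > 0" using \<phi> \<kappa> by (auto simp: w_def intro!: mult_pos_pos cos_gt_zero_pi)
  have Ln: "Ln w = ln \<kappa> + \<i> * \<phi>"
  proof -
    have "w = exp (ln \<kappa> + \<i> * \<phi>)" using \<kappa> by (simp add: w_def exp_add cis_conv_exp exp_of_real)
    then show ?thesis using \<phi> by (auto intro!: Ln_unique)
  qed
  have wp: "w powr (- (real n + 1) / p) * cis (s * \<theta>) ^ n * cis (s * \<theta>) = \<kappa> powr (- (real n + 1) / p) * cis (s * ((real n + 1) * pi / p))" for n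
  proof -
    have "w \<noteq> 0" using Rew by auto
    then have "w powr (- (real n + 1) / p) = exp (complex_of_real (- (real n + 1) / p) * (ln \<kappa> + \<i> * \<phi>))"
      by (simp add: powr_def Ln)
    also have "\<dots> = exp (of_real (- (real n + 1) / p * ln \<kappa>)) * cis (- (real n + 1) / p * \<phi>)"
      by (simp add: cis_conv_exp exp_add[symmetric] distrib_left mult_ac add_divide_distrib)
    also have "exp (complex_of_real (- (real n + 1) / p * ln \<kappa>)) = of_real (\<kappa> powr (- (real n + 1) / p))"
      using \<kappa> by (simp only: exp_of_real powr_def) simp
    finally have "w powr (- (real n + 1) / p) * cis (s * \<theta>) ^ n * cis (s * \<theta>) =
       of_real (\<kappa> powr (- (real n + 1) / p)) * (cis (- (real n + 1) / p * \<phi>) * cis (s * \<theta>) ^ n * cis (s * \<theta>))"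
      by (simp only: mult_ac)
    also have "cis (- (real n + 1) / p * \<phi>) * cis (s * \<theta>) ^ n * cis (s * \<theta>) = cis (s * ((real n + 1) * pi / p))"
    proof -
      have "cis (- (real n + 1) / p * \<phi>) * cis (s * \<theta>) ^ n * cis (s * \<theta>) = cis (- (real n + 1) / p * \<phi> + real n * (s * \<theta>) + s * \<theta>)"
        by (simp only: Complex.DeMoivre cis_mult)
      also have "- (real n + 1) / p * \<phi> + real n * (s * \<theta>) + s * \<theta> = s * ((real n + 1) * pi / p)"
        using p_pos by (simp add: \<phi>_def field_simps)
      finally show ?thesis .
    qed
    finally show ?thesis .
  qed
  show thesis by (rule that[OF Rew w wp])
qed

lemma ray_aux:
  fixes z :: complex
  assumes \<kappa>: "\<kappa> > 0" and \<theta>: "pi / 2 < p * \<theta>" "p * \<theta> < 3 * pi / 2" and s: "s = 1 \<or> s = -1"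
  shows "integrable lborel (\<lambda>r. indicator {0<..} r *\<^sub>R exp (\<kappa> * cis (p * (s * \<theta>)) * r powr p - z * cis (s * \<theta>) * r))"
    and "(\<lambda>n. (- z) ^ n / fact n * (Gamma ((real n + 1) / p) / p * \<kappa> powr (- (real n + 1) / p) * cis (s * ((real n + 1) * pi / p)))) sums ray \<kappa> (s * \<theta>) z"
proof -
  obtain w :: complex where Rew: "Re w > 0" and w: "- w = \<kappa> * cis (p * (s * \<theta>))"
    and wp: "\<And>n. w powr (- (real n + 1) / p) * cis (s * \<theta>) ^ n * cis (s * \<theta>) = \<kappa> powr (- (real n + 1) / p) * cis (s * ((real n + 1) * pi / p))"
    by (rule ray_exponent[OF \<kappa> \<theta> s]) blast
  have e: "\<kappa> * cis (p * (s * \<theta>)) * r powr p - z * cis (s * \<theta>) * r = - w * r powr p - (z * cis (s * \<theta>)) * r" for r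
    by (simp only: w)
  show "integrable lborel (\<lambda>r. indicator {0<..} r *\<^sub>R exp (\<kappa> * cis (p * (s * \<theta>)) * r powr p - z * cis (s * \<theta>) * r))"
    unfolding e by (rule ray_integral(1)[OF p_pos(2) Rew])
  have "(\<lambda>n. cis (s * \<theta>) * ((- (z * cis (s * \<theta>))) ^ n / fact n * (Gamma ((real n + 1) / p) / p * w powr (- (real n + 1) / p)))) sums
     ray \<kappa> (s * \<theta>) z"
    unfolding ray_def e by (intro sums_mult ray_integral(2)[OF p_pos(2) Rew])
  also have "(\<lambda>n. cis (s * \<theta>) * ((- (z * cis (s * \<theta>))) ^ n / fact n * (Gamma ((real n + 1) / p) / p * w powr (- (real n + 1) / p)))) =
     (\<lambda>n. (- z) ^ n / fact n * (Gamma ((real n + 1) / p) / p * (w powr (- (real n + 1) / p) * cis (s * \<theta>) ^ n * cis (s * \<theta>))))"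
    unfolding mult_minus_left[symmetric] power_mult_distrib by (simp add: fun_eq_iff mult_ac)
  finally show "(\<lambda>n. (- z) ^ n / fact n * (Gamma ((real n + 1) / p) / p * \<kappa> powr (- (real n + 1) / p) * cis (s * ((real n + 1) * pi / p)))) sums ray \<kappa> (s * \<theta>) z"
    unfolding wp by (simp only: mult.assoc of_real_mult)
qed

text \<open>In the difference of a ray and its mirror image the coefficients become
  \<open>2 * \<i> * sin (pi * (n + 1) / p)\<close> times a Gamma value, which reflection turns into
  \<open>rGamma\<close>. The prefactor normalises the powers of \<open>\<kappa>\<close>.\<close>

lemma ray_diff:
  fixes z :: complex
  assumes \<kappa>: "\<kappa> > 0" and \<theta>: "pi / 2 < p * \<theta>" "p * \<theta> < 3 * pi / 2"
  shows "(\<lambda>n. of_real (airy_coeff n) * (z * \<kappa> powr (- 1 / p)) ^ n) sums (p * \<kappa> powr (1 / p) / (2 * pi * \<i>) * (ray \<kappa> \<theta> z - ray \<kappa> (- \<theta>) z))"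
proof -
  have "(\<lambda>n. p * \<kappa> powr (1 / p) / (2 * pi * \<i>) *
     ((- z) ^ n / fact n * (Gamma ((real n + 1) / p) / p * \<kappa> powr (- (real n + 1) / p) * cis (((real n + 1) * pi / p)))
      - (- z) ^ n / fact n * (Gamma ((real n + 1) / p) / p * \<kappa> powr (- (real n + 1) / p) * cis (- ((real n + 1) * pi / p))))) sums
     (p * \<kappa> powr (1 / p) / (2 * pi * \<i>) * (ray \<kappa> \<theta> z - ray \<kappa> (- \<theta>) z))"
    using ray_aux(2)[OF \<kappa> \<theta>, of 1 z] ray_aux(2)[OF \<kappa> \<theta>, of "- 1" z]
    by (intro sums_mult sums_diff) (simp_all)
  also have "(\<lambda>n. p * \<kappa> powr (1 / p) / (2 * pi * \<i>) *
     ((- z) ^ n / fact n * (Gamma ((real n + 1) / p) / p * \<kappa> powr (- (real n + 1) / p) * cis (((real n + 1) * pi / p)))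
      - (- z) ^ n / fact n * (Gamma ((real n + 1) / p) / p * \<kappa> powr (- (real n + 1) / p) * cis (- ((real n + 1) * pi / p))))) =
    (\<lambda>n. of_real (airy_coeff n) * (z * \<kappa> powr (- 1 / p)) ^ n)"
  proof
    fix n
    define x where "x = (real n + 1) / p"
    have x: "x > 0" using p_pos by (simp add: x_def)
    have xpi: "(real n + 1) * pi / p = pi * x" by (simp add: x_def)
    have dif: "cis (pi * x) - cis (- (pi * x)) = 2 * \<i> * sin (pi * x)"
      by (simp add: complex_eq_iff)
    have "- (real n + 1) / p = real n * (- 1 / p) + (- 1 / p)" using p_pos by (simp add: field_simps)
    then have kp: "\<kappa> powr (- (real n + 1) / p) = (\<kappa> powr (- 1 / p)) ^ n * \<kappa> powr (- 1 / p)"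
      using \<kappa> by (simp only: powr_add) (simp add: powr_powr powr_realpow[symmetric])
    have k1: "\<kappa> powr (1 / p) * \<kappa> powr (- 1 / p) = 1" using \<kappa> by (simp add: powr_add[symmetric])
    have cn: "airy_coeff n = (- 1) ^ n * (Gamma x * sin (pi * x) / pi) / fact n"
      using rGamma_reflection_real[OF x] by (simp add: airy_coeff_def x_def)
    have zn: "(- z) ^ n = (- 1) ^ n * z ^ n" by (simp add: power_mult_distrib[symmetric])
    have "p * \<kappa> powr (1 / p) / (2 * pi * \<i>) *
     ((- z) ^ n / fact n * (Gamma x / p * \<kappa> powr (- (real n + 1) / p) * cis (pi * x))
      - (- z) ^ n / fact n * (Gamma x / p * \<kappa> powr (- (real n + 1) / p) * cis (- (pi * x)))) =
      p * \<kappa> powr (1 / p) / (2 * pi * \<i>) * ((- z) ^ n / fact n * (Gamma x / p * \<kappa> powr (- (real n + 1) / p)) * (cis (pi * x) - cis (- (pi * x))))"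
      by (simp add: right_diff_distrib mult.assoc)
    also have "\<dots> = of_real (\<kappa> powr (1 / p) * \<kappa> powr (- 1 / p)) * ((- 1) ^ n * (Gamma x * sin (pi * x) / pi) / fact n) * (z ^ n * (\<kappa> powr (- 1 / p)) ^ n)"
      unfolding dif kp zn using p_pos by (simp add: field_simps)
    also have "\<dots> = of_real (airy_coeff n) * (z * \<kappa> powr (- 1 / p)) ^ n"
      unfolding k1 cn by (simp add: power_mult_distrib)
    finally show "p * \<kappa> powr (1 / p) / (2 * pi * \<i>) *
     ((- z) ^ n / fact n * (Gamma ((real n + 1) / p) / p * \<kappa> powr (- (real n + 1) / p) * cis (((real n + 1) * pi / p)))
      - (- z) ^ n / fact n * (Gamma ((real n + 1) / p) / p * \<kappa> powr (- (real n + 1) / p) * cis (- ((real n + 1) * pi / p))))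
       = of_real (airy_coeff n) * (z * \<kappa> powr (- 1 / p)) ^ n"
      unfolding xpi x_def[symmetric] .
  qed
  finally show ?thesis .
qed

text \<open>The same function is represented for every admissible angle. The angle
  \<open>pi / 2\<close> gives the integral over the imaginary axis needed for the martingale,
  \<open>pi / 4\<close> gives bounds in the sector.\<close>

lemma airy_ray:
  fixes z :: complex
  assumes "\<kappa> > 0" "pi / 2 < p * \<theta>" "p * \<theta> < 3 * pi / 2"
  shows "airy (z * \<kappa> powr (- 1 / p)) = p * \<kappa> powr (1 / p) / (2 * pi * \<i>) * (ray \<kappa> \<theta> z - ray \<kappa> (- \<theta>) z)"
  using sums_unique[OF ray_diff[OF assms]] by (simp add: airy_def)

text \<open>The imaginary axis is admissible because \<open>p < 3\<close>, the rays at angle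
  \<open>pi / 4\<close> because \<open>p > 2\<close>.\<close>

lemma half_pi_angle: "pi / 2 < p * (pi / 2)" "p * (pi / 2) < 3 * pi / 2"
  using p_gt_2 p_lt_3 by (auto simp: field_simps)

lemma quarter_pi_angle: "pi / 2 < p * (pi / 4)" "p * (pi / 4) < 3 * pi / 2"
  using p_gt_2 p_lt_3 by (auto simp: field_simps)

lemma airy_sums: "(\<lambda>n. of_real (airy_coeff n) * z ^ n) sums airy z"
  using ray_diff[OF zero_less_one half_pi_angle, where z = z] by (simp add: airy_def sums_iff)

lemma airy_has_derivative: "(airy has_field_derivative (\<Sum>n. diffs (\<lambda>n. of_real (airy_coeff n)) n * z ^ n)) (at z)"
  unfolding airy_def[abs_def] by (rule termdiffs_strong_converges_everywhere) (use airy_sums sums_summable in blast)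

lemma airy_holomorphic: "airy holomorphic_on A"
  using airy_has_derivative by (meson field_differentiable_at_within field_differentiable_def holomorphic_on_def)

lemma continuous_airy [continuous_intros]: "continuous_on A f \<Longrightarrow> continuous_on A (\<lambda>x. airy (f x))"
  by (rule continuous_on_compose2[OF holomorphic_on_imp_continuous_on[OF airy_holomorphic[of UNIV]]]) auto

lemma airy_measurable [measurable]: "airy \<in> borel_measurable borel"
  by (rule borel_measurable_continuous_onI) (intro continuous_intros)

lemma airy_0: "airy 0 = of_real (rGamma (1 - 1 / p))"
  unfolding airy_def powser_zero by (simp add: airy_coeff_def)

lemma airy_0_pos: "rGamma (1 - 1 / p) > 0"
  using p_pos by (simp add: rGamma_inverse_Gamma Gamma_real_pos)

end

section \<open>Integrals over vertical lines and the shift of the contour\<close>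

lemma integral_real_line_split:
  fixes f :: "real \<Rightarrow> 'b :: {banach, second_countable_topology}"
  assumes 1: "integrable lborel (\<lambda>y. indicator {0<..} y *\<^sub>R f y)"
    and 2: "integrable lborel (\<lambda>y. indicator {0<..} y *\<^sub>R f (- y))" and f[measurable]: "f \<in> borel_measurable borel"
  shows "integrable lborel f"
    and "(\<integral>y. f y \<partial>lborel) = (\<integral>y. indicator {0<..} y *\<^sub>R f y \<partial>lborel) + (\<integral>y. indicator {0<..} y *\<^sub>R f (- y) \<partial>lborel)"
proof -
  have 3: "integrable lborel (\<lambda>y. indicator {0<..} (- y) *\<^sub>R f y)"
    using lborel_integrable_real_affine_iff[of "-1" "\<lambda>y. indicator {0<..} (- y) *\<^sub>R f y" 0] 2 by simp
  have 4: "(\<integral>y. indicator {0<..} (- y) *\<^sub>R f y \<partial>lborel) = (\<integral>y. indicator {0<..} y *\<^sub>R f (- y) \<partial>lborel)"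
    using lborel_integral_real_affine[of "-1" "\<lambda>y. indicator {0<..} (- y) *\<^sub>R f y" 0] by simp
  have ae: "AE y in lborel. indicator {0<..} y *\<^sub>R f y + indicator {0<..} (- y) *\<^sub>R f y = f y"
    using AE_lborel_singleton[of "0::real"] by eventually_elim (auto simp: indicator_def)
  show "integrable lborel f"
    by (rule Bochner_Integration.integrable_cong_AE_imp[OF Bochner_Integration.integrable_add[OF 1 3]]) (use ae in \<open>auto elim: eventually_mono\<close>)
  have "(\<integral>y. f y \<partial>lborel) = (\<integral>y. indicator {0<..} y *\<^sub>R f y + indicator {0<..} (- y) *\<^sub>R f y \<partial>lborel)"
    by (rule integral_cong_AE) (use ae in \<open>auto elim: eventually_mono\<close>)
  then show "(\<integral>y. f y \<partial>lborel) = (\<integral>y. indicator {0<..} y *\<^sub>R f y \<partial>lborel) + (\<integral>y. indicator {0<..} y *\<^sub>R f (- y) \<partial>lborel)"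
    using 1 3 by (simp add: 4)
qed

context stable_airy
begin

definition kern :: "real \<Rightarrow> complex \<Rightarrow> complex" where
  "kern \<kappa> z = exp (of_real \<kappa> * z powr of_real p)"

lemma kern_measurable[measurable]: "kern \<kappa> \<in> borel_measurable borel"
  unfolding kern_def[abs_def] by measurable

lemma Complex_measurable[measurable]: "Complex a \<in> borel_measurable borel"
  unfolding Complex_eq by measurable

lemma powr_imag: "r > 0 \<Longrightarrow> Complex 0 r powr p = r powr p * cis (p * (pi / 2))"
  "r > 0 \<Longrightarrow> Complex 0 (- r) powr p = r powr p * cis (p * (- (pi / 2)))"
proof -
  assume r: "r > 0"
  have "Complex 0 r = of_real r * \<i>" "Complex 0 (- r) = of_real r * (- \<i>)" by (auto simp: complex_eq_iff)
  moreover have "(of_real r * w) powr p = of_real (r powr p) * w powr p" for w :: complex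
    using r by (subst powr_times_real_left) (auto simp: powr_of_real)
  moreover have "\<i> powr p = cis (p * (pi / 2))" "(- \<i>) powr p = cis (p * (- (pi / 2)))"
    by (auto simp: powr_def cis_conv_exp Ln_minus_ii mult_ac)
  ultimately show "Complex 0 r powr p = r powr p * cis (p * (pi / 2))" "Complex 0 (- r) powr p = r powr p * cis (p * (- (pi / 2)))"
    by (simp_all only:)
qed

text \<open>The imaginary axis consists of the rays at angles \<open>pi / 2\<close> and
  \<open>- pi / 2\<close>. The factor \<open>\<i>\<close> of the differential along the axis is what
  the difference of the two rays is divided by.\<close>

lemma kern_line:
  fixes x :: real
  assumes \<kappa>: "\<kappa> > 0"
  shows "integrable lborel (\<lambda>y. kern \<kappa> (Complex 0 y) * exp (- x * Complex 0 y))"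
    and "(\<integral>y. kern \<kappa> (Complex 0 y) * exp (- x * Complex 0 y) \<partial>lborel) = 2 * pi / p * \<kappa> powr (- 1 / p) * airy (of_real (x * \<kappa> powr (- 1 / p)))"
proof -
  let ?f = "\<lambda>y. kern \<kappa> (Complex 0 y) * exp (- x * Complex 0 y)"
  let ?g1 = "\<lambda>r. indicator {0<..} r *\<^sub>R exp (\<kappa> * cis (p * (pi/2)) * r powr p - x * cis (pi / 2) * r)"
  let ?g2 = "\<lambda>r. indicator {0<..} r *\<^sub>R exp (\<kappa> * cis (p * (- (pi/2))) * r powr p - x * cis (- (pi / 2)) * r)"
  have eq1: "(\<lambda>y. indicator {0<..} y *\<^sub>R ?f y) = ?g1"
  proof
    fix y :: real
    have "?f y = exp (\<kappa> * cis (p * (pi/2)) * y powr p - x * cis (pi / 2) * y)" if "y > 0"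
      unfolding kern_def mult_exp_exp powr_imag(1)[OF that]
      by (rule arg_cong[where f = exp]) (simp add: Complex_eq mult_ac)
    then show "indicator {0<..} y *\<^sub>R ?f y = ?g1 y" by (auto simp: indicator_def)
  qed
  have eq2: "(\<lambda>y. indicator {0<..} y *\<^sub>R ?f (- y)) = ?g2"
  proof
    fix y :: real
    have "?f (- y) = exp (\<kappa> * cis (p * (- (pi/2))) * y powr p - x * cis (- (pi / 2)) * y)" if "y > 0"
      unfolding kern_def mult_exp_exp powr_imag(2)[OF that]
      by (rule arg_cong[where f = exp]) (simp add: Complex_eq mult_ac)
    then show "indicator {0<..} y *\<^sub>R ?f (- y) = ?g2 y" by (auto simp: indicator_def)
  qed
  have i1: "integrable lborel ?g1" using ray_aux(1)[OF \<kappa> half_pi_angle, of 1 x] by simp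
  have i2: "integrable lborel ?g2" using ray_aux(1)[OF \<kappa> half_pi_angle, of "-1" x] by simp
  have r1: "ray \<kappa> (pi / 2) x = \<i> * integral\<^sup>L lborel ?g1" unfolding ray_def by simp
  have r2: "ray \<kappa> (- (pi / 2)) x = - \<i> * integral\<^sup>L lborel ?g2" unfolding ray_def by simp
  have m: "?f \<in> borel_measurable borel" by measurable
  show "integrable lborel ?f"
    by (rule integral_real_line_split(1)[OF _ _ m]) (simp_all only: eq1 eq2 i1 i2)
  have "integral\<^sup>L lborel ?f = integral\<^sup>L lborel ?g1 + integral\<^sup>L lborel ?g2"
    by (subst integral_real_line_split(2)[OF _ _ m]) (simp_all only: eq1 eq2 i1 i2)
  also have "\<dots> = (ray \<kappa> (pi / 2) x - ray \<kappa> (- (pi / 2)) x) / \<i>"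
    unfolding r1 r2 by (simp add: field_simps)
  also have "\<dots> = 2 * pi / p * \<kappa> powr (- 1 / p) * airy (of_real (x * \<kappa> powr (- 1 / p)))"
  proof -
    have "\<kappa> powr (- 1 / p) * \<kappa> powr (1 / p) = 1" using \<kappa> by (simp add: powr_add[symmetric])
    then have k: "complex_of_real (\<kappa> powr (- 1 / p)) * of_real (\<kappa> powr (1 / p)) = 1"
      by (metis of_real_1 of_real_mult)
    have "2 * pi / p * \<kappa> powr (- 1 / p) * airy (of_real (x * \<kappa> powr (- 1 / p)))
       = 2 * pi / p * \<kappa> powr (- 1 / p) * (p * \<kappa> powr (1 / p) / (2 * pi * \<i>) * (ray \<kappa> (pi/2) x - ray \<kappa> (- (pi/2)) x))"
      using airy_ray[OF \<kappa> half_pi_angle, of "of_real x"] by simp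
    also have "\<dots> = (of_real (\<kappa> powr (- 1 / p)) * of_real (\<kappa> powr (1 / p))) * ((ray \<kappa> (pi/2) x - ray \<kappa> (- (pi/2)) x) / \<i>)"
      using p_pos by simp
    finally show ?thesis unfolding k by simp
  qed
  finally show "integral\<^sup>L lborel ?f = 2 * pi / p * \<kappa> powr (- 1 / p) * airy (of_real (x * \<kappa> powr (- 1 / p)))" .
qed

text \<open>Scaling gives \<open>Complex b y powr p = y powr p * Complex (b / y) 1 powr p\<close>,
  and for small \<open>b / y\<close> the second factor is close to its value at \<open>\<i>\<close>,
  whose real part \<open>cos (p * pi / 2)\<close> is negative. Negative \<open>y\<close> follows by
  conjugation.\<close>

lemma Re_powr_decay:
  obtains \<delta> R where "\<delta> > 0" "R > 0" "\<And>b y. 0 \<le> b \<Longrightarrow> b \<le> B \<Longrightarrow> \<bar>y\<bar> \<ge> R \<Longrightarrow> Re (Complex b y powr p) \<le> - \<delta> * \<bar>y\<bar> powr p"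
proof -
  have cosneg: "cos (p * (pi / 2)) < 0"
    using half_pi_angle cos_lt_zero_pi[of "p * (pi/2)"] by simp
  \<comment> \<open>Half of the limiting value leaves room for the continuity argument.\<close>
  define \<delta> where "\<delta> = - cos (p * (pi / 2)) / 2"
  have \<delta>: "\<delta> > 0" using cosneg by (simp add: \<delta>_def)
  have "((\<lambda>e. Re (Complex e 1 powr p)) \<longlongrightarrow> Re (Complex 0 1 powr p)) (at 0)"
    unfolding Complex_eq by (intro tendsto_intros tendsto_powr_complex) (auto simp: complex_nonpos_Reals_iff)
  also have "Re (Complex 0 1 powr p) = cos (p * (pi / 2))"
    by (subst powr_imag) auto
  finally have "\<forall>\<^sub>F e in at 0. Re (Complex e 1 powr p) < - \<delta>"
    by (rule order_tendstoD) (use cosneg in \<open>simp add: \<delta>_def\<close>)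
  then obtain d where d: "d > 0" "\<And>e. e \<noteq> 0 \<Longrightarrow> \<bar>e\<bar> < d \<Longrightarrow> Re (Complex e 1 powr p) < - \<delta>"
    by (auto simp: eventually_at)
  have e0: "Re (Complex e 1 powr p) \<le> - \<delta>" if "\<bar>e\<bar> < d" for e
    using d(2)[of e] that powr_imag(1)[of 1] cosneg by (cases "e = 0") (auto simp: \<delta>_def)
  define R where "R = (\<bar>B\<bar> + 1) / d"
  have R: "R > 0" using d by (simp add: R_def)
  have pos: "Re (Complex b y powr p) \<le> - \<delta> * y powr p" if "0 \<le> b" "b \<le> B" "y \<ge> R" for b y
  proof -
    have y: "y > 0" using that R by linarith
    have "\<bar>b / y\<bar> < d"
    proof -
      have "b < R * d" using that d by (simp add: R_def)
      also have "\<dots> \<le> y * d" using that d by (intro mult_right_mono) auto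
      finally show ?thesis using y that by (simp add: field_simps)
    qed
    moreover have "Complex b y = of_real y * Complex (b / y) 1" using y by (simp add: complex_eq_iff)
    then have "Complex b y powr p = of_real (y powr p) * (Complex (b / y) 1 powr p)"
      using y by (simp only:) (subst powr_times_real_left, auto simp: powr_of_real)
    ultimately show ?thesis using mult_left_mono[OF e0[of "b / y"], of "y powr p"] by (simp add: mult.commute)
  qed
  show ?thesis
  proof (rule that[OF \<delta> R])
    fix b y :: real assume *: "0 \<le> b" "b \<le> B" "\<bar>y\<bar> \<ge> R"
    show "Re (Complex b y powr p) \<le> - \<delta> * \<bar>y\<bar> powr p"
    proof (cases "y \<ge> 0")
      case True then show ?thesis using pos[of b y] * by simp
    next
      case False
      have "Complex b y powr p = cnj (Complex b (- y) powr p)"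
        by (subst cnj_powr) (use * False in \<open>auto simp: complex_cnj\<close>)
      then show ?thesis using pos[of b "- y"] * False by simp
    qed
  qed
qed

lemma integrable_exp_powr_line:
  assumes "\<delta> > 0"
  shows "integrable lborel (\<lambda>y::real. exp (- \<delta> * \<bar>y\<bar> powr p))"
proof (rule integral_real_line_split(1))
  have *: "integrable lborel (\<lambda>y. indicator {0<..} y *\<^sub>R (y powr (1 - 1) * exp (- \<delta> * y powr p)))"
    using has_bochner_integral_powr_exp_real[of 1 p \<delta>] p_pos assms by (simp add: has_bochner_integral_iff)
  have "(\<lambda>y. indicator {0<..} y *\<^sub>R (y powr (1 - 1) * exp (- \<delta> * y powr p))) = (\<lambda>y. indicator {0<..} y *\<^sub>R exp (- \<delta> * \<bar>y\<bar> powr p))"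
    by (auto simp: indicator_def fun_eq_iff)
  with * show "integrable lborel (\<lambda>y::real. indicator {0<..} y *\<^sub>R exp (- \<delta> * \<bar>y\<bar> powr p))" by simp
  then show "integrable lborel (\<lambda>y::real. indicator {0<..} y *\<^sub>R exp (- \<delta> * \<bar>- y\<bar> powr p))" by simp
qed auto

lemma continuous_on_powr_halfplane:
  "continuous_on {z. 0 \<le> Re z} (\<lambda>z::complex. z powr of_real p)"
  using p_pos by (intro continuous_on_powr_complex continuous_intros) auto

text \<open>Cauchy's theorem on the rectangle between the lines with real parts 0 and
  \<open>b\<close>: the horizontal sides vanish as the height grows. Both integrals run over the
  imaginary part, so the factor \<open>\<i>\<close> drops out.\<close>

lemma kern_shift:
  fixes x b :: real
  assumes \<kappa>: "\<kappa> > 0" and b: "b \<ge> 0"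
  shows "integrable lborel (\<lambda>y. kern \<kappa> (Complex b y) * exp (- x * Complex b y))"
    and "(\<integral>y. kern \<kappa> (Complex b y) * exp (- x * Complex b y) \<partial>lborel) = (\<integral>y. kern \<kappa> (Complex 0 y) * exp (- x * Complex 0 y) \<partial>lborel)"
proof -
  define F where "F = (\<lambda>z::complex. kern \<kappa> z * exp (- x * z))"
  obtain \<delta> R where \<delta>: "\<delta> > 0" and R: "R > 0"
    and decay: "\<And>b' y. 0 \<le> b' \<Longrightarrow> b' \<le> b \<Longrightarrow> \<bar>y\<bar> \<ge> R \<Longrightarrow> Re (Complex b' y powr p) \<le> - \<delta> * \<bar>y\<bar> powr p"
    using Re_powr_decay[of b] by blast
  have contF: "continuous_on {z. 0 \<le> Re z} F"
    unfolding F_def kern_def by (intro continuous_intros continuous_on_powr_halfplane)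
  have normF: "norm (F (Complex b' y)) = exp (\<kappa> * Re (Complex b' y powr p)) * exp (- x * b')" for b' y
    by (simp add: F_def kern_def norm_mult)
  have bF: "norm (F (Complex b' y)) \<le> exp (\<bar>x\<bar> * b) * exp (- (\<kappa> * \<delta>) * \<bar>y\<bar> powr p)" if "0 \<le> b'" "b' \<le> b" "\<bar>y\<bar> \<ge> R" for b' y
  proof -
    have "exp (\<kappa> * Re (Complex b' y powr p)) \<le> exp (- (\<kappa> * \<delta>) * \<bar>y\<bar> powr p)"
      using mult_left_mono[OF decay[OF that], of \<kappa>] \<kappa> by (simp add: mult_ac)
    moreover have "- x * b' \<le> \<bar>x\<bar> * b" using that
      by (metis abs_ge_minus_self abs_ge_zero mult_left_mono mult_right_mono order_trans)
    then have "exp (- x * b') \<le> exp (\<bar>x\<bar> * b)" by simp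
    ultimately show ?thesis unfolding normF by (subst mult.commute) (intro mult_mono, auto)
  qed
  have int: "integrable lborel (\<lambda>y. F (Complex b' y))" if b': "0 \<le> b'" "b' \<le> b" for b'
  proof -
    have cont: "continuous_on UNIV (\<lambda>y. F (Complex b' y))"
      by (rule continuous_on_compose2[OF contF]) (use b' in \<open>auto simp: Complex_eq intro!: continuous_intros\<close>)
    have "bounded ((\<lambda>y. F (Complex b' y)) ` {-R..R})"
      by (intro compact_imp_bounded compact_continuous_image continuous_on_subset[OF cont]) auto
    then obtain K where "\<forall>z\<in>(\<lambda>y. F (Complex b' y)) ` {-R..R}. norm z \<le> K"
      unfolding bounded_iff by blast
    then have K: "norm (F (Complex b' y)) \<le> K" if "y \<in> {-R..R}" for y using that by blast
    have "integrable lborel (\<lambda>y. K * indicator {-R..R} y + exp (\<bar>x\<bar> * b) * exp (- (\<kappa> * \<delta>) * \<bar>y\<bar> powr p))"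
      using \<kappa> \<delta> R by (intro Bochner_Integration.integrable_add integrable_mult_right integrable_exp_powr_line integrable_real_indicator) auto
    then show ?thesis
    proof (rule Bochner_Integration.integrable_bound)
      show "(\<lambda>y. F (Complex b' y)) \<in> borel_measurable lborel" using cont by (simp add: borel_measurable_continuous_onI)
      have "norm (F (Complex b' y)) \<le> K * indicator {-R..R} y + exp (\<bar>x\<bar> * b) * exp (- (\<kappa> * \<delta>) * \<bar>y\<bar> powr p)" for y
      proof (cases "\<bar>y\<bar> \<ge> R")
        case True
        have "K \<ge> 0" using order_trans[OF norm_ge_zero K[of 0]] R by simp
        then have "0 \<le> K * indicator {-R..R} y" by simp
        then show ?thesis using bF[OF b' True] by linarith
      next
        case False
        have "0 \<le> exp (\<bar>x\<bar> * b) * exp (- (\<kappa> * \<delta>) * \<bar>y\<bar> powr p)" by simp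
        moreover have "y \<in> {-R..R}" using False by auto
        ultimately show ?thesis using K[of y] by (simp add: add_increasing2)
      qed
      then show "AE y in lborel. norm (F (Complex b' y)) \<le> norm (K * indicator {-R..R} y + exp (\<bar>x\<bar> * b) * exp (- (\<kappa> * \<delta>) * \<bar>y\<bar> powr p))"
        by (intro AE_I2) (auto intro: order_trans[OF _ abs_ge_self])
    qed
  qed
  show "integrable lborel (\<lambda>y. kern \<kappa> (Complex b y) * exp (- x * Complex b y))"
    using int[of b] b by (simp add: F_def)
  have lim: "(\<lambda>n. integral {- real n..real n} (\<lambda>y. F (Complex b' y))) \<longlonglongrightarrow> (\<integral>y. F (Complex b' y) \<partial>lborel)" if b': "0 \<le> b'" "b' \<le> b" for b'
  proof -
    have "(\<lambda>n. \<integral>y. indicator {- real n..real n} y *\<^sub>R F (Complex b' y) \<partial>lborel) \<longlonglongrightarrow> (\<integral>y. F (Complex b' y) \<partial>lborel)"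
    proof (rule integral_dominated_convergence[where w = "\<lambda>y. norm (F (Complex b' y))"])
      show "AE y in lborel. (\<lambda>n. indicator {- real n..real n} y *\<^sub>R F (Complex b' y)) \<longlonglongrightarrow> F (Complex b' y)"
      proof (intro AE_I2)
        fix y :: real
        obtain n0 where "\<bar>y\<bar> \<le> real n0" using real_arch_simple by blast
        then have "\<forall>\<^sub>F n in sequentially. indicator {- real n..real n} y *\<^sub>R F (Complex b' y) = F (Complex b' y)"
          by (auto simp: eventually_sequentially indicator_def intro!: exI[of _ n0])
        then show "(\<lambda>n. indicator {- real n..real n} y *\<^sub>R F (Complex b' y)) \<longlonglongrightarrow> F (Complex b' y)"
          by (rule tendsto_eventually)
      qed
    qed (use int[OF b'] in \<open>auto simp: indicator_def\<close>)
    moreover have "(\<integral>y. indicator {- real n..real n} y *\<^sub>R F (Complex b' y) \<partial>lborel) = integral {- real n..real n} (\<lambda>y. F (Complex b' y))" for n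
      using set_borel_integral_eq_integral(2)[of "{- real n..real n}" "\<lambda>y. F (Complex b' y)"] int[OF b']
      by (simp add: set_lebesgue_integral_def set_integrable_def integrable_mult_indicator)
    ultimately show ?thesis by simp
  qed
  have diff: "norm (integral {- real n..real n} (\<lambda>y. F (Complex b y)) - integral {- real n..real n} (\<lambda>y. F (Complex 0 y)))
       \<le> 2 * b * (exp (\<bar>x\<bar> * b) * exp (- (\<kappa> * \<delta>) * real n powr p))" if n: "real n \<ge> R" for n
  proof -
    let ?r = "real n"
    have r: "?r > 0" using n R by linarith
    let ?A = "Complex 0 (- ?r)" and ?B = "Complex b (- ?r)" and ?C = "Complex b ?r" and ?D = "Complex 0 ?r"
    have seg: "closed_segment u v \<subseteq> {z. 0 \<le> Re z}" if "0 \<le> Re u" "0 \<le> Re v" for u v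
      by (rule closed_segment_subset) (use that in \<open>auto intro: convex_halfspace_Re_ge\<close>)
    have "(F has_contour_integral 0) (linepath ?A ?B +++ linepath ?B ?C +++ linepath ?C ?D +++ linepath ?D ?A)"
    \<comment> \<open>The left side of the rectangle passes through the branch point 0. The version
      for convex sets asks for continuity on the closed half-plane and for differentiability only
      inside.\<close>
    proof (rule Cauchy_theorem_convex[OF contF convex_halfspace_Re_ge, of "{}"])
      fix z assume "z \<in> interior {z. 0 \<le> Re z} - {}"
      then have "Re z > 0" using interior_halfspace_ge[of "1::complex" 0] by (simp add: inner_complex_def)
      then show "F field_differentiable at z"
        unfolding F_def kern_def field_differentiable_def
        by (intro exI) (rule derivative_eq_intros has_field_derivative_powr refl | force simp: complex_nonpos_Reals_iff)+
    qed (use seg b in \<open>auto simp: path_image_join\<close>)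
    then have sum0: "contour_integral (linepath ?A ?B) F + contour_integral (linepath ?B ?C) F
        + contour_integral (linepath ?C ?D) F + contour_integral (linepath ?D ?A) F = 0"
      by (rule has_chain_integral_chain_integral4)
    have ci: "F contour_integrable_on linepath u v" if "0 \<le> Re u" "0 \<le> Re v" for u v
      by (intro contour_integrable_continuous_linepath continuous_on_subset[OF contF] seg that)
    have hor: "norm (contour_integral (linepath u v) F) \<le> exp (\<bar>x\<bar> * b) * exp (- (\<kappa> * \<delta>) * ?r powr p) * norm (v - u)"
      if "Re u \<in> {0..b}" "Re v \<in> {0..b}" "Im u = y" "Im v = y" "\<bar>y\<bar> = ?r" for u v y
    proof (rule contour_integral_bound_linepath)
      fix z assume z: "z \<in> closed_segment u v"
      obtain t where t: "0 \<le> t" "t \<le> 1" "z = (1 - t) *\<^sub>R u + t *\<^sub>R v"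
        using z by (auto simp: in_segment)
      have "Im z = (1 - t) * Im u + t * Im v" using t(3) by simp
      then have "Im z = y" using that by (simp add: algebra_simps)
      moreover have "0 \<le> Re z" using t that by simp
      moreover have "(1 - t) * Re u + t * Re v \<le> b" using t that by (intro convex_bound_le) auto
      then have "Re z \<le> b" using t(3) by simp
      ultimately have "z = Complex (Re z) y" "0 \<le> Re z" "Re z \<le> b" by (auto simp: complex_eq_iff)
      then show "norm (F z) \<le> exp (\<bar>x\<bar> * b) * exp (- (\<kappa> * \<delta>) * ?r powr p)"
        using bF[of "Re z" y] that n by metis
    qed (use ci that in auto)
    have "contour_integral (linepath ?B ?C) F = \<i> * integral {- ?r..?r} (\<lambda>y. F (Complex b y))"
      using r by (intro contour_integral_linepath_same_Re) auto
    moreover have "contour_integral (linepath ?D ?A) F = - contour_integral (linepath ?A ?D) F"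
      using contour_integral_reversepath[of "linepath ?A ?D" F] by simp
    moreover have "contour_integral (linepath ?A ?D) F = \<i> * integral {- ?r..?r} (\<lambda>y. F (Complex 0 y))"
      using r by (intro contour_integral_linepath_same_Re) auto
    ultimately have "\<i> * (integral {- ?r..?r} (\<lambda>y. F (Complex b y)) - integral {- ?r..?r} (\<lambda>y. F (Complex 0 y)))
        = - (contour_integral (linepath ?A ?B) F + contour_integral (linepath ?C ?D) F)"
      using sum0 by (simp add: algebra_simps add_eq_0_iff)
    then have "norm (integral {- ?r..?r} (\<lambda>y. F (Complex b y)) - integral {- ?r..?r} (\<lambda>y. F (Complex 0 y)))
        = norm (contour_integral (linepath ?A ?B) F + contour_integral (linepath ?C ?D) F)"
      by (metis mult_1 norm_ii norm_minus_cancel norm_mult)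
    also have "\<dots> \<le> exp (\<bar>x\<bar> * b) * exp (- (\<kappa> * \<delta>) * ?r powr p) * norm (?B - ?A) + exp (\<bar>x\<bar> * b) * exp (- (\<kappa> * \<delta>) * ?r powr p) * norm (?D - ?C)"
      by (rule norm_triangle_mono; rule hor) (use b in auto)
    also have "\<dots> = 2 * b * (exp (\<bar>x\<bar> * b) * exp (- (\<kappa> * \<delta>) * ?r powr p))"
      using b by (simp add: cmod_def)
    finally show ?thesis .
  qed
  have "(\<lambda>n. integral {- real n..real n} (\<lambda>y. F (Complex b y)) - integral {- real n..real n} (\<lambda>y. F (Complex 0 y))) \<longlonglongrightarrow> 0"
  proof (rule Lim_null_comparison)
    show "\<forall>\<^sub>F n in sequentially. norm (integral {- real n..real n} (\<lambda>y. F (Complex b y)) - integral {- real n..real n} (\<lambda>y. F (Complex 0 y)))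
       \<le> 2 * b * (exp (\<bar>x\<bar> * b) * exp (- (\<kappa> * \<delta>) * real n powr p))"
      using eventually_ge_at_top[of "nat \<lceil>R\<rceil>"]
    proof eventually_elim
      case (elim n)
      then have "R \<le> real n" by (simp add: nat_le_iff ceiling_le_iff)
      then show ?case by (rule diff)
    qed
    define e where "e = \<kappa> * \<delta>"
    have "e > 0" using \<kappa> \<delta> by (simp add: e_def)
    have "(\<lambda>n. exp (- e * real n powr p)) \<longlonglongrightarrow> 0"
    proof (rule Lim_null_comparison)
      show "(\<lambda>n. exp (- e) ^ n) \<longlonglongrightarrow> 0" using \<open>e > 0\<close> by (intro LIMSEQ_power_zero) simp
      have "exp (- e * real n powr p) \<le> exp (- e) ^ n" if "n \<ge> 1" for n
      proof -
        have "real n \<le> real n powr p" using powr_mono[of 1 p "real n"] that p_pos by simp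
        then show ?thesis using \<open>e > 0\<close> by (simp add: exp_of_nat_mult[symmetric] mult.commute)
      qed
      then show "\<forall>\<^sub>F n in sequentially. norm (exp (- e * real n powr p)) \<le> exp (- e) ^ n"
        by (intro eventually_sequentiallyI[of 1]) simp
    qed
    then have "(\<lambda>n. exp (- (\<kappa> * \<delta>) * real n powr p)) \<longlonglongrightarrow> 0" by (simp only: e_def)
    then show "(\<lambda>n. 2 * b * (exp (\<bar>x\<bar> * b) * exp (- (\<kappa> * \<delta>) * real n powr p))) \<longlonglongrightarrow> 0"
      by (intro tendsto_mult_right_zero)
  qed
  moreover have "(\<lambda>n. integral {- real n..real n} (\<lambda>y. F (Complex b y)) - integral {- real n..real n} (\<lambda>y. F (Complex 0 y)))
     \<longlonglongrightarrow> (\<integral>y. F (Complex b y) \<partial>lborel) - (\<integral>y. F (Complex 0 y) \<partial>lborel)"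
    using b by (intro tendsto_diff lim) auto
  ultimately have "0 = (\<integral>y. F (Complex b y) \<partial>lborel) - (\<integral>y. F (Complex 0 y) \<partial>lborel)"
    by (rule LIMSEQ_unique)
  then show "(\<integral>y. kern \<kappa> (Complex b y) * exp (- x * Complex b y) \<partial>lborel) = (\<integral>y. kern \<kappa> (Complex 0 y) * exp (- x * Complex 0 y) \<partial>lborel)"
    unfolding F_def by simp
qed

end

section \<open>Inversion of the Laplace transform\<close>

text \<open>The closed cone of arguments between \<open>- pi / 4\<close> and \<open>pi / 4\<close>,
  together with its apex 0.\<close>

definition sector :: "complex set" where "sector = {z. \<bar>Im z\<bar> \<le> Re z}"

lemma convex_sector: "convex sector"
  unfolding sector_def convex_def
proof (intro ballI allI impI, clarsimp)
  fix x y :: complex and u v :: real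
  assume *: "\<bar>Im x\<bar> \<le> Re x" "\<bar>Im y\<bar> \<le> Re y" "0 \<le> u" "0 \<le> v" "u + v = 1"
  have "\<bar>u * Im x + v * Im y\<bar> \<le> u * \<bar>Im x\<bar> + v * \<bar>Im y\<bar>"
    using * abs_triangle_ineq[of "u * Im x" "v * Im y"] by (simp add: abs_mult)
  also have "\<dots> \<le> u * Re x + v * Re y" using * by (intro add_mono mult_left_mono) auto
  finally show "\<bar>u * Im x + v * Im y\<bar> \<le> u * Re x + v * Re y" .
qed

lemma interior_sector: "{z. \<bar>Im z\<bar> < Re z} \<subseteq> interior sector" "interior sector \<subseteq> {z. \<bar>Im z\<bar> < Re z}"
proof -
  show "{z. \<bar>Im z\<bar> < Re z} \<subseteq> interior sector"
    by (rule interior_maximal) (auto simp: sector_def intro!: open_Collect_less continuous_intros)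
  show "interior sector \<subseteq> {z. \<bar>Im z\<bar> < Re z}"
  proof
    fix z assume "z \<in> interior sector"
    then obtain e where e: "e > 0" "ball z e \<subseteq> sector" by (auto simp: mem_interior)
    have "z - of_real (e/2) \<in> ball z e" using e by (simp add: dist_norm)
    then have "z - of_real (e/2) \<in> sector" using e by blast
    then show "z \<in> {z. \<bar>Im z\<bar> < Re z}" using e by (simp add: sector_def)
  qed
qed

lemma sector_Im_Ln: "z \<in> sector \<Longrightarrow> z \<noteq> 0 \<Longrightarrow> \<bar>Im (Ln z)\<bar> \<le> pi / 4"
proof -
  assume z: "z \<in> sector" "z \<noteq> 0"
  then have Re: "Re z > 0" by (auto simp: sector_def complex_eq_iff)
  have "\<bar>Im z / Re z\<bar> \<le> 1" using z Re by (simp add: sector_def)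
  then have "arctan (Im z / Re z) \<le> arctan 1" "arctan (- 1) \<le> arctan (Im z / Re z)"
    by (auto simp only: arctan_le_iff abs_le_iff)
  then show ?thesis
    using Arg_eq_Im_Ln[of z] arg_conv_arctan[OF Re] z by (simp add: arctan_one arctan_minus)
qed

lemma cis_quarter_sector: "r \<ge> 0 \<Longrightarrow> of_real r * cis (pi / 4) \<in> sector" "r \<ge> 0 \<Longrightarrow> of_real r * cis (- (pi / 4)) \<in> sector"
  by (auto simp: sector_def cos_45 sin_45 abs_mult)

lemma sector_rotate:
  assumes "z \<in> sector"
  shows "Re (z * cis (pi / 4)) \<ge> 0" "Re (z * cis (- (pi / 4))) \<ge> 0"
proof -
  have "Re (z * cis (pi / 4)) = (Re z - Im z) * (sqrt 2 / 2)" "Re (z * cis (- (pi / 4))) = (Re z + Im z) * (sqrt 2 / 2)"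
    by (auto simp: cos_45 sin_45 algebra_simps)
  moreover have "0 \<le> (Re z - Im z) * (sqrt 2 / 2)" "0 \<le> (Re z + Im z) * (sqrt 2 / 2)"
    using assms by (auto simp: sector_def)
  ultimately show "Re (z * cis (pi / 4)) \<ge> 0" "Re (z * cis (- (pi / 4))) \<ge> 0" by (simp_all only:)
qed

context stable_airy
begin

text \<open>In the sector \<open>p\<close> times the argument is at most \<open>3 * pi / 4\<close>
  in modulus, so \<open>Ln\<close> undoes the power without a jump. Consequently
  \<open>q - z powr p / p\<close> has only its real zero there.\<close>

lemma sector_powr_inj:
  assumes w: "w \<in> sector" and x: "x > 0" and eq: "w powr of_real p = complex_of_real x powr of_real p"
  shows "w = of_real x"
proof -
  have w0: "w \<noteq> 0" using eq x p_pos by auto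
  have "\<bar>p * Im (Ln w)\<bar> \<le> 3 * (pi / 4)"
    unfolding abs_mult using p_gt_2 p_lt_3 sector_Im_Ln[OF w w0] by (intro mult_mono) auto
  then have "\<bar>p * Im (Ln w)\<bar> < pi" using pi_gt_zero by linarith
  then have "Ln (w powr p) = p * Ln w"
    using w0 by (auto simp: powr_def abs_less_iff intro!: Ln_exp)
  moreover have "Ln (of_real x powr complex_of_real p) = p * Ln (of_real x)"
    using x by (auto simp: powr_def Ln_of_real intro!: Ln_exp)
  ultimately have "of_real p * Ln w = of_real p * Ln (of_real x)" using eq by metis
  then have "Ln w = Ln (of_real x)" using p_pos by simp
  then show ?thesis using w0 x by (metis exp_Ln of_real_eq_0_iff less_irrefl)
qed

text \<open>Use the rays at angles \<open>pi / 4\<close> and \<open>- pi / 4\<close>: for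
  \<open>z\<close> in the sector the product of \<open>z\<close> with a point of these rays has
  nonnegative real part, so \<open>exp (- z * w)\<close> has modulus at most 1 and the integrand is
  dominated by the one for \<open>z = 0\<close>. On the imaginary axis this would fail.\<close>

lemma airy_bounded_sector: "\<exists>C. \<forall>z\<in>sector. norm (airy z) \<le> C"
proof -
  let ?f = "\<lambda>s z r. indicator {0<..} r *\<^sub>R exp (of_real 1 * cis (p * (s * (pi/4))) * of_real (r powr p) - z * cis (s * (pi/4)) * of_real r)"
  let ?C = "\<lambda>s. \<integral>r. norm (?f s 0 r) \<partial>lborel"
  have ray: "norm (ray 1 (s * (pi/4)) z) \<le> ?C s" if z: "z \<in> sector" and s: "s = 1 \<or> s = - 1" for z s
  proof -
    have "norm (ray 1 (s * (pi/4)) z) = norm (\<integral>r. ?f s z r \<partial>lborel)"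
      unfolding ray_def norm_mult by simp
    also have "\<dots> \<le> (\<integral>r. norm (?f s z r) \<partial>lborel)" by (rule integral_norm_bound)
    also have "\<dots> \<le> ?C s"
    proof (rule integral_mono)
      show "integrable lborel (\<lambda>r. norm (?f s z r))"
        using ray_aux(1)[OF zero_less_one quarter_pi_angle s, of z] by (intro integrable_norm) simp
      show "integrable lborel (\<lambda>r. norm (?f s 0 r))"
        using ray_aux(1)[OF zero_less_one quarter_pi_angle s, of 0] by (intro integrable_norm) simp
      fix r :: real
      have "Re (z * cis (s * (pi/4))) \<ge> 0" using sector_rotate[OF z] s by auto
      then have "r > 0 \<Longrightarrow> Re (z * cis (s * (pi / 4)) * of_real r) \<ge> 0" by (simp only: Re_complex_of_real times_complex.sel) simp
      then show "norm (?f s z r) \<le> norm (?f s 0 r)"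
        by (auto simp: indicator_def)
    qed
    finally show ?thesis .
  qed
  have "norm (airy z) \<le> p / (2 * pi) * (?C 1 + ?C (- 1))" if z: "z \<in> sector" for z
  proof -
    have "airy z = p / (2 * pi * \<i>) * (ray 1 (pi/4) z - ray 1 (- (pi/4)) z)"
      using airy_ray[OF zero_less_one quarter_pi_angle, of z] by simp
    then have "norm (airy z) = p / (2 * pi) * norm (ray 1 (pi/4) z - ray 1 (- (pi/4)) z)"
      using p_pos by (simp add: norm_mult norm_divide)
    also have "\<dots> \<le> p / (2 * pi) * (?C 1 + ?C (- 1))"
      using ray[OF z, of 1] ray[OF z, of "- 1"] p_pos norm_triangle_ineq4[of "ray 1 (pi/4) z" "ray 1 (- (pi/4)) z"]
      by (intro mult_left_mono) auto
    finally show ?thesis .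
  qed
  then show ?thesis by blast
qed

text \<open>Dominated convergence on the same two rays, where \<open>exp (- z * w)\<close> tends to
  0 for every \<open>r > 0\<close> as \<open>z\<close> tends to infinity along the reals. It later
  excludes an atom of the area at 0.\<close>

lemma airy_tendsto_0:
  assumes x: "filterlim x at_top sequentially"
  shows "(\<lambda>n. airy (of_real (x n))) \<longlonglongrightarrow> 0"
proof -
  let ?f = "\<lambda>s z r. indicator {0<..} r *\<^sub>R exp (of_real 1 * cis (p * (s * (pi/4))) * of_real (r powr p) - z * cis (s * (pi/4)) * of_real r)"
  have x': "\<forall>\<^sub>F n in sequentially. x n \<ge> 0" using x by (auto simp: filterlim_at_top)
  obtain n0 where n0: "\<And>n. n \<ge> n0 \<Longrightarrow> x n \<ge> 0" using x' by (auto simp: eventually_sequentially)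
  have xs: "filterlim (\<lambda>n. x (n + n0)) at_top sequentially"
    by (rule filterlim_compose[OF x filterlim_add_const_nat_at_top])
  have lim: "(\<lambda>n. ray 1 (s * (pi/4)) (of_real (x (n + n0)))) \<longlonglongrightarrow> 0" if s: "s = 1 \<or> s = - 1" for s
  proof -
    have "(\<lambda>n. \<integral>r. ?f s (of_real (x (n + n0))) r \<partial>lborel) \<longlonglongrightarrow> integral\<^sup>L lborel (\<lambda>r::real. 0)"
    proof (rule integral_dominated_convergence[where w = "\<lambda>r. norm (?f s 0 r)"])
      show "integrable lborel (\<lambda>r. norm (?f s 0 r))"
        using ray_aux(1)[OF zero_less_one quarter_pi_angle s, of 0] by (intro integrable_norm) simp
      have cs: "cos (s * pi / 4) = sqrt 2 / 2" using s by (auto simp: cos_45)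
      show "AE r in lborel. (\<lambda>n. ?f s (of_real (x (n + n0))) r) \<longlonglongrightarrow> 0"
      proof (intro AE_I2)
        fix r :: real
        show "(\<lambda>n. ?f s (of_real (x (n + n0))) r) \<longlonglongrightarrow> 0"
        proof (cases "r > 0")
          case True
          define a where "a = sqrt 2 / 2 * r"
          have a: "a > 0" using True by (simp add: a_def)
          have "filterlim (\<lambda>n. a * x (n + n0)) at_top sequentially"
            by (rule filterlim_tendsto_pos_mult_at_top[OF tendsto_const a xs])
          then have "(\<lambda>n. exp (- (a * x (n + n0)))) \<longlonglongrightarrow> 0"
            by (intro filterlim_compose[OF exp_at_bot] filterlim_compose[OF filterlim_uminus_at_bot_at_top])
          then have "(\<lambda>n. exp (cos (p * (s * (pi/4))) * r powr p) * exp (- (a * x (n + n0)))) \<longlonglongrightarrow> 0"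
            by (rule tendsto_mult_right_zero)
          moreover have "norm (?f s (of_real (x (n + n0))) r) = exp (cos (p * (s * (pi/4))) * r powr p) * exp (- (a * x (n + n0)))" for n
            using True by (simp add: cs a_def mult_exp_exp)
          ultimately show ?thesis by (subst tendsto_norm_zero_iff[symmetric]) (simp only:)
        qed (simp add: indicator_def)
      qed
      show "AE r in lborel. norm (?f s (of_real (x (n + n0))) r) \<le> norm (?f s 0 r)" for n
        using n0[of "n + n0"] by (intro AE_I2) (auto simp: indicator_def cs)
    qed measurable
    then show ?thesis unfolding ray_def integral_zero by (rule tendsto_mult_right_zero)
  qed
  have "(\<lambda>n. p / (2 * pi * \<i>) * (ray 1 (1 * (pi/4)) (of_real (x (n + n0))) - ray 1 (- 1 * (pi/4)) (of_real (x (n + n0))))) \<longlonglongrightarrow> p / (2 * pi * \<i>) * (0 - 0)"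
    by (intro tendsto_intros lim) auto
  moreover have "airy z = p / (2 * pi * \<i>) * (ray 1 (1 * (pi/4)) z - ray 1 (- 1 * (pi/4)) z)" for z
    using airy_ray[OF zero_less_one quarter_pi_angle, of z] by simp
  ultimately have "(\<lambda>n. airy (of_real (x (n + n0)))) \<longlonglongrightarrow> 0" by simp
  then show ?thesis by (rule LIMSEQ_offset)
qed

text \<open>Coefficients of \<open>(1 - airy z / airy 0) / z\<close>. Defining this quotient by its
  series makes it entire, with no exception at 0, which is a corner of the contour.\<close>

definition quot_coeff :: "nat \<Rightarrow> real" where "quot_coeff n = - airy_coeff (Suc n) / airy_coeff 0"

definition airy_quot :: "complex \<Rightarrow> complex" where "airy_quot z = (\<Sum>n. of_real (quot_coeff n) * z ^ n)"

lemma airy_coeff_0: "airy_coeff 0 = rGamma (1 - 1 / p)" "airy_coeff 0 > 0"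
  using airy_0_pos by (auto simp: airy_coeff_def)

lemma airy_0_airy_coeff: "airy 0 = of_real (airy_coeff 0)" using airy_0 airy_coeff_0 by simp

lemma airy_quot_sums: "(\<lambda>n. of_real (quot_coeff n) * z ^ n) sums airy_quot z"
proof -
  have "summable (\<lambda>n. of_real (quot_coeff n) * z ^ n)"
  proof (cases "z = 0")
    case False
    have "summable (\<lambda>n. of_real (airy_coeff (Suc n)) * z ^ Suc n)"
      using airy_sums[of z] by (subst summable_Suc_iff[where f = "\<lambda>n. of_real (airy_coeff n) * z ^ n"]) (auto simp: sums_iff)
    then have "summable (\<lambda>n. (- 1 / (of_real (airy_coeff 0) * z)) * (of_real (airy_coeff (Suc n)) * z ^ Suc n))"
      by (rule summable_mult)
    then show ?thesis using False by (simp add: quot_coeff_def field_simps)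
  qed (auto intro: summable_finite[of "{0}"])
  then show ?thesis by (simp add: airy_quot_def sums_iff)
qed

lemma z_airy_quot: "z * airy_quot z = 1 - airy z / airy 0"
proof -
  have "(\<lambda>n. of_real (airy_coeff (Suc n)) * z ^ Suc n) sums (airy z - of_real (airy_coeff 0) * z ^ 0)"
    using airy_sums[of z] by (subst sums_Suc_iff) simp
  then have "(\<lambda>n. (- 1 / of_real (airy_coeff 0)) * (of_real (airy_coeff (Suc n)) * z ^ Suc n)) sums ((- 1 / of_real (airy_coeff 0)) * (airy z - of_real (airy_coeff 0) * z ^ 0))"
    by (rule sums_mult)
  moreover have "(\<lambda>n. (- 1 / of_real (airy_coeff 0)) * (of_real (airy_coeff (Suc n)) * z ^ Suc n)) = (\<lambda>n. z * (of_real (quot_coeff n) * z ^ n))"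
    by (simp add: quot_coeff_def fun_eq_iff)
  ultimately have "(\<lambda>n. z * (of_real (quot_coeff n) * z ^ n)) sums ((- 1 / of_real (airy_coeff 0)) * (airy z - of_real (airy_coeff 0) * z ^ 0))"
    by (simp only:)
  moreover have "(\<lambda>n. z * (of_real (quot_coeff n) * z ^ n)) sums (z * airy_quot z)" by (intro sums_mult airy_quot_sums)
  ultimately have "z * airy_quot z = (- 1 / of_real (airy_coeff 0)) * (airy z - of_real (airy_coeff 0) * z ^ 0)" by (rule sums_unique2[rotated])
  then show ?thesis using airy_coeff_0(2) by (simp add: airy_0_airy_coeff field_simps)
qed

lemma airy_quot_has_derivative: "(airy_quot has_field_derivative (\<Sum>n. diffs (\<lambda>n. of_real (quot_coeff n)) n * z ^ n)) (at z)"
  unfolding airy_quot_def[abs_def] by (rule termdiffs_strong_converges_everywhere) (use airy_quot_sums sums_summable in blast)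

lemma airy_quot_holomorphic: "airy_quot holomorphic_on A"
  using airy_quot_has_derivative by (meson field_differentiable_at_within field_differentiable_def holomorphic_on_def)

lemma continuous_airy_quot [continuous_intros]: "continuous_on A f \<Longrightarrow> continuous_on A (\<lambda>x. airy_quot (f x))"
  by (rule continuous_on_compose2[OF holomorphic_on_imp_continuous_on[OF airy_quot_holomorphic[of UNIV]]]) auto

lemma airy_quot_measurable [measurable]: "airy_quot \<in> borel_measurable borel"
  by (rule borel_measurable_continuous_onI) (intro continuous_intros)

lemma airy_quot_cnj: "airy_quot (cnj z) = cnj (airy_quot z)"
  using sums_unique2[OF airy_quot_sums[of "cnj z"], of "cnj (airy_quot z)"] airy_quot_sums[of z, THEN sums_cnj[THEN iffD2]] by simp

text \<open>Compactness handles the unit disc; outside it the bound on \<open>airy\<close> in the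
  sector is divided by \<open>norm z\<close>.\<close>

lemma airy_quot_bound:
  obtains B where "B > 0" "\<And>z. z \<in> sector \<Longrightarrow> norm (airy_quot z) \<le> B / (1 + norm z)"
proof -
  obtain C where C: "\<And>z. z \<in> sector \<Longrightarrow> norm (airy z) \<le> C" using airy_bounded_sector by blast
  have "0 \<in> sector" by (simp add: sector_def)
  then have C0: "C \<ge> 0" using C norm_ge_zero order_trans by blast
  have "compact (airy_quot ` cball 0 1)" by (intro compact_continuous_image continuous_intros) auto
  then obtain D where D: "\<forall>w\<in>airy_quot ` cball 0 1. norm w \<le> D" using compact_imp_bounded bounded_iff by blast
  \<comment> \<open>The factor 2 pays for \<open>1 + norm z \<le> 2\<close> inside the unit disc and
    for \<open>1 + norm z \<le> 2 * norm z\<close> outside.\<close>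
  define B where "B = 2 * (\<bar>D\<bar> + 1 + C / airy_coeff 0)"
  have B: "B > 0" using C0 airy_coeff_0 by (simp add: B_def add_nonneg_pos add_pos_nonneg)
  have "norm (airy_quot z) \<le> B / (1 + norm z)" if z: "z \<in> sector" for z
  proof (cases "norm z \<le> 1")
    case True
    then have "norm (airy_quot z) \<le> D" using D by auto
    moreover have "norm (airy_quot z) * (1 + norm z) \<le> norm (airy_quot z) * 2" using True by (intro mult_left_mono) auto
    moreover have "C / airy_coeff 0 \<ge> 0" using C0 airy_coeff_0 by simp
    ultimately have "norm (airy_quot z) * (1 + norm z) \<le> B" unfolding B_def using abs_ge_self[of D] by argo
    then show ?thesis by (subst pos_le_divide_eq) (auto intro: add_pos_nonneg)
  next
    case False
    have "norm z * norm (airy_quot z) = norm (1 - airy z / airy 0)" unfolding norm_mult[symmetric] z_airy_quot ..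
    also have "\<dots> \<le> 1 + norm (airy z / airy 0)" using norm_triangle_ineq4[of 1 "airy z / airy 0"] by simp
    also have "norm (airy z / airy 0) \<le> C / airy_coeff 0" using C[OF z] airy_coeff_0 by (simp add: norm_divide airy_0_airy_coeff divide_right_mono)
    finally have 1: "norm z * norm (airy_quot z) \<le> 1 + C / airy_coeff 0" by simp
    have "(1 + norm z) * norm (airy_quot z) \<le> (2 * norm z) * norm (airy_quot z)" using False by (intro mult_right_mono) auto
    also have "\<dots> \<le> B" using 1 by (simp add: B_def)
    finally show ?thesis using False by (simp add: field_simps add_pos_nonneg)
  qed
  with B show thesis by (rule that)
qed

lemma powr_ray: "r \<ge> 0 \<Longrightarrow> (of_real r * cis (pi / 4)) powr of_real p = of_real (r powr p) * cis (p * (pi / 4))"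
proof -
  assume r: "r \<ge> 0"
  have "Ln (cis (pi / 4)) = \<i> * of_real (pi / 4)" by (auto simp: cis_conv_exp intro!: Ln_unique)
  then have "cis (pi / 4) powr of_real p = cis (p * (pi / 4))"
    by (simp add: powr_def cis_conv_exp mult_ac)
  then show ?thesis using r by (subst powr_times_real_left) (auto simp: powr_of_real)
qed

section \<open>The contour integral around the sector\<close>

context
  fixes q :: real assumes q: "q > 0"
begin

definition pole :: real where "pole = (p * q) powr (1 / p)"

definition resolvent :: "complex \<Rightarrow> complex" where "resolvent z = airy_quot z / (of_real q - z powr of_real p / of_real p)"

lemma pole_pos: "pole > 0" using q p_pos by (simp add: pole_def)

lemma pole_powr: "pole powr p = p * q" using q p_pos by (simp add: pole_def powr_powr)

lemma resolvent_denom_nz: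
  assumes "z \<in> sector" "z \<noteq> of_real pole"
  shows "of_real q - z powr of_real p / of_real p \<noteq> 0"
proof
  assume "of_real q - z powr of_real p / of_real p = 0"
  then have "z powr of_real p = of_real (p * q)" using p_pos by (simp add: field_simps)
  also have "\<dots> = of_real pole powr of_real p" using pole_pos by (simp add: powr_of_real pole_powr)
  finally show False using sector_powr_inj[OF assms(1) pole_pos] assms(2) by blast
qed

lemma continuous_on_powr_sector: "continuous_on sector (\<lambda>z::complex. z powr of_real p)"
  by (rule continuous_on_subset[OF continuous_on_powr_halfplane]) (auto simp: sector_def)

text \<open>Difference quotient of the power at the pole, with the removable singularity filled in.
  Dividing it out writes \<open>resolvent\<close> as a regular function over
  \<open>w - of_real pole\<close>, so that Cauchy's integral formula replaces a residue
  computation.\<close>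

definition pole_quot :: "complex \<Rightarrow> complex" where
  "pole_quot w = (if w = of_real pole then deriv (\<lambda>w. w powr of_real p) (of_real pole)
           else (w powr of_real p - of_real pole powr of_real p) / (w - of_real pole))"

lemma deriv_pole: "deriv (\<lambda>w::complex. w powr of_real p) (of_real pole) = of_real (p * pole powr (p - 1))"
proof -
  have "((\<lambda>w. w powr complex_of_real p) has_field_derivative (of_real p * of_real pole powr (of_real p - 1))) (at (of_real pole))"
    by (rule has_field_derivative_powr) (use pole_pos in auto)
  then have "deriv (\<lambda>w::complex. w powr of_real p) (of_real pole) = of_real p * of_real pole powr (complex_of_real (p - 1))"
    by (simp add: DERIV_imp_deriv)
  also have "of_real pole powr (complex_of_real (p - 1)) = of_real (pole powr (p - 1))"
    using pole_pos by (subst powr_of_real) auto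
  finally show ?thesis by simp
qed

lemma pole_interior: "of_real pole \<in> interior sector"
  using interior_sector(1) pole_pos by (auto intro!: subsetD[OF interior_sector(1)])

lemma pole_quot_holomorphic: "pole_quot holomorphic_on interior sector"
  unfolding pole_quot_def[abs_def]
proof (rule pole_lemma_open)
  show "(\<lambda>w. w powr complex_of_real p) holomorphic_on interior sector"
    by (intro holomorphic_intros) (use interior_sector(2) in \<open>auto simp: complex_nonpos_Reals_iff\<close>)
qed auto

lemma continuous_on_pole_quot: "continuous_on sector pole_quot"
  unfolding continuous_on_eq_continuous_within
proof
  fix w assume w: "w \<in> sector"
  show "continuous (at w within sector) pole_quot"
  proof (cases "w = of_real pole")
    case True
    have "isCont pole_quot w" using pole_quot_holomorphic pole_interior True
      by (metis continuous_on_interior holomorphic_on_imp_continuous_on interior_interior)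
    then show ?thesis by (rule continuous_at_imp_continuous_at_within)
  next
    case False
    have t: "((\<lambda>v. v powr complex_of_real p) \<longlongrightarrow> w powr complex_of_real p) (at w within sector)"
      using continuous_on_powr_sector w by (auto simp: continuous_on_def)
    have "((\<lambda>v. (v powr of_real p - of_real pole powr of_real p) / (v - of_real pole)) \<longlongrightarrow>
        (w powr of_real p - of_real pole powr of_real p) / (w - of_real pole)) (at w within sector)"
      by (intro tendsto_divide tendsto_diff tendsto_const tendsto_ident_at t) (use False in simp)
    moreover have "\<forall>\<^sub>F v in at w within sector. pole_quot v = (v powr of_real p - of_real pole powr of_real p) / (v - of_real pole)"
    proof -
      have "\<forall>\<^sub>F v in at w within sector. v \<noteq> of_real pole"
        by (rule tendsto_imp_eventually_ne[OF tendsto_ident_at False])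
      then show ?thesis by eventually_elim (simp add: pole_quot_def)
    qed
    ultimately have "(pole_quot \<longlongrightarrow> (w powr of_real p - of_real pole powr of_real p) / (w - of_real pole)) (at w within sector)"
      by (subst tendsto_cong)
    then show ?thesis using False by (simp add: continuous_within pole_quot_def)
  qed
qed

lemma pole_quot_nz: "w \<in> sector \<Longrightarrow> pole_quot w \<noteq> 0"
  using resolvent_denom_nz[of w] pole_pos p_pos sector_powr_inj[of w pole] by (auto simp: pole_quot_def deriv_pole)

lemma resolvent_eq: "w \<noteq> of_real pole \<Longrightarrow> resolvent w = (- of_real p * airy_quot w / pole_quot w) / (w - of_real pole)"
proof -
  assume w: "w \<noteq> of_real pole"
  have "of_real q = of_real pole powr of_real p / complex_of_real p"
    using pole_pos p_pos by (simp add: powr_of_real pole_powr)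
  then have "of_real q - w powr of_real p / of_real p = - (w powr of_real p - of_real pole powr of_real p) / of_real p"
    by (simp add: diff_divide_distrib)
  also have "\<dots> = - (pole_quot w * (w - of_real pole)) / of_real p" using w by (simp add: pole_quot_def)
  finally have e: "of_real q - w powr of_real p / of_real p = - (pole_quot w * (w - of_real pole)) / of_real p" .
  show ?thesis unfolding resolvent_def e by (simp add: mult_ac)
qed

text \<open>The triangle is run through counterclockwise and winds once around the pole. Its corner
  0 is a branch point of the power, so Cauchy's formula is used in the form that needs continuity on
  the closed sector and differentiability only in its interior. At the pole \<open>pole_quot\<close>
  equals \<open>p * pole powr (p - 1) = p * (p * q) / pole\<close>, which explains the denominator
  of the value.\<close>

lemma triangle_contour:
  assumes d: "d > pole"
  shows "contour_integral (linepath 0 (Complex d (- d))) resolvent + contour_integral (linepath (Complex d (- d)) (Complex d d)) resolvent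
       + contour_integral (linepath (Complex d d) 0) resolvent = - (2 * pi * \<i> * p * airy_quot (of_real pole) * of_real pole / of_real (p * (p * q)))"
    and "resolvent contour_integrable_on linepath 0 (Complex d (- d))" "resolvent contour_integrable_on linepath 0 (Complex d d)"
proof -
  have d0: "d > 0" using d pole_pos by simp
  let ?a = "0::complex" and ?b = "Complex d (- d)" and ?c = "Complex d d"
  let ?\<gamma> = "linepath ?a ?b +++ linepath ?b ?c +++ linepath ?c ?a"
  let ?f = "\<lambda>w. - of_real p * airy_quot w / pole_quot w"
  have inS: "?a \<in> sector" "?b \<in> sector" "?c \<in> sector" using d0 by (auto simp: sector_def)
  have seg: "closed_segment u v \<subseteq> sector" if "u \<in> sector" "v \<in> sector" for u v
    using that convex_sector by (rule closed_segment_subset)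
  have edge1: "of_real pole \<notin> closed_segment ?a ?b" "of_real pole \<notin> closed_segment ?a ?c"
    using d0 pole_pos by (auto simp: in_segment complex_eq_iff)
  have edge2: "of_real pole \<notin> closed_segment ?b ?c"
    using d by (auto simp: in_segment complex_eq_iff algebra_simps)
  have edge3: "of_real pole \<notin> closed_segment ?c ?a" using edge1(2) by (subst closed_segment_commute)
  have z0tri: "of_real pole \<in> interior (convex hull {?a, ?b, ?c})"
  proof -
    have sub: "{z. \<bar>Im z\<bar> < Re z \<and> Re z < d} \<subseteq> convex hull {?a, ?b, ?c}"
    proof
      fix z assume "z \<in> {z. \<bar>Im z\<bar> < Re z \<and> Re z < d}"
      then have z: "\<bar>Im z\<bar> < Re z" "Re z < d" by auto
      define v where "v = (Re z - Im z) / (2 * d)"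
      define w where "w = (Re z + Im z) / (2 * d)"
      have "v \<ge> 0" "w \<ge> 0" "v + w \<le> 1" using z d0 by (auto simp: v_def w_def field_simps)
      moreover have "z = (1 - v - w) *\<^sub>R ?a + v *\<^sub>R ?b + w *\<^sub>R ?c"
        using d0 by (auto simp: complex_eq_iff v_def w_def field_simps)
      ultimately show "z \<in> convex hull {?a, ?b, ?c}"
        unfolding convex_hull_3 by (intro CollectI exI[of _ "1 - v - w"] exI[of _ v] exI[of _ w]) auto
    qed
    have "open {z. \<bar>Im z\<bar> < Re z \<and> Re z < d}"
      by (intro open_Collect_conj open_Collect_less continuous_intros)
    then show ?thesis using interior_maximal[OF sub] pole_pos d by auto
  qed
  have wind: "winding_number ?\<gamma> (of_real pole) = 1"
    unfolding winding_number_triangle[OF z0tri] using d0 pole_pos by simp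
  have contf: "continuous_on sector ?f"
    by (intro continuous_intros continuous_on_pole_quot) (use pole_quot_nz in auto)
  have "((\<lambda>w. ?f w / (w - of_real pole)) has_contour_integral (2 * pi * \<i> * winding_number ?\<gamma> (of_real pole) * ?f (of_real pole))) ?\<gamma>"
  proof (rule Cauchy_integral_formula_weak[OF convex_sector _ contf, where k = "{}"])
    fix w assume "w \<in> interior sector - {}"
    then have w: "w \<in> interior sector" by simp
    have "?f holomorphic_on interior sector"
      by (intro holomorphic_intros airy_quot_holomorphic pole_quot_holomorphic) (use pole_quot_nz interior_subset in blast)
    then show "?f field_differentiable at w" using w by (simp add: holomorphic_on_imp_differentiable_at)
  next
    show "path_image ?\<gamma> \<subseteq> sector - {of_real pole}"
      using seg inS edge1 edge2 edge3 by (auto simp: path_image_join)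
  qed (use pole_interior in auto)
  then have hc: "((\<lambda>w. ?f w / (w - of_real pole)) has_contour_integral (2 * pi * \<i> * ?f (of_real pole))) ?\<gamma>"
    by (simp add: wind)
  have "(resolvent has_contour_integral (2 * pi * \<i> * ?f (of_real pole))) ?\<gamma>"
  proof (rule has_contour_integral_eq[OF hc])
    fix w assume "w \<in> path_image ?\<gamma>"
    then have "w \<noteq> of_real pole" using edge1 edge2 edge3 by (auto simp: path_image_join)
    then show "?f w / (w - of_real pole) = resolvent w" by (rule resolvent_eq[symmetric])
  qed
  note hH0 = this
  have fz: "?f (of_real pole) = - (p * airy_quot (of_real pole) * of_real pole / of_real (p * (p * q)))"
  proof -
    have "pole powr (p - 1) = (p * q) / pole" using pole_pos pole_powr by (simp add: powr_diff)
    then have DD: "pole_quot (of_real pole) = of_real (p * ((p * q) / pole))" unfolding pole_quot_def deriv_pole by simp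
    show ?thesis unfolding DD using pole_pos p_pos q by (simp add: field_simps)
  qed
  have hH: "(resolvent has_contour_integral (- (2 * pi * \<i> * p * airy_quot (of_real pole) * of_real pole / of_real (p * (p * q))))) ?\<gamma>"
    using hH0 unfolding fz by (simp only: mult_minus_right times_divide_eq_right mult.assoc)
  then show "contour_integral (linepath 0 (Complex d (- d))) resolvent + contour_integral (linepath (Complex d (- d)) (Complex d d)) resolvent
       + contour_integral (linepath (Complex d d) 0) resolvent = - (2 * pi * \<i> * p * airy_quot (of_real pole) * of_real pole / of_real (p * (p * q)))"
    by (rule has_chain_integral_chain_integral3)
  have ci: "resolvent contour_integrable_on linepath u v" if "closed_segment u v \<subseteq> sector" "of_real pole \<notin> closed_segment u v" for u v
  proof (rule contour_integrable_continuous_linepath)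
    have "continuous_on (closed_segment u v) (\<lambda>w. airy_quot w / (of_real q - w powr of_real p / of_real p))"
      using that resolvent_denom_nz p_pos by (intro continuous_intros continuous_on_subset[OF continuous_on_powr_sector]) auto
    then show "continuous_on (closed_segment u v) resolvent" by (simp add: resolvent_def[abs_def])
  qed
  show "resolvent contour_integrable_on linepath 0 (Complex d (- d))" "resolvent contour_integrable_on linepath 0 (Complex d d)"
    using ci seg inS edge1 by auto
qed

text \<open>On the ray at angle \<open>pi / 4\<close> the real part of \<open>z powr p\<close> is
  \<open>r powr p * cos (p * pi / 4)\<close> with a negative cosine, so the real part of the
  denominator grows. Because \<open>p > 2\<close> the growth is at least quadratic, which gives
  integrability in \<open>r\<close>.\<close>

lemma denom_bound:
  obtains c' where "c' > 0" "\<And>r. r \<ge> 0 \<Longrightarrow> c' * (1 + r\<^sup>2) \<le> q - r powr p * cos (p * (pi / 4)) / p"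
proof -
  have cosneg: "cos (p * (pi / 4)) < 0"
    using quarter_pi_angle cos_lt_zero_pi[of "p * (pi/4)"] by simp
  \<comment> \<open>The first entry makes the power term dominate \<open>c' * (r * r - 1)\<close>;
    the second gives \<open>2 * c' \<le> q\<close>, which makes up the difference to
    \<open>c' * (1 + r * r)\<close>.\<close>
  define c' where "c' = min (- cos (p * (pi / 4)) / p) (q / 2)"
  have "cos (p * (pi / 4)) / p < 0" using cosneg p_pos(1) by (rule divide_neg_pos)
  then have c': "c' > 0" using q by (simp add: c'_def)
  show thesis
  proof (rule that[OF c'])
    fix r :: real assume r: "r \<ge> 0"
    have "r\<^sup>2 - 1 \<le> r powr p"
    proof (cases "r \<ge> 1")
      case True
      then have "r powr 2 \<le> r powr p" using p_gt_2 by (intro powr_mono) auto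
      then show ?thesis using True by simp
    next
      case False
      then have "r\<^sup>2 \<le> 1" using r by (simp add: power_le_one)
      then show ?thesis using powr_ge_zero[of r p] by linarith
    qed
    then have "c' * (r\<^sup>2 - 1) \<le> c' * r powr p" using c' by (intro mult_left_mono) auto
    also have "\<dots> \<le> (- cos (p * (pi / 4)) / p) * r powr p" by (intro mult_right_mono) (auto simp: c'_def)
    finally have "c' * (r\<^sup>2 - 1) \<le> - (r powr p * cos (p * (pi / 4)) / p)" by (simp add: mult_ac)
    moreover have "c' * (1 + r\<^sup>2) = c' * (r\<^sup>2 - 1) + 2 * c'" by (simp add: algebra_simps)
    moreover have "2 * c' \<le> q" by (simp add: c'_def)
    ultimately show "c' * (1 + r\<^sup>2) \<le> q - r powr p * cos (p * (pi / 4)) / p" by linarith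
  qed
qed

text \<open>Two uses of the resolvent: the quadratic bound makes the integral along the ray
  converge, and the bound in terms of \<open>Re w\<close> lets the vertical side of the triangle
  disappear.\<close>

lemma resolvent_bound:
  obtains B where "B > 0" "\<And>r. r \<ge> 0 \<Longrightarrow> norm (resolvent (of_real r * cis (pi / 4))) \<le> B / (1 + r\<^sup>2)"
    "\<And>w. w \<in> sector \<Longrightarrow> Re w powr p > p * q \<Longrightarrow> norm (resolvent w) \<le> B / ((1 + Re w) * (Re w powr p / p - q))"
proof -
  obtain B0 where B0: "B0 > 0" "\<And>z. z \<in> sector \<Longrightarrow> norm (airy_quot z) \<le> B0 / (1 + norm z)" by (rule airy_quot_bound) blast
  have B0': "norm (airy_quot z) \<le> B0" if "z \<in> sector" for z
  proof -
    have "B0 / (1 + norm z) \<le> B0 / 1" using B0(1) by (intro divide_left_mono) (auto intro: add_pos_nonneg)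
    then show ?thesis using B0(2)[OF that] by simp
  qed
  obtain c' where c': "c' > 0" "\<And>r. r \<ge> 0 \<Longrightarrow> c' * (1 + r\<^sup>2) \<le> q - r powr p * cos (p * (pi / 4)) / p"
    by (rule denom_bound) blast
  define B where "B = max B0 (B0 / c')"
  show thesis
  proof (rule that[of B])
    show "B > 0" using B0 by (simp add: B_def)
    fix r :: real assume r: "r \<ge> 0"
    have s: "of_real r * cis (pi / 4) \<in> sector" by (rule cis_quarter_sector(1)[OF r])
    have "c' * (1 + r\<^sup>2) \<le> q - r powr p * cos (p * (pi / 4)) / p" by (rule c'(2)[OF r])
    also have "\<dots> = Re (of_real q - (of_real r * cis (pi / 4)) powr of_real p / of_real p)"
      by (simp add: powr_ray[OF r])
    also have "\<dots> \<le> norm (of_real q - (of_real r * cis (pi / 4)) powr of_real p / of_real p)" by (rule complex_Re_le_cmod)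
    finally have den: "c' * (1 + r\<^sup>2) \<le> norm (of_real q - (of_real r * cis (pi / 4)) powr of_real p / of_real p)" .
    have "0 < c' * (1 + r\<^sup>2)" using c' by (intro mult_pos_pos add_pos_nonneg) auto
    then have "norm (resolvent (of_real r * cis (pi / 4))) \<le> B0 / (c' * (1 + r\<^sup>2))"
      unfolding resolvent_def norm_divide using den B0'[OF s] B0(1) by (intro frac_le) auto
    also have "\<dots> = (B0 / c') / (1 + r\<^sup>2)" by simp
    also have "\<dots> \<le> B / (1 + r\<^sup>2)" by (intro divide_right_mono) (auto simp: B_def)
    finally show "norm (resolvent (of_real r * cis (pi / 4))) \<le> B / (1 + r\<^sup>2)" .
  next
    fix w assume w: "w \<in> sector" and big: "Re w powr p > p * q"
    have Re: "Re w \<ge> 0" using w by (simp add: sector_def)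
    have Ren: "Re w \<le> norm w" by (rule complex_Re_le_cmod)
    have "norm (w powr of_real p) = norm w powr p" by (subst norm_powr_real_powr') auto
    moreover have "Re w powr p \<le> norm w powr p" using Re Ren p_pos by (intro powr_mono2) auto
    ultimately have "Re w powr p / p \<le> norm (w powr of_real p / of_real p)" using p_pos by (simp add: norm_divide divide_right_mono)
    moreover have "norm (w powr of_real p / of_real p) - norm (complex_of_real q) \<le> norm (of_real q - w powr of_real p / of_real p)"
      by (metis norm_minus_commute norm_triangle_ineq2)
    ultimately have den: "Re w powr p / p - q \<le> norm (of_real q - w powr of_real p / of_real p)" using q by simp
    have pos: "Re w powr p / p - q > 0" using big p_pos by (simp add: field_simps)
    have "norm (resolvent w) \<le> (B0 / (1 + norm w)) / (Re w powr p / p - q)"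
      unfolding resolvent_def norm_divide using B0(2)[OF w] den pos B0(1) by (intro frac_le) (auto intro: add_pos_nonneg)
    also have "\<dots> \<le> (B / (1 + Re w)) / (Re w powr p / p - q)"
      using Re Ren pos B0(1) by (intro divide_right_mono frac_le) (auto simp: B_def)
    finally show "norm (resolvent w) \<le> B / ((1 + Re w) * (Re w powr p / p - q))" by simp
  qed
qed

lemma resolvent_measurable [measurable]: "resolvent \<in> borel_measurable borel"
  unfolding resolvent_def[abs_def] by measurable

lemma resolvent_cnj: "0 \<le> Re w \<Longrightarrow> resolvent (cnj w) = cnj (resolvent w)"
  by (simp add: resolvent_def airy_quot_cnj cnj_powr)

lemma resolvent_integrable: "integrable lborel (\<lambda>r. indicator {0<..} r *\<^sub>R resolvent (of_real r * cis (pi / 4)))"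
proof -
  obtain B where B: "B > 0" "\<And>r. r \<ge> 0 \<Longrightarrow> norm (resolvent (of_real r * cis (pi / 4))) \<le> B / (1 + r\<^sup>2)" by (rule resolvent_bound) blast
  have "integrable lborel (\<lambda>r::real. B * inverse (1 + r\<^sup>2))"
    using integrable_inverse_1_plus_square by (simp add: set_integrable_def)
  then show ?thesis
  proof (rule Bochner_Integration.integrable_bound)
    have "norm (indicator {0<..} r *\<^sub>R resolvent (of_real r * cis (pi / 4))) \<le> norm (B * inverse (1 + r\<^sup>2))" for r
    proof (cases "r > 0")
      case True
      have "norm (resolvent (of_real r * cis (pi / 4))) \<le> B / (1 + r\<^sup>2)" by (rule B(2)) (use True in simp)
      also have "\<dots> \<le> norm (B * inverse (1 + r\<^sup>2))" unfolding divide_inverse real_norm_def by (rule abs_ge_self)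
      finally show ?thesis using True by (simp only: indicator_simps greaterThan_iff scaleR_one if_True)
    next
      case False
      then have "indicator {0<..} r *\<^sub>R resolvent (of_real r * cis (pi / 4)) = 0" by simp
      then show ?thesis by (simp only: norm_zero norm_ge_zero)
    qed
    then show "AE r in lborel. norm (indicator {0<..} r *\<^sub>R resolvent (of_real r * cis (pi / 4))) \<le> norm (B * inverse (1 + r\<^sup>2))"
      by (rule AE_I2)
  next
    show "(\<lambda>r. indicator {0<..} r *\<^sub>R resolvent (of_real r * cis (pi / 4))) \<in> borel_measurable lborel" by measurable
  qed
qed

lemma linepath_ray:
  assumes R: "R > 0" and ci: "resolvent contour_integrable_on linepath 0 (of_real R * e)"
    and int: "integrable lborel (\<lambda>r. indicator {0<..} r *\<^sub>R resolvent (of_real r * e))"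
  shows "contour_integral (linepath 0 (of_real R * e)) resolvent = e * (\<integral>r. indicator {0<..R} r *\<^sub>R resolvent (of_real r * e) \<partial>lborel)"
proof -
  have i2: "integrable lborel (\<lambda>r. indicator {0<..R} r *\<^sub>R resolvent (of_real r * e))"
  proof (rule Bochner_Integration.integrable_bound[OF int])
    show "(\<lambda>r. indicator {0<..R} r *\<^sub>R resolvent (of_real r * e)) \<in> borel_measurable lborel" by measurable
  qed (auto simp: indicator_def)
  have i3: "integrable lborel (\<lambda>t. indicator {0<..1} t *\<^sub>R resolvent (of_real (R * t) * e))"
    using lborel_integrable_real_affine[OF i2, of R 0] R by (simp add: indicator_def zero_less_mult_iff cong: if_cong)
  have "(resolvent has_contour_integral contour_integral (linepath 0 (of_real R * e)) resolvent) (linepath 0 (of_real R * e))"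
    by (rule has_contour_integral_integral[OF ci])
  then have "((\<lambda>t. resolvent (linepath 0 (of_real R * e) t) * (of_real R * e)) has_integral contour_integral (linepath 0 (of_real R * e)) resolvent) {0..1}"
    by (simp add: has_contour_integral_linepath)
  then have "((\<lambda>t. resolvent (of_real (R * t) * e) * (of_real R * e)) has_integral contour_integral (linepath 0 (of_real R * e)) resolvent) {0..1}"
    by (simp add: linepath_def scaleR_conv_of_real mult_ac)
  then have a: "((\<lambda>t. resolvent (of_real (R * t) * e) * (of_real R * e)) has_integral contour_integral (linepath 0 (of_real R * e)) resolvent) {0<..1}"
    by (rule iffD1[OF has_integral_spike_set_eq, rotated -1]; intro negligible_subset[OF negligible_sing[of 0]]) auto
  have si: "set_integrable lborel {0<..1} (\<lambda>t. resolvent (of_real (R * t) * e) * (of_real R * e))"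
    using i3 by (simp add: set_integrable_def flip: mult_scaleR_left)
  have "contour_integral (linepath 0 (of_real R * e)) resolvent = (\<integral>t\<in>{0<..1}. resolvent (of_real (R * t) * e) * (of_real R * e) \<partial>lborel)"
    unfolding set_borel_integral_eq_integral(2)[OF si] integral_unique[OF a] ..
  also have "\<dots> = e * (of_real R * (\<integral>t. indicator {0<..1} t *\<^sub>R resolvent (of_real (R * t) * e) \<partial>lborel))"
    unfolding set_lebesgue_integral_def by (subst mult_scaleR_left[symmetric], subst integral_mult_left_zero) (simp add: mult_ac)
  also have "of_real R * (\<integral>t. indicator {0<..1} t *\<^sub>R resolvent (of_real (R * t) * e) \<partial>lborel) = (\<integral>r. indicator {0<..R} r *\<^sub>R resolvent (of_real r * e) \<partial>lborel)"
    using lborel_integral_real_affine[of R "\<lambda>r. indicator {0<..R} r *\<^sub>R resolvent (of_real r * e)" 0] R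
    by (simp add: indicator_def zero_less_mult_iff scaleR_conv_of_real cong: if_cong)
  finally show ?thesis .
qed

text \<open>Let the triangle grow. The vertical side disappears, and the lower edge is the complex
  conjugate of the upper one, so the two together contribute \<open>- 2 * \<i>\<close> times the
  imaginary part of the upper integral. The value at the pole is rewritten by
  \<open>z_airy_quot\<close>.\<close>

lemma resolvent_ray_integral:
  "Im (cis (pi / 4) * (\<integral>r. indicator {0<..} r *\<^sub>R resolvent (of_real r * cis (pi / 4)) \<partial>lborel))
     = pi / (p * q) * Re (1 - airy (of_real pole) / airy 0)"
proof -
  define e where "e = cis (pi / 4)"
  have ce: "cnj e = cis (- (pi / 4))" by (simp add: e_def cis_cnj)
  define J where "J = e * (\<integral>r. indicator {0<..} r *\<^sub>R resolvent (of_real r * e) \<partial>lborel)"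
  define JR where "JR = (\<lambda>R. e * (\<integral>r. indicator {0<..R} r *\<^sub>R resolvent (of_real r * e) \<partial>lborel))"
  have int: "integrable lborel (\<lambda>r. indicator {0<..} r *\<^sub>R resolvent (of_real r * e))" unfolding e_def by (rule resolvent_integrable)
  have Hc: "resolvent (of_real r * cnj e) = cnj (resolvent (of_real r * e))" if "r > 0" for r
    using resolvent_cnj[of "of_real r * e"] that by (simp add: e_def cos_45)
  then have eqc: "(\<lambda>r. indicator {0<..} r *\<^sub>R resolvent (of_real r * cnj e)) = (\<lambda>r. cnj (indicator {0<..} r *\<^sub>R resolvent (of_real r * e)))"
    "\<And>R. (\<lambda>r. indicator {0<..R} r *\<^sub>R resolvent (of_real r * cnj e)) = (\<lambda>r. cnj (indicator {0<..R} r *\<^sub>R resolvent (of_real r * e)))"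
    by (auto simp: fun_eq_iff indicator_def)
  have intc: "integrable lborel (\<lambda>r. indicator {0<..} r *\<^sub>R resolvent (of_real r * cnj e))" unfolding eqc by (rule integrable_bounded_linear[OF bounded_linear_cnj int])
  obtain B where B: "B > 0" "\<And>w. w \<in> sector \<Longrightarrow> Re w powr p > p * q \<Longrightarrow> norm (resolvent w) \<le> B / ((1 + Re w) * (Re w powr p / p - q))"
    by (rule resolvent_bound) blast
  define rhs where "rhs = - (2 * pi * \<i> * p * airy_quot (of_real pole) * of_real pole / of_real (p * (p * q)))"
  have main: "norm (cnj (JR (sqrt 2 * d)) - JR (sqrt 2 * d) - rhs) \<le> 2 * B / (d powr p / p - q)" if d: "d > pole" for d
  proof -
    have d0: "d > 0" using d pole_pos by simp
    have big: "d powr p > p * q" using powr_less_mono2[of p pole d] d pole_pos p_pos pole_powr by simp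
    let ?R = "sqrt 2 * d"
    have R: "?R > 0" using d0 by simp
    have c1: "Complex d d = of_real ?R * e" "Complex d (- d) = of_real ?R * cnj e"
      by (auto simp: complex_eq_iff e_def cos_45 sin_45)
    note tri = triangle_contour[OF d]
    have l1: "contour_integral (linepath 0 (Complex d d)) resolvent = JR ?R"
      unfolding JR_def c1 by (rule linepath_ray[OF R _ int]) (use tri(3) in \<open>simp only: c1\<close>)
    have l2: "contour_integral (linepath 0 (Complex d (- d))) resolvent = cnj (JR ?R)"
    proof -
      have "contour_integral (linepath 0 (Complex d (- d))) resolvent = cnj e * (\<integral>r. indicator {0<..?R} r *\<^sub>R resolvent (of_real r * cnj e) \<partial>lborel)"
        unfolding c1 by (rule linepath_ray[OF R _ intc]) (use tri(2) in \<open>simp only: c1\<close>)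
      then show ?thesis unfolding JR_def eqc(2) complex_cnj_mult Bochner_Integration.integral_cnj .
    qed
    have l3: "contour_integral (linepath (Complex d d) 0) resolvent = - JR ?R"
      using contour_integral_reversepath[of "linepath 0 (Complex d d)" resolvent] l1 by simp
    have "cnj (JR ?R) - JR ?R - rhs = - contour_integral (linepath (Complex d (- d)) (Complex d d)) resolvent"
      using tri(1) unfolding l2 l3 rhs_def by (simp add: algebra_simps eq_neg_iff_add_eq_0)
    then have "norm (cnj (JR ?R) - JR ?R - rhs) = norm (contour_integral (linepath (Complex d (- d)) (Complex d d)) resolvent)" by simp
    also have "\<dots> \<le> B / ((1 + d) * (d powr p / p - q)) * norm (Complex d d - Complex d (- d))"
    proof (rule contour_integral_bound_linepath)
      have pos: "d powr p / p - q > 0" using big p_pos by (simp add: field_simps)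
      show "0 \<le> B / ((1 + d) * (d powr p / p - q))" using pos B d0 by simp
      have onseg: "w \<in> sector \<and> Re w = d" if w: "w \<in> closed_segment (Complex d (- d)) (Complex d d)" for w
      proof
        show "w \<in> sector" using d0 by (intro subsetD[OF closed_segment_subset[OF _ _ convex_sector] w]) (auto simp: sector_def)
        obtain u where "w = (1 - u) *\<^sub>R Complex d (- d) + u *\<^sub>R Complex d d"
          using w unfolding in_segment by blast
        then have "Re w = (1 - u) * d + u * d" by simp
        then show "Re w = d" by (simp add: algebra_simps)
      qed
      then show "norm (resolvent w) \<le> B / ((1 + d) * (d powr p / p - q))" if "w \<in> closed_segment (Complex d (- d)) (Complex d d)" for w
        using B(2)[of w] onseg[OF that] big by simp
      have "continuous_on (closed_segment (Complex d (- d)) (Complex d d)) (\<lambda>w. airy_quot w / (of_real q - w powr of_real p / of_real p))"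
      proof (intro continuous_intros continuous_on_subset[OF continuous_on_powr_sector] ballI)
        fix w assume "w \<in> closed_segment (Complex d (- d)) (Complex d d)"
        then have "w \<in> sector" "Re w = d" using onseg by auto
        then show "of_real q - w powr of_real p / of_real p \<noteq> 0" using d by (intro resolvent_denom_nz) auto
      qed (use onseg p_pos d0 in auto)
      then show "resolvent contour_integrable_on linepath (Complex d (- d)) (Complex d d)"
        by (intro contour_integrable_continuous_linepath) (simp add: resolvent_def[abs_def])
    qed
    also have "Complex d d - Complex d (- d) = of_real (2 * d) * \<i>" by (simp add: complex_eq_iff)
    also have "norm (of_real (2 * d) * \<i>) = 2 * d" using d0 by (simp add: norm_mult)
    \<comment> \<open>The decay of \<open>airy_quot\<close> supplies the factor \<open>1 + d\<close>
      that absorbs the length \<open>2 * d\<close> of the side; the growth of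
      \<open>d powr p\<close> is left over.\<close>
    also have "B / ((1 + d) * (d powr p / p - q)) * (2 * d) = (2 * B / (d powr p / p - q)) * (d / (1 + d))" by (simp add: mult_ac)
    also have "\<dots> \<le> (2 * B / (d powr p / p - q)) * 1"
      using d0 B big p_pos by (intro mult_left_mono) (auto simp: field_simps)
    finally show ?thesis by simp
  qed
  have JRlim: "(\<lambda>n. JR (sqrt 2 * real n)) \<longlonglongrightarrow> J"
    unfolding JR_def J_def
  proof (intro tendsto_mult_left integral_dominated_convergence[where w = "\<lambda>r. norm (indicator {0<..} r *\<^sub>R resolvent (of_real r * e))"])
    show "AE r in lborel. (\<lambda>n. indicator {0<..sqrt 2 * real n} r *\<^sub>R resolvent (of_real r * e)) \<longlonglongrightarrow> indicator {0<..} r *\<^sub>R resolvent (of_real r * e)"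
    proof (intro AE_I2 tendsto_eventually)
      fix r :: real
      obtain n0 where n0: "r \<le> real n0" using real_arch_simple by blast
      have "r \<le> sqrt 2 * real n" if "n \<ge> n0" for n
      proof -
        have "1 * real n \<le> sqrt 2 * real n" by (intro mult_right_mono) auto
        then show ?thesis using n0 that by (auto intro: order_trans)
      qed
      then show "\<forall>\<^sub>F n in sequentially. indicator {0<..sqrt 2 * real n} r *\<^sub>R resolvent (of_real r * e) = indicator {0<..} r *\<^sub>R resolvent (of_real r * e)"
        by (intro eventually_sequentiallyI[of n0]) (auto simp: indicator_def)
    qed
    show "integrable lborel (\<lambda>r. norm (indicator {0<..} r *\<^sub>R resolvent (of_real r * e)))"
      by (rule integrable_norm[OF int])
    show "AE r in lborel. norm (indicator {0<..sqrt 2 * real n} r *\<^sub>R resolvent (of_real r * e)) \<le> norm (indicator {0<..} r *\<^sub>R resolvent (of_real r * e))" for n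
      by (intro AE_I2) (auto simp: indicator_def)
  qed measurable
  have "(\<lambda>n. cnj (JR (sqrt 2 * real n)) - JR (sqrt 2 * real n) - rhs) \<longlonglongrightarrow> 0"
  proof (rule Lim_null_comparison)
    obtain n0 where "pole < real n0" using reals_Archimedean2 by blast
    then show "\<forall>\<^sub>F n in sequentially. norm (cnj (JR (sqrt 2 * real n)) - JR (sqrt 2 * real n) - rhs) \<le> 2 * B / (real n powr p / p - q)"
      by (intro eventually_sequentiallyI[of n0] main) (auto intro: order_less_le_trans)
    have "filterlim (\<lambda>n. real n powr p) at_top sequentially"
      using p_pos(1) by real_asymp
    then have "filterlim (\<lambda>n. real n powr p * (1/p)) at_top sequentially"
      using p_pos by (intro filterlim_at_top_mult_tendsto_pos[OF tendsto_const[of "1/p"]]) auto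
    then have "filterlim (\<lambda>n. - q + real n powr p * (1/p)) at_top sequentially"
      by (rule filterlim_tendsto_add_at_top[OF tendsto_const])
    then have "filterlim (\<lambda>n. real n powr p / p - q) at_top sequentially" by simp
    then show "(\<lambda>n. 2 * B / (real n powr p / p - q)) \<longlonglongrightarrow> 0"
      by (intro tendsto_divide_0[OF tendsto_const]) (rule filterlim_at_top_imp_at_infinity)
  qed
  moreover have "(\<lambda>n. cnj (JR (sqrt 2 * real n)) - JR (sqrt 2 * real n) - rhs) \<longlonglongrightarrow> cnj J - J - rhs"
    by (intro tendsto_intros JRlim tendsto_cnj)
  ultimately have "cnj J - J - rhs = 0" using LIMSEQ_unique by blast
  then have "Im (cnj J - J) = Im rhs" by simp
  then have "2 * Im J = - Im rhs" by simp
  also have "- Im rhs = Im (2 * pi * \<i> * p * airy_quot (of_real pole) * of_real pole / of_real (p * (p * q)))" by (simp add: rhs_def)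
  also have "2 * pi * \<i> * p * airy_quot (of_real pole) * of_real pole / of_real (p * (p * q)) = of_real (2 * pi / (p * q)) * (\<i> * (of_real pole * airy_quot (of_real pole)))"
    using p_pos q by (simp add: field_simps)
  also have "Im \<dots> = 2 * (pi / (p * q) * Re (1 - airy (of_real pole) / airy 0))"
    unfolding z_airy_quot by (simp only: Im_complex_of_real Re_complex_of_real times_complex.sel) simp
  finally have "Im J = pi / (p * q) * Re (1 - airy (of_real pole) / airy 0)" by simp
  then show ?thesis by (simp add: J_def e_def)
qed

end

end

section \<open>The explicit tail and its derivative\<close>

lemma has_bochner_integral_exp_decay:
  fixes w :: complex assumes w: "Re w > 0"
  shows "has_bochner_integral lborel (\<lambda>x::real. indicator {0<..} x *\<^sub>R exp (- w * of_real x)) (1 / w)"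
proof -
  have "w \<noteq> 0" using w by auto
  then have e: "complex_of_real (Gamma (1 / 1) / 1) * w powr complex_of_real (- 1 / 1) = 1 / w"
    by (simp add: powr_minus inverse_eq_divide)
  have f: "(\<lambda>r. indicator {0<..} r *\<^sub>R (r powr (1 - 1) *\<^sub>R exp (- w * complex_of_real (r powr 1)))) = (\<lambda>x. indicator {0<..} x *\<^sub>R exp (- w * of_real x))"
  proof
    fix r :: real
    show "indicator {0<..} r *\<^sub>R (r powr (1 - 1) *\<^sub>R exp (- w * complex_of_real (r powr 1))) = indicator {0<..} r *\<^sub>R exp (- w * of_real r)"
      by (cases "r > 0") auto
  qed
  show ?thesis using has_bochner_integral_powr_exp[OF zero_less_one zero_less_one w] unfolding e f .
qed

context stable_airy
begin

text \<open>Writing \<open>1 / (q - z powr p / p)\<close> as the integral of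
  \<open>exp (- (q - z powr p / p) * x)\<close> over \<open>x > 0\<close> exhibits the ray integral
  of the resolvent as a Laplace transform in \<open>q\<close>, and this is the function of
  \<open>x\<close> being transformed. The factor \<open>cis (pi / 4)\<close> of the differential is
  added in \<open>tail\<close>.\<close>

definition ray_int :: "real \<Rightarrow> complex" where
  "ray_int x = (\<integral>r. indicator {0<..} r *\<^sub>R (exp (of_real (x / p) * cis (p * (pi / 4)) * of_real (r powr p)) * airy_quot (of_real r * cis (pi / 4))) \<partial>lborel)"

definition tail :: "real \<Rightarrow> real" where "tail x = p / pi * Im (cis (pi / 4) * ray_int x)"

text \<open>Exchange of the integrals over \<open>r\<close> and \<open>x\<close>. Integrating the
  modulus over \<open>x\<close> first leaves \<open>norm (airy_quot z) / Re (s r)\<close>, which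
  \<open>denom_bound\<close> controls by a multiple of \<open>1 / (1 + r * r)\<close>. The factor
  \<open>p / pi\<close> in \<open>tail\<close> cancels the constant of
  \<open>resolvent_ray_integral\<close> down to \<open>1 / q\<close>.\<close>

lemma tail_laplace:
  assumes q: "q > 0"
  shows "has_bochner_integral lborel (\<lambda>x. indicator {0<..} x *\<^sub>R (exp (- q * x) * tail x)) (Re (1 - airy (of_real ((p * q) powr (1 / p))) / airy 0) / q)"
proof -
  define e where "e = cis (pi / 4)"
  define s where "s = (\<lambda>r. of_real q - (of_real r * e) powr of_real p / of_real p)"
  define F where "F = (\<lambda>r x. indicator {0<..} r *\<^sub>R (airy_quot (of_real r * e) * (indicator {0<..} x *\<^sub>R exp (- s r * of_real x))))"
  obtain c' where c': "c' > 0" "\<And>r. r \<ge> 0 \<Longrightarrow> c' * (1 + r\<^sup>2) \<le> q - r powr p * cos (p * (pi / 4)) / p"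
    using denom_bound[OF q] by blast
  have Res: "Re (s r) = q - r powr p * cos (p * (pi / 4)) / p" if "r \<ge> 0" for r
    using powr_ray[OF that] by (simp add: s_def e_def)
  have sge: "c' * (1 + r\<^sup>2) \<le> Re (s r)" if "r \<ge> 0" for r using c'(2)[OF that] Res[OF that] by simp
  have spos: "Re (s r) > 0" if "r \<ge> 0" for r
    using sge[OF that] c'(1) by (smt (verit) mult_pos_pos zero_le_power2)
  have Fx: "has_bochner_integral lborel (F r) (indicator {0<..} r *\<^sub>R resolvent q (of_real r * e))" for r
  proof (cases "r > 0")
    case True
    have "has_bochner_integral lborel (\<lambda>x. airy_quot (of_real r * e) * (indicator {0<..} x *\<^sub>R exp (- s r * complex_of_real x))) (airy_quot (of_real r * e) * (1 / s r))"
      by (intro has_bochner_integral_mult_right has_bochner_integral_exp_decay spos) (use True in auto)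
    then show ?thesis using True by (simp add: F_def resolvent_def[OF q] s_def)
  qed (simp add: F_def has_bochner_integral_zero)
  have Fn: "has_bochner_integral lborel (\<lambda>x. norm (F r x)) (indicator {0<..} r * (norm (airy_quot (of_real r * e)) / Re (s r)))" for r
  proof (cases "r > 0")
    case True
    have "has_bochner_integral lborel (\<lambda>x. indicator {0<..} x *\<^sub>R exp (- complex_of_real (Re (s r)) * complex_of_real x)) (1 / complex_of_real (Re (s r)))"
      by (intro has_bochner_integral_exp_decay) (use spos True in auto)
    then have "has_bochner_integral lborel (\<lambda>x. Re (indicator {0<..} x *\<^sub>R exp (- complex_of_real (Re (s r)) * complex_of_real x))) (Re (1 / complex_of_real (Re (s r))))"
      by (rule has_bochner_integral_bounded_linear[OF bounded_linear_Re])
    moreover have "Re (indicator {0<..} x *\<^sub>R exp (- complex_of_real (Re (s r)) * complex_of_real x)) = norm (indicator {0<..} x *\<^sub>R exp (- s r * complex_of_real x))" for x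
      by (simp add: Re_exp indicator_def)
    moreover have "Re (1 / complex_of_real (Re (s r))) = 1 / Re (s r)" by (simp add: Re_divide_of_real[symmetric])
    ultimately have "has_bochner_integral lborel (\<lambda>x. norm (indicator {0<..} x *\<^sub>R exp (- s r * complex_of_real x))) (1 / Re (s r))"
      by (simp only:)
    then have "has_bochner_integral lborel (\<lambda>x. norm (airy_quot (of_real r * e)) * norm (indicator {0<..} x *\<^sub>R exp (- s r * complex_of_real x))) (norm (airy_quot (of_real r * e)) * (1 / Re (s r)))"
      by (rule has_bochner_integral_mult_right)
    moreover have "(\<lambda>x. norm (F r x)) = (\<lambda>x. norm (airy_quot (of_real r * e)) * norm (indicator {0<..} x *\<^sub>R exp (- s r * complex_of_real x)))"
      using True by (simp add: F_def norm_mult mult_ac)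
    ultimately show ?thesis using True by simp
  qed (simp add: F_def has_bochner_integral_zero)
  have Fm: "case_prod F \<in> borel_measurable (lborel \<Otimes>\<^sub>M lborel)"
    unfolding F_def s_def by measurable
  obtain B where B: "B > 0" "\<And>z. z \<in> sector \<Longrightarrow> norm (airy_quot z) \<le> B / (1 + norm z)" by (rule airy_quot_bound) blast
  have Fi: "integrable (lborel \<Otimes>\<^sub>M lborel) (case_prod F)"
  proof (rule lborel_pair.Fubini_integrable[OF Fm])
    have "integrable lborel (\<lambda>r. (B / c') * inverse (1 + r\<^sup>2))"
      using integrable_inverse_1_plus_square by (simp add: set_integrable_def)
    then have "integrable lborel (\<lambda>r. indicator {0<..} r * (norm (airy_quot (of_real r * e)) / Re (s r)))"
    proof (rule Bochner_Integration.integrable_bound)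
      show "(\<lambda>r. indicator {0<..} r * (norm (airy_quot (of_real r * e)) / Re (s r))) \<in> borel_measurable lborel"
        unfolding s_def by measurable
      have "norm (indicator {0<..} r * (norm (airy_quot (of_real r * e)) / Re (s r))) \<le> norm (B / c' * inverse (1 + r\<^sup>2))" for r
      proof (cases "r > 0")
        case True
        have pos: "0 < c' * (1 + r\<^sup>2)" using c' by (intro mult_pos_pos add_pos_nonneg) auto
        have "norm (airy_quot (of_real r * e)) \<le> B / (1 + norm (of_real r * e))"
          unfolding e_def by (rule B(2)[OF cis_quarter_sector(1)]) (use True in simp)
        also have "\<dots> \<le> B / 1" using B(1) by (intro divide_left_mono) (auto intro: add_pos_nonneg)
        finally have "norm (airy_quot (of_real r * e)) / Re (s r) \<le> B / (c' * (1 + r\<^sup>2))"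
          using sge[of r] True pos B(1) by (intro frac_le) auto
        also have "\<dots> = B / c' * inverse (1 + r\<^sup>2)" by (simp add: divide_inverse)
        also have "\<dots> \<le> norm (B / c' * inverse (1 + r\<^sup>2))" unfolding real_norm_def by (rule abs_ge_self)
        finally have "norm (airy_quot (of_real r * e)) / Re (s r) \<le> norm (B / c' * inverse (1 + r\<^sup>2))" .
        moreover have "0 \<le> norm (airy_quot (of_real r * e)) / Re (s r)" using spos[of r] True by simp
        moreover have "indicator {0<..} r = (1::real)" using True by simp
        ultimately show ?thesis by (simp only: mult_1 real_norm_def abs_of_nonneg)
      next
        case False
        then have "indicator {0<..} r = (0::real)" by simp
        then show ?thesis by (simp only: mult_zero_left norm_zero norm_ge_zero)
      qed
      then show "AE r in lborel. norm (indicator {0<..} r * (norm (airy_quot (of_real r * e)) / Re (s r))) \<le> norm (B / c' * inverse (1 + r\<^sup>2))"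
        by (rule AE_I2)
    qed
    then show "integrable lborel (\<lambda>r. \<integral>x. norm (case_prod F (r, x)) \<partial>lborel)"
      using has_bochner_integral_integral_eq[OF Fn] by simp
    show "AE r in lborel. integrable lborel (\<lambda>x. case_prod F (r, x))"
      using Fx by (auto simp: has_bochner_integral_iff)
  qed
  have Feq: "(\<integral>r. F r x \<partial>lborel) = indicator {0<..} x *\<^sub>R (exp (- q * x) * ray_int x)" for x
  proof (cases "x > 0")
    case True
    have "F r x = exp (- q * x) * (indicator {0<..} r *\<^sub>R (exp (of_real (x / p) * cis (p * (pi / 4)) * of_real (r powr p)) * airy_quot (of_real r * cis (pi / 4))))" for r
    proof (cases "r > 0")
      case True
      have "- s r * of_real x = of_real (- q * x) + of_real (x / p) * cis (p * (pi / 4)) * of_real (r powr p)"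
        using powr_ray[of r] True p_pos by (simp add: s_def e_def field_simps)
      then have "exp (- s r * of_real x) = of_real (exp (- q * x)) * exp (of_real (x / p) * cis (p * (pi / 4)) * of_real (r powr p))"
        by (simp only: exp_add exp_of_real)
      then show ?thesis using True \<open>x > 0\<close> by (simp add: F_def e_def mult_ac)
    qed (simp add: F_def)
    then have "(\<integral>r. F r x \<partial>lborel) = exp (- q * x) * ray_int x"
      unfolding ray_int_def by (simp only: Bochner_Integration.integral_mult_right_zero)
    then show ?thesis using True by simp
  qed (simp add: F_def)
  have int: "integrable lborel (\<lambda>x. indicator {0<..} x *\<^sub>R (exp (- q * x) * ray_int x))"
    using lborel_pair.integrable_snd[OF Fi] unfolding Feq .
  have "(\<integral>x. indicator {0<..} x *\<^sub>R (exp (- q * x) * ray_int x) \<partial>lborel) = (\<integral>x. (\<integral>r. F r x \<partial>lborel) \<partial>lborel)"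
    unfolding Feq ..
  also have "\<dots> = (\<integral>r. (\<integral>x. F r x \<partial>lborel) \<partial>lborel)" by (rule lborel_pair.Fubini_integral[OF Fi])
  also have "\<dots> = (\<integral>r. indicator {0<..} r *\<^sub>R resolvent q (of_real r * e) \<partial>lborel)"
    by (simp only: has_bochner_integral_integral_eq[OF Fx])
  finally have hb: "has_bochner_integral lborel (\<lambda>x. indicator {0<..} x *\<^sub>R (exp (- q * x) * ray_int x)) (\<integral>r. indicator {0<..} r *\<^sub>R resolvent q (of_real r * e) \<partial>lborel)"
    using int by (simp add: has_bochner_integral_iff)
  have bl: "bounded_linear (\<lambda>z. p / pi * Im (e * z))"
    by (intro bounded_linear_const_mult bounded_linear_compose[OF bounded_linear_Im] bounded_linear_mult_right)
  have "has_bochner_integral lborel (\<lambda>x. p / pi * Im (e * (indicator {0<..} x *\<^sub>R (exp (- q * x) * ray_int x))))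
     (p / pi * Im (e * (\<integral>r. indicator {0<..} r *\<^sub>R resolvent q (of_real r * e) \<partial>lborel)))"
    by (rule has_bochner_integral_bounded_linear[OF bl hb])
  also have "(\<lambda>x. p / pi * Im (e * (indicator {0<..} x *\<^sub>R (exp (- q * x) * ray_int x)))) = (\<lambda>x. indicator {0<..} x *\<^sub>R (exp (- q * x) * tail x))"
  proof
    fix x
    have "e * (indicator {0<..} x *\<^sub>R (of_real (exp (- q * x)) * ray_int x)) = of_real (indicator {0<..} x * exp (- q * x)) * (e * ray_int x)"
      by (simp add: scaleR_conv_of_real mult_ac)
    then show "p / pi * Im (e * (indicator {0<..} x *\<^sub>R (exp (- q * x) * ray_int x))) = indicator {0<..} x *\<^sub>R (exp (- q * x) * tail x)"
      unfolding tail_def e_def by (simp only: Im_complex_of_real times_complex.sel Re_complex_of_real) simp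
  qed
  also have "p / pi * Im (e * (\<integral>r. indicator {0<..} r *\<^sub>R resolvent q (of_real r * e) \<partial>lborel)) = Re (1 - airy (of_real ((p * q) powr (1 / p))) / airy 0) / q"
    using resolvent_ray_integral[OF q] p_pos by (simp add: e_def pole_def[OF q])
  finally show ?thesis .
qed

text \<open>Coefficients with respect to the variable \<open>(x / p) powr (- 1 / p)\<close>.
  Integration along the ray raises the power by one, so the series starts at index 1, in accordance
  with a tail that vanishes at infinity.\<close>

definition tail_coeff :: "nat \<Rightarrow> real" where
  "tail_coeff n = (case n of 0 \<Rightarrow> 0 | Suc n \<Rightarrow> quot_coeff n * rGamma (1 - (real n + 1) / p))"

text \<open>The factorial is weakened from \<open>fact (Suc n)\<close> to \<open>fact n\<close> so
  that the bound fits \<open>summable_Gamma_Gamma_fact\<close>.\<close>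

lemma abs_quot_coeff_le: "\<bar>quot_coeff n\<bar> \<le> Gamma (real n * (1 / p) + 2 / p) / fact n / airy_coeff 0"
proof -
  have "\<bar>quot_coeff n\<bar> = \<bar>rGamma (1 - (real n + 2) / p)\<bar> / fact (Suc n) / airy_coeff 0"
    using airy_coeff_0(2) by (simp add: quot_coeff_def airy_coeff_def abs_mult add.commute)
  also have "\<dots> \<le> Gamma ((real n + 2) / p) / fact n / airy_coeff 0"
    using airy_coeff_0(2) p_pos by (intro divide_right_mono frac_le abs_rGamma_one_minus_le) (auto intro!: less_imp_le[OF Gamma_real_pos] fact_mono simp del: fact_Suc)
  finally show ?thesis by (simp add: add_divide_distrib)
qed

text \<open>Expand \<open>airy_quot\<close> into its power series and integrate along the ray term
  by term. The imaginary part of \<open>cis ((n + 1) * pi / p)\<close> together with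
  \<open>Gamma ((n + 1) / p)\<close> gives a second reciprocal Gamma by reflection, beside the one
  already contained in \<open>quot_coeff\<close>.\<close>

lemma tail_sums:
  assumes x: "x > 0"
  shows "(\<lambda>n. tail_coeff n * ((x / p) powr (- 1 / p)) ^ n) sums tail x"
proof -
  define \<kappa> where "\<kappa> = x / p"
  have \<kappa>: "\<kappa> > 0" using x p_pos by (simp add: \<kappa>_def)
  define e where "e = cis (pi / 4)"
  obtain w :: complex where Rew: "Re w > 0" and w: "- w = \<kappa> * cis (p * (1 * (pi / 4)))"
    and wp: "\<And>n. w powr (- (real n + 1) / p) * cis (1 * (pi / 4)) ^ n * cis (1 * (pi / 4)) = \<kappa> powr (- (real n + 1) / p) * cis (1 * ((real n + 1) * pi / p))"
    by (rule ray_exponent[OF \<kappa> quarter_pi_angle, of 1]) auto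
  define f where "f = (\<lambda>n r. of_real (quot_coeff n) * e ^ n * (indicator {0<..} r *\<^sub>R (r powr (real n + 1 - 1) *\<^sub>R exp (- w * of_real (r powr p)))))"
  have hf: "has_bochner_integral lborel (f n) (of_real (quot_coeff n) * e ^ n * (of_real (Gamma ((real n + 1) / p) / p) * w powr (of_real (- (real n + 1) / p))))" for n
    unfolding f_def using p_pos Rew by (intro has_bochner_integral_mult_right has_bochner_integral_powr_exp) auto
  have nf: "has_bochner_integral lborel (\<lambda>r. norm (f n r)) (\<bar>quot_coeff n\<bar> * (Gamma ((real n + 1) / p) / p * Re w powr (- (real n + 1) / p)))" for n
  proof -
    have "(\<lambda>r. norm (f n r)) = (\<lambda>r. \<bar>quot_coeff n\<bar> * (indicator {0<..} r *\<^sub>R (r powr (real n + 1 - 1) * exp (- Re w * r powr p))))"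
      by (auto simp: f_def norm_mult norm_power e_def fun_eq_iff indicator_def)
    then show ?thesis
      using p_pos Rew has_bochner_integral_powr_exp_real[of "real n + 1" p "Re w"] by (simp only:) (intro has_bochner_integral_mult_right, auto)
  qed
  have sumint: "summable (\<lambda>n. \<integral>r. norm (f n r) \<partial>lborel)"
  proof -
    define y where "y = Re w powr (- 1 / p)"
    have y: "y \<ge> 0" by (simp add: y_def)
    \<comment> \<open>Two Gammas against one factorial: the bound on \<open>quot_coeff\<close>
      contributes the first Gamma, the integral over \<open>r\<close> the second, and the condition
      becomes \<open>2 / p < 1\<close>.\<close>
    have "summable (\<lambda>n. y ^ n / fact n * (Gamma (real n * (1/p) + 2/p) * Gamma (real n * (1/p) + 1/p)) * (y / p / airy_coeff 0))"
      using p_gt_2 y by (intro summable_mult2 summable_Gamma_Gamma_fact) auto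
    moreover have "norm (\<bar>quot_coeff n\<bar> * (Gamma ((real n + 1) / p) / p * Re w powr (- (real n + 1) / p))) \<le>
       y ^ n / fact n * (Gamma (real n * (1/p) + 2/p) * Gamma (real n * (1/p) + 1/p)) * (y / p / airy_coeff 0)" for n
    proof -
      have "- (real n + 1) / p = real n * (- 1 / p) + (- 1 / p)" using p_pos by (simp add: field_simps)
      then have yy: "Re w powr (- (real n + 1) / p) = y ^ n * y"
        using Rew by (simp only: powr_add y_def) (simp add: powr_powr powr_realpow[symmetric])
      have G: "Gamma ((real n + 1) / p) = Gamma (real n * (1/p) + 1/p)" by (simp add: add_divide_distrib)
      have Gp: "Gamma (real n * (1/p) + 1/p) > 0" using p_pos by (intro Gamma_real_pos) (simp add: add_nonneg_pos)
      have "norm (\<bar>quot_coeff n\<bar> * (Gamma ((real n + 1) / p) / p * Re w powr (- (real n + 1) / p))) = \<bar>quot_coeff n\<bar> * (Gamma (real n * (1/p) + 1/p) / p * (y ^ n * y))"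
        unfolding yy G using Gp y p_pos by (simp add: abs_mult)
      also have "\<dots> \<le> (Gamma (real n * (1 / p) + 2 / p) / fact n / airy_coeff 0) * (Gamma (real n * (1/p) + 1/p) / p * (y ^ n * y))"
        using Gp y p_pos by (intro mult_right_mono abs_quot_coeff_le) auto
      finally show ?thesis by (simp add: mult_ac)
    qed
    ultimately have "summable (\<lambda>n. \<bar>quot_coeff n\<bar> * (Gamma ((real n + 1) / p) / p * Re w powr (- (real n + 1) / p)))"
      by (rule summable_comparison_test'[where N = 0])
    then show ?thesis using has_bochner_integral_integral_eq[OF nf] by simp
  qed
  have fi: "integrable lborel (f n)" for n using hf[of n] by (simp add: has_bochner_integral_iff)
  have fr: "f n r = indicator {0<..} r *\<^sub>R (exp (- w * of_real (r powr p)) * (of_real (quot_coeff n) * (of_real r * e) ^ n))" for n r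
    by (simp add: f_def powr_realpow power_mult_distrib scaleR_conv_of_real indicator_def mult_ac)
  have fs: "(\<lambda>n. f n r) sums (indicator {0<..} r *\<^sub>R (exp (- w * of_real (r powr p)) * airy_quot (of_real r * e)))" for r
    unfolding fr by (intro sums_scaleR_right sums_mult airy_quot_sums)
  have fn: "summable (\<lambda>n. norm (f n r))" for r
  proof -
    \<comment> \<open>The radius \<open>2 * \<bar>r\<bar> + 1\<close> exceeds
      \<open>\<bar>r\<bar>\<close>, so convergence there forces absolute convergence at
      \<open>of_real r * e\<close>.\<close>
    have s2: "summable (\<lambda>n. of_real (quot_coeff n) * (of_real (2 * \<bar>r\<bar> + 1)) ^ n :: complex)" by (rule sums_summable[OF airy_quot_sums])
    have "summable (\<lambda>n. norm (of_real (quot_coeff n) * (of_real r * e) ^ n))"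
      by (rule powser_insidea[OF s2]) (simp add: norm_mult e_def del: of_real_add of_real_mult)
    then have "summable (\<lambda>n. norm (indicator {0<..} r *\<^sub>R exp (- w * of_real (r powr p))) * norm (of_real (quot_coeff n) * (of_real r * e) ^ n))"
      by (rule summable_mult)
    then show ?thesis unfolding fr by (simp add: norm_mult mult_ac)
  qed
  have "(\<lambda>n. integral\<^sup>L lborel (f n)) sums (\<integral>r. (\<Sum>n. f n r) \<partial>lborel)"
    using sums_integral[OF fi _ sumint] fn by auto
  also have "(\<integral>r. (\<Sum>n. f n r) \<partial>lborel) = ray_int x"
    unfolding ray_int_def by (intro Bochner_Integration.integral_cong) (use sums_unique[OF fs] in \<open>simp_all add: w \<kappa>_def e_def\<close>)
  finally have "(\<lambda>n. p / pi * Im (e * integral\<^sup>L lborel (f n))) sums tail x"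
    unfolding tail_def e_def by (intro sums_mult sums_Im)
  moreover have "p / pi * Im (e * integral\<^sup>L lborel (f n)) = tail_coeff (Suc n) * ((x / p) powr (- 1 / p)) ^ Suc n" for n
  proof -
    have "e * integral\<^sup>L lborel (f n) = of_real (quot_coeff n * (Gamma ((real n + 1) / p) / p)) * (w powr (of_real (- (real n + 1) / p)) * e ^ n * e)"
      unfolding has_bochner_integral_integral_eq[OF hf] by (simp add: mult_ac)
    also have "w powr (of_real (- (real n + 1) / p)) * e ^ n * e = of_real (\<kappa> powr (- (real n + 1) / p)) * cis ((real n + 1) * pi / p)"
      using wp[of n] by (simp add: e_def)
    finally have "e * integral\<^sup>L lborel (f n) = of_real (quot_coeff n * (Gamma ((real n + 1) / p) / p) * \<kappa> powr (- (real n + 1) / p)) * cis ((real n + 1) * pi / p)"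
      by simp
    then have "Im (e * integral\<^sup>L lborel (f n)) = (quot_coeff n * (Gamma ((real n + 1) / p) / p) * \<kappa> powr (- (real n + 1) / p)) * sin ((real n + 1) * pi / p)"
      by (simp only: Im_complex_of_real times_complex.sel Re_complex_of_real cis.sel mult_zero_left add_0_right)
    moreover have "rGamma (1 - (real n + 1) / p) = Gamma ((real n + 1) / p) * sin (pi * ((real n + 1) / p)) / pi"
      using p_pos by (intro rGamma_reflection_real) simp
    moreover have "- (real n + 1) / p = real (Suc n) * (- 1 / p)" by (simp add: p_pos(3) field_simps)
    then have "\<kappa> powr (- (real n + 1) / p) = (\<kappa> powr (- 1 / p)) ^ Suc n"
      using \<kappa> by (simp only: powr_realpow[symmetric] powr_gt_zero powr_powr) (simp add: mult.commute)
    ultimately show ?thesis using p_pos by (simp add: tail_coeff_def \<kappa>_def mult_ac)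
  qed
  ultimately have "(\<lambda>n. tail_coeff (Suc n) * ((x / p) powr (- 1 / p)) ^ Suc n) sums tail x" by simp
  then have "(\<lambda>n. tail_coeff n * ((x / p) powr (- 1 / p)) ^ n) sums (tail x + tail_coeff 0 * ((x / p) powr (- 1 / p)) ^ 0)"
    by (rule iffD1[OF sums_Suc_iff])
  moreover have "tail_coeff 0 = 0" by (simp add: tail_coeff_def)
  ultimately show ?thesis by simp
qed

definition tail_series :: "real \<Rightarrow> real" where "tail_series t = (\<Sum>n. tail_coeff n * t ^ n)"

definition tail_series_deriv :: "real \<Rightarrow> real" where "tail_series_deriv t = (\<Sum>n. diffs tail_coeff n * t ^ n)"

text \<open>Every real \<open>t\<close> is smaller in modulus than
  \<open>(x / p) powr (- 1 / p)\<close> for a suitable \<open>x > 0\<close>, where convergence is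
  known from \<open>tail_sums\<close>. Hence the series may be differentiated everywhere.\<close>

lemma summable_tail_coeff: "summable (\<lambda>n. tail_coeff n * t ^ n)"
proof -
  define x where "x = p * (\<bar>t\<bar> + 1) powr (- p)"
  have x: "x > 0" using p_pos by (simp add: x_def add_nonneg_pos)
  have "(x / p) powr (- 1 / p) = \<bar>t\<bar> + 1"
    using p_pos by (simp add: x_def powr_powr)
  then have "summable (\<lambda>n. tail_coeff n * (\<bar>t\<bar> + 1) ^ n)" using tail_sums[OF x] by (simp add: sums_iff)
  then show ?thesis by (rule powser_inside) simp
qed

lemma tail_series_has_derivative: "(tail_series has_real_derivative tail_series_deriv t) (at t)"
  unfolding tail_series_def[abs_def] tail_series_deriv_def by (rule termdiffs_strong_converges_everywhere) (rule summable_tail_coeff)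

lemma tail_series_deriv_continuous: "isCont tail_series_deriv t"
proof -
  have "(tail_series_deriv has_real_derivative (\<Sum>n. diffs (diffs tail_coeff) n * t ^ n)) (at t)"
    unfolding tail_series_deriv_def[abs_def] by (rule termdiffs_strong_converges_everywhere termdiff_converges_all summable_tail_coeff)+
  then show ?thesis by (rule DERIV_isCont)
qed

lemma tail_tail_series: "x > 0 \<Longrightarrow> tail x = tail_series ((x / p) powr (- 1 / p))"
  using sums_unique[OF tail_sums] by (simp add: tail_series_def)

text \<open>Minus the derivative of \<open>tail\<close>, by the chain rule through
  \<open>(x / p) powr (- 1 / p)\<close>.\<close>

definition dens :: "real \<Rightarrow> real" where
  "dens x = tail_series_deriv ((x / p) powr (- 1 / p)) * ((x / p) powr (- 1 / p - 1) / p\<^sup>2)"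

lemma tail_has_derivative:
  assumes x: "x > 0"
  shows "(tail has_real_derivative - dens x) (at x)"
proof -
  have "((\<lambda>x. tail_series ((x / p) powr (- 1 / p))) has_real_derivative (tail_series_deriv ((x / p) powr (- 1 / p)) * (((- 1 / p) * (x / p) powr (- 1 / p - 1)) * (1 / p)))) (at x)"
    by (rule DERIV_chain2[OF tail_series_has_derivative]) (use x p_pos in \<open>auto intro!: derivative_eq_intros simp: powr_diff\<close>)
  also have "tail_series_deriv ((x / p) powr (- 1 / p)) * (((- 1 / p) * (x / p) powr (- 1 / p - 1)) * (1 / p)) = - dens x"
    by (simp add: dens_def power2_eq_square)
  finally show ?thesis
    by (rule has_field_derivative_transform_within_open[of _ _ _ "{0<..}"]) (use x tail_tail_series in auto)
qed

lemma dens_continuous: "x > 0 \<Longrightarrow> isCont dens x"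
  unfolding dens_def[abs_def] using p_pos by (intro continuous_intros isCont_o2[OF _ tail_series_deriv_continuous]) auto

text \<open>The factor \<open>n + 1\<close> from differentiation cancels against
  \<open>fact (Suc n)\<close> in \<open>airy_coeff (Suc n)\<close>. One of the two
  \<open>rGamma\<close> factors comes from that shifted coefficient, the other from the ray
  integral. The normalisation \<open>airy_coeff 0\<close> is the reciprocal of the Gamma value in
  front of the series to be proved.\<close>

lemma dens_sums:
  assumes x: "x > 0"
  shows "(\<lambda>n. (- 1) ^ n * p powr ((real n + 1) / p - 1) * x powr (- ((real n + 1) / p) - 1) / fact n
       * rGamma (1 - (real n + 1) / p) * rGamma (1 - (real n + 2) / p)) sums (airy_coeff 0 * dens x)"
proof -
  let ?t = "(x / p) powr (- 1 / p)" and ?s = "(x / p) powr (- 1 / p - 1) / p\<^sup>2"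
  have "(\<lambda>n. airy_coeff 0 * (diffs tail_coeff n * ?t ^ n * ?s)) sums (airy_coeff 0 * (tail_series_deriv ?t * ?s))"
    unfolding tail_series_deriv_def by (intro sums_mult sums_mult2 summable_sums termdiff_converges_all summable_tail_coeff)
  moreover have "airy_coeff 0 * (diffs tail_coeff n * ?t ^ n * ?s) = (- 1) ^ n * p powr ((real n + 1) / p - 1) * x powr (- ((real n + 1) / p) - 1) / fact n
       * rGamma (1 - (real n + 1) / p) * rGamma (1 - (real n + 2) / p)" for n
  proof -
    have "?t ^ n = (x / p) powr (real n * (- 1 / p))"
      using x p_pos by (simp add: powr_realpow[symmetric] powr_powr mult.commute)
    then have "?t ^ n * ?s = (x / p) powr (real n * (- 1 / p) + (- 1 / p - 1)) / p\<^sup>2"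
      by (simp only: powr_add times_divide_eq_right)
    also have "real n * (- 1 / p) + (- 1 / p - 1) = - ((real n + 1) / p) - 1" using p_pos by (simp add: field_simps)
    also have "(x / p) powr (- ((real n + 1) / p) - 1) / p\<^sup>2 = x powr (- ((real n + 1) / p) - 1) * p powr ((real n + 1) / p - 1)"
    proof -
      define m where "m = - ((real n + 1) / p) - 1"
      have "(x / p) powr m = x powr m * p powr (- m)" using x p_pos by (simp add: powr_divide powr_minus_divide)
      moreover have "1 / p\<^sup>2 = p powr (- 2)" using p_pos by (simp add: powr_minus_divide)
      then have "y / p\<^sup>2 = y * p powr (- 2)" for y by (metis mult.right_neutral times_divide_eq_right)
      ultimately have "(x / p) powr m / p\<^sup>2 = x powr m * p powr (- m + - 2)" by (simp only: powr_add mult.assoc)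
      then show ?thesis by (simp add: m_def)
    qed
    finally have ts: "?t ^ n * ?s = x powr (- ((real n + 1) / p) - 1) * p powr ((real n + 1) / p - 1)" .
    have "diffs tail_coeff n = (real n + 1) * (quot_coeff n * rGamma (1 - (real n + 1) / p))" by (simp add: diffs_def tail_coeff_def add.commute)
    moreover have "airy_coeff 0 * ((real n + 1) * quot_coeff n) = (- 1) ^ n * rGamma (1 - (real n + 2) / p) / fact n"
    proof -
      define u where "u = real n + 1"
      have u: "u \<noteq> 0" by (simp add: u_def)
      have "fact (Suc n) = u * (fact n :: real)" by (simp add: u_def add.commute)
      moreover have e: "real (Suc n) + 1 = real n + 2" by simp
      ultimately have "airy_coeff (Suc n) = - ((- 1) ^ n * rGamma (1 - (real n + 2) / p) / (u * fact n))"
        unfolding airy_coeff_def by (simp only: power_Suc mult_minus_left mult_1 minus_divide_left)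
      moreover have "airy_coeff 0 * (u * quot_coeff n) = - (u * airy_coeff (Suc n))" using airy_coeff_0(2) by (simp add: quot_coeff_def)
      ultimately have "airy_coeff 0 * (u * quot_coeff n) = (- 1) ^ n * rGamma (1 - (real n + 2) / p) / fact n" using u by simp
      then show ?thesis by (simp only: u_def)
    qed
    moreover have "airy_coeff 0 * ((real n + 1) * (quot_coeff n * y)) = (airy_coeff 0 * ((real n + 1) * quot_coeff n)) * y" for y by (simp only: mult_ac)
    ultimately have "airy_coeff 0 * diffs tail_coeff n = (- 1) ^ n * rGamma (1 - (real n + 2) / p) / fact n * rGamma (1 - (real n + 1) / p)"
      by (simp only:)
    moreover have "airy_coeff 0 * (diffs tail_coeff n * ?t ^ n * ?s) = (airy_coeff 0 * diffs tail_coeff n) * (?t ^ n * ?s)" by (simp only: mult_ac)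
    ultimately have "airy_coeff 0 * (diffs tail_coeff n * ?t ^ n * ?s) = (- 1) ^ n * rGamma (1 - (real n + 2) / p) / fact n * rGamma (1 - (real n + 1) / p) * (?t ^ n * ?s)"
      by (simp only:)
    then show ?thesis unfolding ts by (simp add: mult_ac)
  qed
  ultimately show ?thesis by (simp add: dens_def)
qed

end

section \<open>Spectrally positive stable processes\<close>

text \<open>Bounded second moments imply uniform integrability. Fatou's lemma puts the limit into
  the same class; the error is truncated at a level \<open>K\<close>, dominated convergence treats
  the truncated part, and the rest is at most the second moment divided by \<open>K\<close>.\<close>

lemma (in prob_space) L2_bounded_tendsto:
  fixes f :: "nat \<Rightarrow> 'a \<Rightarrow> 'b :: {banach, second_countable_topology}"
  assumes [measurable]: "\<And>n. f n \<in> borel_measurable M" "g \<in> borel_measurable M"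
    and lim: "AE \<omega> in M. (\<lambda>n. f n \<omega>) \<longlonglongrightarrow> g \<omega>"
    and int2: "\<And>n. integrable M (\<lambda>\<omega>. (norm (f n \<omega>))\<^sup>2)"
    and bound: "\<And>n. (\<integral>\<omega>. (norm (f n \<omega>))\<^sup>2 \<partial>M) \<le> C"
  shows "integrable M g" "(\<lambda>n. \<integral>\<omega>. f n \<omega> \<partial>M) \<longlonglongrightarrow> (\<integral>\<omega>. g \<omega> \<partial>M)"
proof -
  have C0: "C \<ge> 0" using bound[of 0] by (rule order_trans[rotated]) (simp add: integral_nonneg_AE)
  have nn: "(\<integral>\<^sup>+\<omega>. ennreal ((norm (f n \<omega>))\<^sup>2) \<partial>M) \<le> ennreal C" for n
    using bound[of n] by (subst nn_integral_eq_integral[OF int2]) (auto simp: ennreal_leI)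
  have "(\<integral>\<^sup>+\<omega>. ennreal ((norm (g \<omega>))\<^sup>2) \<partial>M) = (\<integral>\<^sup>+\<omega>. liminf (\<lambda>n. ennreal ((norm (f n \<omega>))\<^sup>2)) \<partial>M)"
  proof (rule nn_integral_cong_AE)
    show "AE \<omega> in M. ennreal ((norm (g \<omega>))\<^sup>2) = liminf (\<lambda>n. ennreal ((norm (f n \<omega>))\<^sup>2))"
      using lim
    proof eventually_elim
      case (elim \<omega>)
      then have "(\<lambda>n. ennreal ((norm (f n \<omega>))\<^sup>2)) \<longlonglongrightarrow> ennreal ((norm (g \<omega>))\<^sup>2)"
        by (intro tendsto_intros)
      then show ?case by (rule lim_imp_Liminf[symmetric, OF trivial_limit_sequentially])
    qed
  qed
  also have "\<dots> \<le> liminf (\<lambda>n. \<integral>\<^sup>+\<omega>. ennreal ((norm (f n \<omega>))\<^sup>2) \<partial>M)"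
    by (rule nn_integral_liminf) measurable
  also have "\<dots> \<le> ennreal C" using nn by (intro Liminf_le) (auto intro: always_eventually)
  finally have gn: "(\<integral>\<^sup>+\<omega>. ennreal ((norm (g \<omega>))\<^sup>2) \<partial>M) \<le> ennreal C" .
  have g2: "integrable M (\<lambda>\<omega>. (norm (g \<omega>))\<^sup>2)"
    by (rule integrableI_bounded) (use gn in \<open>auto intro: le_less_trans ennreal_less_top\<close>)
  have g2C: "(\<integral>\<omega>. (norm (g \<omega>))\<^sup>2 \<partial>M) \<le> C"
    using gn C0 by (subst (asm) nn_integral_eq_integral[OF g2]) (auto simp: ennreal_le_iff)
  have L1: "integrable M h" if "integrable M (\<lambda>\<omega>. (norm (h \<omega>))\<^sup>2)" "h \<in> borel_measurable M" for h :: "'a \<Rightarrow> 'b"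
  proof (rule Bochner_Integration.integrable_bound[where f = "\<lambda>\<omega>. 1 + (norm (h \<omega>))\<^sup>2"])
    have "a \<le> 1 + a\<^sup>2" for a :: real
      using zero_le_power2[of "a - 1/2"] by (simp add: power2_eq_square algebra_simps)
    then show "AE \<omega> in M. norm (h \<omega>) \<le> norm (1 + (norm (h \<omega>))\<^sup>2)"
      by (intro AE_I2) (simp add: abs_of_nonneg add_nonneg_nonneg)
  qed (use that in auto)
  show ig: "integrable M g" by (rule L1[OF g2]) measurable
  have if': "integrable M (f n)" for n by (rule L1[OF int2]) measurable
  define e where "e = (\<lambda>n \<omega>. norm (f n \<omega> - g \<omega>))"
  have e2: "(e n \<omega>)\<^sup>2 \<le> 2 * (norm (f n \<omega>))\<^sup>2 + 2 * (norm (g \<omega>))\<^sup>2" for n \<omega>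
  proof -
    have "e n \<omega> \<le> norm (f n \<omega>) + norm (g \<omega>)" by (simp add: e_def norm_triangle_ineq4)
    then have "(e n \<omega>)\<^sup>2 \<le> (norm (f n \<omega>) + norm (g \<omega>))\<^sup>2" by (intro power_mono) (auto simp: e_def)
    also have "\<dots> \<le> 2 * (norm (f n \<omega>))\<^sup>2 + 2 * (norm (g \<omega>))\<^sup>2"
      using zero_le_power2[of "norm (f n \<omega>) - norm (g \<omega>)"] by (simp add: power2_eq_square algebra_simps)
    finally show ?thesis .
  qed
  have em[measurable]: "e n \<in> borel_measurable M" for n unfolding e_def by measurable
  have ie2: "integrable M (\<lambda>\<omega>. (e n \<omega>)\<^sup>2)" for n
  proof (rule Bochner_Integration.integrable_bound[where f = "\<lambda>\<omega>. 2 * (norm (f n \<omega>))\<^sup>2 + 2 * (norm (g \<omega>))\<^sup>2"])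
    show "integrable M (\<lambda>\<omega>. 2 * (norm (f n \<omega>))\<^sup>2 + 2 * (norm (g \<omega>))\<^sup>2)"
      using int2 g2 by (intro Bochner_Integration.integrable_add integrable_mult_right)
    show "AE \<omega> in M. norm ((e n \<omega>)\<^sup>2) \<le> norm (2 * (norm (f n \<omega>))\<^sup>2 + 2 * (norm (g \<omega>))\<^sup>2)"
      using e2 by (intro AE_I2) (simp add: abs_of_nonneg)
  qed measurable
  have ie2C: "(\<integral>\<omega>. (e n \<omega>)\<^sup>2 \<partial>M) \<le> 4 * C" for n
  proof -
    have "(\<integral>\<omega>. (e n \<omega>)\<^sup>2 \<partial>M) \<le> (\<integral>\<omega>. 2 * (norm (f n \<omega>))\<^sup>2 + 2 * (norm (g \<omega>))\<^sup>2 \<partial>M)"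
      by (intro integral_mono ie2 Bochner_Integration.integrable_add integrable_mult_right int2 g2 e2)
    also have "\<dots> = 2 * (\<integral>\<omega>. (norm (f n \<omega>))\<^sup>2 \<partial>M) + 2 * (\<integral>\<omega>. (norm (g \<omega>))\<^sup>2 \<partial>M)"
      using int2 g2 by (simp add: Bochner_Integration.integral_add)
    also have "\<dots> \<le> 4 * C" using bound[of n] g2C by linarith
    finally show ?thesis .
  qed
  have ie: "integrable M (e n)" for n unfolding e_def using ig if' by auto
  have trunc: "(\<lambda>n. \<integral>\<omega>. min (e n \<omega>) K \<partial>M) \<longlonglongrightarrow> (\<integral>\<omega>. 0 \<partial>M)" if "K > 0" for K :: real
  proof (rule integral_dominated_convergence[where w = "\<lambda>_. K"])
    show "AE \<omega> in M. (\<lambda>n. min (e n \<omega>) K) \<longlonglongrightarrow> 0"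
      using lim
    proof eventually_elim
      case (elim \<omega>)
      then have "(\<lambda>n. e n \<omega>) \<longlonglongrightarrow> 0" unfolding e_def using tendsto_norm_zero Lim_null by blast
      then have "(\<lambda>n. min (e n \<omega>) K) \<longlonglongrightarrow> min 0 K" by (intro tendsto_intros)
      then show ?case using \<open>K > 0\<close> by simp
    qed
    show "AE \<omega> in M. norm (min (e n \<omega>) K) \<le> K" for n using \<open>K > 0\<close> by (intro AE_I2) (auto simp: e_def)
  qed auto
  have "(\<lambda>n. \<integral>\<omega>. e n \<omega> \<partial>M) \<longlonglongrightarrow> 0"
  proof (rule LIMSEQ_I)
    fix r :: real assume r: "r > 0"
    \<comment> \<open>Chosen so that \<open>(1 / K) * (4 * C) \<le> r / 2\<close>, where
      \<open>4 * C\<close> bounds the second moment of the error.\<close>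
    define K where "K = 8 * (C + 1) / r"
    have K: "K > 0" using r C0 by (simp add: K_def)
    have "\<exists>no. \<forall>n\<ge>no. norm ((\<integral>\<omega>. min (e n \<omega>) K \<partial>M) - 0) < r / 2"
      using LIMSEQ_D[OF trunc[OF K], of "r/2"] r by simp
    then obtain no where no': "\<forall>n\<ge>no. norm ((\<integral>\<omega>. min (e n \<omega>) K \<partial>M) - 0) < r / 2" by blast
    have no: "(\<integral>\<omega>. min (e n \<omega>) K \<partial>M) < r / 2" if "n \<ge> no" for n using no'[rule_format, OF that] by simp
    have "norm ((\<integral>\<omega>. e n \<omega> \<partial>M) - 0) < r" if "n \<ge> no" for n
    proof -
      have ptw: "e n \<omega> \<le> min (e n \<omega>) K + (1/K) * (e n \<omega>)\<^sup>2" for \<omega>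
      proof (cases "e n \<omega> \<le> K")
        case False
        then have "1 \<le> e n \<omega> / K" "0 \<le> e n \<omega>" using K by auto
        then have "e n \<omega> * 1 \<le> e n \<omega> * (e n \<omega> / K)" by (intro mult_left_mono)
        then show ?thesis using K False by (simp add: power2_eq_square)
      qed (use K in auto)
      have imin: "integrable M (\<lambda>\<omega>. min (e n \<omega>) K)"
        by (rule Bochner_Integration.integrable_bound[OF ie[of n]]) (use K in \<open>auto simp: e_def\<close>)
      have "(\<integral>\<omega>. e n \<omega> \<partial>M) \<le> (\<integral>\<omega>. min (e n \<omega>) K + (1/K) * (e n \<omega>)\<^sup>2 \<partial>M)"
        by (intro integral_mono ie ptw Bochner_Integration.integrable_add imin integrable_mult_right ie2)
      also have "\<dots> = (\<integral>\<omega>. min (e n \<omega>) K \<partial>M) + (1/K) * (\<integral>\<omega>. (e n \<omega>)\<^sup>2 \<partial>M)"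
        using imin ie2 by (simp add: Bochner_Integration.integral_add)
      also have "\<dots> < r / 2 + (1/K) * (4 * C)"
        using no[OF that] ie2C[of n] K by (intro add_less_le_mono mult_left_mono) auto
      also have "(1/K) * (4 * C) \<le> r / 2" using r C0 by (simp add: K_def field_simps)
      finally have "(\<integral>\<omega>. e n \<omega> \<partial>M) < r" by simp
      moreover have "(\<integral>\<omega>. e n \<omega> \<partial>M) \<ge> 0" by (simp add: e_def)
      ultimately show ?thesis by simp
    qed
    then show "\<exists>no. \<forall>n\<ge>no. norm ((\<integral>\<omega>. e n \<omega> \<partial>M) - 0) < r" by blast
  qed
  note e0 = this
  have "norm ((\<integral>\<omega>. f n \<omega> \<partial>M) - (\<integral>\<omega>. g \<omega> \<partial>M)) \<le> (\<integral>\<omega>. e n \<omega> \<partial>M)" for n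
    unfolding e_def Bochner_Integration.integral_diff[OF if' ig, symmetric] by (rule integral_norm_bound)
  then have "(\<lambda>n. (\<integral>\<omega>. f n \<omega> \<partial>M) - (\<integral>\<omega>. g \<omega> \<partial>M)) \<longlonglongrightarrow> 0"
    by (intro Lim_null_comparison[OF _ e0] always_eventually allI)
  then show "(\<lambda>n. \<integral>\<omega>. f n \<omega> \<partial>M) \<longlonglongrightarrow> (\<integral>\<omega>. g \<omega> \<partial>M)"
    by (rule LIM_zero_cancel)
qed

text \<open>Right-continuity bounds the path just after a time and the left limit just before it;
  compactness of the interval makes this uniform.\<close>

lemma cadlag_bounded:
  assumes "cadlag w" "T \<ge> 0"
  obtains B where "\<And>t. t \<in> {0..T} \<Longrightarrow> \<bar>w t\<bar> \<le> B"
proof -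
  have loc: "\<exists>e>0. \<exists>B. \<forall>s. s \<ge> 0 \<longrightarrow> dist s t < e \<longrightarrow> \<bar>w s\<bar> \<le> B" if t: "t \<ge> 0" for t
  proof -
    have "(w \<longlongrightarrow> w t) (at_right t)" using assms(1) t by (simp add: cadlag_def continuous_within)
    then have "((\<lambda>s. \<bar>w s\<bar>) \<longlongrightarrow> \<bar>w t\<bar>) (at_right t)" by (intro tendsto_intros)
    then have "\<forall>\<^sub>F s in at_right t. \<bar>w s\<bar> < \<bar>w t\<bar> + 1" by (rule order_tendstoD) simp
    then obtain b where b: "b > t" "\<And>s. t < s \<Longrightarrow> s < b \<Longrightarrow> \<bar>w s\<bar> < \<bar>w t\<bar> + 1"
      unfolding eventually_at_right_field by blast
    obtain l a where a: "a < t" "\<And>s. a < s \<Longrightarrow> s < t \<Longrightarrow> s \<ge> 0 \<Longrightarrow> \<bar>w s\<bar> < \<bar>l\<bar> + 1"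
    proof (cases "t > 0")
      case True
      then obtain l where "(w \<longlongrightarrow> l) (at_left t)" using assms(1) by (auto simp: cadlag_def)
      then have "((\<lambda>s. \<bar>w s\<bar>) \<longlongrightarrow> \<bar>l\<bar>) (at_left t)" by (intro tendsto_intros)
      then have "\<forall>\<^sub>F s in at_left t. \<bar>w s\<bar> < \<bar>l\<bar> + 1" by (rule order_tendstoD) simp
      then obtain a where "a < t" "\<And>s. a < s \<Longrightarrow> s < t \<Longrightarrow> \<bar>w s\<bar> < \<bar>l\<bar> + 1"
        unfolding eventually_at_left_field by blast
      then show ?thesis using that by blast
    next
      case False
      then show ?thesis using that[of "t - 1" 0] t by auto
    qed
    show ?thesis
    proof (intro exI conjI allI impI)
      show "min (b - t) (t - a) > 0" using a b by simp
      fix s assume s: "s \<ge> 0" "dist s t < min (b - t) (t - a)"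
      show "\<bar>w s\<bar> \<le> \<bar>w t\<bar> + \<bar>l\<bar> + 1"
        using a(2)[of s] b(2)[of s] s by (cases s t rule: linorder_cases) (auto simp: dist_real_def abs_if split: if_splits)
    qed
  qed
  then obtain e B where eB: "\<And>t. t \<ge> 0 \<Longrightarrow> e t > 0" "\<And>t s. t \<ge> 0 \<Longrightarrow> s \<ge> 0 \<Longrightarrow> dist s t < e t \<Longrightarrow> \<bar>w s\<bar> \<le> B t"
    by metis
  obtain C' where C': "C' \<subseteq> {0..T}" "finite C'" "{0..T} \<subseteq> (\<Union>t\<in>C'. ball t (e t))"
    by (rule compactE_image[of "{0..T}" "{0..T}" "\<lambda>t. ball t (e t)"]) (use eB(1) in auto)
  show ?thesis
  proof (rule that[of "\<Sum>t\<in>C'. \<bar>B t\<bar>"])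
    fix s assume s: "s \<in> {0..T}"
    then obtain t where t: "t \<in> C'" "dist t s < e t" using C' by auto
    then have "\<bar>w s\<bar> \<le> B t" using C' s by (intro eB(2)) (auto simp: dist_commute)
    also have "\<dots> \<le> \<bar>B t\<bar>" by simp
    also have "\<dots> \<le> (\<Sum>t\<in>C'. \<bar>B t\<bar>)" using C' t by (intro member_le_sum) auto
    finally show "\<bar>w s\<bar> \<le> (\<Sum>t\<in>C'. \<bar>B t\<bar>)" .
  qed
qed

text \<open>The sums integrate the path read at the right end of each cell. These points approach
  \<open>s\<close> from the right, so right-continuity suffices and dominated convergence concludes.
  The number of cells is an arbitrary sequence \<open>N m\<close>, which lets the same lemma serve
  all multiples of a fixed mesh.\<close>

lemma right_riemann_sums:
  fixes w :: "real \<Rightarrow> 'b :: {banach, second_countable_topology}"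
  assumes T: "T > 0" and B: "\<And>t. t \<in> {0..T} \<Longrightarrow> norm (w t) \<le> B"
    and rc: "\<And>t. t \<in> {0..<T} \<Longrightarrow> continuous (at_right t) w"
    and N: "filterlim N at_top sequentially" "\<And>m. N m > (0::nat)"
  shows "integrable lborel (\<lambda>s. indicator {0<..T} s *\<^sub>R w s)"
    and "(\<lambda>m. (T / real (N m)) *\<^sub>R (\<Sum>i<N m. w (real (Suc i) * (T / real (N m))))) \<longlonglongrightarrow> (\<integral>s. indicator {0<..T} s *\<^sub>R w s \<partial>lborel)"
proof -
  define \<delta> where "\<delta> = (\<lambda>m. T / real (N m))"
  have \<delta>: "\<delta> m > 0" for m using T N(2)[of m] by (simp add: \<delta>_def)
  have \<delta>0: "\<delta> \<longlonglongrightarrow> 0"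
    unfolding \<delta>_def by (intro tendsto_divide_0[OF tendsto_const] filterlim_at_top_imp_at_infinity filterlim_compose[OF filterlim_real_sequentially N(1)])
  \<comment> \<open>Right end of the cell containing \<open>s\<close>. At \<open>s = T\<close> it is
    \<open>T\<close> itself, so no value beyond the interval is ever read.\<close>
  define st where "st = (\<lambda>m s. of_int \<lceil>s / \<delta> m\<rceil> * \<delta> m)"
  have st_ge: "s \<le> st m s" for m s
  proof -
    have "s / \<delta> m * \<delta> m \<le> of_int \<lceil>s / \<delta> m\<rceil> * \<delta> m" using \<delta>[of m] by (intro mult_right_mono le_of_int_ceiling) auto
    then show ?thesis using \<delta>[of m] by (simp add: st_def)
  qed
  have st_lt: "st m s < s + \<delta> m" for m s
  proof -
    have "of_int \<lceil>s / \<delta> m\<rceil> < s / \<delta> m + 1" by linarith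
    then have "st m s < (s / \<delta> m + 1) * \<delta> m" unfolding st_def using \<delta>[of m] by (intro mult_strict_right_mono)
    also have "\<dots> = s + \<delta> m" using \<delta>[of m] by (simp add: distrib_right)
    finally show ?thesis .
  qed
  define f where "f = (\<lambda>m s. indicator {0<..T} s *\<^sub>R w (st m s))"
  have fm[measurable]: "f m \<in> borel_measurable borel" for m
  proof -
    have "(\<lambda>s. w (st m s)) = (\<lambda>i. w (of_int i * \<delta> m)) \<circ> (\<lambda>s. \<lceil>s / \<delta> m\<rceil>)" by (auto simp: st_def)
    moreover have "(\<lambda>i. w (of_int i * \<delta> m)) \<circ> (\<lambda>s. \<lceil>s / \<delta> m\<rceil>) \<in> borel_measurable borel"
      by (rule measurable_comp[of _ _ "count_space UNIV"]) measurable
    ultimately have [measurable]: "(\<lambda>s. w (st m s)) \<in> borel_measurable borel" by simp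
    show ?thesis unfolding f_def by measurable
  qed
  have NT: "real (N m) * \<delta> m = T" for m using N(2)[of m] by (simp add: \<delta>_def)
  have st_range: "st m s \<in> {0..T}" if "s \<in> {0<..T}" for m s
  proof -
    have "s / \<delta> m \<le> real (N m)" using that \<delta>[of m] NT[of m] by (simp add: pos_divide_le_eq)
    then have "\<lceil>s / \<delta> m\<rceil> \<le> int (N m)" by (simp add: ceiling_le_iff)
    then have "real_of_int \<lceil>s / \<delta> m\<rceil> * \<delta> m \<le> real (N m) * \<delta> m" using \<delta>[of m] by (intro mult_right_mono) auto
    then show ?thesis using st_ge[of s m] that NT[of m] by (simp add: st_def)
  qed
  have fw: "(\<lambda>m. f m s) \<longlonglongrightarrow> indicator {0<..T} s *\<^sub>R w s" for s
  proof (cases "s \<in> {0<..<T}")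
    case True
    have "(w \<longlongrightarrow> w s) (at_right s)" using rc[of s] True by (simp add: continuous_within)
    then have w': "continuous (at s within {s..}) w"
    proof -
      have "{s..} - {s} = {s<..} - {s}" by auto
      then have "at s within {s..} = at_right s" by (simp only: at_within_def)
      then show ?thesis using \<open>(w \<longlongrightarrow> w s) (at_right s)\<close> by (simp add: continuous_within)
    qed
    have "(\<lambda>m. st m s) \<longlonglongrightarrow> s"
    proof (rule tendsto_sandwich[of "\<lambda>_. s" _ _ "\<lambda>m. s + \<delta> m"])
      show "(\<lambda>m. s + \<delta> m) \<longlonglongrightarrow> s" using tendsto_add[OF tendsto_const \<delta>0, of s] by simp
      show "\<forall>\<^sub>F m in sequentially. s \<le> st m s" using st_ge by (intro always_eventually allI)
      show "\<forall>\<^sub>F m in sequentially. st m s \<le> s + \<delta> m" using st_lt by (intro always_eventually allI less_imp_le)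
    qed simp
    then have "(\<lambda>m. w (st m s)) \<longlonglongrightarrow> w s"
      by (rule continuous_within_tendsto_compose[OF w', rotated]) (use st_ge in auto)
    then show ?thesis unfolding f_def by (intro tendsto_scaleR tendsto_const)
  next
    case False
    have "f m s = indicator {0<..T} s *\<^sub>R w s" for m
    proof (cases "s = T")
      case True
      have "st m T = T" using st_range[of T m] st_ge[of T m] T by auto
      then show ?thesis by (simp add: f_def True)
    next
      case False
      then show ?thesis using \<open>s \<notin> {0<..<T}\<close> by (auto simp: f_def indicator_def)
    qed
    then show ?thesis by simp
  qed
  have wm[measurable]: "(\<lambda>s. indicator {0<..T} s *\<^sub>R w s) \<in> borel_measurable borel"
    by (rule borel_measurable_LIMSEQ_metric[OF fm fw])
  have ib: "integrable lborel (\<lambda>s. B * indicator {0<..T} s)" using T by (intro integrable_mult_right integrable_real_indicator) auto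
  show "integrable lborel (\<lambda>s. indicator {0<..T} s *\<^sub>R w s)"
  proof (rule Bochner_Integration.integrable_bound[OF ib])
    show "AE s in lborel. norm (indicator {0<..T} s *\<^sub>R w s) \<le> norm (B * indicator {0<..T} s)"
      using B by (intro AE_I2) (auto simp: indicator_def intro: order_trans[OF _ abs_ge_self])
  qed simp
  have "(\<lambda>m. \<integral>s. f m s \<partial>lborel) \<longlonglongrightarrow> (\<integral>s. indicator {0<..T} s *\<^sub>R w s \<partial>lborel)"
  proof (rule integral_dominated_convergence[OF _ _ ib])
    show "AE s in lborel. (\<lambda>m. f m s) \<longlonglongrightarrow> indicator {0<..T} s *\<^sub>R w s" using fw by simp
    show "AE s in lborel. norm (f m s) \<le> B * indicator {0<..T} s" for m
      using B st_range by (intro AE_I2) (auto simp: f_def indicator_def)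
  qed auto
  moreover have "(\<integral>s. f m s \<partial>lborel) = (T / real (N m)) *\<^sub>R (\<Sum>i<N m. w (real (Suc i) * (T / real (N m))))" for m
  proof -
    have "f m s = (\<Sum>i<N m. indicator {real i * \<delta> m<..real (Suc i) * \<delta> m} s *\<^sub>R w (real (Suc i) * \<delta> m))" for s
    proof (cases "s \<in> {0<..T}")
      case True
      define j where "j = nat (\<lceil>s / \<delta> m\<rceil> - 1)"
      have "s / \<delta> m > 0" using True \<delta>[of m] by simp
      then have cj: "\<lceil>s / \<delta> m\<rceil> = int j + 1" unfolding j_def by (simp add: ceiling_less_iff)
      then have stj: "st m s = real (Suc j) * \<delta> m" by (simp add: st_def)
      have jN: "j < N m"
      proof -
        have "s / \<delta> m \<le> real (N m)" using True \<delta>[of m] NT[of m] by (simp add: pos_divide_le_eq)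
        then have "\<lceil>s / \<delta> m\<rceil> \<le> int (N m)" by (simp add: ceiling_le_iff)
        then show ?thesis using cj by simp
      qed
      have ind: "indicator {real i * \<delta> m<..real (Suc i) * \<delta> m} s = (if i = j then 1 else 0 :: real)" for i
      proof -
        have "s \<in> {real i * \<delta> m<..real (Suc i) * \<delta> m} \<longleftrightarrow> real i < s / \<delta> m \<and> s / \<delta> m \<le> real (Suc i)"
          using \<delta>[of m] by (simp add: pos_divide_le_eq pos_less_divide_eq)
        also have "\<dots> \<longleftrightarrow> \<lceil>s / \<delta> m\<rceil> = int i + 1" by (auto simp: ceiling_eq_iff)
        also have "\<dots> \<longleftrightarrow> i = j" using cj by auto
        finally show ?thesis by (simp add: indicator_def)
      qed
      show ?thesis unfolding ind using True jN by (simp add: f_def stj if_distrib[of "\<lambda>c. c *\<^sub>R _"] cong: if_cong)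
    next
      case False
      have "indicator {real i * \<delta> m<..real (Suc i) * \<delta> m} s = (0::real)" if "i < N m" for i
      proof -
        have "real (Suc i) * \<delta> m \<le> real (N m) * \<delta> m" using \<delta>[of m] that by (intro mult_right_mono) auto
        moreover have "0 \<le> real i * \<delta> m" using \<delta>[of m] by simp
        ultimately show ?thesis using False NT[of m] by (auto simp: indicator_def)
      qed
      then show ?thesis using False by (simp add: f_def)
    qed
    then have "(\<integral>s. f m s \<partial>lborel) = (\<integral>s. (\<Sum>i<N m. indicator {real i * \<delta> m<..real (Suc i) * \<delta> m} s *\<^sub>R w (real (Suc i) * \<delta> m)) \<partial>lborel)"
      by simp
    also have "\<dots> = (\<Sum>i<N m. \<integral>s. indicator {real i * \<delta> m<..real (Suc i) * \<delta> m} s *\<^sub>R w (real (Suc i) * \<delta> m) \<partial>lborel)"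
    proof (rule Bochner_Integration.integral_sum)
      fix i assume "i \<in> {..<N m}"
      have "real i * \<delta> m \<le> real (Suc i) * \<delta> m" using \<delta>[of m] by (intro mult_right_mono) auto
      then show "integrable lborel (\<lambda>s. indicator {real i * \<delta> m<..real (Suc i) * \<delta> m} s *\<^sub>R w (real (Suc i) * \<delta> m))"
        by (intro integrable_scaleR_left integrable_real_indicator) auto
    qed
    also have "\<dots> = (\<Sum>i<N m. \<delta> m *\<^sub>R w (real (Suc i) * \<delta> m))"
    proof (rule sum.cong[OF refl])
      fix i
      have "real i * \<delta> m \<le> real (Suc i) * \<delta> m" using \<delta>[of m] by (intro mult_right_mono) auto
      then show "(\<integral>s. indicator {real i * \<delta> m<..real (Suc i) * \<delta> m} s *\<^sub>R w (real (Suc i) * \<delta> m) \<partial>lborel) = \<delta> m *\<^sub>R w (real (Suc i) * \<delta> m)"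
        by (subst integral_scaleR_left) (auto simp: algebra_simps)
    qed
    finally show ?thesis by (simp add: scaleR_sum_right \<delta>_def)
  qed
  ultimately show "(\<lambda>m. (T / real (N m)) *\<^sub>R (\<Sum>i<N m. w (real (Suc i) * (T / real (N m))))) \<longlonglongrightarrow> (\<integral>s. indicator {0<..T} s *\<^sub>R w s \<partial>lborel)"
    by simp
qed

section \<open>The joint transform of the process and its area\<close>

text \<open>Here \<open>p\<close> is \<alpha> + 1 and the path properties hold for every outcome,
  which a modification on a null set achieves. The condition \<open>lap\<close> condenses
  stationarity, self-similarity and normalisation. The starting point \<open>x\<close> is arbitrary
  because the argument is also applied to \<open>L\<close> lowered by a constant.\<close>

locale spectrally_positive = prob_space M for M :: "'a measure" +
  fixes p x :: real and L :: "real \<Rightarrow> 'a \<Rightarrow> real"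
  assumes p2: "2 < p" and p3: "p < 3"
    and rv: "\<And>t. t \<ge> 0 \<Longrightarrow> L t \<in> borel_measurable M"
    and start: "\<And>\<omega>. \<omega> \<in> space M \<Longrightarrow> L 0 \<omega> = x"
    and cad: "\<And>\<omega>. \<omega> \<in> space M \<Longrightarrow> cadlag (\<lambda>t. L t \<omega>)"
    and nnj: "\<And>\<omega>. \<omega> \<in> space M \<Longrightarrow> no_negative_jumps (\<lambda>t. L t \<omega>)"
    and ind: "\<And>t n. 0 \<le> t 0 \<Longrightarrow> incseq t \<Longrightarrow> indep_vars (\<lambda>_. borel) (\<lambda>i \<omega>. L (t (Suc i)) \<omega> - L (t i) \<omega>) {..<n::nat}"
    and lap: "\<And>s h q. s \<ge> 0 \<Longrightarrow> h > 0 \<Longrightarrow> q > 0 \<Longrightarrow>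
        has_bochner_integral M (\<lambda>\<omega>. exp (- q * (L (s + h) \<omega> - L s \<omega>))) (exp (h * q powr (p - 1)))"

sublocale spectrally_positive \<subseteq> stable_airy p
  by unfold_locales (use p2 p3 in auto)

context spectrally_positive
begin

lemma lap_complex:
  fixes z :: complex
  assumes s: "s \<ge> 0" and h: "h > 0" and z: "Re z > 0"
  shows "has_bochner_integral M (\<lambda>\<omega>. exp (- z * of_real (L (s + h) \<omega> - L s \<omega>))) (exp (of_real h * z powr of_real (p - 1)))"
proof (rule laplace_analytic_continuation[OF _ lap[OF s h]])
  have [measurable]: "L (s + h) \<in> borel_measurable M" "L s \<in> borel_measurable M" using s h by (auto intro!: rv)
  show "(\<lambda>\<omega>. L (s + h) \<omega> - L s \<omega>) \<in> borel_measurable M" by measurable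
  show "(\<lambda>z. exp (complex_of_real h * z powr complex_of_real (p - 1))) holomorphic_on {z. 0 < Re z}"
    by (intro holomorphic_intros) (auto simp: complex_nonpos_Reals_iff)
  show "exp (complex_of_real h * complex_of_real q powr complex_of_real (p - 1)) = of_real (exp (h * q powr (p - 1)))" if "q > 0" for q
    using powr_of_real[of q "p - 1"] that by (simp flip: exp_of_real)
qed (use z in auto)

definition incr :: "real \<Rightarrow> nat \<Rightarrow> 'a \<Rightarrow> real" where
  "incr \<delta> j \<omega> = L (real (Suc j) * \<delta>) \<omega> - L (real j * \<delta>) \<omega>"

text \<open>The information in the first \<open>i\<close> increments along the grid of mesh
  \<open>\<delta>\<close>. It is the preimage under one vector-valued map because the independence
  assumption speaks of increments along a grid; the start being constant, it also determines the
  grid values of \<open>L\<close>.\<close>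

definition history :: "real \<Rightarrow> nat \<Rightarrow> 'a measure" where
  "history \<delta> i = vimage_algebra (space M) (\<lambda>\<omega>. \<lambda>j\<in>{..<i}. incr \<delta> j \<omega>) (PiM {..<i} (\<lambda>_. borel))"

lemma space_history [simp]: "space (history \<delta> i) = space M"
  by (simp add: history_def)

lemma sets_history: "sets (history \<delta> i) = {(\<lambda>\<omega>. \<lambda>j\<in>{..<i}. incr \<delta> j \<omega>) -` A \<inter> space M | A. A \<in> sets (PiM {..<i} (\<lambda>_. borel))}"
  unfolding history_def by (rule sets_vimage_algebra2) (auto simp: space_PiM)

lemma measurable_incr: "\<delta> \<ge> 0 \<Longrightarrow> incr \<delta> j \<in> borel_measurable M"
  unfolding incr_def by (intro borel_measurable_diff rv) auto

lemma measurable_history: "\<delta> \<ge> 0 \<Longrightarrow> (\<lambda>\<omega>. \<lambda>j\<in>{..<i}. incr \<delta> j \<omega>) \<in> measurable M (PiM {..<i} (\<lambda>_. borel))"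
  by (intro measurable_restrict measurable_incr)

lemma history_subalgebra: "\<delta> \<ge> 0 \<Longrightarrow> subalgebra M (history \<delta> i)"
  unfolding subalgebra_def using measurable_history[of \<delta> i] by (auto simp: sets_history intro: measurable_sets)

lemma history_measurable_M: "\<delta> \<ge> 0 \<Longrightarrow> G \<in> measurable (history \<delta> i) N \<Longrightarrow> G \<in> measurable M N"
  by (rule measurable_from_subalg[OF history_subalgebra])

lemma incr_measurable_history:
  assumes "j < i" shows "incr \<delta> j \<in> borel_measurable (history \<delta> i)"
proof -
  have "(\<lambda>\<omega>. \<lambda>j\<in>{..<i}. incr \<delta> j \<omega>) \<in> measurable (history \<delta> i) (PiM {..<i} (\<lambda>_. borel))"
    unfolding history_def by (rule measurable_vimage_algebra1) (auto simp: space_PiM)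
  then have "(\<lambda>\<omega>. (\<lambda>j\<in>{..<i}. incr \<delta> j \<omega>) j) \<in> borel_measurable (history \<delta> i)"
    by (rule measurable_compose[OF _ measurable_component_singleton]) (use assms in auto)
  then show ?thesis using assms by simp
qed

lemma history_mono:
  assumes "i \<le> i'" "G \<in> measurable (history \<delta> i) N" shows "G \<in> measurable (history \<delta> i') N"
proof -
  have h: "(\<lambda>\<omega>. \<lambda>j\<in>{..<i}. incr \<delta> j \<omega>) \<in> measurable (history \<delta> i') (PiM {..<i} (\<lambda>_. borel))"
    by (intro measurable_restrict incr_measurable_history) (use assms in auto)
  have "subalgebra (history \<delta> i') (history \<delta> i)"
    unfolding subalgebra_def
  proof safe
    fix A assume "A \<in> sets (history \<delta> i)"
    then obtain B where "B \<in> sets (PiM {..<i} (\<lambda>_. borel))" "A = (\<lambda>\<omega>. \<lambda>j\<in>{..<i}. incr \<delta> j \<omega>) -` B \<inter> space M"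
      by (auto simp: sets_history)
    then show "A \<in> sets (history \<delta> i')" using measurable_sets[OF h, of B] by simp
  qed simp_all
  then show ?thesis using assms(2) by (rule measurable_from_subalg)
qed

lemma L_sum_incr: "\<omega> \<in> space M \<Longrightarrow> L (real j * \<delta>) \<omega> = x + (\<Sum>l<j. incr \<delta> l \<omega>)"
  by (induction j) (auto simp: start incr_def)

lemma L_measurable_history: "j \<le> i \<Longrightarrow> L (real j * \<delta>) \<in> borel_measurable (history \<delta> i)"
proof -
  assume "j \<le> i"
  then have "(\<lambda>\<omega>. x + (\<Sum>l<j. incr \<delta> l \<omega>)) \<in> borel_measurable (history \<delta> i)"
    by (intro borel_measurable_add borel_measurable_sum borel_measurable_const incr_measurable_history) auto
  then show ?thesis by (subst measurable_cong[of _ _ "\<lambda>\<omega>. x + (\<Sum>l<j. incr \<delta> l \<omega>)"]) (auto simp: L_sum_incr)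
qed

text \<open>The first \<open>i\<close> increments and the next one are independent blocks of an
  independent family. The events of \<open>G\<close> are events of the first block, those of the
  exponential are events of the second.\<close>

lemma history_indep:
  fixes G :: "'a \<Rightarrow> complex" and c :: complex
  assumes \<delta>: "\<delta> \<ge> 0" and G: "G \<in> borel_measurable (history \<delta> i)"
  shows "indep_var borel G borel (\<lambda>\<omega>. exp (- c * of_real (incr \<delta> i \<omega>)))"
proof -
  let ?R = "\<lambda>\<omega>. \<lambda>j\<in>{..<i}. incr \<delta> j \<omega>" and ?R' = "\<lambda>\<omega>. \<lambda>j\<in>{i}. incr \<delta> j \<omega>"
  let ?E = "\<lambda>\<omega>. exp (- c * of_real (incr \<delta> i \<omega>))"
  have "indep_vars (\<lambda>_. borel) (\<lambda>j \<omega>. L (real (Suc j) * \<delta>) \<omega> - L (real j * \<delta>) \<omega>) {..<Suc i}"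
    by (rule ind[of "\<lambda>j. real j * \<delta>"]) (use \<delta> in \<open>auto simp: incseq_def intro!: mult_right_mono\<close>)
  then have iv: "indep_vars (\<lambda>_. borel) (incr \<delta>) {..<Suc i}" unfolding incr_def[abs_def] .
  have iRR: "indep_var (PiM {..<i} (\<lambda>_. borel)) ?R (PiM {i} (\<lambda>_. borel)) ?R'"
    by (rule indep_var_restrict[OF iv]) auto
  have [measurable]: "incr \<delta> i \<in> borel_measurable M" by (rule measurable_incr[OF \<delta>])
  have R': "?R' \<in> measurable M (PiM {i} (\<lambda>_. borel))" by (intro measurable_restrict measurable_incr[OF \<delta>])
  have "{G -` A \<inter> space M | A. A \<in> sets borel} \<subseteq> {?R -` A \<inter> space M | A. A \<in> sets (PiM {..<i} (\<lambda>_. borel))}"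
    using measurable_sets[OF G] by (auto simp: sets_history)
  then have sub: "sigma_sets (space M) {G -` A \<inter> space M | A. A \<in> sets borel} \<subseteq> sigma_sets (space M) {?R -` A \<inter> space M | A. A \<in> sets (PiM {..<i} (\<lambda>_. borel))}"
    by (rule sigma_sets_mono')
  have "{?E -` A \<inter> space M | A. A \<in> sets borel} \<subseteq> {?R' -` A \<inter> space M | A. A \<in> sets (PiM {i} (\<lambda>_. borel))}"
  proof safe
    fix A :: "complex set" assume A: "A \<in> sets borel"
    have e: "(\<lambda>f. exp (- c * complex_of_real (f i))) \<in> borel_measurable (PiM {i} (\<lambda>_. borel))" by measurable
    show "\<exists>B. ?E -` A \<inter> space M = ?R' -` B \<inter> space M \<and> B \<in> sets (PiM {i} (\<lambda>_. borel))"
      using measurable_sets[OF e A]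
      by (intro exI[of _ "(\<lambda>f. exp (- c * complex_of_real (f i))) -` A \<inter> space (PiM {i} (\<lambda>_. borel))"] conjI)
         (auto simp: space_PiM)
  qed
  then have sub': "sigma_sets (space M) {?E -` A \<inter> space M | A. A \<in> sets borel} \<subseteq> sigma_sets (space M) {?R' -` A \<inter> space M | A. A \<in> sets (PiM {i} (\<lambda>_. borel))}"
    by (rule sigma_sets_mono')
  show ?thesis
    unfolding indep_var_eq
  proof (intro conjI)
    show "random_variable borel G" by (rule history_measurable_M[OF \<delta> G])
    show "random_variable borel ?E" by measurable
    show "indep_set (sigma_sets (space M) {G -` A \<inter> space M |A. A \<in> sets borel}) (sigma_sets (space M) {?E -` A \<inter> space M |A. A \<in> sets borel})"
      using iRR sub sub' unfolding indep_var_eq indep_sets2_eq by (meson subset_iff)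
  qed
qed

lemma history_step:
  fixes G :: "'a \<Rightarrow> complex" and c :: complex
  assumes \<delta>: "\<delta> > 0" and G: "G \<in> borel_measurable (history \<delta> i)" and int: "integrable M G" and c: "Re c > 0"
  shows "has_bochner_integral M (\<lambda>\<omega>. G \<omega> * exp (- c * of_real (incr \<delta> i \<omega>))) ((\<integral>\<omega>. G \<omega> \<partial>M) * exp (of_real \<delta> * c powr of_real (p - 1)))"
proof -
  have \<delta>': "\<delta> \<ge> 0" using \<delta> by simp
  have iv: "indep_var borel G borel (\<lambda>\<omega>. exp (- c * complex_of_real (incr \<delta> i \<omega>)))"
    by (rule history_indep[OF \<delta>' G])
  have e: "real (Suc i) * \<delta> = real i * \<delta> + \<delta>" by (simp add: algebra_simps)
  have hb: "has_bochner_integral M (\<lambda>\<omega>. exp (- c * complex_of_real (incr \<delta> i \<omega>))) (exp (of_real \<delta> * c powr of_real (p - 1)))"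
    unfolding incr_def e by (rule lap_complex) (use \<delta> c in auto)
  then show ?thesis
    using indep_var_lebesgue_integral[OF iv int] indep_var_integrable[OF iv int] by (auto simp: has_bochner_integral_iff)
qed

text \<open>Right Riemann sum for the area. With right end points the newest summand is a multiple
  of the current value of \<open>L\<close>, so it merges with the exponent \<open>z\<close> of that
  value.\<close>

definition mesh_area :: "real \<Rightarrow> nat \<Rightarrow> 'a \<Rightarrow> real" where
  "mesh_area \<delta> n \<omega> = \<delta> * (\<Sum>i<n. L (real (Suc i) * \<delta>) \<omega>)"

lemma mesh_area_measurable_history: "n \<le> i \<Longrightarrow> mesh_area \<delta> n \<in> borel_measurable (history \<delta> i)"
  unfolding mesh_area_def by (intro borel_measurable_times borel_measurable_sum borel_measurable_const L_measurable_history) auto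

text \<open>Peel off the last step. The newest area term raises the exponent of the last value of
  \<open>L\<close> from \<open>z\<close> to \<open>z + q * \<delta>\<close>; splitting this value
  into the previous one and an independent increment produces one factor of the transform and leaves
  the same expression with the larger exponent. Hence the induction runs over all
  \<open>z\<close>.\<close>

lemma mesh_identity:
  fixes G :: "'a \<Rightarrow> complex" and z :: complex
  assumes \<delta>: "\<delta> > 0" and q: "q > 0" and z: "Re z \<ge> 0" and G: "G \<in> borel_measurable (history \<delta> n)"
    and int: "integrable M (\<lambda>\<omega>. G \<omega> * exp (- of_real (q * mesh_area \<delta> n \<omega>) - (z + of_real (q * \<delta> * real l)) * of_real (L (real n * \<delta>) \<omega>)))"
  shows "has_bochner_integral M (\<lambda>\<omega>. G \<omega> * exp (- of_real (q * mesh_area \<delta> (n + l) \<omega>) - z * of_real (L (real (n + l) * \<delta>) \<omega>)))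
     ((\<integral>\<omega>. G \<omega> * exp (- of_real (q * mesh_area \<delta> n \<omega>) - (z + of_real (q * \<delta> * real l)) * of_real (L (real n * \<delta>) \<omega>)) \<partial>M)
       * exp (of_real \<delta> * (\<Sum>j<l. (z + of_real (q * (real (Suc j) * \<delta>))) powr of_real (p - 1))))"
  using z int
proof (induction l arbitrary: z)
  case 0
  then show ?case by (simp add: has_bochner_integral_iff)
next
  case (Suc l)
  \<comment> \<open>Even for imaginary \<open>z\<close> this has positive real part, so the
    transform of the increment is available although the identity is wanted on the imaginary
    axis.\<close>
  define z' where "z' = z + of_real (q * \<delta>)"
  have z': "Re z' > 0" using Suc.prems(1) q \<delta> by (simp add: z'_def add_nonneg_pos)
  have zz: "z + of_real (q * \<delta> * real (Suc l)) = z' + of_real (q * \<delta> * real l)"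
    by (simp add: z'_def algebra_simps)
  let ?H = "\<lambda>\<omega>. G \<omega> * exp (- of_real (q * mesh_area \<delta> (n + l) \<omega>) - z' * of_real (L (real (n + l) * \<delta>) \<omega>))"
  let ?E = "\<integral>\<omega>. G \<omega> * exp (- of_real (q * mesh_area \<delta> n \<omega>) - (z' + of_real (q * \<delta> * real l)) * of_real (L (real n * \<delta>) \<omega>)) \<partial>M"
  have IH: "has_bochner_integral M ?H (?E * exp (of_real \<delta> * (\<Sum>j<l. (z' + of_real (q * (real (Suc j) * \<delta>))) powr of_real (p - 1))))"
    by (rule Suc.IH) (use z' Suc.prems(2) in \<open>simp_all only: zz less_imp_le\<close>)
  have Hm: "?H \<in> borel_measurable (history \<delta> (n + l))"
  proof -
    have [measurable]: "G \<in> borel_measurable (history \<delta> (n + l))" "mesh_area \<delta> (n + l) \<in> borel_measurable (history \<delta> (n + l))" "L (real (n + l) * \<delta>) \<in> borel_measurable (history \<delta> (n + l))"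
      by (rule history_mono[OF _ G], simp, rule mesh_area_measurable_history, simp, rule L_measurable_history, simp)
    show ?thesis by measurable
  qed
  have step: "has_bochner_integral M (\<lambda>\<omega>. ?H \<omega> * exp (- z' * of_real (incr \<delta> (n + l) \<omega>)))
     ((\<integral>\<omega>. ?H \<omega> \<partial>M) * exp (of_real \<delta> * z' powr of_real (p - 1)))"
    by (rule history_step[OF \<delta> Hm _ z']) (use IH in \<open>simp add: has_bochner_integral_iff\<close>)
  have eq: "?H \<omega> * exp (- z' * of_real (incr \<delta> (n + l) \<omega>)) = G \<omega> * exp (- of_real (q * mesh_area \<delta> (n + Suc l) \<omega>) - z * of_real (L (real (n + Suc l) * \<delta>) \<omega>))" for \<omega>
  proof -
    let ?a = "L (real (n + l) * \<delta>) \<omega>" and ?b = "L (real (n + Suc l) * \<delta>) \<omega>"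
    have r: "mesh_area \<delta> (n + Suc l) \<omega> = mesh_area \<delta> (n + l) \<omega> + \<delta> * ?b" by (simp add: mesh_area_def distrib_left)
    have d: "incr \<delta> (n + l) \<omega> = ?b - ?a" by (simp add: incr_def)
    have "- complex_of_real (q * mesh_area \<delta> (n + l) \<omega>) - z' * of_real ?a + (- z' * of_real (incr \<delta> (n + l) \<omega>)) = - of_real (q * mesh_area \<delta> (n + Suc l) \<omega>) - z * of_real ?b"
      unfolding r d z'_def by (simp add: algebra_simps)
    then show ?thesis by (simp only: mult.assoc mult_exp_exp)
  qed
  have "exp (of_real \<delta> * (\<Sum>j<l. (z' + of_real (q * (real (Suc j) * \<delta>))) powr of_real (p - 1))) * exp (of_real \<delta> * z' powr of_real (p - 1))
     = exp (of_real \<delta> * (\<Sum>j<Suc l. (z + of_real (q * (real (Suc j) * \<delta>))) powr of_real (p - 1)))"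
  proof -
    have "(\<Sum>j<Suc l. (z + of_real (q * (real (Suc j) * \<delta>))) powr complex_of_real (p - 1)) =
      z' powr of_real (p - 1) + (\<Sum>j<l. (z' + of_real (q * (real (Suc j) * \<delta>))) powr of_real (p - 1))"
      unfolding sum.lessThan_Suc_shift by (simp add: z'_def algebra_simps)
    then show ?thesis by (simp only: mult_exp_exp distrib_left add.commute)
  qed
  then show ?case
    using step unfolding eq has_bochner_integral_integral_eq[OF IH] zz by (simp only: mult.assoc)
qed

text \<open>The case of \<open>mesh_identity\<close> started at time 0 with a real exponent. The
  bound involves the mesh only through the total time \<open>real N * \<delta>\<close>, which makes
  it uniform under refinement.\<close>

lemma mesh_moment:
  fixes c :: real
  assumes \<delta>: "\<delta> > 0" and q: "q > 0" and c: "c \<ge> 0"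
  shows "integrable M (\<lambda>\<omega>. exp (- q * mesh_area \<delta> N \<omega> - c * L (real N * \<delta>) \<omega>))"
    and "(\<integral>\<omega>. exp (- q * mesh_area \<delta> N \<omega> - c * L (real N * \<delta>) \<omega>) \<partial>M) \<le> exp (\<bar>x\<bar> * (c + q * (real N * \<delta>)) + real N * \<delta> * (c + q * (real N * \<delta>)) powr (p - 1))"
proof -
  let ?S = "\<delta> * (\<Sum>j<N. (c + q * (real (Suc j) * \<delta>)) powr (p - 1))"
  have int: "integrable M (\<lambda>\<omega>. 1 * exp (- of_real (q * mesh_area \<delta> 0 \<omega>) - (of_real c + of_real (q * \<delta> * real N)) * complex_of_real (L (real 0 * \<delta>) \<omega>)))"
    by (subst Bochner_Integration.integrable_cong[OF refl, of _ _ "\<lambda>_. exp (- (of_real c + of_real (q * \<delta> * real N)) * of_real x)"]) (auto simp: start mesh_area_def algebra_simps)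
  have E0: "(\<integral>\<omega>. 1 * exp (- of_real (q * mesh_area \<delta> 0 \<omega>) - (of_real c + of_real (q * \<delta> * real N)) * complex_of_real (L (real 0 * \<delta>) \<omega>)) \<partial>M) = of_real (exp (- (c + q * \<delta> * real N) * x))"
    by (subst Bochner_Integration.integral_cong[OF refl, of _ _ "\<lambda>_. of_real (exp (- (c + q * \<delta> * real N) * x))"]) (auto simp: start mesh_area_def prob_space algebra_simps simp flip: exp_of_real)
  have S: "complex_of_real \<delta> * (\<Sum>j<N. (of_real c + of_real (q * (real (Suc j) * \<delta>))) powr of_real (p - 1)) = of_real ?S"
  proof -
    have "(of_real c + of_real (q * (real (Suc j) * \<delta>))) powr complex_of_real (p - 1) = of_real ((c + q * (real (Suc j) * \<delta>)) powr (p - 1))" for j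
    proof -
      have "c + q * (real (Suc j) * \<delta>) \<ge> 0" using c q \<delta> by simp
      then show ?thesis using powr_of_real[of "c + q * (real (Suc j) * \<delta>)" "p - 1"] by (simp only: of_real_add)
    qed
    then show ?thesis by (simp only: of_real_mult of_real_sum)
  qed
  have "has_bochner_integral M (\<lambda>\<omega>. 1 * exp (- of_real (q * mesh_area \<delta> (0 + N) \<omega>) - of_real c * complex_of_real (L (real (0 + N) * \<delta>) \<omega>)))
      (of_real (exp (- (c + q * \<delta> * real N) * x)) * exp (of_real ?S))"
    using mesh_identity[OF \<delta> q _ _ int] c unfolding E0 S by simp
  then have "has_bochner_integral M (\<lambda>\<omega>. Re (1 * exp (- of_real (q * mesh_area \<delta> (0 + N) \<omega>) - of_real c * complex_of_real (L (real (0 + N) * \<delta>) \<omega>))))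
      (Re (of_real (exp (- (c + q * \<delta> * real N) * x)) * exp (of_real ?S)))"
    by (rule has_bochner_integral_bounded_linear[OF bounded_linear_Re])
  then have hb: "has_bochner_integral M (\<lambda>\<omega>. exp (- q * mesh_area \<delta> N \<omega> - c * L (real N * \<delta>) \<omega>)) (exp (- (c + q * \<delta> * real N) * x) * exp ?S)"
    by (simp add: Re_exp)
  then show "integrable M (\<lambda>\<omega>. exp (- q * mesh_area \<delta> N \<omega> - c * L (real N * \<delta>) \<omega>))" by (simp add: has_bochner_integral_iff)
  have "(c + q * (real (Suc j) * \<delta>)) powr (p - 1) \<le> (c + q * (real N * \<delta>)) powr (p - 1)" if "j < N" for j
    using that c q \<delta> p2 by (intro powr_mono2 add_left_mono mult_left_mono mult_right_mono) auto
  then have "(\<Sum>j<N. (c + q * (real (Suc j) * \<delta>)) powr (p - 1)) \<le> (\<Sum>j<N. (c + q * (real N * \<delta>)) powr (p - 1))"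
    by (intro sum_mono) auto
  then have "?S \<le> \<delta> * (real N * (c + q * (real N * \<delta>)) powr (p - 1))" using \<delta> by (intro mult_left_mono) auto
  moreover have "- (c + q * \<delta> * real N) * x \<le> \<bar>x\<bar> * (c + q * (real N * \<delta>))"
  proof -
    have "- (c + q * \<delta> * real N) * x = (- x) * (c + q * (real N * \<delta>))" by (simp add: algebra_simps)
    also have "\<dots> \<le> \<bar>x\<bar> * (c + q * (real N * \<delta>))" using c q \<delta> by (intro mult_right_mono) auto
    finally show ?thesis .
  qed
  ultimately show "(\<integral>\<omega>. exp (- q * mesh_area \<delta> N \<omega> - c * L (real N * \<delta>) \<omega>) \<partial>M) \<le> exp (\<bar>x\<bar> * (c + q * (real N * \<delta>)) + real N * \<delta> * (c + q * (real N * \<delta>)) powr (p - 1))"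
    unfolding has_bochner_integral_integral_eq[OF hb] mult_exp_exp by (simp add: mult_ac)
qed

definition area :: "real \<Rightarrow> 'a \<Rightarrow> real" where
  "area t \<omega> = (\<integral>s. indicator {0<..t} s *\<^sub>R L s \<omega> \<partial>lborel)"

lemma mesh_area_tendsto_area:
  fixes k :: nat
  assumes h: "h > 0" and \<omega>: "\<omega> \<in> space M"
  shows "(\<lambda>m. mesh_area (h / real (Suc m)) (k * Suc m) \<omega>) \<longlonglongrightarrow> area (real k * h) \<omega>"
proof (cases "k = 0")
  case False
  define T where "T = real k * h"
  have T: "T > 0" using h False by (simp add: T_def)
  obtain B where B: "\<And>t. t \<in> {0..T} \<Longrightarrow> \<bar>L t \<omega>\<bar> \<le> B" using cadlag_bounded[OF cad[OF \<omega>], of T] T by auto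
  have le: "Suc m \<le> k * Suc m" for m using False by (cases k) auto
  have "filterlim (\<lambda>m. k * Suc m) at_top sequentially"
    by (rule filterlim_at_top_mono[OF filterlim_Suc]) (use le in \<open>auto intro!: always_eventually simp del: mult_Suc_right\<close>)
  then have "(\<lambda>m. (T / real (k * Suc m)) *\<^sub>R (\<Sum>i<k * Suc m. L (real (Suc i) * (T / real (k * Suc m))) \<omega>)) \<longlonglongrightarrow> area T \<omega>"
    unfolding area_def using cad[OF \<omega>] B False
    by (intro right_riemann_sums[OF T]) (auto simp: cadlag_def)
  moreover have "T / real (k * Suc m) = h / real (Suc m)" for m unfolding T_def of_nat_mult using False by (simp del: of_nat_Suc)
  ultimately show ?thesis by (simp only: mesh_area_def T_def real_scaleR_def)
qed (simp add: mesh_area_def area_def)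

lemma area_measurable: "t \<ge> 0 \<Longrightarrow> area t \<in> borel_measurable M"
proof -
  assume t: "t \<ge> 0"
  show ?thesis
  proof (cases "t = 0")
    case True then show ?thesis by (simp add: area_def[abs_def])
  next
    case False
    show ?thesis
    proof (rule borel_measurable_LIMSEQ_metric)
      show "mesh_area (t / real (Suc m)) (1 * Suc m) \<in> borel_measurable M" for m
        by (rule history_measurable_M[OF _ mesh_area_measurable_history]) (use t in auto)
      show "(\<lambda>m. mesh_area (t / real (Suc m)) (1 * Suc m) \<omega>) \<longlonglongrightarrow> area t \<omega>" if "\<omega> \<in> space M" for \<omega>
        using mesh_area_tendsto_area[of t \<omega> 1] t False that by simp
    qed
  qed
qed

text \<open>Closed form of the integral of \<open>(z + q * s) powr (p - 1)\<close> over
  \<open>s\<close> between 0 and \<open>\<tau>\<close>, the limit of the exponents that the grid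
  steps accumulate.\<close>

definition area_exponent :: "real \<Rightarrow> complex \<Rightarrow> real \<Rightarrow> complex" where
  "area_exponent q z \<tau> = ((z + of_real (q * \<tau>)) powr of_real p - z powr of_real p) / of_real (q * p)"

text \<open>Riemann sums of a continuous function with antiderivative
  \<open>(z + q * r) powr p / (q * p)\<close>. The derivative is taken only at interior points,
  since for \<open>z = 0\<close> the base vanishes at \<open>r = 0\<close>.\<close>

lemma riemann_area_exponent:
  assumes h: "h > 0" and q: "q > 0" and z: "Re z \<ge> 0"
  shows "(\<lambda>m. of_real (h / real (Suc m)) * (\<Sum>j<l * Suc m. (z + of_real (q * (real (Suc j) * (h / real (Suc m))))) powr of_real (p - 1))) \<longlonglongrightarrow> area_exponent q z (real l * h)"
proof (cases "l = 0")
  case False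
  define T where "T = real l * h"
  have T: "T > 0" using h False by (simp add: T_def)
  let ?w = "\<lambda>r::real. (z + of_real (q * r)) powr complex_of_real (p - 1)"
  have cont: "continuous_on {0..T} (\<lambda>r::real. (z + of_real (q * r)) powr complex_of_real a)" if "a > 0" for a
    using z q that by (intro continuous_intros) auto
  have contw: "continuous_on {0..} ?w" using z q p2 by (intro continuous_intros) auto
  have "bounded (?w ` {0..T})" by (intro compact_imp_bounded compact_continuous_image cont) (use p2 in auto)
  then obtain B where "\<forall>y\<in>?w ` {0..T}. norm y \<le> B" unfolding bounded_iff by blast
  then have B: "norm (?w t) \<le> B" if "t \<in> {0..T}" for t using that by blast
  have rc: "continuous (at_right t) ?w" if "t \<in> {0..<T}" for t
  proof -
    have "continuous (at t within {0..}) ?w" using contw that by (auto simp: continuous_on_eq_continuous_within)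
    then show ?thesis by (rule continuous_within_subset) (use that in auto)
  qed
  have le: "Suc m \<le> l * Suc m" for m using False by (cases l) auto
  have fl: "filterlim (\<lambda>m. l * Suc m) at_top sequentially"
    by (rule filterlim_at_top_mono[OF filterlim_Suc]) (use le in \<open>auto intro!: always_eventually simp del: mult_Suc_right\<close>)
  note rr = right_riemann_sums[OF T B rc fl]
  have lim: "(\<lambda>m. (T / real (l * Suc m)) *\<^sub>R (\<Sum>i<l * Suc m. ?w (real (Suc i) * (T / real (l * Suc m))))) \<longlonglongrightarrow> (\<integral>s. indicator {0<..T} s *\<^sub>R ?w s \<partial>lborel)"
    using False by (intro rr(2)) auto
  have int: "set_integrable lborel {0<..T} ?w" using rr(1) False by (auto simp: set_integrable_def)
  have "(?w has_integral ((z + of_real (q * T)) powr of_real p / of_real (q * p) - (z + of_real (q * 0)) powr of_real p / of_real (q * p))) {0..T}"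
  proof (rule fundamental_theorem_of_calculus_interior)
    show "continuous_on {0..T} (\<lambda>r. (z + of_real (q * r)) powr of_real p / of_real (q * p))"
      using p2 q by (intro continuous_intros cont) auto
    fix r assume r: "r \<in> {0<..<T}"
    have "Re (z + of_real q * of_real r) > 0" using r q z by (simp add: add_nonneg_pos)
    then have nz: "z + of_real q * of_real r \<notin> \<real>\<^sub>\<le>\<^sub>0" by (auto simp: complex_nonpos_Reals_iff)
    have "((\<lambda>y. (z + of_real q * y) powr of_real p / of_real (q * p)) has_field_derivative
        (of_real p * (z + of_real q * of_real r) powr (of_real p - 1) * of_real q / of_real (q * p))) (at (of_real r))"
      by (rule DERIV_cdivide, rule DERIV_chain2[OF has_field_derivative_powr]) (use nz in \<open>auto intro!: derivative_eq_intros\<close>)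
    then have "((\<lambda>y. (z + of_real q * of_real y) powr of_real p / of_real (q * p)) has_vector_derivative
        (of_real p * (z + of_real q * of_real r) powr (of_real p - 1) * of_real q / of_real (q * p))) (at r)"
      by (rule has_vector_derivative_real_field)
    then show "((\<lambda>r. (z + of_real (q * r)) powr of_real p / of_real (q * p)) has_vector_derivative ?w r) (at r)"
      using q p2 by simp
  qed (use T in auto)
  then have "(?w has_integral area_exponent q z T) {0..T}" by (simp add: area_exponent_def diff_divide_distrib)
  then have "(?w has_integral area_exponent q z T) {0<..T}"
    by (rule iffD1[OF has_integral_spike_set_eq, rotated -1]; intro negligible_subset[OF negligible_sing[of 0]]) auto
  then have "(\<integral>s. indicator {0<..T} s *\<^sub>R ?w s \<partial>lborel) = area_exponent q z T"
    using set_borel_integral_eq_integral(2)[OF int] by (simp add: set_lebesgue_integral_def integral_unique)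
  moreover have "T / real (l * Suc m) = h / real (Suc m)" for m unfolding T_def of_nat_mult using False by (simp del: of_nat_Suc)
  ultimately show ?thesis using lim by (simp only: T_def scaleR_conv_of_real)
qed (simp add: area_exponent_def)

text \<open>The square of the integrand is again an exponential of the same kind with
  \<open>q\<close> and \<open>Re w\<close> doubled, so \<open>mesh_moment\<close> bounds the second
  moments uniformly in the refinement and \<open>L2_bounded_tendsto\<close> applies.\<close>

lemma mesh_limit:
  fixes b :: "'a \<Rightarrow> complex" and w :: complex and n :: nat
  assumes h: "h > 0" and q: "q > 0" and w: "Re w \<ge> 0"
    and b[measurable]: "b \<in> borel_measurable M" and b1: "\<And>\<omega>. norm (b \<omega>) \<le> 1"
  shows "integrable M (\<lambda>\<omega>. b \<omega> * exp (- of_real (q * mesh_area (h / real (Suc m)) (n * Suc m) \<omega>) - w * of_real (L (real n * h) \<omega>)))" (is "integrable M (?f m)")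
    and "integrable M (\<lambda>\<omega>. b \<omega> * exp (- of_real (q * area (real n * h) \<omega>) - w * of_real (L (real n * h) \<omega>)))" (is "integrable M ?g")
    and "(\<lambda>m. \<integral>\<omega>. b \<omega> * exp (- of_real (q * mesh_area (h / real (Suc m)) (n * Suc m) \<omega>) - w * of_real (L (real n * h) \<omega>)) \<partial>M)
       \<longlonglongrightarrow> (\<integral>\<omega>. b \<omega> * exp (- of_real (q * area (real n * h) \<omega>) - w * of_real (L (real n * h) \<omega>)) \<partial>M)"
proof -
  have T: "real (n * Suc m) * (h / real (Suc m)) = real n * h" for m unfolding of_nat_mult by (simp del: of_nat_Suc)
  have h': "h / real (Suc m) > 0" for m using h by simp
  have [measurable]: "area (real n * h) \<in> borel_measurable M" "L (real n * h) \<in> borel_measurable M"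
    using h by (auto intro!: area_measurable rv)
  have [measurable]: "mesh_area (h / real (Suc m)) (n * Suc m) \<in> borel_measurable M" for m
    by (rule history_measurable_M[OF less_imp_le[OF h'] mesh_area_measurable_history[OF order_refl]])
  define C where "C = exp (\<bar>x\<bar> * (2 * Re w + (2 * q) * (real n * h)) + real n * h * (2 * Re w + (2 * q) * (real n * h)) powr (p - 1))"
  let ?e = "\<lambda>m \<omega>. exp (- (2 * q) * mesh_area (h / real (Suc m)) (n * Suc m) \<omega> - (2 * Re w) * L (real n * h) \<omega>)"
  have q2: "2 * q > 0" using q by simp
  have w2: "2 * Re w \<ge> 0" using w by simp
  have ie: "integrable M (?e m)" and eC: "(\<integral>\<omega>. ?e m \<omega> \<partial>M) \<le> C" for m
    using mesh_moment[OF h'[of m] q2 w2, of "n * Suc m"] unfolding T C_def by simp_all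
  have nf: "(norm (?f m \<omega>))\<^sup>2 \<le> ?e m \<omega>" for m \<omega>
  proof -
    have "(norm (?f m \<omega>))\<^sup>2 = (norm (b \<omega>))\<^sup>2 * ?e m \<omega>"
      by (simp add: norm_mult power_mult_distrib exp_double[symmetric] algebra_simps del: of_nat_Suc)
    also have "\<dots> \<le> 1 * ?e m \<omega>" using b1[of \<omega>] by (intro mult_right_mono) (auto simp: power_le_one)
    finally show ?thesis by simp
  qed
  have if2: "integrable M (\<lambda>\<omega>. (norm (?f m \<omega>))\<^sup>2)" for m
  proof (rule Bochner_Integration.integrable_bound[OF ie[of m]])
    show "(\<lambda>\<omega>. (norm (?f m \<omega>))\<^sup>2) \<in> borel_measurable M" by measurable
    show "AE \<omega> in M. norm ((norm (?f m \<omega>))\<^sup>2) \<le> norm (?e m \<omega>)"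
      using nf by (intro AE_I2) (simp only: real_norm_def abs_of_nonneg[OF zero_le_power2] abs_exp_cancel)
  qed
  have if2C: "(\<integral>\<omega>. (norm (?f m \<omega>))\<^sup>2 \<partial>M) \<le> C" for m
    using integral_mono[OF if2 ie nf] eC by (rule order_trans)
  have lim: "AE \<omega> in M. (\<lambda>m. ?f m \<omega>) \<longlonglongrightarrow> ?g \<omega>"
    by (intro AE_I2 tendsto_intros mesh_area_tendsto_area[OF h])
  have fm: "?f m \<in> borel_measurable M" for m by measurable
  have gm: "?g \<in> borel_measurable M" by measurable
  show "integrable M ?g" "(\<lambda>m. \<integral>\<omega>. ?f m \<omega> \<partial>M) \<longlonglongrightarrow> (\<integral>\<omega>. ?g \<omega> \<partial>M)"
    by (rule L2_bounded_tendsto[OF fm gm lim if2 if2C])+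
  show "integrable M (?f m)"
  proof (rule Bochner_Integration.integrable_bound[where f = "\<lambda>\<omega>. 1 + (norm (?f m \<omega>))\<^sup>2"])
    have "a \<le> 1 + a\<^sup>2" for a :: real
      using zero_le_power2[of "a - 1/2"] by (simp add: power2_eq_square algebra_simps)
    then show "AE \<omega> in M. norm (?f m \<omega>) \<le> norm (1 + (norm (?f m \<omega>))\<^sup>2)"
      by (intro AE_I2) (simp only: real_norm_def, rule order_trans[OF _ abs_ge_self], simp)
  next
    show "integrable M (\<lambda>\<omega>. 1 + (norm (?f m \<omega>))\<^sup>2)" by (intro Bochner_Integration.integrable_add if2 integrable_const)
    show "?f m \<in> borel_measurable M" by (rule fm)
  qed
qed

text \<open>Dependence on the increments up to time \<open>n * h\<close>, simultaneously for all refinements of the mesh \<open>h\<close>.\<close>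

definition adapted :: "real \<Rightarrow> nat \<Rightarrow> ('a \<Rightarrow> complex) \<Rightarrow> bool" where
  "adapted h n b \<longleftrightarrow> (\<forall>m. b \<in> borel_measurable (history (h / real (Suc m)) (n * Suc m))) \<and> (\<forall>\<omega>. norm (b \<omega>) \<le> 1)"

lemma adapted_measurable:
  assumes h: "h > 0" and b: "adapted h n b" shows "b \<in> borel_measurable M"
proof (rule history_measurable_M)
  show "b \<in> borel_measurable (history (h / real (Suc 0)) (n * Suc 0))" using b unfolding adapted_def by blast
qed (use h in simp)

text \<open>The limit of \<open>mesh_identity\<close> over refinements of the mesh \<open>h\<close>.
  The factor \<open>b\<close> depends on the past alone, so this is the Markov property expressed
  through transforms; being adapted for every refinement, \<open>b\<close> survives each grid
  identity.\<close>

lemma joint_transform: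
  fixes b :: "'a \<Rightarrow> complex" and z :: complex and n l :: nat
  assumes h: "h > 0" and q: "q > 0" and z: "Re z \<ge> 0" and b: "adapted h n b"
  shows "(\<integral>\<omega>. b \<omega> * exp (- of_real (q * area (real (n + l) * h) \<omega>) - z * of_real (L (real (n + l) * h) \<omega>)) \<partial>M)
    = (\<integral>\<omega>. b \<omega> * exp (- of_real (q * area (real n * h) \<omega>) - (z + of_real (q * (real l * h))) * of_real (L (real n * h) \<omega>)) \<partial>M) * exp (area_exponent q z (real l * h))"
proof -
  have bM: "b \<in> borel_measurable M" by (rule adapted_measurable[OF h b])
  have b1: "norm (b \<omega>) \<le> 1" for \<omega> using b by (simp add: adapted_def)
  have h': "h / real (Suc m) > 0" for m using h by simp
  have T: "real (j * Suc m) * (h / real (Suc m)) = real j * h" for j m unfolding of_nat_mult by (simp del: of_nat_Suc)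
  define z' where "z' = z + of_real (q * (real l * h))"
  have z': "Re z' \<ge> 0" using z q h by (simp add: z'_def)
  have zz: "z + of_real (q * (h / real (Suc m)) * real (l * Suc m)) = z'" for m
  proof -
    have "q * (h / real (Suc m)) * real (l * Suc m) = q * (real (l * Suc m) * (h / real (Suc m)))" by (simp only: mult_ac)
    then show ?thesis unfolding T z'_def by simp
  qed
  let ?f = "\<lambda>m. \<integral>\<omega>. b \<omega> * exp (- of_real (q * mesh_area (h / real (Suc m)) ((n + l) * Suc m) \<omega>) - z * of_real (L (real (n + l) * h) \<omega>)) \<partial>M"
  let ?g = "\<lambda>m. \<integral>\<omega>. b \<omega> * exp (- of_real (q * mesh_area (h / real (Suc m)) (n * Suc m) \<omega>) - z' * of_real (L (real n * h) \<omega>)) \<partial>M"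
  let ?s = "\<lambda>m. of_real (h / real (Suc m)) * (\<Sum>j<l * Suc m. (z + of_real (q * (real (Suc j) * (h / real (Suc m))))) powr of_real (p - 1))"
  have "?f m = ?g m * exp (?s m)" for m
  proof -
    have bF: "b \<in> borel_measurable (history (h / real (Suc m)) (n * Suc m))" using b by (simp add: adapted_def)
    have "integrable M (\<lambda>\<omega>. b \<omega> * exp (- of_real (q * mesh_area (h / real (Suc m)) (n * Suc m) \<omega>) - (z + of_real (q * (h / real (Suc m)) * real (l * Suc m))) * of_real (L (real (n * Suc m) * (h / real (Suc m))) \<omega>)))"
      unfolding zz T by (rule mesh_limit(1)[OF h q z' bM b1])
    from has_bochner_integral_integral_eq[OF mesh_identity[OF h' q z bF this]]
    show ?thesis unfolding add_mult_distrib[symmetric] T zz .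
  qed
  moreover have "?f \<longlonglongrightarrow> (\<integral>\<omega>. b \<omega> * exp (- of_real (q * area (real (n + l) * h) \<omega>) - z * of_real (L (real (n + l) * h) \<omega>)) \<partial>M)"
    by (rule mesh_limit(3)[OF h q z bM b1])
  moreover have "(\<lambda>m. ?g m * exp (?s m)) \<longlonglongrightarrow> (\<integral>\<omega>. b \<omega> * exp (- of_real (q * area (real n * h) \<omega>) - z' * of_real (L (real n * h) \<omega>)) \<partial>M) * exp (area_exponent q z (real l * h))"
    by (intro tendsto_mult tendsto_exp mesh_limit(3)[OF h q z' bM b1] riemann_area_exponent[OF h q z])
  ultimately show ?thesis unfolding z'_def using LIMSEQ_unique by simp
qed

section \<open>The martingale built from the Airy-type function\<close>

lemma fourier_swap:
  fixes a :: "'a \<Rightarrow> complex" and \<psi> :: "real \<Rightarrow> complex"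
  assumes a: "integrable M a" and \<psi>: "integrable lborel \<psi>" and \<Lambda>[measurable]: "\<Lambda> \<in> borel_measurable M"
  shows "integrable M (\<lambda>\<omega>. a \<omega> * (\<integral>\<eta>. \<psi> \<eta> * exp (- of_real (\<Lambda> \<omega>) * Complex 0 \<eta>) \<partial>lborel))"
    and "(\<integral>\<omega>. a \<omega> * (\<integral>\<eta>. \<psi> \<eta> * exp (- of_real (\<Lambda> \<omega>) * Complex 0 \<eta>) \<partial>lborel) \<partial>M)
       = (\<integral>\<eta>. \<psi> \<eta> * (\<integral>\<omega>. a \<omega> * exp (- of_real (\<Lambda> \<omega>) * Complex 0 \<eta>) \<partial>M) \<partial>lborel)"
proof -
  interpret MP: pair_sigma_finite M lborel ..
  have [measurable]: "a \<in> borel_measurable M" "\<psi> \<in> borel_measurable borel" using a \<psi> by auto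
  let ?f = "\<lambda>\<omega> \<eta>. a \<omega> * (\<psi> \<eta> * exp (- of_real (\<Lambda> \<omega>) * Complex 0 \<eta>))"
  have n: "norm (exp (- of_real (\<Lambda> \<omega>) * Complex 0 \<eta>)) = 1" for \<omega> \<eta> by simp
  have ex: "integrable lborel (\<lambda>\<eta>. \<psi> \<eta> * exp (- of_real (\<Lambda> \<omega>) * Complex 0 \<eta>))" for \<omega>
    by (rule Bochner_Integration.integrable_bound[OF \<psi>]) (auto simp: norm_mult)
  have i: "integrable (M \<Otimes>\<^sub>M lborel) (case_prod ?f)"
  proof (rule MP.Fubini_integrable)
    show "case_prod ?f \<in> borel_measurable (M \<Otimes>\<^sub>M lborel)" by measurable
    have "(\<integral>\<eta>. norm (case_prod ?f (\<omega>, \<eta>)) \<partial>lborel) = norm (a \<omega>) * (\<integral>\<eta>. norm (\<psi> \<eta>) \<partial>lborel)" for \<omega>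
      by (simp add: norm_mult)
    then show "integrable M (\<lambda>\<omega>. \<integral>\<eta>. norm (case_prod ?f (\<omega>, \<eta>)) \<partial>lborel)" using a by simp
    show "AE \<omega> in M. integrable lborel (\<lambda>\<eta>. case_prod ?f (\<omega>, \<eta>))" using ex by auto
  qed
  have e1: "(\<integral>\<eta>. ?f \<omega> \<eta> \<partial>lborel) = a \<omega> * (\<integral>\<eta>. \<psi> \<eta> * exp (- of_real (\<Lambda> \<omega>) * Complex 0 \<eta>) \<partial>lborel)" for \<omega>
    by (rule Bochner_Integration.integral_mult_right_zero)
  have e2: "(\<integral>\<omega>. ?f \<omega> \<eta> \<partial>M) = \<psi> \<eta> * (\<integral>\<omega>. a \<omega> * exp (- of_real (\<Lambda> \<omega>) * Complex 0 \<eta>) \<partial>M)" for \<eta>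
    by (subst Bochner_Integration.integral_mult_right_zero[symmetric]) (simp add: mult_ac)
  show "integrable M (\<lambda>\<omega>. a \<omega> * (\<integral>\<eta>. \<psi> \<eta> * exp (- of_real (\<Lambda> \<omega>) * Complex 0 \<eta>) \<partial>lborel))"
    using MP.integrable_fst[OF i] unfolding e1 .
  show "(\<integral>\<omega>. a \<omega> * (\<integral>\<eta>. \<psi> \<eta> * exp (- of_real (\<Lambda> \<omega>) * Complex 0 \<eta>) \<partial>lborel) \<partial>M)
       = (\<integral>\<eta>. \<psi> \<eta> * (\<integral>\<omega>. a \<omega> * exp (- of_real (\<Lambda> \<omega>) * Complex 0 \<eta>) \<partial>M) \<partial>lborel)"
    using MP.Fubini_integral[OF i] unfolding e1 e2 by simp
qed

text \<open>The constant \<open>1 / (q * p)\<close> is the one in \<open>area_exponent\<close>: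
  multiplying the kernel at \<open>z\<close> by the exponential of that exponent yields the kernel
  at \<open>z + q * \<tau>\<close>.\<close>

definition airy_scaled :: "real \<Rightarrow> real \<Rightarrow> complex" where
  "airy_scaled q y = (\<integral>\<eta>. kern (1 / (q * p)) (Complex 0 \<eta>) * exp (- of_real y * Complex 0 \<eta>) \<partial>lborel)"

lemma \<kappa>_pos: "q > 0 \<Longrightarrow> 1 / (q * p) > 0" using p2 by simp

lemma airy_scaled_airy: "q > 0 \<Longrightarrow> airy_scaled q y = 2 * pi / p * (p * q) powr (1 / p) * airy (of_real (y * (p * q) powr (1 / p)))"
proof -
  assume q: "q > 0"
  have "(1 / (q * p)) powr (- 1 / p) = (p * q) powr (1 / p)" using q p2 by (simp add: powr_divide powr_minus_divide mult.commute)
  then show ?thesis unfolding airy_scaled_def using kern_line(2)[OF \<kappa>_pos[OF q], of y] by simp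
qed

lemma airy_scaled_continuous: "q > 0 \<Longrightarrow> isCont (airy_scaled q) y"
proof -
  assume "q > 0"
  then have "airy_scaled q = (\<lambda>y. 2 * pi / p * (p * q) powr (1 / p) * airy (of_real (y * (p * q) powr (1 / p))))"
    using airy_scaled_airy by auto
  moreover have "continuous_on UNIV \<dots>" by (intro continuous_intros)
  ultimately show ?thesis by (simp add: continuous_on_eq_continuous_at)
qed

lemma kern_integrable: "q > 0 \<Longrightarrow> integrable lborel (\<lambda>\<eta>. kern (1 / (q * p)) (Complex 0 \<eta>))"
  using kern_line(1)[OF \<kappa>_pos, of q 0] by simp

text \<open>On the imaginary axis the factor containing \<open>y\<close> has modulus 1, so the bound
  holds for negative \<open>y\<close> too. This matters because on a grid the process is stopped at
  a value that may be negative.\<close>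

lemma airy_scaled_bounded:
  assumes q: "q > 0" shows "norm (airy_scaled q y) \<le> (\<integral>\<eta>. norm (kern (1 / (q * p)) (Complex 0 \<eta>)) \<partial>lborel)"
proof -
  have "norm (airy_scaled q y) \<le> (\<integral>\<eta>. norm (kern (1 / (q * p)) (Complex 0 \<eta>) * exp (- of_real y * Complex 0 \<eta>)) \<partial>lborel)"
    unfolding airy_scaled_def by (rule integral_norm_bound)
  then show ?thesis by (simp add: norm_mult)
qed

text \<open>Write \<open>airy_scaled\<close> as an integral over the imaginary axis and take the
  expectation inside. The joint transform moves the kernel to the line with real part
  \<open>\<tau>\<close>; taking the integral back inside the expectation, \<open>kern_shift\<close>
  identifies it as \<open>airy_scaled\<close> at the earlier time. Testing against all adapted
  \<open>b\<close> replaces conditional expectations.\<close>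

lemma martingale:
  fixes b :: "'a \<Rightarrow> complex" and n l :: nat
  assumes h: "h > 0" and q: "q > 0" and b: "adapted h n b"
  shows "integrable M (\<lambda>\<omega>. b \<omega> * exp (- of_real (q * area (real n * h) \<omega>)) * airy_scaled q (L (real n * h) \<omega>))"
    and "(\<integral>\<omega>. b \<omega> * exp (- of_real (q * area (real (n + l) * h) \<omega>)) * airy_scaled q (L (real (n + l) * h) \<omega>) \<partial>M)
       = (\<integral>\<omega>. b \<omega> * exp (- of_real (q * area (real n * h) \<omega>)) * airy_scaled q (L (real n * h) \<omega>) \<partial>M)"
proof -
  have bM: "b \<in> borel_measurable M" by (rule adapted_measurable[OF h b])
  have b1: "norm (b \<omega>) \<le> 1" for \<omega> using b by (simp add: adapted_def)
  let ?\<kappa> = "1 / (q * p)"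
  define \<tau> where "\<tau> = q * (real l * h)"
  have \<tau>: "\<tau> \<ge> 0" using q h by (simp add: \<tau>_def)
  have Lm: "L (real j * h) \<in> borel_measurable M" for j :: nat using h by (intro rv) auto
  have ia: "integrable M (\<lambda>\<omega>. b \<omega> * exp (- of_real (q * area (real j * h) \<omega>)))" for j :: nat
    using mesh_limit(2)[OF h q, of 0 b j] bM b1 by simp
  have ia': "integrable M (\<lambda>\<omega>. b \<omega> * exp (- of_real (q * area (real n * h) \<omega>) - of_real \<tau> * of_real (L (real n * h) \<omega>)))"
    using mesh_limit(2)[OF h q, of "of_real \<tau>" b n] bM b1 \<tau> by simp
  note sw = fourier_swap[OF ia kern_integrable[OF q] Lm, folded airy_scaled_def]
  show "integrable M (\<lambda>\<omega>. b \<omega> * exp (- of_real (q * area (real n * h) \<omega>)) * airy_scaled q (L (real n * h) \<omega>))"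
    by (rule sw(1))
  have int_c: "integrable lborel (\<lambda>\<eta>. kern ?\<kappa> (Complex \<tau> \<eta>))"
    using kern_shift(1)[OF \<kappa>_pos[OF q] \<tau>, of 0] by simp
  have "(\<integral>\<omega>. b \<omega> * exp (- of_real (q * area (real (n + l) * h) \<omega>)) * airy_scaled q (L (real (n + l) * h) \<omega>) \<partial>M)
    = (\<integral>\<eta>. kern ?\<kappa> (Complex 0 \<eta>) * (\<integral>\<omega>. b \<omega> * exp (- of_real (q * area (real (n + l) * h) \<omega>)) * exp (- of_real (L (real (n + l) * h) \<omega>) * Complex 0 \<eta>) \<partial>M) \<partial>lborel)"
    by (rule sw(2))
  also have "\<dots> = (\<integral>\<eta>. kern ?\<kappa> (Complex \<tau> \<eta>) * (\<integral>\<omega>. b \<omega> * exp (- of_real (q * area (real n * h) \<omega>) - of_real \<tau> * of_real (L (real n * h) \<omega>)) * exp (- of_real (L (real n * h) \<omega>) * Complex 0 \<eta>) \<partial>M) \<partial>lborel)"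
  proof (rule Bochner_Integration.integral_cong[OF refl])
    fix \<eta> :: real
    have z: "Re (Complex 0 \<eta>) \<ge> 0" by simp
    have c: "Complex 0 \<eta> + of_real \<tau> = Complex \<tau> \<eta>" by (simp add: complex_eq_iff)
    have "exp (- of_real (q * area (real (n + l) * h) \<omega>)) * exp (- of_real (L (real (n + l) * h) \<omega>) * Complex 0 \<eta>)
        = exp (- of_real (q * area (real (n + l) * h) \<omega>) - Complex 0 \<eta> * of_real (L (real (n + l) * h) \<omega>))" for \<omega>
      unfolding mult_exp_exp by (rule arg_cong[where f = exp]) (simp add: mult.commute)
    then have "(\<integral>\<omega>. b \<omega> * exp (- of_real (q * area (real (n + l) * h) \<omega>)) * exp (- of_real (L (real (n + l) * h) \<omega>) * Complex 0 \<eta>) \<partial>M)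
       = (\<integral>\<omega>. b \<omega> * exp (- of_real (q * area (real (n + l) * h) \<omega>) - Complex 0 \<eta> * of_real (L (real (n + l) * h) \<omega>)) \<partial>M)"
      by (simp only: mult.assoc)
    also have "\<dots> = (\<integral>\<omega>. b \<omega> * exp (- of_real (q * area (real n * h) \<omega>) - Complex \<tau> \<eta> * of_real (L (real n * h) \<omega>)) \<partial>M) * exp (area_exponent q (Complex 0 \<eta>) (real l * h))"
      unfolding joint_transform[OF h q z b] \<tau>_def[symmetric] c ..
    also have "(\<integral>\<omega>. b \<omega> * exp (- of_real (q * area (real n * h) \<omega>) - Complex \<tau> \<eta> * of_real (L (real n * h) \<omega>)) \<partial>M)
       = (\<integral>\<omega>. b \<omega> * exp (- of_real (q * area (real n * h) \<omega>) - of_real \<tau> * of_real (L (real n * h) \<omega>)) * exp (- of_real (L (real n * h) \<omega>) * Complex 0 \<eta>) \<partial>M)"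
    proof (rule Bochner_Integration.integral_cong[OF refl])
      fix \<omega>
      have "- of_real (q * area (real n * h) \<omega>) - Complex \<tau> \<eta> * of_real (L (real n * h) \<omega>)
         = (- of_real (q * area (real n * h) \<omega>) - of_real \<tau> * of_real (L (real n * h) \<omega>)) + - of_real (L (real n * h) \<omega>) * Complex 0 \<eta>"
        unfolding c[symmetric] by (simp add: algebra_simps)
      then show "b \<omega> * exp (- of_real (q * area (real n * h) \<omega>) - Complex \<tau> \<eta> * of_real (L (real n * h) \<omega>))
         = b \<omega> * exp (- of_real (q * area (real n * h) \<omega>) - of_real \<tau> * of_real (L (real n * h) \<omega>)) * exp (- of_real (L (real n * h) \<omega>) * Complex 0 \<eta>)"
        by (simp only: exp_add mult.assoc)
    qed
    finally have e: "(\<integral>\<omega>. b \<omega> * exp (- of_real (q * area (real (n + l) * h) \<omega>)) * exp (- of_real (L (real (n + l) * h) \<omega>) * Complex 0 \<eta>) \<partial>M)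
      = (\<integral>\<omega>. b \<omega> * exp (- of_real (q * area (real n * h) \<omega>) - of_real \<tau> * of_real (L (real n * h) \<omega>)) * exp (- of_real (L (real n * h) \<omega>) * Complex 0 \<eta>) \<partial>M) * exp (area_exponent q (Complex 0 \<eta>) (real l * h))" .
    \<comment> \<open>The subtracted power in \<open>area_exponent\<close> cancels the kernel on the
      axis; the other power is the kernel on the shifted line.\<close>
    have "kern ?\<kappa> (Complex 0 \<eta>) * exp (area_exponent q (Complex 0 \<eta>) (real l * h)) = kern ?\<kappa> (Complex \<tau> \<eta>)"
      unfolding kern_def mult_exp_exp area_exponent_def \<tau>_def[symmetric] c
      by (rule arg_cong[where f = exp]) (use q p2 in \<open>simp add: diff_divide_distrib\<close>)
    note k = this
    show "kern ?\<kappa> (Complex 0 \<eta>) * (\<integral>\<omega>. b \<omega> * exp (- of_real (q * area (real (n + l) * h) \<omega>)) * exp (- of_real (L (real (n + l) * h) \<omega>) * Complex 0 \<eta>) \<partial>M)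
      = kern ?\<kappa> (Complex \<tau> \<eta>) * (\<integral>\<omega>. b \<omega> * exp (- of_real (q * area (real n * h) \<omega>) - of_real \<tau> * of_real (L (real n * h) \<omega>)) * exp (- of_real (L (real n * h) \<omega>) * Complex 0 \<eta>) \<partial>M)"
    proof -
      have ac: "u * (v * w) = (u * w) * v" for u v w :: complex by simp
      show ?thesis unfolding e by (subst ac, subst k) (rule refl)
    qed
  qed
  also have "\<dots> = (\<integral>\<omega>. b \<omega> * exp (- of_real (q * area (real n * h) \<omega>) - of_real \<tau> * of_real (L (real n * h) \<omega>)) * (\<integral>\<eta>. kern ?\<kappa> (Complex \<tau> \<eta>) * exp (- of_real (L (real n * h) \<omega>) * Complex 0 \<eta>) \<partial>lborel) \<partial>M)"
    by (rule fourier_swap(2)[OF ia' int_c Lm, symmetric])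
  also have "\<dots> = (\<integral>\<omega>. b \<omega> * exp (- of_real (q * area (real n * h) \<omega>)) * airy_scaled q (L (real n * h) \<omega>) \<partial>M)"
  proof (rule Bochner_Integration.integral_cong[OF refl])
    fix \<omega>
    let ?y = "L (real n * h) \<omega>"
    have "exp (- of_real \<tau> * complex_of_real ?y) * (kern ?\<kappa> (Complex \<tau> \<eta>) * exp (- of_real ?y * Complex 0 \<eta>)) = kern ?\<kappa> (Complex \<tau> \<eta>) * exp (- of_real ?y * Complex \<tau> \<eta>)" for \<eta>
    proof -
      have "- of_real ?y * Complex \<tau> \<eta> = - of_real \<tau> * complex_of_real ?y + - of_real ?y * Complex 0 \<eta>"
        by (simp add: complex_eq_iff)
      then show ?thesis by (simp only: exp_add mult_ac)
    qed
    \<comment> \<open>The factor \<open>exp (- \<tau> * L)\<close> completes the exponential on the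
      axis to the one on the shifted line, and the contour can be moved back to the axis.\<close>
    then have "exp (- of_real \<tau> * complex_of_real ?y) * (\<integral>\<eta>. kern ?\<kappa> (Complex \<tau> \<eta>) * exp (- of_real ?y * Complex 0 \<eta>) \<partial>lborel) = (\<integral>\<eta>. kern ?\<kappa> (Complex \<tau> \<eta>) * exp (- of_real ?y * Complex \<tau> \<eta>) \<partial>lborel)"
      by (subst Bochner_Integration.integral_mult_right_zero[symmetric]) (simp only:)
    also have "\<dots> = airy_scaled q ?y" unfolding airy_scaled_def using kern_shift(2)[OF \<kappa>_pos[OF q] \<tau>, of ?y] by simp
    finally have u: "exp (- of_real \<tau> * complex_of_real ?y) * (\<integral>\<eta>. kern ?\<kappa> (Complex \<tau> \<eta>) * exp (- of_real ?y * Complex 0 \<eta>) \<partial>lborel) = airy_scaled q ?y" .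
    have "exp (- of_real (q * area (real n * h) \<omega>) - of_real \<tau> * complex_of_real ?y) = exp (- of_real (q * area (real n * h) \<omega>)) * exp (- of_real \<tau> * complex_of_real ?y)"
      by (simp add: mult_exp_exp)
    then show "b \<omega> * exp (- of_real (q * area (real n * h) \<omega>) - of_real \<tau> * of_real ?y) * (\<integral>\<eta>. kern ?\<kappa> (Complex \<tau> \<eta>) * exp (- of_real ?y * Complex 0 \<eta>) \<partial>lborel)
       = b \<omega> * exp (- of_real (q * area (real n * h) \<omega>)) * airy_scaled q ?y"
      unfolding u[symmetric] by (simp only: mult.assoc)
  qed
  finally show "(\<integral>\<omega>. b \<omega> * exp (- of_real (q * area (real (n + l) * h) \<omega>)) * airy_scaled q (L (real (n + l) * h) \<omega>) \<partial>M)
       = (\<integral>\<omega>. b \<omega> * exp (- of_real (q * area (real n * h) \<omega>)) * airy_scaled q (L (real n * h) \<omega>) \<partial>M)" .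
qed

section \<open>Stopping at the first passage to zero\<close>

definition tau :: "real \<Rightarrow> nat \<Rightarrow> 'a \<Rightarrow> nat" where
  "tau h J \<omega> = (LEAST n. L (real n * h) \<omega> \<le> 0 \<or> n = J)"

lemma tau_prop: "L (real (tau h J \<omega>) * h) \<omega> \<le> 0 \<or> tau h J \<omega> = J"
  unfolding tau_def by (rule LeastI_ex) blast

lemma tau_le: "tau h J \<omega> \<le> J"
  unfolding tau_def by (rule Least_le) simp

lemma tau_eq_iff:
  fixes n :: nat
  assumes "n \<le> J"
  shows "tau h J \<omega> = n \<longleftrightarrow> (\<forall>j\<in>{..<n}. 0 < L (real j * h) \<omega>) \<and> (n = J \<or> L (real n * h) \<omega> \<le> 0)"
proof
  assume t: "tau h J \<omega> = n"
  have "0 < L (real j * h) \<omega>" if "j < n" for j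
    using not_less_Least[of j "\<lambda>n. L (real n * h) \<omega> \<le> 0 \<or> n = J"] that t by (simp add: tau_def)
  then show "(\<forall>j\<in>{..<n}. 0 < L (real j * h) \<omega>) \<and> (n = J \<or> L (real n * h) \<omega> \<le> 0)"
    using tau_prop[of h J \<omega>] t by auto
next
  assume a: "(\<forall>j\<in>{..<n}. 0 < L (real j * h) \<omega>) \<and> (n = J \<or> L (real n * h) \<omega> \<le> 0)"
  show "tau h J \<omega> = n"
    unfolding tau_def
  proof (rule Least_equality)
    fix j assume j: "L (real j * h) \<omega> \<le> 0 \<or> j = J"
    show "n \<le> j"
    proof (rule ccontr)
      assume "\<not> n \<le> j"
      then have "0 < L (real j * h) \<omega>" "j \<noteq> J" using a assms by auto
      then show False using j by simp
    qed
  qed (use a in auto)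
qed

definition at_tau :: "real \<Rightarrow> nat \<Rightarrow> nat \<Rightarrow> 'a \<Rightarrow> real" where
  "at_tau h J n \<omega> = (if tau h J \<omega> = n then 1 else 0)"

text \<open>Whether \<open>tau\<close> equals \<open>n\<close> is decided by the values of
  \<open>L\<close> at the grid times up to \<open>n * h\<close>, and these times belong to every
  refinement of the grid.\<close>

lemma at_tau_adapted:
  fixes n :: nat
  assumes h: "h > 0" and n: "n \<le> J"
  shows "adapted h n (\<lambda>\<omega>. of_real (at_tau h J n \<omega>))"
  unfolding adapted_def
proof safe
  fix m
  let ?F = "history (h / real (Suc m)) (n * Suc m)"
  have L: "L (real j * h) \<in> borel_measurable ?F" if "j \<le> n" for j
  proof -
    have "j * Suc m \<le> n * Suc m" by (rule mult_le_mono1[OF that])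
    then have "L (real (j * Suc m) * (h / real (Suc m))) \<in> borel_measurable ?F" by (rule L_measurable_history)
    moreover have "real (j * Suc m) * (h / real (Suc m)) = real j * h" unfolding of_nat_mult by (simp del: of_nat_Suc)
    ultimately show ?thesis by simp
  qed
  have [measurable]: "L (real n * h) \<in> borel_measurable ?F" by (rule L) simp
  define Q where "Q = (\<lambda>\<omega>. \<forall>j\<in>{..<n}. 0 < L (real j * h) \<omega>)"
  have [measurable]: "Measurable.pred ?F Q"
    unfolding Q_def
  proof (rule pred_intros_finite(3))
    fix j assume "j \<in> {..<n}"
    then have [measurable]: "L (real j * h) \<in> borel_measurable ?F" by (intro L) simp
    show "Measurable.pred ?F (\<lambda>\<omega>. 0 < L (real j * h) \<omega>)" by measurable
  qed simp
  have "(\<lambda>\<omega>. if Q \<omega> \<and> (n = J \<or> L (real n * h) \<omega> \<le> 0) then 1 else 0 :: real) \<in> borel_measurable ?F"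
    by measurable
  then have [measurable]: "at_tau h J n \<in> borel_measurable ?F"
    unfolding at_tau_def[abs_def] tau_eq_iff[OF n] Q_def .
  show "(\<lambda>\<omega>. complex_of_real (at_tau h J n \<omega>)) \<in> borel_measurable ?F" by measurable
qed (simp add: at_tau_def)

lemma at_tau_measurable:
  assumes h: "h > 0" and n: "n \<le> J" shows "at_tau h J n \<in> borel_measurable M"
proof -
  have [measurable]: "(\<lambda>\<omega>. complex_of_real (at_tau h J n \<omega>)) \<in> borel_measurable M"
    by (rule adapted_measurable[OF h at_tau_adapted[OF h n]])
  have "(\<lambda>\<omega>. Re (complex_of_real (at_tau h J n \<omega>))) \<in> borel_measurable M" by measurable
  then show ?thesis by simp
qed

lemma sum_at_tau: "(\<Sum>n\<le>J. of_real (at_tau h J n \<omega>) * f n) = (f (tau h J \<omega>) :: 'b :: real_normed_field)"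
proof -
  have "(\<Sum>n\<le>J. of_real (at_tau h J n \<omega>) * f n) = (\<Sum>n\<le>J. if n = tau h J \<omega> then f n else 0)"
    by (intro sum.cong) (auto simp: at_tau_def)
  then show ?thesis using tau_le[of h J \<omega>] by simp
qed

definition airy_mart :: "real \<Rightarrow> real \<Rightarrow> 'a \<Rightarrow> complex" where
  "airy_mart q t \<omega> = exp (- of_real (q * area t \<omega>)) * airy_scaled q (L t \<omega>)"

lemma airy_scaled_measurable: "q > 0 \<Longrightarrow> airy_scaled q \<in> borel_measurable borel"
  using airy_scaled_continuous by (intro borel_measurable_continuous_onI continuous_at_imp_continuous_on) auto

lemma airy_mart_measurable: "q > 0 \<Longrightarrow> t \<ge> 0 \<Longrightarrow> airy_mart q t \<in> borel_measurable M"
proof -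
  assume "q > 0" "t \<ge> 0"
  then have [measurable]: "airy_scaled q \<in> borel_measurable borel" "L t \<in> borel_measurable M" "area t \<in> borel_measurable M"
    by (auto intro: airy_scaled_measurable rv area_measurable)
  show ?thesis unfolding airy_mart_def[abs_def] by measurable
qed

text \<open>Optional stopping at a bounded grid time: split according to the value \<open>n\<close>
  of \<open>tau\<close>, move each piece from \<open>n\<close> to \<open>J\<close> with its
  indicator as adapted factor, add up, and return from \<open>J\<close> to time 0.\<close>

lemma expectation_airy_mart_tau:
  assumes h: "h > 0" and q: "q > 0"
  shows "(\<lambda>\<omega>. airy_mart q (real (tau h J \<omega>) * h) \<omega>) \<in> borel_measurable M"
    and "(\<integral>\<omega>. airy_mart q (real (tau h J \<omega>) * h) \<omega> \<partial>M) = airy_scaled q x"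
proof -
  let ?b = "\<lambda>n \<omega>. complex_of_real (at_tau h J n \<omega>)"
  have e: "airy_mart q (real (tau h J \<omega>) * h) \<omega> = (\<Sum>n\<le>J. ?b n \<omega> * airy_mart q (real n * h) \<omega>)" for \<omega>
    by (rule sum_at_tau[symmetric])
  have [measurable]: "at_tau h J n \<in> borel_measurable M" if "n \<le> J" for n by (rule at_tau_measurable[OF h that])
  have [measurable]: "airy_mart q (real n * h) \<in> borel_measurable M" for n :: nat using h by (intro airy_mart_measurable q) simp
  show "(\<lambda>\<omega>. airy_mart q (real (tau h J \<omega>) * h) \<omega>) \<in> borel_measurable M"
    unfolding e by (intro borel_measurable_sum borel_measurable_times) auto
  have one: "adapted h n (\<lambda>_. 1)" for n by (simp add: adapted_def)
  have i: "integrable M (\<lambda>\<omega>. ?b n \<omega> * airy_mart q (real n * h) \<omega>)" if "n \<le> J" for n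
    using martingale(1)[OF h q at_tau_adapted[OF h that]] by (simp add: airy_mart_def mult.assoc)
  have m: "(\<integral>\<omega>. ?b n \<omega> * airy_mart q (real n * h) \<omega> \<partial>M) = (\<integral>\<omega>. ?b n \<omega> * airy_mart q (real J * h) \<omega> \<partial>M)" if "n \<le> J" for n
    using martingale(2)[OF h q at_tau_adapted[OF h that], of "J - n"] that by (simp add: airy_mart_def mult.assoc)
  have iJ: "integrable M (\<lambda>\<omega>. ?b n \<omega> * airy_mart q (real J * h) \<omega>)" if "n \<le> J" for n
  proof (rule Bochner_Integration.integrable_bound)
    show "integrable M (\<lambda>\<omega>. airy_mart q (real J * h) \<omega>)" using martingale(1)[OF h q one, of J] by (simp add: airy_mart_def)
    show "(\<lambda>\<omega>. ?b n \<omega> * airy_mart q (real J * h) \<omega>) \<in> borel_measurable M" using that by measurable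
  qed (auto simp: at_tau_def norm_mult)
  have "(\<integral>\<omega>. airy_mart q (real (tau h J \<omega>) * h) \<omega> \<partial>M) = (\<Sum>n\<le>J. \<integral>\<omega>. ?b n \<omega> * airy_mart q (real n * h) \<omega> \<partial>M)"
    unfolding e by (rule Bochner_Integration.integral_sum) (use i in auto)
  also have "\<dots> = (\<Sum>n\<le>J. \<integral>\<omega>. ?b n \<omega> * airy_mart q (real J * h) \<omega> \<partial>M)" by (intro sum.cong refl m) auto
  also have "\<dots> = (\<integral>\<omega>. (\<Sum>n\<le>J. ?b n \<omega> * airy_mart q (real J * h) \<omega>) \<partial>M)"
    by (rule Bochner_Integration.integral_sum[symmetric]) (use iJ in auto)
  also have "\<dots> = (\<integral>\<omega>. airy_mart q (real J * h) \<omega> \<partial>M)" unfolding sum_at_tau ..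
  also have "\<dots> = (\<integral>\<omega>. airy_mart q (real 0 * h) \<omega> \<partial>M)"
    using martingale(2)[OF h q one, of 0 J] by (simp add: airy_mart_def)
  also have "\<dots> = (\<integral>\<omega>. airy_scaled q x \<partial>M)" by (intro Bochner_Integration.integral_cong) (auto simp: airy_mart_def area_def start)
  also have "\<dots> = airy_scaled q x" by (simp add: prob_space)
  finally show "(\<integral>\<omega>. airy_mart q (real (tau h J \<omega>) * h) \<omega> \<partial>M) = airy_scaled q x" .
qed

lemma integrable_exp_area:
  fixes c :: real and b :: "'a \<Rightarrow> real" and n :: nat
  assumes h: "h > 0" and q: "q > 0" and c: "c \<ge> 0" and b: "adapted h j (\<lambda>\<omega>. of_real (b \<omega>))"
  shows "integrable M (\<lambda>\<omega>. b \<omega> * exp (- q * area (real n * h) \<omega> - c * L (real n * h) \<omega>))"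
    and "complex_of_real (\<integral>\<omega>. b \<omega> * exp (- q * area (real n * h) \<omega> - c * L (real n * h) \<omega>) \<partial>M) =
       (\<integral>\<omega>. of_real (b \<omega>) * exp (- of_real (q * area (real n * h) \<omega>) - of_real c * of_real (L (real n * h) \<omega>)) \<partial>M)"
proof -
  have b1: "norm (complex_of_real (b \<omega>)) \<le> 1" for \<omega> using b by (simp add: adapted_def)
  have bM: "(\<lambda>\<omega>. complex_of_real (b \<omega>)) \<in> borel_measurable M" by (rule adapted_measurable[OF h b])
  have eq: "of_real (b \<omega>) * exp (- of_real (q * area (real n * h) \<omega>) - of_real c * of_real (L (real n * h) \<omega>)) = complex_of_real (b \<omega> * exp (- q * area (real n * h) \<omega> - c * L (real n * h) \<omega>))" for \<omega>
    by (simp flip: exp_of_real)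
  have "integrable M (\<lambda>\<omega>. of_real (b \<omega>) * exp (- of_real (q * area (real n * h) \<omega>) - complex_of_real c * of_real (L (real n * h) \<omega>)))"
    by (rule mesh_limit(2)[OF h q _ bM b1]) (use c in simp)
  then have i: "integrable M (\<lambda>\<omega>. complex_of_real (b \<omega> * exp (- q * area (real n * h) \<omega> - c * L (real n * h) \<omega>)))"
    unfolding eq .
  show i1: "integrable M (\<lambda>\<omega>. b \<omega> * exp (- q * area (real n * h) \<omega> - c * L (real n * h) \<omega>))"
  proof -
    have "integrable M (\<lambda>\<omega>. Re (complex_of_real (b \<omega> * exp (- q * area (real n * h) \<omega> - c * L (real n * h) \<omega>))))"
      by (rule integrable_bounded_linear[OF bounded_linear_Re i])
    then show ?thesis unfolding Re_complex_of_real .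
  qed
  show "complex_of_real (\<integral>\<omega>. b \<omega> * exp (- q * area (real n * h) \<omega> - c * L (real n * h) \<omega>) \<partial>M) =
       (\<integral>\<omega>. of_real (b \<omega>) * exp (- of_real (q * area (real n * h) \<omega>) - of_real c * of_real (L (real n * h) \<omega>)) \<partial>M)"
    unfolding eq by (rule integral_of_real[symmetric, OF i1])
qed

text \<open>Since \<open>L \<le> 0\<close> at the stopping time, restarting the process there can only increase the exponential moment.\<close>

lemma exp_area_tau_le:
  assumes h: "h > 0" and q: "q > 0" and n: "n \<le> J"
  shows "(\<integral>\<omega>. at_tau h J n \<omega> * exp (- q * area (real n * h) \<omega>) \<partial>M) \<le> (\<integral>\<omega>. at_tau h J n \<omega> * exp (- q * area (real J * h) \<omega>) \<partial>M)"
proof (cases "n = J")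
  case False
  then have nJ: "n < J" using n by simp
  define l where "l = J - n"
  have l: "n + l = J" using n by (simp add: l_def)
  let ?b = "at_tau h J n"
  note ad = at_tau_adapted[OF h n]
  have q2: "q * (real l * h) \<ge> 0" using q h by simp
  have \<Phi>: "area_exponent q 0 (real l * h) = of_real ((q * (real l * h)) powr p / (q * p))"
    using powr_of_real[OF q2, of p] by (simp add: area_exponent_def)
  have "complex_of_real (\<integral>\<omega>. ?b \<omega> * exp (- q * area (real J * h) \<omega> - 0 * L (real J * h) \<omega>) \<partial>M)
     = (\<integral>\<omega>. of_real (?b \<omega>) * exp (- of_real (q * area (real (n + l) * h) \<omega>) - 0 * of_real (L (real (n + l) * h) \<omega>)) \<partial>M)"
    unfolding l using integrable_exp_area(2)[OF h q order_refl ad, of J] by simp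
  also have "\<dots> = (\<integral>\<omega>. of_real (?b \<omega>) * exp (- of_real (q * area (real n * h) \<omega>) - (0 + of_real (q * (real l * h))) * of_real (L (real n * h) \<omega>)) \<partial>M) * exp (area_exponent q 0 (real l * h))"
    by (rule joint_transform[OF h q _ ad]) simp
  also have "\<dots> = of_real ((\<integral>\<omega>. ?b \<omega> * exp (- q * area (real n * h) \<omega> - (q * (real l * h)) * L (real n * h) \<omega>) \<partial>M) * exp ((q * (real l * h)) powr p / (q * p)))"
    unfolding \<Phi> of_real_mult[of "integral\<^sup>L M _"] integrable_exp_area(2)[OF h q q2 ad] by (simp flip: exp_of_real)
  finally have eq: "(\<integral>\<omega>. ?b \<omega> * exp (- q * area (real J * h) \<omega> - 0 * L (real J * h) \<omega>) \<partial>M) =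
      (\<integral>\<omega>. ?b \<omega> * exp (- q * area (real n * h) \<omega> - (q * (real l * h)) * L (real n * h) \<omega>) \<partial>M) * exp ((q * (real l * h)) powr p / (q * p))"
    unfolding of_real_eq_iff .
  have "(\<integral>\<omega>. ?b \<omega> * exp (- q * area (real n * h) \<omega> - 0 * L (real n * h) \<omega>) \<partial>M) \<le> (\<integral>\<omega>. ?b \<omega> * exp (- q * area (real n * h) \<omega> - (q * (real l * h)) * L (real n * h) \<omega>) \<partial>M)"
  proof (rule integral_mono[OF integrable_exp_area(1)[OF h q order_refl ad] integrable_exp_area(1)[OF h q q2 ad]])
    fix \<omega>
    show "?b \<omega> * exp (- q * area (real n * h) \<omega> - 0 * L (real n * h) \<omega>) \<le> ?b \<omega> * exp (- q * area (real n * h) \<omega> - (q * (real l * h)) * L (real n * h) \<omega>)"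
    proof (cases "tau h J \<omega> = n")
      case True
      then have "L (real n * h) \<omega> \<le> 0" using tau_prop[of h J \<omega>] nJ by auto
      then have "(q * (real l * h)) * L (real n * h) \<omega> \<le> 0" using q2 by (simp only: mult_nonneg_nonpos)
      then show ?thesis using True by (simp add: at_tau_def)
    qed (simp add: at_tau_def)
  qed
  also have "\<dots> \<le> (\<integral>\<omega>. ?b \<omega> * exp (- q * area (real n * h) \<omega> - (q * (real l * h)) * L (real n * h) \<omega>) \<partial>M) * exp ((q * (real l * h)) powr p / (q * p))"
  proof -
    have "1 \<le> exp ((q * (real l * h)) powr p / (q * p))" using q p2 by simp
    moreover have "0 \<le> (\<integral>\<omega>. ?b \<omega> * exp (- q * area (real n * h) \<omega> - (q * (real l * h)) * L (real n * h) \<omega>) \<partial>M)"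
      by (rule Bochner_Integration.integral_nonneg) (simp add: at_tau_def)
    ultimately show ?thesis by (simp add: mult_le_cancel_left1)
  qed
  finally show ?thesis unfolding eq[symmetric] by simp
qed simp

text \<open>Between grid times the path may be negative, so \<open>exp (- q * area t)\<close> is unbounded; the second moments
  provide the uniform integrability needed to refine the grid.\<close>

lemma airy_mart_tau_L2:
  assumes h: "h > 0" and q: "q > 0"
  shows "integrable M (\<lambda>\<omega>. (norm (airy_mart q (real (tau h J \<omega>) * h) \<omega>))\<^sup>2)"
    and "(\<integral>\<omega>. (norm (airy_mart q (real (tau h J \<omega>) * h) \<omega>))\<^sup>2 \<partial>M) \<le>
      (\<integral>\<eta>. norm (kern (1 / (q * p)) (Complex 0 \<eta>)) \<partial>lborel)\<^sup>2 * (\<integral>\<omega>. exp (- (2 * q) * area (real J * h) \<omega>) \<partial>M)"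
proof -
  define C where "C = (\<integral>\<eta>. norm (kern (1 / (q * p)) (Complex 0 \<eta>)) \<partial>lborel)"
  have q2: "2 * q > 0" using q by simp
  have one: "adapted h 0 (\<lambda>\<omega>. of_real 1)" by (simp add: adapted_def)
  have [measurable]: "at_tau h J n \<in> borel_measurable M" if "n \<le> J" for n by (rule at_tau_measurable[OF h that])
  have i: "integrable M (\<lambda>\<omega>. at_tau h J n \<omega> * exp (- (2 * q) * area (real j * h) \<omega>))" if "n \<le> J" for n j
    using integrable_exp_area(1)[OF h q2 order_refl at_tau_adapted[OF h that], of j] by simp
  have s: "(\<Sum>n\<le>J. at_tau h J n \<omega> * f n) = f (tau h J \<omega>)" for \<omega> and f :: "nat \<Rightarrow> real"
    using sum_at_tau[of h J \<omega> f] by simp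
  let ?e = "\<lambda>\<omega>. C\<^sup>2 * (\<Sum>n\<le>J. at_tau h J n \<omega> * exp (- (2 * q) * area (real n * h) \<omega>))"
  have ie: "integrable M ?e" by (intro integrable_mult_right Bochner_Integration.integrable_sum i) auto
  have le: "(norm (airy_mart q (real (tau h J \<omega>) * h) \<omega>))\<^sup>2 \<le> ?e \<omega>" for \<omega>
  proof -
    let ?t = "real (tau h J \<omega>) * h"
    have "(norm (airy_mart q ?t \<omega>))\<^sup>2 = (norm (airy_scaled q (L ?t \<omega>)))\<^sup>2 * exp (- (2 * q) * area ?t \<omega>)"
      by (simp add: airy_mart_def norm_mult power_mult_distrib exp_double[symmetric] mult.commute mult.left_commute)
    also have "\<dots> \<le> C\<^sup>2 * exp (- (2 * q) * area ?t \<omega>)"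
      using airy_scaled_bounded[OF q, of "L ?t \<omega>"] unfolding C_def by (intro mult_right_mono power_mono) auto
    finally show ?thesis unfolding s .
  qed
  show i2: "integrable M (\<lambda>\<omega>. (norm (airy_mart q (real (tau h J \<omega>) * h) \<omega>))\<^sup>2)"
  proof (rule Bochner_Integration.integrable_bound[OF ie])
    show "(\<lambda>\<omega>. (norm (airy_mart q (real (tau h J \<omega>) * h) \<omega>))\<^sup>2) \<in> borel_measurable M"
      using expectation_airy_mart_tau(1)[OF h q, of J] by measurable
    show "AE \<omega> in M. norm ((norm (airy_mart q (real (tau h J \<omega>) * h) \<omega>))\<^sup>2) \<le> norm (?e \<omega>)"
    proof (rule AE_I2)
      fix \<omega>
      have "norm ((norm (airy_mart q (real (tau h J \<omega>) * h) \<omega>))\<^sup>2) = (norm (airy_mart q (real (tau h J \<omega>) * h) \<omega>))\<^sup>2" by simp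
      also have "\<dots> \<le> ?e \<omega>" by (rule le)
      also have "\<dots> \<le> norm (?e \<omega>)" unfolding real_norm_def by (rule abs_ge_self)
      finally show "norm ((norm (airy_mart q (real (tau h J \<omega>) * h) \<omega>))\<^sup>2) \<le> norm (?e \<omega>)" .
    qed
  qed
  have "(\<integral>\<omega>. (norm (airy_mart q (real (tau h J \<omega>) * h) \<omega>))\<^sup>2 \<partial>M) \<le> (\<integral>\<omega>. ?e \<omega> \<partial>M)"
    by (rule integral_mono[OF i2 ie le])
  also have "\<dots> = C\<^sup>2 * (\<Sum>n\<le>J. \<integral>\<omega>. at_tau h J n \<omega> * exp (- (2 * q) * area (real n * h) \<omega>) \<partial>M)"
    by (subst Bochner_Integration.integral_mult_right_zero, subst Bochner_Integration.integral_sum) (use i in auto)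
  also have "\<dots> \<le> C\<^sup>2 * (\<Sum>n\<le>J. \<integral>\<omega>. at_tau h J n \<omega> * exp (- (2 * q) * area (real J * h) \<omega>) \<partial>M)"
    by (intro mult_left_mono sum_mono exp_area_tau_le[OF h q2]) auto
  also have "\<dots> = C\<^sup>2 * (\<integral>\<omega>. (\<Sum>n\<le>J. at_tau h J n \<omega> * exp (- (2 * q) * area (real J * h) \<omega>)) \<partial>M)"
    by (subst Bochner_Integration.integral_sum) (use i in auto)
  also have "\<dots> = C\<^sup>2 * (\<integral>\<omega>. exp (- (2 * q) * area (real J * h) \<omega>) \<partial>M)" unfolding s ..
  finally show "(\<integral>\<omega>. (norm (airy_mart q (real (tau h J \<omega>) * h) \<omega>))\<^sup>2 \<partial>M) \<le>
      (\<integral>\<eta>. norm (kern (1 / (q * p)) (Complex 0 \<eta>)) \<partial>lborel)\<^sup>2 * (\<integral>\<omega>. exp (- (2 * q) * area (real J * h) \<omega>) \<partial>M)"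
    unfolding C_def .
qed

text \<open>Dyadic times keep the infimum measurable. Since the path has no negative jumps, it vanishes there.\<close>

definition dyadic_hits :: "'a \<Rightarrow> real set" where
  "dyadic_hits \<omega> = {t. (\<exists>j n. t = real j / 2 ^ n) \<and> L t \<omega> \<le> 0}"

definition hit :: "'a \<Rightarrow> bool" where "hit \<omega> \<longleftrightarrow> dyadic_hits \<omega> \<noteq> {}"

text \<open>The infimum of the empty set is an arbitrary value, so statements about
  \<open>hit_time\<close> go together with \<open>hit\<close>.\<close>

definition hit_time :: "'a \<Rightarrow> real" where "hit_time \<omega> = Inf (dyadic_hits \<omega>)"

definition hit_time_min :: "nat \<Rightarrow> 'a \<Rightarrow> real" where
  "hit_time_min N \<omega> = (if hit \<omega> \<and> hit_time \<omega> \<le> real N then hit_time \<omega> else real N)"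

lemma dyadic_hits_nonneg: "t \<in> dyadic_hits \<omega> \<Longrightarrow> t \<ge> 0" by (auto simp: dyadic_hits_def)

lemma dyadic_hits_bdd: "bdd_below (dyadic_hits \<omega>)" using dyadic_hits_nonneg by (intro bdd_belowI) auto

lemma hit_time_nonneg: "hit \<omega> \<Longrightarrow> hit_time \<omega> \<ge> 0"
  unfolding hit_time_def hit_def using dyadic_hits_nonneg by (intro cInf_greatest) auto

lemma hit_time_le: "t \<in> dyadic_hits \<omega> \<Longrightarrow> hit_time \<omega> \<le> t"
  unfolding hit_time_def by (rule cInf_lower[OF _ dyadic_hits_bdd])

lemma hit_time_min_nonneg: "hit_time_min N \<omega> \<ge> 0" using hit_time_nonneg by (simp add: hit_time_min_def)

lemma hit_time_min_le: "hit_time_min N \<omega> \<le> real N" by (simp add: hit_time_min_def)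

lemma dyadic_between:
  fixes a b :: real assumes "0 \<le> a" "a < b"
  obtains j n :: nat where "a < real j / 2 ^ n" "real j / 2 ^ n < b"
proof -
  obtain n where n: "1 / (b - a) < 2 ^ n" using real_arch_pow[of 2] by auto
  have n': "1 < 2 ^ n * (b - a)" using n assms by (simp add: field_simps)
  define j where "j = nat (\<lfloor>2 ^ n * a\<rfloor> + 1)"
  have nn: "0 \<le> \<lfloor>2 ^ n * a\<rfloor>" using assms by simp
  then have j: "real j = of_int \<lfloor>2 ^ n * a\<rfloor> + 1" by (simp add: j_def)
  have "2 ^ n * a < real j" "real j \<le> 2 ^ n * a + 1" unfolding j by linarith+
  then have "a < real j / 2 ^ n" "real j / 2 ^ n < b" using n' by (auto simp: field_simps)
  then show thesis by (rule that)
qed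

text \<open>The stopping time on the grid of mesh \<open>1 / 2 ^ n\<close>, capped at time
  \<open>N\<close>. It takes finitely many values and approximates \<open>hit_time_min\<close> from
  above, which is what right-continuity of the path requires.\<close>

definition sig_approx :: "nat \<Rightarrow> nat \<Rightarrow> 'a \<Rightarrow> real" where
  "sig_approx N n \<omega> = real (tau (1 / 2 ^ n) (N * 2 ^ n) \<omega>) * (1 / 2 ^ n)"

lemma hit_time_min_approx_le: "sig_approx N n \<omega> \<le> real N"
proof -
  have "real (tau (1 / 2 ^ n) (N * 2 ^ n) \<omega>) * (1 / 2 ^ n) \<le> real (N * 2 ^ n) * (1 / 2 ^ n)"
    using tau_le by (intro mult_right_mono) (auto simp only: of_nat_le_iff, simp)
  then show ?thesis by (simp add: sig_approx_def)
qed

lemma hit_time_min_approx_ge: "hit_time_min N \<omega> \<le> sig_approx N n \<omega>"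
  using tau_prop[of "1 / 2 ^ n" "N * 2 ^ n" \<omega>]
proof
  assume "L (real (tau (1 / 2 ^ n) (N * 2 ^ n) \<omega>) * (1 / 2 ^ n)) \<omega> \<le> 0"
  then have "sig_approx N n \<omega> \<in> dyadic_hits \<omega>" by (auto simp: dyadic_hits_def sig_approx_def)
  then have "hit \<omega>" "hit_time \<omega> \<le> sig_approx N n \<omega>" using hit_time_le by (auto simp: hit_def)
  then show ?thesis using hit_time_min_approx_le[of N n \<omega>] by (simp add: hit_time_min_def)
next
  assume "tau (1 / 2 ^ n) (N * 2 ^ n) \<omega> = N * 2 ^ n"
  then have "sig_approx N n \<omega> = real N" by (simp add: sig_approx_def)
  then show ?thesis using hit_time_min_le by simp
qed

text \<open>A dyadic time with denominator \<open>2 ^ m\<close> lies on every finer grid, so from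
  \<open>n = m\<close> onwards the grid time does not exceed it.\<close>

lemma hit_time_min_approx_tendsto: "(\<lambda>n. sig_approx N n \<omega>) \<longlonglongrightarrow> hit_time_min N \<omega>"
proof (rule order_tendstoI)
  fix a assume "a < hit_time_min N \<omega>"
  then show "\<forall>\<^sub>F n in sequentially. a < sig_approx N n \<omega>"
    using hit_time_min_approx_ge[of N \<omega>] by (intro always_eventually allI) (rule less_le_trans)
next
  fix a assume a: "hit_time_min N \<omega> < a"
  show "\<forall>\<^sub>F n in sequentially. sig_approx N n \<omega> < a"
  proof (cases "hit \<omega> \<and> hit_time \<omega> < real N")
    case False
    then have "hit_time_min N \<omega> = real N" by (auto simp: hit_time_min_def)
    then show ?thesis using hit_time_min_approx_le[of N _ \<omega>] a by (intro always_eventually allI) (metis le_less_trans)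
  next
    case True
    then have "hit_time \<omega> < min a (real N)" using a by (simp add: hit_time_min_def)
    moreover have "dyadic_hits \<omega> \<noteq> {}" using True by (simp add: hit_def)
    ultimately have "\<exists>t\<in>dyadic_hits \<omega>. t < min a (real N)" unfolding hit_time_def by (intro cInf_lessD)
    then obtain t where t: "t \<in> dyadic_hits \<omega>" "t < min a (real N)" by blast
    then obtain j m where jm: "t = real j / 2 ^ m" "L t \<omega> \<le> 0" by (auto simp: dyadic_hits_def)
    show ?thesis
    proof (rule eventually_sequentiallyI[of m])
      fix n assume n: "m \<le> n"
      then obtain e where e: "n = m + e" using le_Suc_ex by blast
      define i where "i = j * 2 ^ e"
      have ti: "t = real i * (1 / 2 ^ n)" by (simp add: i_def jm e power_add)
      have "tau (1 / 2 ^ n) (N * 2 ^ n) \<omega> \<le> i"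
        unfolding tau_def by (rule Least_le) (use jm(2) ti in simp)
      then have "sig_approx N n \<omega> \<le> t" unfolding sig_approx_def ti by (intro mult_right_mono) auto
      then show "sig_approx N n \<omega> < a" using t by simp
    qed
  qed
qed

lemma area_tendsto:
  assumes \<omega>: "\<omega> \<in> space M" and t: "\<And>n. t n \<ge> 0" "t \<longlonglongrightarrow> t0"
  shows "(\<lambda>n. area (t n) \<omega>) \<longlonglongrightarrow> area t0 \<omega>"
proof -
  have "Bseq t" using t(2) by (rule convergent_imp_Bseq[OF convergentI])
  then obtain T where T: "T > 0" "\<And>n. \<bar>t n\<bar> \<le> T" by (auto simp: Bseq_def)
  have t0: "t0 \<le> T" using T(2) by (intro LIMSEQ_le_const2[OF t(2)]) (auto simp: abs_le_iff)
  obtain B where B: "\<And>t. t \<in> {0..T} \<Longrightarrow> \<bar>L t \<omega>\<bar> \<le> B" using cadlag_bounded[OF cad[OF \<omega>], of T] T by auto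
  have i: "integrable lborel (\<lambda>s. indicator {0<..T} s *\<^sub>R L s \<omega>)"
    using right_riemann_sums(1)[OF T(1), of "\<lambda>s. L s \<omega>" B Suc] B cad[OF \<omega>] filterlim_Suc by (auto simp: cadlag_def)
  have m: "(\<lambda>s. indicator {0<..u} s *\<^sub>R L s \<omega>) \<in> borel_measurable lborel" if "u \<le> T" for u
  proof -
    have "(\<lambda>s. indicator {0<..u} s *\<^sub>R (indicator {0<..T} s *\<^sub>R L s \<omega>)) \<in> borel_measurable lborel"
      using i by measurable
    also have "(\<lambda>s. indicator {0<..u} s *\<^sub>R (indicator {0<..T} s *\<^sub>R L s \<omega>)) = (\<lambda>s. indicator {0<..u} s *\<^sub>R L s \<omega>)"
      using that by (auto simp: indicator_def)
    finally show ?thesis .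
  qed
  show ?thesis
    unfolding area_def
  proof (rule integral_dominated_convergence[where w = "\<lambda>s. norm (indicator {0<..T} s *\<^sub>R L s \<omega>)"])
    show "integrable lborel (\<lambda>s. norm (indicator {0<..T} s *\<^sub>R L s \<omega>))" by (rule integrable_norm[OF i])
    show "AE s in lborel. norm (indicator {0<..t n} s *\<^sub>R L s \<omega>) \<le> norm (indicator {0<..T} s *\<^sub>R L s \<omega>)" for n
      using T(2)[of n] by (intro AE_I2) (auto simp: indicator_def abs_le_iff)
    show "AE s in lborel. (\<lambda>n. indicator {0<..t n} s *\<^sub>R L s \<omega>) \<longlonglongrightarrow> indicator {0<..t0} s *\<^sub>R L s \<omega>"
      using AE_lborel_singleton[of t0]
    proof eventually_elim
      case (elim s)
      have "\<forall>\<^sub>F n in sequentially. (s \<le> t n) = (s \<le> t0)"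
      proof (cases "s < t0")
        case True
        then show ?thesis using order_tendstoD(1)[OF t(2) True] by (auto elim!: eventually_mono)
      next
        case False
        then have "t0 < s" using elim by simp
        then show ?thesis using order_tendstoD(2)[OF t(2) \<open>t0 < s\<close>] by (auto elim!: eventually_mono)
      qed
      then have "\<forall>\<^sub>F n in sequentially. indicator {0<..t n} s *\<^sub>R L s \<omega> = indicator {0<..t0} s *\<^sub>R L s \<omega>"
        by eventually_elim (auto simp: indicator_def)
      then show ?case by (rule tendsto_eventually)
    qed
  qed (use m T t0 in \<open>auto simp: abs_le_iff\<close>)
qed

text \<open>Refinement of the dyadic grid: the expectation is the same for every \<open>n\<close>,
  the martingale converges along the path by right-continuity, and the second moments are
  bounded.\<close>

lemma airy_mart_hit_time_min:
  assumes q: "q > 0"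
  shows "integrable M (\<lambda>\<omega>. airy_mart q (hit_time_min N \<omega>) \<omega>)" "(\<integral>\<omega>. airy_mart q (hit_time_min N \<omega>) \<omega> \<partial>M) = airy_scaled q x"
proof -
  let ?f = "\<lambda>n \<omega>. airy_mart q (sig_approx N n \<omega>) \<omega>"
  have h: "(1::real) / 2 ^ n > 0" for n :: nat by simp
  have fm: "?f n \<in> borel_measurable M" for n
    unfolding sig_approx_def by (rule expectation_airy_mart_tau(1)[OF h q])
  have lim: "(\<lambda>n. ?f n \<omega>) \<longlonglongrightarrow> airy_mart q (hit_time_min N \<omega>) \<omega>" if \<omega>: "\<omega> \<in> space M" for \<omega>
  proof -
    have "(\<lambda>n. area (sig_approx N n \<omega>) \<omega>) \<longlonglongrightarrow> area (hit_time_min N \<omega>) \<omega>"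
      by (rule area_tendsto[OF \<omega> _ hit_time_min_approx_tendsto]) (simp add: sig_approx_def)
    moreover have "(\<lambda>n. L (sig_approx N n \<omega>) \<omega>) \<longlonglongrightarrow> L (hit_time_min N \<omega>) \<omega>"
    proof -
      have "continuous (at_right (hit_time_min N \<omega>)) (\<lambda>t. L t \<omega>)" using cad[OF \<omega>] hit_time_min_nonneg by (simp add: cadlag_def)
      moreover have "{hit_time_min N \<omega>..} - {hit_time_min N \<omega>} = {hit_time_min N \<omega><..} - {hit_time_min N \<omega>}" by auto
      then have "at (hit_time_min N \<omega>) within {hit_time_min N \<omega>..} = at_right (hit_time_min N \<omega>)" by (simp only: at_within_def)
      ultimately have c: "continuous (at (hit_time_min N \<omega>) within {hit_time_min N \<omega>..}) (\<lambda>t. L t \<omega>)" by (simp add: continuous_within)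
      show ?thesis
        by (rule continuous_within_tendsto_compose[OF c, rotated]) (use hit_time_min_approx_ge hit_time_min_approx_tendsto in auto)
    qed
    then have "(\<lambda>n. airy_scaled q (L (sig_approx N n \<omega>) \<omega>)) \<longlonglongrightarrow> airy_scaled q (L (hit_time_min N \<omega>) \<omega>)"
      by (rule isCont_tendsto_compose[OF airy_scaled_continuous[OF q]])
    ultimately show ?thesis unfolding airy_mart_def by (intro tendsto_intros)
  qed
  have gm: "(\<lambda>\<omega>. airy_mart q (hit_time_min N \<omega>) \<omega>) \<in> borel_measurable M"
    by (rule borel_measurable_LIMSEQ_metric[OF fm lim])
  \<comment> \<open>Every dyadic grid ends at time \<open>N\<close> exactly, so the bound of
    \<open>airy_mart_tau_L2\<close> is the same for all \<open>n\<close>.\<close>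
  define C where "C = (\<integral>\<eta>. norm (kern (1 / (q * p)) (Complex 0 \<eta>)) \<partial>lborel)\<^sup>2 * (\<integral>\<omega>. exp (- (2 * q) * area (real N) \<omega>) \<partial>M)"
  have NN: "real (N * 2 ^ n) * (1 / 2 ^ n) = real N" for n :: nat by simp
  have i2: "integrable M (\<lambda>\<omega>. (norm (?f n \<omega>))\<^sup>2)" for n
    unfolding sig_approx_def by (rule airy_mart_tau_L2(1)[OF h q])
  have i2C: "(\<integral>\<omega>. (norm (?f n \<omega>))\<^sup>2 \<partial>M) \<le> C" for n
    using airy_mart_tau_L2(2)[OF h[of n] q, of "N * 2 ^ n"] unfolding NN C_def sig_approx_def .
  have lim': "AE \<omega> in M. (\<lambda>n. ?f n \<omega>) \<longlonglongrightarrow> airy_mart q (hit_time_min N \<omega>) \<omega>" using lim by (rule AE_I2)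
  note L2 = L2_bounded_tendsto[OF fm gm lim' i2 i2C]
  show "integrable M (\<lambda>\<omega>. airy_mart q (hit_time_min N \<omega>) \<omega>)" by (rule L2(1))
  have "(\<integral>\<omega>. ?f n \<omega> \<partial>M) = airy_scaled q x" for n
    unfolding sig_approx_def by (rule expectation_airy_mart_tau(2)[OF h q])
  then show "(\<integral>\<omega>. airy_mart q (hit_time_min N \<omega>) \<omega> \<partial>M) = airy_scaled q x" using LIMSEQ_unique[OF L2(2)] by simp
qed

end

section \<open>Decay along the process and certainty of passage\<close>

lemma Re_powr_imag:
  fixes \<theta> a :: real
  assumes "\<theta> \<noteq> 0"
  shows "Re (Complex 0 \<theta> powr of_real a) = \<bar>\<theta>\<bar> powr a * cos (a * (pi / 2))"
proof -
  have ln: "Ln (Complex 0 \<theta>) = of_real (ln \<bar>\<theta>\<bar>) + \<i> * of_real (sgn \<theta> * (pi / 2))"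
  proof (cases "\<theta> > 0")
    case True
    then have "Complex 0 \<theta> = of_real \<theta> * \<i>" by (simp add: complex_eq_iff)
    then show ?thesis using True by (simp add: Ln_times_of_real Ln_of_real)
  next
    case False
    then have "\<theta> < 0" using assms by simp
    have "Complex 0 \<theta> = of_real (- \<theta>) * (- \<i>)" by (simp add: complex_eq_iff)
    then have "Ln (Complex 0 \<theta>) = Ln (of_real (- \<theta>) * (- \<i>))" by (simp only:)
    also have "\<dots> = of_real (ln (- \<theta>)) + Ln (- \<i>)"
      using \<open>\<theta> < 0\<close> by (subst Ln_times_of_real, simp, simp) (simp only: Ln_of_real[of "- \<theta>"] neg_0_less_iff_less)
    finally show ?thesis using \<open>\<theta> < 0\<close> by (simp add: Ln_minus_ii)
  qed
  have "Complex 0 \<theta> \<noteq> 0" using assms by (simp add: complex_eq_iff)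
  then have "Complex 0 \<theta> powr of_real a = exp (of_real (a * ln \<bar>\<theta>\<bar>) + \<i> * of_real (a * (sgn \<theta> * (pi / 2))))"
    by (simp add: powr_def ln distrib_left mult_ac)
  then have "Re (Complex 0 \<theta> powr of_real a) = exp (a * ln \<bar>\<theta>\<bar>) * cos (a * (sgn \<theta> * (pi / 2)))"
    by (simp add: Re_exp)
  also have "cos (a * (sgn \<theta> * (pi / 2))) = cos (a * (pi / 2))" using assms by (cases "\<theta> > 0") auto
  finally show ?thesis using assms by (simp add: powr_def)
qed

context spectrally_positive
begin

text \<open>The Laplace transform is known for positive real part only, so \<open>\<theta>\<close>
  on the imaginary axis is approached from the right. The integrands stay below
  \<open>1 + exp (- X)\<close>, where \<open>X\<close> is the increment.\<close>

lemma fourier_transform: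
  fixes \<theta> :: real
  assumes h: "h > 0"
  shows "(\<integral>\<omega>. exp (- of_real (L h \<omega>) * Complex 0 \<theta>) \<partial>M) = exp (- of_real x * Complex 0 \<theta>) * exp (of_real h * Complex 0 \<theta> powr of_real (p - 1))"
proof -
  define z where "z = (\<lambda>n. Complex (inverse (real (Suc n))) \<theta>)"
  let ?X = "\<lambda>\<omega>. L h \<omega> - L 0 \<omega>"
  have [measurable]: "L h \<in> borel_measurable M" "L 0 \<in> borel_measurable M" using h by (auto intro: rv)
  have zlim: "z \<longlonglongrightarrow> Complex 0 \<theta>"
    unfolding z_def Complex_eq by (intro tendsto_intros tendsto_of_real LIMSEQ_inverse_real_of_nat)
  have zl: "(\<integral>\<omega>. exp (- z n * of_real (?X \<omega>)) \<partial>M) = exp (of_real h * z n powr of_real (p - 1))" for n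
    using has_bochner_integral_integral_eq[OF lap_complex[of 0 h "z n"]] h by (simp add: z_def)
  have lim1: "(\<lambda>n. \<integral>\<omega>. exp (- z n * of_real (?X \<omega>)) \<partial>M) \<longlonglongrightarrow> (\<integral>\<omega>. exp (- Complex 0 \<theta> * of_real (?X \<omega>)) \<partial>M)"
  proof (rule integral_dominated_convergence[where w = "\<lambda>\<omega>. 1 + exp (- 1 * ?X \<omega>)"])
    show "integrable M (\<lambda>\<omega>. 1 + exp (- 1 * ?X \<omega>))"
      using lap[of 0 h 1] h by (intro Bochner_Integration.integrable_add) (auto simp: has_bochner_integral_iff)
    show "AE \<omega> in M. (\<lambda>n. exp (- z n * of_real (?X \<omega>))) \<longlonglongrightarrow> exp (- Complex 0 \<theta> * of_real (?X \<omega>))"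
      by (intro AE_I2 tendsto_intros zlim)
    show "AE \<omega> in M. norm (exp (- z n * of_real (?X \<omega>))) \<le> 1 + exp (- 1 * ?X \<omega>)" for n
    proof (rule AE_I2)
      fix \<omega>
      define r where "r = inverse (real (Suc n))"
      have r: "0 \<le> r" "r \<le> 1" by (auto simp: r_def inverse_eq_divide)
      have "norm (exp (- z n * of_real (?X \<omega>))) = exp (- r * ?X \<omega>)" by (simp add: z_def r_def)
      also have "\<dots> \<le> 1 + exp (- 1 * ?X \<omega>)"
      proof (cases "?X \<omega> \<ge> 0")
        case True
        then have "exp (- r * ?X \<omega>) \<le> exp 0" using r by (intro exp_mono) simp
        then show ?thesis by (simp add: add_increasing2)
      next
        case False
        then have "- r * ?X \<omega> \<le> - 1 * ?X \<omega>" using r by (intro mult_right_mono_neg) auto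
        then have "exp (- r * ?X \<omega>) \<le> exp (- 1 * ?X \<omega>)" by (intro exp_mono)
        then show ?thesis by (simp add: add_increasing)
      qed
      finally show "norm (exp (- z n * of_real (?X \<omega>))) \<le> 1 + exp (- 1 * ?X \<omega>)" .
    qed
  qed measurable
  have "continuous_on {w. 0 \<le> Re w} (\<lambda>w::complex. w powr of_real (p - 1))"
    using p2 by (intro continuous_on_powr_complex continuous_intros) auto
  then have c: "continuous (at (Complex 0 \<theta>) within {w. 0 \<le> Re w}) (\<lambda>w::complex. w powr of_real (p - 1))"
    by (simp add: continuous_on_eq_continuous_within)
  have "(\<lambda>n. z n powr of_real (p - 1)) \<longlonglongrightarrow> Complex 0 \<theta> powr of_real (p - 1)"
    by (rule continuous_within_tendsto_compose[OF c, rotated]) (use zlim in \<open>auto simp: z_def\<close>)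
  then have "(\<lambda>n. exp (of_real h * z n powr of_real (p - 1))) \<longlonglongrightarrow> exp (of_real h * Complex 0 \<theta> powr of_real (p - 1))"
    by (intro tendsto_exp tendsto_mult tendsto_const)
  then have e: "(\<integral>\<omega>. exp (- Complex 0 \<theta> * of_real (?X \<omega>)) \<partial>M) = exp (of_real h * Complex 0 \<theta> powr of_real (p - 1))"
    using lim1 unfolding zl by (rule LIMSEQ_unique[symmetric])
  have "(\<integral>\<omega>. exp (- of_real (L h \<omega>) * Complex 0 \<theta>) \<partial>M) = (\<integral>\<omega>. exp (- of_real x * Complex 0 \<theta>) * exp (- Complex 0 \<theta> * of_real (?X \<omega>)) \<partial>M)"
    by (intro Bochner_Integration.integral_cong refl) (simp add: start mult_exp_exp algebra_simps)
  also have "\<dots> = exp (- of_real x * Complex 0 \<theta>) * (\<integral>\<omega>. exp (- Complex 0 \<theta> * of_real (?X \<omega>)) \<partial>M)"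
    by (rule Bochner_Integration.integral_mult_right_zero)
  finally show ?thesis unfolding e .
qed

text \<open>The real part of the exponent at frequency \<open>\<theta>\<close> is a positive
  multiple of \<open>cos ((p - 1) * pi / 2)\<close>, negative since \<open>p - 1\<close> lies
  between 1 and 2. The modulus of the characteristic function thus decays geometrically in
  time.\<close>

lemma fourier_transform_tendsto_0:
  fixes \<theta> :: real
  assumes "\<theta> \<noteq> 0"
  shows "(\<lambda>N. \<integral>\<omega>. exp (- of_real (L (real (Suc N)) \<omega>) * Complex 0 \<theta>) \<partial>M) \<longlonglongrightarrow> 0"
proof -
  define r where "r = - (\<bar>\<theta>\<bar> powr (p - 1) * cos ((p - 1) * (pi / 2)))"
  have "pi / 2 < (p - 1) * (pi / 2)" "(p - 1) * (pi / 2) < pi" using p2 p3 pi_gt_zero by auto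
  then have "cos ((p - 1) * (pi / 2)) < 0" using pi_gt_zero by (intro cos_lt_zero_pi) linarith+
  then have r: "r > 0" using assms by (simp add: r_def mult_pos_neg)
  have "norm (\<integral>\<omega>. exp (- of_real (L (real (Suc N)) \<omega>) * Complex 0 \<theta>) \<partial>M) = exp (- r) ^ Suc N" for N
    unfolding fourier_transform[OF of_nat_0_less_iff[THEN iffD2, OF zero_less_Suc]]
    using Re_powr_imag[OF assms, of "p - 1"] by (simp add: norm_mult r_def exp_of_nat_mult[symmetric] del: of_nat_Suc power_Suc)
  moreover have "(\<lambda>N. exp (- r) ^ Suc N) \<longlonglongrightarrow> 0"
    using r by (intro LIMSEQ_Suc LIMSEQ_power_zero) simp
  ultimately show ?thesis by (subst tendsto_norm_zero_iff[symmetric]) simp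
qed

text \<open>The second moment is a superposition of values of the characteristic function of \<open>L t\<close>, which tends to
  zero at every nonzero frequency.\<close>

lemma airy_scaled_decay:
  assumes q: "q > 0"
  shows "(\<lambda>N. \<integral>\<omega>. (norm (airy_scaled q (L (real (Suc N)) \<omega>)))\<^sup>2 \<partial>M) \<longlonglongrightarrow> 0"
proof -
  note of_nat_Suc [simp del]
  have [measurable]: "cnj \<in> borel_measurable borel"
    by (intro borel_measurable_continuous_onI continuous_intros)
  define \<psi> where "\<psi> = (\<lambda>\<eta>. kern (1 / (q * p)) (Complex 0 \<eta>))"
  have \<psi>: "integrable lborel \<psi>" unfolding \<psi>_def by (rule kern_integrable[OF q])
  then have [measurable]: "\<psi> \<in> borel_measurable borel" by auto
  have Um[measurable]: "airy_scaled q \<in> borel_measurable borel" by (rule airy_scaled_measurable[OF q])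
  have Lm[measurable]: "L (real (Suc N)) \<in> borel_measurable M" for N by (rule rv) simp
  define G where "G = (\<lambda>N \<eta>. \<integral>\<omega>. cnj (airy_scaled q (L (real (Suc N)) \<omega>)) * exp (- of_real (L (real (Suc N)) \<omega>) * Complex 0 \<eta>) \<partial>M)"
  define \<phi> where "\<phi> = (\<lambda>N \<theta>. \<integral>\<omega>. exp (- of_real (L (real (Suc N)) \<omega>) * Complex 0 \<theta>) \<partial>M)"
  have \<phi>1: "norm (\<phi> N \<theta>) \<le> 1" for N \<theta>
  proof -
    have "norm (\<phi> N \<theta>) \<le> (\<integral>\<omega>. norm (exp (- complex_of_real (L (real (Suc N)) \<omega>) * Complex 0 \<theta>)) \<partial>M)"
      unfolding \<phi>_def by (rule integral_norm_bound)
    then show ?thesis by (simp add: prob_space del: of_nat_Suc)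
  qed
  have ib: "integrable M f" if "f \<in> borel_measurable M" "\<And>\<omega>. norm (f \<omega>) \<le> B" for f :: "'a \<Rightarrow> complex" and B
    by (rule integrable_const_bound[OF AE_I2[OF that(2)] that(1)])
  define CU where "CU = (\<integral>\<eta>. norm (\<psi> \<eta>) \<partial>lborel)"
  have U1: "norm (airy_scaled q y) \<le> CU" for y unfolding CU_def \<psi>_def by (rule airy_scaled_bounded[OF q])
  have step1: "complex_of_real (\<integral>\<omega>. (norm (airy_scaled q (L (real (Suc N)) \<omega>)))\<^sup>2 \<partial>M) = (\<integral>\<eta>. \<psi> \<eta> * G N \<eta> \<partial>lborel)" for N
  proof -
    have i: "integrable M (\<lambda>\<omega>. cnj (airy_scaled q (L (real (Suc N)) \<omega>)))"
    proof (rule ib)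
      show "(\<lambda>\<omega>. cnj (airy_scaled q (L (real (Suc N)) \<omega>))) \<in> borel_measurable M" by measurable
      show "norm (cnj (airy_scaled q (L (real (Suc N)) \<omega>))) \<le> CU" for \<omega> unfolding complex_mod_cnj by (rule U1)
    qed
    have i2: "integrable M (\<lambda>\<omega>. (norm (airy_scaled q (L (real (Suc N)) \<omega>)))\<^sup>2)"
    proof (rule integrable_const_bound[of _ "CU\<^sup>2"])
      show "AE \<omega> in M. norm ((norm (airy_scaled q (L (real (Suc N)) \<omega>)))\<^sup>2) \<le> CU\<^sup>2"
        by (intro AE_I2) (simp add: power_mono[OF U1])
    qed measurable
    have "complex_of_real (\<integral>\<omega>. (norm (airy_scaled q (L (real (Suc N)) \<omega>)))\<^sup>2 \<partial>M) = (\<integral>\<omega>. of_real ((norm (airy_scaled q (L (real (Suc N)) \<omega>)))\<^sup>2) \<partial>M)"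
      by (rule integral_of_real[symmetric, OF i2])
    also have "\<dots> = (\<integral>\<omega>. cnj (airy_scaled q (L (real (Suc N)) \<omega>)) * airy_scaled q (L (real (Suc N)) \<omega>) \<partial>M)"
      by (intro Bochner_Integration.integral_cong refl) (simp only: complex_norm_square mult.commute)
    also have "\<dots> = (\<integral>\<eta>. \<psi> \<eta> * G N \<eta> \<partial>lborel)"
      using fourier_swap(2)[OF i \<psi> Lm[of N]] unfolding G_def \<psi>_def airy_scaled_def[symmetric] .
    finally show ?thesis .
  qed
  \<comment> \<open>The conjugate turns the oscillating factor round, so that a second exchange of
    integrals leaves the characteristic function at \<open>\<zeta> - \<eta>\<close>. It tends to 0
    except at \<open>\<zeta> = \<eta>\<close>, a null set.\<close>
  have G_eq: "cnj (G N \<eta>) = (\<integral>\<zeta>. \<psi> \<zeta> * \<phi> N (\<zeta> - \<eta>) \<partial>lborel)" for N \<eta>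
  proof -
    let ?l = "L (real (Suc N))"
    have i: "integrable M (\<lambda>\<omega>. exp (of_real (?l \<omega>) * Complex 0 \<eta>))"
    proof (rule ib)
      show "(\<lambda>\<omega>. exp (of_real (?l \<omega>) * Complex 0 \<eta>)) \<in> borel_measurable M" by measurable
      show "norm (exp (of_real (?l \<omega>) * Complex 0 \<eta>)) \<le> 1" for \<omega> by simp
    qed
    have "cnj (G N \<eta>) = (\<integral>\<omega>. cnj (cnj (airy_scaled q (?l \<omega>)) * exp (- of_real (?l \<omega>) * Complex 0 \<eta>)) \<partial>M)"
      unfolding G_def by (rule Bochner_Integration.integral_cnj[symmetric])
    also have "\<dots> = (\<integral>\<omega>. exp (of_real (?l \<omega>) * Complex 0 \<eta>) * airy_scaled q (?l \<omega>) \<partial>M)"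
    proof (intro Bochner_Integration.integral_cong refl)
      fix \<omega>
      have "cnj (Complex 0 \<eta>) = - Complex 0 \<eta>" by (simp add: complex_eq_iff)
      then have "cnj (exp (- of_real (?l \<omega>) * Complex 0 \<eta>)) = exp (of_real (?l \<omega>) * Complex 0 \<eta>)"
        by (simp only: exp_cnj complex_cnj_mult complex_cnj_minus complex_cnj_complex_of_real) simp
      then show "cnj (cnj (airy_scaled q (?l \<omega>)) * exp (- of_real (?l \<omega>) * Complex 0 \<eta>)) = exp (of_real (?l \<omega>) * Complex 0 \<eta>) * airy_scaled q (?l \<omega>)"
        by (simp only: complex_cnj_mult complex_cnj_cnj mult.commute)
    qed
    also have "\<dots> = (\<integral>\<zeta>. \<psi> \<zeta> * (\<integral>\<omega>. exp (of_real (?l \<omega>) * Complex 0 \<eta>) * exp (- of_real (?l \<omega>) * Complex 0 \<zeta>) \<partial>M) \<partial>lborel)"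
      using fourier_swap(2)[OF i \<psi> Lm[of N]] unfolding \<psi>_def airy_scaled_def[symmetric] .
    also have "(\<lambda>\<zeta>. \<integral>\<omega>. exp (of_real (?l \<omega>) * Complex 0 \<eta>) * exp (- of_real (?l \<omega>) * Complex 0 \<zeta>) \<partial>M) = (\<lambda>\<zeta>. \<phi> N (\<zeta> - \<eta>))"
    proof
      fix \<zeta>
      have "of_real y * Complex 0 \<eta> + - of_real y * Complex 0 \<zeta> = - of_real y * Complex 0 (\<zeta> - \<eta>)" for y
        by (simp add: complex_eq_iff algebra_simps)
      then show "(\<integral>\<omega>. exp (of_real (?l \<omega>) * Complex 0 \<eta>) * exp (- of_real (?l \<omega>) * Complex 0 \<zeta>) \<partial>M) = \<phi> N (\<zeta> - \<eta>)"
        unfolding \<phi>_def mult_exp_exp by (simp only:)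
    qed
    finally show ?thesis .
  qed
  have \<phi>m[measurable]: "\<phi> N \<in> borel_measurable borel" for N
    unfolding \<phi>_def fourier_transform[OF of_nat_0_less_iff[THEN iffD2, OF zero_less_Suc]] by measurable
  have \<phi>0: "(\<lambda>N. \<phi> N \<theta>) \<longlonglongrightarrow> 0" if "\<theta> \<noteq> 0" for \<theta>
    unfolding \<phi>_def by (rule fourier_transform_tendsto_0[OF that])
  have cG: "(\<lambda>N. cnj (G N \<eta>)) \<longlonglongrightarrow> integral\<^sup>L lborel (\<lambda>\<zeta>::real. 0)" for \<eta>
    unfolding G_eq
  proof (rule integral_dominated_convergence[where w = "\<lambda>\<zeta>. norm (\<psi> \<zeta>)"])
    show "AE \<zeta> in lborel. (\<lambda>N. \<psi> \<zeta> * \<phi> N (\<zeta> - \<eta>)) \<longlonglongrightarrow> 0"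
      using AE_lborel_singleton[of \<eta>] by eventually_elim (auto intro!: tendsto_mult_right_zero \<phi>0)
    show "AE \<zeta> in lborel. norm (\<psi> \<zeta> * \<phi> N (\<zeta> - \<eta>)) \<le> norm (\<psi> \<zeta>)" for N
      unfolding norm_mult using \<phi>1 by (intro AE_I2 mult_left_le) auto
    show "integrable lborel (\<lambda>\<zeta>. norm (\<psi> \<zeta>))" by (rule integrable_norm[OF \<psi>])
  qed measurable
  have G0: "(\<lambda>N. G N \<eta>) \<longlonglongrightarrow> 0" for \<eta>
    using tendsto_cnj[OF cG[of \<eta>]] by simp
  have Gb: "norm (G N \<eta>) \<le> CU" for N \<eta>
  proof -
    have "norm (G N \<eta>) \<le> (\<integral>\<omega>. CU \<partial>M)"
      unfolding G_def by (rule integral_norm_bound[THEN order_trans], rule integral_mono[OF integrable_norm]) (use U1 in \<open>auto intro!: ib[of _ CU] simp: norm_mult\<close>)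
    then show ?thesis by (simp add: prob_space)
  qed
  have Gm: "G N \<in> borel_measurable borel" for N
  proof -
    have "(\<lambda>\<eta>. \<integral>\<omega>. cnj (airy_scaled q (L (real (Suc N)) \<omega>)) * exp (- of_real (L (real (Suc N)) \<omega>) * Complex 0 \<eta>) \<partial>M) \<in> borel_measurable lborel"
      by (rule borel_measurable_lebesgue_integral) measurable
    then show ?thesis by (simp add: G_def)
  qed
  have "(\<lambda>N. \<integral>\<eta>. \<psi> \<eta> * G N \<eta> \<partial>lborel) \<longlonglongrightarrow> integral\<^sup>L lborel (\<lambda>\<eta>::real. 0)"
  proof (rule integral_dominated_convergence[where w = "\<lambda>\<eta>. norm (\<psi> \<eta>) * CU"])
    show "AE \<eta> in lborel. (\<lambda>N. \<psi> \<eta> * G N \<eta>) \<longlonglongrightarrow> 0" by (intro AE_I2 tendsto_mult_right_zero G0)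
    show "AE \<eta> in lborel. norm (\<psi> \<eta> * G N \<eta>) \<le> norm (\<psi> \<eta>) * CU" for N
      unfolding norm_mult using Gb by (intro AE_I2 mult_left_mono) auto
    show "integrable lborel (\<lambda>\<eta>. norm (\<psi> \<eta>) * CU)" by (intro integrable_mult_left integrable_norm \<psi>)
  qed (use Gm in measurable)
  then have "(\<lambda>N. complex_of_real (\<integral>\<omega>. (norm (airy_scaled q (L (real (Suc N)) \<omega>)))\<^sup>2 \<partial>M)) \<longlonglongrightarrow> 0"
    unfolding step1 by simp
  then show ?thesis using tendsto_of_real_iff[of _ 0, where 'a = complex] by (metis of_real_0)
qed

text \<open>By right-continuity a negative value persists for a short time, and every interval
  contains dyadic times, so there are dyadic hits arbitrarily close after \<open>t\<close>.\<close>

lemma L_neg_imp_hit: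
  assumes \<omega>: "\<omega> \<in> space M" and t: "t \<ge> 0" "L t \<omega> < 0"
  shows "hit \<omega>" "hit_time \<omega> \<le> t"
proof -
  have ex: "\<exists>d\<in>dyadic_hits \<omega>. d < t + e" if e: "e > 0" for e
  proof -
    have "continuous (at_right t) (\<lambda>t. L t \<omega>)" using cad[OF \<omega>] t by (simp add: cadlag_def)
    then have "((\<lambda>s. L s \<omega>) \<longlongrightarrow> L t \<omega>) (at_right t)" by (simp add: continuous_within)
    then have "\<forall>\<^sub>F s in at_right t. L s \<omega> < 0" using t(2) by (rule order_tendstoD)
    then obtain b where b: "b > t" "\<And>s. t < s \<Longrightarrow> s < b \<Longrightarrow> L s \<omega> < 0"
      unfolding eventually_at_right_field by blast
    obtain j n :: nat where jn: "t < real j / 2 ^ n" "real j / 2 ^ n < min b (t + e)"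
      using dyadic_between[of t "min b (t + e)"] t b(1) e by auto
    then have "L (real j / 2 ^ n) \<omega> < 0" using b by simp
    then have "real j / 2 ^ n \<in> dyadic_hits \<omega>" by (auto simp: dyadic_hits_def)
    then show ?thesis using jn by auto
  qed
  from ex[of 1] show "hit \<omega>" by (auto simp: hit_def)
  show "hit_time \<omega> \<le> t"
  proof (rule field_le_epsilon)
    fix e :: real assume "e > 0"
    then obtain d where "d \<in> dyadic_hits \<omega>" "d < t + e" using ex by blast
    then show "hit_time \<omega> \<le> t + e" using hit_time_le[of d \<omega>] by simp
  qed
qed

lemma L_nonneg_before: "\<omega> \<in> space M \<Longrightarrow> t \<ge> 0 \<Longrightarrow> (hit \<omega> \<Longrightarrow> t < hit_time \<omega>) \<Longrightarrow> L t \<omega> \<ge> 0"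
  using L_neg_imp_hit[of \<omega> t] by force

text \<open>A positive value would persist to the right and keep all dyadic hits away from their
  infimum.\<close>

lemma L_hit_time_le_0:
  assumes \<omega>: "\<omega> \<in> space M" and h: "hit \<omega>" shows "L (hit_time \<omega>) \<omega> \<le> 0"
proof (rule ccontr)
  assume "\<not> L (hit_time \<omega>) \<omega> \<le> 0"
  then have pos: "0 < L (hit_time \<omega>) \<omega>" by simp
  have "continuous (at_right (hit_time \<omega>)) (\<lambda>t. L t \<omega>)" using cad[OF \<omega>] hit_time_nonneg[OF h] by (simp add: cadlag_def)
  then have "((\<lambda>s. L s \<omega>) \<longlongrightarrow> L (hit_time \<omega>) \<omega>) (at_right (hit_time \<omega>))" by (simp add: continuous_within)
  then have "\<forall>\<^sub>F s in at_right (hit_time \<omega>). 0 < L s \<omega>" using pos by (rule order_tendstoD)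
  then obtain b where b: "b > hit_time \<omega>" "\<And>s. hit_time \<omega> < s \<Longrightarrow> s < b \<Longrightarrow> 0 < L s \<omega>"
    unfolding eventually_at_right_field by blast
  have "\<exists>t\<in>dyadic_hits \<omega>. t < b" using b(1) h unfolding hit_time_def hit_def by (intro cInf_lessD)
  then obtain t where t: "t \<in> dyadic_hits \<omega>" "t < b" by blast
  then have "hit_time \<omega> \<le> t" "L t \<omega> \<le> 0" using hit_time_le by (auto simp: dyadic_hits_def)
  then show False using b(2)[of t] t pos by (cases "t = hit_time \<omega>") auto
qed

lemma hit_time_pos: "x > 0 \<Longrightarrow> \<omega> \<in> space M \<Longrightarrow> hit \<omega> \<Longrightarrow> hit_time \<omega> > 0"
  using L_hit_time_le_0[of \<omega>] hit_time_nonneg[of \<omega>] start[of \<omega>] by (cases "hit_time \<omega> = 0") auto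

text \<open>Before the passage the path is nonnegative, hence so is its left limit, and without
  negative jumps the path cannot fall below that limit.\<close>

lemma L_hit_time_eq_0:
  assumes x: "x > 0" and \<omega>: "\<omega> \<in> space M" and h: "hit \<omega>" shows "L (hit_time \<omega>) \<omega> = 0"
proof -
  have S: "hit_time \<omega> > 0" by (rule hit_time_pos[OF x \<omega> h])
  then obtain l where l: "((\<lambda>t. L t \<omega>) \<longlongrightarrow> l) (at_left (hit_time \<omega>))" using cad[OF \<omega>] by (auto simp: cadlag_def)
  have "\<forall>\<^sub>F t in at_left (hit_time \<omega>). 0 \<le> L t \<omega>"
    unfolding eventually_at_left_field
    by (intro exI[of _ 0] conjI S allI impI L_nonneg_before[OF \<omega>]) auto
  then have "0 \<le> l" by (rule tendsto_lowerbound[OF l]) (simp add: trivial_limit_at_left_real)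
  also have "l \<le> L (hit_time \<omega>) \<omega>" using nnj[OF \<omega>] S l by (simp add: no_negative_jumps_def)
  finally show ?thesis using L_hit_time_le_0[OF \<omega> h] by simp
qed

lemma L_nonneg_upto_hit_time_min:
  assumes x: "x > 0" and \<omega>: "\<omega> \<in> space M" and t: "0 \<le> t" "t \<le> hit_time_min N \<omega>" shows "L t \<omega> \<ge> 0"
proof (cases "hit \<omega> \<and> t = hit_time \<omega>")
  case True then show ?thesis using L_hit_time_eq_0[OF x \<omega>] by simp
next
  case False
  then show ?thesis using t by (intro L_nonneg_before[OF \<omega>]) (auto simp: hit_time_min_def split: if_splits)
qed

lemma area_nonneg: "(\<And>s. 0 < s \<Longrightarrow> s \<le> t \<Longrightarrow> L s \<omega> \<ge> 0) \<Longrightarrow> area t \<omega> \<ge> 0"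
  unfolding area_def by (intro Bochner_Integration.integral_nonneg) (auto simp: indicator_def)

text \<open>The value 0 off \<open>hit\<close> is a placeholder on an event that
  \<open>AE_hit\<close> shows to be null.\<close>

definition hit_area :: "'a \<Rightarrow> real" where "hit_area \<omega> = (if hit \<omega> then area (hit_time \<omega>) \<omega> else 0)"

text \<open>The strict inequality means that some dyadic time before \<open>u\<close> is a hit, a
  countable union of events. The nonstrict one is recovered later as a countable
  intersection.\<close>

lemma measurable_hit_less: "{\<omega> \<in> space M. hit \<omega> \<and> hit_time \<omega> < u} \<in> sets M"
proof -
  have eq: "{\<omega> \<in> space M. hit \<omega> \<and> hit_time \<omega> < u} = {\<omega> \<in> space M. \<exists>j n. real j / 2 ^ n < u \<and> L (real j / 2 ^ n) \<omega> \<le> 0}"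
  proof safe
    fix \<omega> assume "hit \<omega>" "hit_time \<omega> < u"
    then have "\<exists>t\<in>dyadic_hits \<omega>. t < u" unfolding hit_time_def hit_def by (intro cInf_lessD)
    then show "\<exists>j n. real j / 2 ^ n < u \<and> L (real j / 2 ^ n) \<omega> \<le> 0" by (auto simp: dyadic_hits_def)
  next
    fix \<omega> j n assume a: "real j / 2 ^ n < u" "L (real j / 2 ^ n) \<omega> \<le> 0"
    then have "real j / 2 ^ n \<in> dyadic_hits \<omega>" by (auto simp: dyadic_hits_def)
    then show "hit \<omega>" "hit_time \<omega> < u" using hit_time_le a by (auto simp: hit_def intro: le_less_trans)
  qed
  have [measurable]: "L (real j / 2 ^ n) \<in> borel_measurable M" for j n :: nat by (rule rv) simp
  show ?thesis unfolding eq by measurable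
qed

lemma measurable_hit: "{\<omega> \<in> space M. hit \<omega>} \<in> sets M"
proof -
  have "{\<omega> \<in> space M. hit \<omega>} = (\<Union>n::nat. {\<omega> \<in> space M. hit \<omega> \<and> hit_time \<omega> < real n})"
    using reals_Archimedean2 by auto
  also have "\<dots> \<in> sets M" by (intro sets.countable_UN) (use measurable_hit_less in auto)
  finally show ?thesis .
qed

lemma measurable_hit_le: "{\<omega> \<in> space M. hit \<omega> \<and> hit_time \<omega> \<le> u} \<in> sets M"
proof -
  have "{\<omega> \<in> space M. hit \<omega> \<and> hit_time \<omega> \<le> u} = (\<Inter>n::nat. {\<omega> \<in> space M. hit \<omega> \<and> hit_time \<omega> < u + inverse (real (Suc n))})"
  proof (intro equalityI subsetI INT_I CollectI conjI)
    fix \<omega> assume *: "\<omega> \<in> (\<Inter>n::nat. {\<omega> \<in> space M. hit \<omega> \<and> hit_time \<omega> < u + inverse (real (Suc n))})"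
    then show "\<omega> \<in> space M" "hit \<omega>" by auto
    show "hit_time \<omega> \<le> u"
    proof (rule field_le_epsilon)
      fix e :: real assume "e > 0"
      then obtain n where "inverse (real (Suc n)) < e" using reals_Archimedean by blast
      moreover have "hit_time \<omega> < u + inverse (real (Suc n))" using * by blast
      ultimately show "hit_time \<omega> \<le> u + e" by linarith
    qed
  qed (auto intro: le_less_trans simp: add_strict_increasing2)
  also have "\<dots> \<in> sets M" by (intro sets.countable_INT) (use measurable_hit_less in auto)
  finally show ?thesis .
qed

lemma hit_time_min_eventually: "hit \<omega> \<Longrightarrow> \<forall>\<^sub>F N in sequentially. hit_time_min N \<omega> = hit_time \<omega> \<and> hit_time \<omega> \<le> real N"
proof -
  assume h: "hit \<omega>"
  obtain n0 where n0: "hit_time \<omega> \<le> real n0" using real_arch_simple by blast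
  show ?thesis
    by (rule eventually_sequentiallyI[of n0]) (use h n0 in \<open>auto simp: hit_time_min_def\<close>)
qed

text \<open>The approximating grid times take finitely many values, so the area up to them is a
  finite sum of measurable terms.\<close>

lemma area_hit_time_min_measurable: "(\<lambda>\<omega>. area (hit_time_min N \<omega>) \<omega>) \<in> borel_measurable M"
proof (rule borel_measurable_LIMSEQ_metric)
  show "(\<lambda>n. area (sig_approx N n \<omega>) \<omega>) \<longlonglongrightarrow> area (hit_time_min N \<omega>) \<omega>" if "\<omega> \<in> space M" for \<omega>
    by (rule area_tendsto[OF that _ hit_time_min_approx_tendsto]) (simp add: sig_approx_def)
  show "(\<lambda>\<omega>. area (sig_approx N n \<omega>) \<omega>) \<in> borel_measurable M" for n
  proof -
    let ?h = "1 / 2 ^ n :: real"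
    have "area (sig_approx N n \<omega>) \<omega> = (\<Sum>j\<le>N * 2 ^ n. at_tau ?h (N * 2 ^ n) j \<omega> * area (real j * ?h) \<omega>)" for \<omega>
      using sum_at_tau[of ?h "N * 2 ^ n" \<omega> "\<lambda>j. area (real j * ?h) \<omega>"] by (simp add: sig_approx_def)
    moreover have "(\<lambda>\<omega>. \<Sum>j\<le>N * 2 ^ n. at_tau ?h (N * 2 ^ n) j \<omega> * area (real j * ?h) \<omega>) \<in> borel_measurable M"
      by (intro borel_measurable_sum borel_measurable_times at_tau_measurable area_measurable) auto
    ultimately show ?thesis by simp
  qed
qed

lemma hit_area_measurable: "hit_area \<in> borel_measurable M"
proof (rule borel_measurable_LIMSEQ_metric)
  show "(\<lambda>N. indicator {\<omega> \<in> space M. hit \<omega>} \<omega> * area (hit_time_min N \<omega>) \<omega>) \<longlonglongrightarrow> hit_area \<omega>" if "\<omega> \<in> space M" for \<omega>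
  proof (cases "hit \<omega>")
    case True
    have "\<forall>\<^sub>F N in sequentially. indicator {\<omega> \<in> space M. hit \<omega>} \<omega> * area (hit_time_min N \<omega>) \<omega> = hit_area \<omega>"
      using hit_time_min_eventually[OF True] by eventually_elim (use True that in \<open>simp add: hit_area_def\<close>)
    then show ?thesis by (rule tendsto_eventually)
  qed (simp add: hit_area_def)
  show "(\<lambda>\<omega>. indicator {\<omega> \<in> space M. hit \<omega>} \<omega> * area (hit_time_min N \<omega>) \<omega>) \<in> borel_measurable M" for N
    using measurable_hit area_hit_time_min_measurable by (intro borel_measurable_times borel_measurable_indicator)
qed

lemma hit_area_nonneg: "x > 0 \<Longrightarrow> \<omega> \<in> space M \<Longrightarrow> hit_area \<omega> \<ge> 0"
proof -
  assume x: "x > 0" and \<omega>: "\<omega> \<in> space M"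
  have "area (hit_time \<omega>) \<omega> \<ge> 0" if h: "hit \<omega>"
  proof (rule area_nonneg)
    fix s assume "0 < s" "s \<le> hit_time \<omega>"
    then show "L s \<omega> \<ge> 0" using L_hit_time_eq_0[OF x \<omega> h] L_nonneg_before[OF \<omega>, of s] by (cases "s = hit_time \<omega>") auto
  qed
  then show ?thesis by (simp add: hit_area_def)
qed

text \<open>Compare the martingale stopped at time \<open>N\<close> or at the passage with its value
  \<open>Z\<close> at the passage, where \<open>L = 0\<close>. They differ only if the passage has
  not occurred by \<open>N\<close>: either it comes later, an event whose probability vanishes, or
  the term with \<open>L\<close> at time \<open>N\<close> enters, which tends to 0 by
  \<open>airy_scaled_decay\<close>. Before the passage the area is nonnegative, so the exponential
  factor is at most 1.\<close>

lemma laplace_hit_area_hit: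
  assumes x: "x > 0" and q: "q > 0"
  shows "(\<integral>\<omega>. indicator {\<omega> \<in> space M. hit \<omega>} \<omega> * exp (- q * hit_area \<omega>) \<partial>M) = Re (airy (of_real (x * (p * q) powr (1 / p))) / airy 0)"
proof -
  note of_nat_Suc [simp del]
  define C where "C = (\<integral>\<eta>. norm (kern (1 / (q * p)) (Complex 0 \<eta>)) \<partial>lborel)"
  have UC: "norm (airy_scaled q y) \<le> C" for y unfolding C_def by (rule airy_scaled_bounded[OF q])
  have C0: "C \<ge> 0" using UC norm_ge_zero order_trans by blast
  have [measurable]: "airy_scaled q \<in> borel_measurable borel" by (rule airy_scaled_measurable[OF q])
  have [measurable]: "hit_area \<in> borel_measurable M" by (rule hit_area_measurable)
  have [measurable]: "L (real (Suc N)) \<in> borel_measurable M" for N by (rule rv) simp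
  let ?H = "{\<omega> \<in> space M. hit \<omega>}"
  let ?H' = "\<lambda>N. {\<omega> \<in> space M. hit \<omega> \<and> hit_time \<omega> \<le> real N}"
  have [measurable]: "?H \<in> sets M" "?H' N \<in> sets M" for N by (rule measurable_hit measurable_hit_le)+
  define Z where "Z = (\<lambda>\<omega>. of_real (indicator ?H \<omega> * exp (- q * hit_area \<omega>)) * airy_scaled q 0)"
  have Zm[measurable]: "Z \<in> borel_measurable M" unfolding Z_def by measurable
  have e1: "\<bar>indicator ?H \<omega> * exp (- q * hit_area \<omega>)\<bar> \<le> 1" if "\<omega> \<in> space M" for \<omega>
    using hit_area_nonneg[OF x that] q by (auto simp: indicator_def)
  have iZ: "integrable M Z"
  proof (rule integrable_const_bound[of _ C])
    show "AE \<omega> in M. norm (Z \<omega>) \<le> C"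
    proof (rule AE_I2)
      fix \<omega> assume "\<omega> \<in> space M"
      then show "norm (Z \<omega>) \<le> C" using mult_mono[OF e1 UC[of 0]] by (simp add: Z_def norm_mult abs_mult)
    qed
  qed measurable
  let ?e = "\<lambda>N \<omega>. C * indicator (?H - ?H' N) \<omega> + norm (airy_scaled q (L (real N) \<omega>))"
  have bound: "norm (airy_mart q (hit_time_min N \<omega>) \<omega> - Z \<omega>) \<le> ?e N \<omega>" if \<omega>: "\<omega> \<in> space M" for N \<omega>
  proof (cases "hit \<omega> \<and> hit_time \<omega> \<le> real N")
    case True
    then have "airy_mart q (hit_time_min N \<omega>) \<omega> = Z \<omega>"
      using L_hit_time_eq_0[OF x \<omega>] \<omega> by (simp add: airy_mart_def Z_def hit_time_min_def hit_area_def exp_of_real[symmetric])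
    then show ?thesis using C0 by (auto simp: indicator_def)
  next
    case False
    then have sN: "hit_time_min N \<omega> = real N" by (auto simp: hit_time_min_def)
    have "area (real N) \<omega> \<ge> 0" by (rule area_nonneg) (use L_nonneg_upto_hit_time_min[OF x \<omega>, of _ N] sN in auto)
    then have "norm (airy_mart q (real N) \<omega>) \<le> norm (airy_scaled q (L (real N) \<omega>))"
      using q by (simp add: airy_mart_def norm_mult mult_left_le_one_le)
    moreover have "norm (Z \<omega>) \<le> C * indicator (?H - ?H' N) \<omega>"
      using False \<omega> mult_mono[OF e1[OF \<omega>] UC[of 0]] by (auto simp: Z_def indicator_def norm_mult)
    ultimately show ?thesis unfolding sN using norm_triangle_ineq4[of "airy_mart q (real N) \<omega>" "Z \<omega>"] by linarith
  qed
  have iU: "integrable M (\<lambda>\<omega>. norm (airy_scaled q (L (real (Suc N)) \<omega>)))" for N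
  proof (rule integrable_const_bound[of _ C])
    show "AE \<omega> in M. norm (norm (airy_scaled q (L (real (Suc N)) \<omega>))) \<le> C" unfolding real_norm_def abs_norm_cancel by (intro AE_I2 UC)
  qed measurable
  have iU2: "integrable M (\<lambda>\<omega>. (norm (airy_scaled q (L (real (Suc N)) \<omega>)))\<^sup>2)" for N
  proof (rule integrable_const_bound[of _ "C\<^sup>2"])
    show "AE \<omega> in M. norm ((norm (airy_scaled q (L (real (Suc N)) \<omega>)))\<^sup>2) \<le> C\<^sup>2"
      by (intro AE_I2) (simp add: power_mono[OF UC])
  qed measurable
  have U0: "(\<lambda>N. \<integral>\<omega>. norm (airy_scaled q (L (real (Suc N)) \<omega>)) \<partial>M) \<longlonglongrightarrow> 0"
  proof (rule LIMSEQ_I)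
    fix r :: real assume r: "r > 0"
    have "\<exists>no. \<forall>n\<ge>no. norm ((\<integral>\<omega>. (norm (airy_scaled q (L (real (Suc n)) \<omega>)))\<^sup>2 \<partial>M) - 0) < r\<^sup>2"
      using LIMSEQ_D[OF airy_scaled_decay[OF q], of "r\<^sup>2"] r by simp
    then obtain no where no: "\<forall>n\<ge>no. norm ((\<integral>\<omega>. (norm (airy_scaled q (L (real (Suc n)) \<omega>)))\<^sup>2 \<partial>M) - 0) < r\<^sup>2" by blast
    have "norm ((\<integral>\<omega>. norm (airy_scaled q (L (real (Suc n)) \<omega>)) \<partial>M) - 0) < r" if "n \<ge> no" for n
    proof -
      let ?f = "\<lambda>\<omega>. norm (airy_scaled q (L (real (Suc n)) \<omega>))"
      \<comment> \<open>Nonnegativity of the variance serves as the Cauchy-Schwarz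
        inequality.\<close>
      have "(\<integral>\<omega>. ?f \<omega> \<partial>M)\<^sup>2 \<le> (\<integral>\<omega>. (?f \<omega>)\<^sup>2 \<partial>M)"
        using variance_positive[of ?f] variance_eq[OF iU iU2, of n] by simp
      also have "\<dots> < r\<^sup>2" using no[rule_format, OF that] by simp
      finally have "(\<integral>\<omega>. ?f \<omega> \<partial>M) < r" using power_less_imp_less_base[OF _ less_imp_le[OF r]] by blast
      moreover have "(\<integral>\<omega>. ?f \<omega> \<partial>M) \<ge> 0" by (rule Bochner_Integration.integral_nonneg) simp
      ultimately show ?thesis by simp
    qed
    then show "\<exists>no. \<forall>n\<ge>no. norm ((\<integral>\<omega>. norm (airy_scaled q (L (real (Suc n)) \<omega>)) \<partial>M) - 0) < r" by blast
  qed
  have ind0: "(\<lambda>N. \<integral>\<omega>. C * indicator (?H - ?H' (Suc N)) \<omega> \<partial>M) \<longlonglongrightarrow> integral\<^sup>L M (\<lambda>\<omega>. 0)"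
  proof (rule integral_dominated_convergence[where w = "\<lambda>_. C"])
    show "AE \<omega> in M. (\<lambda>N. C * indicator (?H - ?H' (Suc N)) \<omega>) \<longlonglongrightarrow> 0"
    proof (rule AE_I2, cases)
      fix \<omega> assume \<omega>: "\<omega> \<in> space M" and h: "hit \<omega>"
      have "\<forall>\<^sub>F N in sequentially. C * indicator (?H - ?H' (Suc N)) \<omega> = 0"
        using hit_time_min_eventually[OF h] by eventually_elim (use h \<omega> in \<open>auto simp: indicator_def\<close>)
      then show "(\<lambda>N. C * indicator (?H - ?H' (Suc N)) \<omega>) \<longlonglongrightarrow> 0" by (rule tendsto_eventually)
    qed simp
    show "AE \<omega> in M. norm (C * indicator (?H - ?H' (Suc N)) \<omega>) \<le> C" for N using C0 by (intro AE_I2) (auto simp: indicator_def)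
    show "integrable M (\<lambda>_. C)" by simp
  qed measurable
  have "norm (airy_scaled q x - (\<integral>\<omega>. Z \<omega> \<partial>M)) \<le> (\<integral>\<omega>. C * indicator (?H - ?H' (Suc N)) \<omega> \<partial>M) + (\<integral>\<omega>. norm (airy_scaled q (L (real (Suc N)) \<omega>)) \<partial>M)" for N
  proof -
    have iI: "integrable M (\<lambda>\<omega>. C * indicator (?H - ?H' (Suc N)) \<omega>)"
    proof (rule integrable_const_bound[of _ C])
      show "AE \<omega> in M. norm (C * indicator (?H - ?H' (Suc N)) \<omega>) \<le> C" using C0 by (intro AE_I2) (auto simp: indicator_def)
    qed measurable
    have "airy_scaled q x - (\<integral>\<omega>. Z \<omega> \<partial>M) = (\<integral>\<omega>. airy_mart q (hit_time_min (Suc N) \<omega>) \<omega> - Z \<omega> \<partial>M)"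
      using airy_mart_hit_time_min[OF q, of "Suc N"] iZ by (simp add: Bochner_Integration.integral_diff)
    also have "norm \<dots> \<le> (\<integral>\<omega>. norm (airy_mart q (hit_time_min (Suc N) \<omega>) \<omega> - Z \<omega>) \<partial>M)" by (rule integral_norm_bound)
    also have "\<dots> \<le> (\<integral>\<omega>. ?e (Suc N) \<omega> \<partial>M)"
    proof (rule integral_mono)
      show "integrable M (\<lambda>\<omega>. norm (airy_mart q (hit_time_min (Suc N) \<omega>) \<omega> - Z \<omega>))"
        by (intro integrable_norm Bochner_Integration.integrable_diff airy_mart_hit_time_min(1)[OF q] iZ)
      show "integrable M (?e (Suc N))" by (rule Bochner_Integration.integrable_add[OF iI iU])
      show "norm (airy_mart q (hit_time_min (Suc N) \<omega>) \<omega> - Z \<omega>) \<le> ?e (Suc N) \<omega>" if "\<omega> \<in> space M" for \<omega>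
        by (rule bound[OF that])
    qed
    also have "\<dots> = (\<integral>\<omega>. C * indicator (?H - ?H' (Suc N)) \<omega> \<partial>M) + (\<integral>\<omega>. norm (airy_scaled q (L (real (Suc N)) \<omega>)) \<partial>M)"
      by (rule Bochner_Integration.integral_add[OF iI iU])
    finally show ?thesis .
  qed
  moreover have "(\<lambda>N. (\<integral>\<omega>. C * indicator (?H - ?H' (Suc N)) \<omega> \<partial>M) + (\<integral>\<omega>. norm (airy_scaled q (L (real (Suc N)) \<omega>)) \<partial>M)) \<longlonglongrightarrow> 0"
    using tendsto_add[OF ind0 U0] by simp
  ultimately have "norm (airy_scaled q x - (\<integral>\<omega>. Z \<omega> \<partial>M)) \<le> 0"
    by (intro LIMSEQ_le_const[of _ 0]) auto
  then have UZ: "airy_scaled q x = (\<integral>\<omega>. Z \<omega> \<partial>M)" by simp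
  have "integrable M (\<lambda>\<omega>. indicator ?H \<omega> * exp (- q * hit_area \<omega>))"
  proof (rule integrable_const_bound[of _ 1])
    show "AE \<omega> in M. norm (indicator ?H \<omega> * exp (- q * hit_area \<omega>)) \<le> 1" unfolding real_norm_def by (rule AE_I2, rule e1)
  qed measurable
  then have "(\<integral>\<omega>. Z \<omega> \<partial>M) = of_real (\<integral>\<omega>. indicator ?H \<omega> * exp (- q * hit_area \<omega>) \<partial>M) * airy_scaled q 0"
    unfolding Z_def by (subst Bochner_Integration.integral_mult_left_zero) (simp only: integral_of_real)
  then have "complex_of_real (\<integral>\<omega>. indicator ?H \<omega> * exp (- q * hit_area \<omega>) \<partial>M) * airy_scaled q 0 = airy_scaled q x" using UZ by simp
  moreover have "airy_scaled q 0 \<noteq> 0"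
    using airy_coeff_0(2) p2 q by (simp add: airy_scaled_airy airy_0_airy_coeff)
  ultimately have "complex_of_real (\<integral>\<omega>. indicator ?H \<omega> * exp (- q * hit_area \<omega>) \<partial>M) = airy_scaled q x / airy_scaled q 0" by (simp add: field_simps)
  also have "\<dots> = airy (of_real (x * (p * q) powr (1 / p))) / airy 0"
    using p2 q by (simp add: airy_scaled_airy)
  finally show ?thesis by (metis Re_complex_of_real)
qed

text \<open>As \<open>q\<close> tends to 0 the transform restricted to \<open>hit\<close> tends to
  the probability of \<open>hit\<close>, while the right-hand side tends to
  \<open>airy 0 / airy 0 = 1\<close>.\<close>

lemma AE_hit:
  assumes x: "x > 0" shows "AE \<omega> in M. hit \<omega>"
proof -
  let ?H = "{\<omega> \<in> space M. hit \<omega>}"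
  have [measurable]: "?H \<in> sets M" by (rule measurable_hit)
  have [measurable]: "hit_area \<in> borel_measurable M" by (rule hit_area_measurable)
  define q where "q = (\<lambda>n. inverse (real (Suc n)))"
  have q: "q n > 0" for n by (simp add: q_def)
  have q0: "q \<longlonglongrightarrow> 0" unfolding q_def by (rule LIMSEQ_inverse_real_of_nat)
  have "(\<lambda>n. \<integral>\<omega>. indicator ?H \<omega> * exp (- q n * hit_area \<omega>) \<partial>M) \<longlonglongrightarrow> (\<integral>\<omega>. indicator ?H \<omega> \<partial>M)"
  proof (rule integral_dominated_convergence[where w = "\<lambda>_. 1"])
    show "AE \<omega> in M. (\<lambda>n. indicator ?H \<omega> * exp (- q n * hit_area \<omega>)) \<longlonglongrightarrow> indicator ?H \<omega>"
    proof (rule AE_I2)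
      fix \<omega>
      have "(\<lambda>n. indicator ?H \<omega> * exp (- q n * hit_area \<omega>)) \<longlonglongrightarrow> indicator ?H \<omega> * exp (- 0 * hit_area \<omega>)"
        by (intro tendsto_intros q0)
      then show "(\<lambda>n. indicator ?H \<omega> * exp (- q n * hit_area \<omega>)) \<longlonglongrightarrow> indicator ?H \<omega>" by simp
    qed
    show "AE \<omega> in M. norm (indicator ?H \<omega> * exp (- q n * hit_area \<omega>)) \<le> 1" for n
      using hit_area_nonneg[OF x] less_imp_le[OF q[of n]] by (intro AE_I2) (auto simp: indicator_def)
    show "integrable M (\<lambda>_. 1 :: real)" by simp
  qed measurable
  moreover have "(\<lambda>n. Re (airy (of_real (x * (p * q n) powr (1 / p))) / airy 0)) \<longlonglongrightarrow> Re (airy (of_real (x * 0)) / airy 0)"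
  proof -
    have "(\<lambda>n. (p * q n) powr (1 / p)) \<longlonglongrightarrow> (p * 0) powr (1 / p)"
      using p2 less_imp_le[OF q] by (intro tendsto_powr' tendsto_mult tendsto_const q0) auto
    then have "(\<lambda>n. complex_of_real (x * (p * q n) powr (1 / p))) \<longlonglongrightarrow> of_real (x * 0)"
      using p2 by (intro tendsto_of_real tendsto_mult tendsto_const) simp
    moreover have "isCont airy (of_real (x * 0))" using airy_has_derivative DERIV_isCont by blast
    ultimately have "(\<lambda>n. airy (of_real (x * (p * q n) powr (1 / p)))) \<longlonglongrightarrow> airy (of_real (x * 0))"
      by (rule isCont_tendsto_compose[rotated])
    then show ?thesis using airy_coeff_0(2) by (intro tendsto_Re tendsto_divide tendsto_const) (auto simp: airy_0_airy_coeff)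
  qed
  ultimately have "(\<integral>\<omega>. indicator ?H \<omega> \<partial>M) = Re (airy (of_real (x * 0)) / airy 0)"
    unfolding laplace_hit_area_hit[OF x q] by (rule LIMSEQ_unique)
  then have "prob ?H = 1" using airy_coeff_0(2) by (simp add: airy_0_airy_coeff)
  then show ?thesis using prob_Collect_eq_1[of hit] measurable_hit by simp
qed

theorem laplace_hit_area:
  assumes x: "x > 0" and q: "q > 0"
  shows "(\<integral>\<omega>. exp (- q * hit_area \<omega>) \<partial>M) = Re (airy (of_real (x * (p * q) powr (1 / p))) / airy 0)"
proof -
  have [measurable]: "{\<omega> \<in> space M. hit \<omega>} \<in> sets M" by (rule measurable_hit)
  have [measurable]: "hit_area \<in> borel_measurable M" by (rule hit_area_measurable)
  have "(\<integral>\<omega>. exp (- q * hit_area \<omega>) \<partial>M) = (\<integral>\<omega>. indicator {\<omega> \<in> space M. hit \<omega>} \<omega> * exp (- q * hit_area \<omega>) \<partial>M)"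
  proof (rule integral_cong_AE)
    show "AE \<omega> in M. exp (- q * hit_area \<omega>) = indicator {\<omega> \<in> space M. hit \<omega>} \<omega> * exp (- q * hit_area \<omega>)"
      using AE_hit[OF x] AE_space by eventually_elim simp
  qed measurable
  then show ?thesis using laplace_hit_area_hit[OF x q] by simp
qed

end

section \<open>The law of the area\<close>

text \<open>With \<open>u = exp (- x)\<close> the transform at the integers gives the moments, and polynomials are dense among
  the continuous functions of \<open>u\<close>.\<close>

lemma laplace_zero_continuous:
  fixes h f :: "real \<Rightarrow> real"
  assumes h: "\<And>q. q > 0 \<Longrightarrow> has_bochner_integral lborel (\<lambda>x. indicator {0<..} x *\<^sub>R (exp (- q * x) * h x)) 0"
    and f: "continuous_on UNIV f"
  shows "has_bochner_integral lborel (\<lambda>x. f (exp (- x)) * (indicator {0<..} x *\<^sub>R (exp (- 1 * x) * h x))) 0"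
proof -
  define k where "k = (\<lambda>x. indicator {0<..} x *\<^sub>R (exp (- 1 * x) * h x))"
  have k: "integrable lborel k" using h[of 1] unfolding k_def by (simp add: has_bochner_integral_iff)
  then have [measurable]: "k \<in> borel_measurable borel" by auto
  have [measurable]: "f \<in> borel_measurable borel" by (rule borel_measurable_continuous_onI[OF f])
  have mono: "has_bochner_integral lborel (\<lambda>x. exp (- x) ^ i * k x) 0" for i
  proof -
    have "(\<lambda>x. exp (- x) ^ i * k x) = (\<lambda>x. indicator {0<..} x *\<^sub>R (exp (- real (Suc i) * x) * h x))"
      by (rule ext) (simp add: k_def exp_of_nat_mult[symmetric] mult_exp_exp algebra_simps)
    then show ?thesis using h[of "real (Suc i)"] by (simp del: of_nat_Suc)
  qed
  have poly: "has_bochner_integral lborel (\<lambda>x. (\<Sum>i\<le>n. a i * exp (- x) ^ i) * k x) 0" for a :: "nat \<Rightarrow> real" and n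
  proof -
    have "has_bochner_integral lborel (\<lambda>x. \<Sum>i\<le>n. a i * (exp (- x) ^ i * k x)) (\<Sum>i\<le>n. a i * 0)"
      by (intro has_bochner_integral_sum has_bochner_integral_mult_right mono)
    then show ?thesis by (simp add: sum_distrib_right mult.assoc)
  qed
  obtain B where B: "\<And>u. u \<in> {0..1} \<Longrightarrow> norm (f u) \<le> B"
    using compact_imp_bounded[OF compact_continuous_image[OF continuous_on_subset[OF f] compact_Icc]]
    unfolding bounded_iff by (metis imageI subset_UNIV)
  have k0: "k x = 0" if "x \<le> 0" for x using that by (simp add: k_def)
  have int: "integrable lborel (\<lambda>x. f (exp (- x)) * k x)"
  proof (rule Bochner_Integration.integrable_bound[OF integrable_mult_right[OF integrable_norm[OF k], of B]])
    show "AE x in lborel. norm (f (exp (- x)) * k x) \<le> norm (B * norm (k x))"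
    proof (rule AE_I2)
      fix x :: real
      show "norm (f (exp (- x)) * k x) \<le> norm (B * norm (k x))"
      proof (cases "x \<le> 0")
        case False
        then have "norm (f (exp (- x))) \<le> B" by (intro B) simp
        then show ?thesis by (simp add: abs_mult mult_right_mono)
      qed (simp add: k0)
    qed
  qed measurable
  have "\<bar>integral\<^sup>L lborel (\<lambda>x. f (exp (- x)) * k x)\<bar> \<le> e * (\<integral>x. \<bar>k x\<bar> \<partial>lborel)" if e: "e > 0" for e
  proof -
    obtain g where g: "real_polynomial_function g" "\<And>u. u \<in> {0..1} \<Longrightarrow> \<bar>f u - g u\<bar> < e"
      using Stone_Weierstrass_real_polynomial_function[OF compact_Icc continuous_on_subset[OF f] e, of 0 "1 :: real"] by auto
    then obtain a n where gs: "g = (\<lambda>u. \<Sum>i\<le>n. a i * u ^ i)" by (auto simp: real_polynomial_function_iff_sum)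
    have gi: "has_bochner_integral lborel (\<lambda>x. g (exp (- x)) * k x) 0" unfolding gs by (rule poly)
    then have "integral\<^sup>L lborel (\<lambda>x. f (exp (- x)) * k x) = integral\<^sup>L lborel (\<lambda>x. f (exp (- x)) * k x - g (exp (- x)) * k x)"
      using int by (simp add: has_bochner_integral_iff)
    also have "\<bar>\<dots>\<bar> \<le> (\<integral>x. \<bar>f (exp (- x)) * k x - g (exp (- x)) * k x\<bar> \<partial>lborel)" by (rule integral_abs_bound)
    also have "\<dots> \<le> (\<integral>x. e * \<bar>k x\<bar> \<partial>lborel)"
    proof (rule integral_mono)
      show "integrable lborel (\<lambda>x. \<bar>f (exp (- x)) * k x - g (exp (- x)) * k x\<bar>)"
        using int gi by (intro integrable_abs Bochner_Integration.integrable_diff) (auto simp: has_bochner_integral_iff)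
      show "integrable lborel (\<lambda>x. e * \<bar>k x\<bar>)" using k by (intro integrable_mult_right integrable_abs)
      show "\<bar>f (exp (- x)) * k x - g (exp (- x)) * k x\<bar> \<le> e * \<bar>k x\<bar>" for x
      proof (cases "x \<le> 0")
        case False
        then have "\<bar>f (exp (- x)) - g (exp (- x))\<bar> \<le> e" by (intro less_imp_le g(2)) simp
        then show ?thesis by (simp add: left_diff_distrib[symmetric] abs_mult mult_right_mono)
      qed (simp add: k0)
    qed
    finally show ?thesis by simp
  qed
  note b = this
  have "\<bar>integral\<^sup>L lborel (\<lambda>x. f (exp (- x)) * k x)\<bar> \<le> 0"
  proof (rule field_le_epsilon)
    fix e :: real assume e: "e > 0"
    define C where "C = (\<integral>x. \<bar>k x\<bar> \<partial>lborel)"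
    have C: "C \<ge> 0" unfolding C_def by (rule Bochner_Integration.integral_nonneg) simp
    have "e / (C + 1) > 0" using C e by (intro divide_pos_pos) auto
    from b[OF this] have "\<bar>integral\<^sup>L lborel (\<lambda>x. f (exp (- x)) * k x)\<bar> \<le> e / (C + 1) * C"
      unfolding C_def .
    also have "\<dots> \<le> e" using C e by (simp add: field_simps)
    finally show "\<bar>integral\<^sup>L lborel (\<lambda>x. f (exp (- x)) * k x)\<bar> \<le> 0 + e" by simp
  qed
  then have "integral\<^sup>L lborel (\<lambda>x. f (exp (- x)) * k x) = 0" by simp
  then have "has_bochner_integral lborel (\<lambda>x. f (exp (- x)) * k x) 0" using int by (simp add: has_bochner_integral_iff)
  then show ?thesis unfolding k_def .
qed

text \<open>If \<open>h a\<close> were positive, \<open>h\<close> would be positive on an interval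
  to the right of \<open>a\<close>, and a continuous function of \<open>exp (- x)\<close> supported
  there would give a positive integral. Applied to a difference and to its negative this yields
  equality, and right-continuity is all that a probability tail offers.\<close>

lemma laplace_zero_nonpos:
  fixes h :: "real \<Rightarrow> real"
  assumes h: "\<And>q. q > 0 \<Longrightarrow> has_bochner_integral lborel (\<lambda>x. indicator {0<..} x *\<^sub>R (exp (- q * x) * h x)) 0"
    and a: "a > 0" and c: "(h \<longlongrightarrow> h a) (at_right a)"
  shows "h a \<le> 0"
proof (rule ccontr)
  assume "\<not> h a \<le> 0"
  then have "0 < h a" by simp
  with c have "\<forall>\<^sub>F x in at_right a. 0 < h x" by (rule order_tendstoD)
  then obtain b where b: "b > a" "\<And>x. a < x \<Longrightarrow> x < b \<Longrightarrow> 0 < h x" unfolding eventually_at_right_field by blast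
  \<comment> \<open>A tent in the variable \<open>u = exp (- x)\<close>, positive exactly for
    \<open>x\<close> strictly between \<open>a\<close> and \<open>b\<close>.\<close>
  define f :: "real \<Rightarrow> real" where "f = (\<lambda>u. max 0 (min (u - exp (- b)) (exp (- a) - u)))"
  define F where "F = (\<lambda>x. f (exp (- x)) * (indicator {0<..} x *\<^sub>R (exp (- 1 * x) * h x)))"
  have F: "has_bochner_integral lborel F 0"
    unfolding F_def by (rule laplace_zero_continuous[OF h]) (auto simp: f_def intro!: continuous_intros)
  have pos: "F x > 0" if "a < x" "x < b" for x
    using that a b(2)[of x] by (simp add: F_def f_def)
  have zero: "F x = 0" if "\<not> (a < x \<and> x < b)" for x
  proof -
    have "exp (- a) \<le> exp (- x) \<or> exp (- x) \<le> exp (- b)" using that by auto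
    then have "min (exp (- x) - exp (- b)) (exp (- a) - exp (- x)) \<le> 0" unfolding min_le_iff_disj by auto
    then have "f (exp (- x)) = 0" unfolding f_def by (rule max_absorb1)
    then show ?thesis by (simp add: F_def)
  qed
  have "F x \<ge> 0" for x using pos[of x] zero[of x] by (cases "a < x \<and> x < b") auto
  then have "AE x in lborel. F x = 0"
    using integral_nonneg_eq_0_iff_AE[of lborel F] F by (simp add: has_bochner_integral_iff)
  then have "AE x in lborel. x \<notin> {a<..<b}"
    by eventually_elim (metis greaterThanLessThan_iff less_irrefl pos)
  moreover have "{x \<in> space lborel. \<not> x \<notin> {a<..<b}} = {a<..<b}" by auto
  ultimately have "emeasure lborel {a<..<b} = 0" by (subst (asm) AE_iff_measurable) auto
  then show False using b(1) by simp
qed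

section \<open>Tail, positivity and density of the area up to the passage\<close>

context spectrally_positive
begin

text \<open>Fubini: integrating \<open>exp (- q * t)\<close> over the times \<open>t\<close> below
  \<open>f \<omega>\<close> gives \<open>(1 - exp (- q * f \<omega>)) / q\<close>.\<close>

lemma laplace_tail:
  assumes Wm: "f \<in> borel_measurable M" and W0: "\<And>\<omega>. \<omega> \<in> space M \<Longrightarrow> f \<omega> \<ge> 0" and q: "q > 0"
  shows "has_bochner_integral lborel (\<lambda>t. indicator {0<..} t *\<^sub>R (exp (- q * t) * prob {\<omega> \<in> space M. t < f \<omega>})) ((1 - expectation (\<lambda>\<omega>. exp (- q * f \<omega>))) / q)"
proof -
  note [measurable] = Wm
  interpret pair_sigma_finite M lborel ..
  let ?e = "\<lambda>t. indicator {0<..} t * exp (- q * t)"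
  have e1: "exp (- q * f \<omega>) \<le> 1" if "\<omega> \<in> space M" for \<omega> using W0[OF that] q by simp
  have ie: "integrable M (\<lambda>\<omega>. exp (- q * f \<omega>))"
  proof (rule integrable_const_bound[of _ 1])
    show "AE \<omega> in M. norm (exp (- q * f \<omega>)) \<le> 1" using e1 by (intro AE_I2) simp
  qed measurable
  have inner: "(\<integral>\<^sup>+ t. ennreal (?e t * indicator {t. t < f \<omega>} t) \<partial>lborel) = ennreal ((1 - exp (- q * f \<omega>)) / q)"
    if \<omega>: "\<omega> \<in> space M" for \<omega>
  proof -
    have "(\<integral>\<^sup>+ t. ennreal (?e t * indicator {t. t < f \<omega>} t) \<partial>lborel) = (\<integral>\<^sup>+ t. ennreal (exp (- q * t)) * indicator {0..f \<omega>} t \<partial>lborel)"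
      by (rule nn_integral_cong_AE, use AE_lborel_singleton[of 0] AE_lborel_singleton[of "f \<omega>"] in eventually_elim)
        (auto simp: indicator_def)
    also have "\<dots> = ennreal (- (exp (- q * f \<omega>) / q) - - (exp (- q * 0) / q))"
      by (rule nn_integral_FTC_Icc[OF _ _ _ W0[OF \<omega>]]) (use q in \<open>auto intro!: derivative_eq_intros\<close>)
    also have "- (exp (- q * f \<omega>) / q) - - (exp (- q * 0) / q) = (1 - exp (- q * f \<omega>)) / q" by (simp add: diff_divide_distrib)
    finally show ?thesis .
  qed
  have sec: "(\<integral>\<^sup>+ \<omega>. ennreal (?e t * indicator {t. t < f \<omega>} t) \<partial>M) = ennreal (indicator {0<..} t *\<^sub>R (exp (- q * t) * prob {\<omega> \<in> space M. t < f \<omega>}))" for t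
  proof -
    have "(\<integral>\<^sup>+ \<omega>. ennreal (?e t * indicator {t. t < f \<omega>} t) \<partial>M) = (\<integral>\<^sup>+ \<omega>. ennreal (?e t) * indicator {\<omega> \<in> space M. t < f \<omega>} \<omega> \<partial>M)"
      by (intro nn_integral_cong) (auto simp: indicator_def)
    also have "\<dots> = ennreal (?e t) * emeasure M {\<omega> \<in> space M. t < f \<omega>}"
      by (rule nn_integral_cmult_indicator) measurable
    also have "\<dots> = ennreal (indicator {0<..} t *\<^sub>R (exp (- q * t) * prob {\<omega> \<in> space M. t < f \<omega>}))"
      by (simp add: emeasure_eq_measure ennreal_mult' mult.assoc)
    finally show ?thesis .
  qed
  have Tm: "(\<lambda>t. prob {\<omega> \<in> space M. t < f \<omega>}) \<in> borel_measurable borel"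
  proof -
    have "antimono (\<lambda>t. prob {\<omega> \<in> space M. t < f \<omega>})"
      by (intro antimonoI finite_measure_mono) auto
    then have "mono (\<lambda>t. - prob {\<omega> \<in> space M. t < f \<omega>})" by (auto simp: mono_def antimono_def)
    then have "(\<lambda>t. - prob {\<omega> \<in> space M. t < f \<omega>}) \<in> borel_measurable borel" by (rule borel_measurable_mono)
    then show ?thesis by simp
  qed
  have "(\<integral>\<^sup>+ t. ennreal (indicator {0<..} t *\<^sub>R (exp (- q * t) * prob {\<omega> \<in> space M. t < f \<omega>})) \<partial>lborel)
      = (\<integral>\<^sup>+ t. (\<integral>\<^sup>+ \<omega>. ennreal (?e t * indicator {t. t < f \<omega>} t) \<partial>M) \<partial>lborel)" by (simp only: sec)
  also have "\<dots> = (\<integral>\<^sup>+ \<omega>. (\<integral>\<^sup>+ t. ennreal (?e t * indicator {t. t < f \<omega>} t) \<partial>lborel) \<partial>M)"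
  proof (rule Fubini')
    have "(\<lambda>(\<omega>, t). ennreal (?e t * indicator {t. t < f \<omega>} t)) = (\<lambda>y. ennreal (?e (snd y) * (if snd y < f (fst y) then 1 else 0)))"
      by (auto simp: indicator_def)
    also have "\<dots> \<in> borel_measurable (M \<Otimes>\<^sub>M lborel)" by measurable
    finally show "(\<lambda>(\<omega>, t). ennreal (?e t * indicator {t. t < f \<omega>} t)) \<in> borel_measurable (M \<Otimes>\<^sub>M lborel)" .
  qed
  also have "\<dots> = (\<integral>\<^sup>+ \<omega>. ennreal ((1 - exp (- q * f \<omega>)) / q) \<partial>M)"
    by (intro nn_integral_cong inner)
  also have "\<dots> = ennreal (\<integral>\<omega>. (1 - exp (- q * f \<omega>)) / q \<partial>M)"
  proof (rule nn_integral_eq_integral)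
    show "integrable M (\<lambda>\<omega>. (1 - exp (- q * f \<omega>)) / q)" using ie by simp
    show "AE \<omega> in M. 0 \<le> (1 - exp (- q * f \<omega>)) / q" using e1 q by (intro AE_I2) simp
  qed
  also have "(\<integral>\<omega>. (1 - exp (- q * f \<omega>)) / q \<partial>M) = (1 - expectation (\<lambda>\<omega>. exp (- q * f \<omega>))) / q"
    using ie by (simp add: prob_space)
  finally have nn: "(\<integral>\<^sup>+ t. ennreal (indicator {0<..} t *\<^sub>R (exp (- q * t) * prob {\<omega> \<in> space M. t < f \<omega>})) \<partial>lborel)
      = ennreal ((1 - expectation (\<lambda>\<omega>. exp (- q * f \<omega>))) / q)" .
  show ?thesis
  proof (rule has_bochner_integral_nn_integral[OF _ _ _ nn])
    show "(\<lambda>t. indicator {0<..} t *\<^sub>R (exp (- q * t) * prob {\<omega> \<in> space M. t < f \<omega>})) \<in> borel_measurable lborel"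
      using Tm by measurable
    have "expectation (\<lambda>\<omega>. exp (- q * f \<omega>)) \<le> expectation (\<lambda>\<omega>. 1)"
      using e1 by (intro integral_mono ie) auto
    then show "0 \<le> (1 - expectation (\<lambda>\<omega>. exp (- q * f \<omega>))) / q" using q by (simp add: prob_space)
  qed (simp add: AE_I2)
qed

lemma tail_right_continuous:
  fixes f :: "'a \<Rightarrow> real" and a :: real
  assumes Wm: "f \<in> borel_measurable M"
  shows "((\<lambda>t. prob {\<omega> \<in> space M. t < f \<omega>}) \<longlongrightarrow> prob {\<omega> \<in> space M. a < f \<omega>}) (at_right a)"
    and "((\<lambda>t. prob {\<omega> \<in> space M. t < f \<omega>}) \<longlongrightarrow> 0) at_top"
proof -
  interpret d: real_distribution "distr M borel f"
    using Wm by (intro real_distribution_distr)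
  have eq: "prob {\<omega> \<in> space M. t < f \<omega>} = 1 - cdf (distr M borel f) t" for t
  proof -
    have "cdf (distr M borel f) t = prob {\<omega> \<in> space M. f \<omega> \<le> t}"
      unfolding cdf_def using Wm by (subst measure_distr) (auto intro: arg_cong[where f = prob])
    moreover have "prob {\<omega> \<in> space M. t < f \<omega>} = 1 - prob {\<omega> \<in> space M. f \<omega> \<le> t}"
      using Wm by (subst prob_neg[symmetric]) (auto simp: not_le)
    ultimately show ?thesis by simp
  qed
  show "((\<lambda>t. prob {\<omega> \<in> space M. t < f \<omega>}) \<longlongrightarrow> prob {\<omega> \<in> space M. a < f \<omega>}) (at_right a)"
    unfolding eq using d.cdf_is_right_cont[of a] by (intro tendsto_diff tendsto_const) (simp add: continuous_within)
  have "((\<lambda>t. 1 - cdf (distr M borel f) t) \<longlongrightarrow> 1 - 1) at_top"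
    by (intro tendsto_diff tendsto_const d.cdf_lim_at_top_prob)
  then show "((\<lambda>t. prob {\<omega> \<in> space M. t < f \<omega>}) \<longlongrightarrow> 0) at_top" unfolding eq by simp
qed

text \<open>Both sides have the same Laplace transform, are right-continuous, and the difference is
  tested in both directions. The start 1 enters because \<open>tail_laplace\<close> has
  \<open>airy\<close> at the unscaled argument.\<close>

lemma tail_hit_area:
  assumes x: "x = 1" and a: "a > 0"
  shows "prob {\<omega> \<in> space M. a < hit_area \<omega>} = tail a"
proof -
  have x0: "x > 0" using x by simp
  let ?T = "\<lambda>t. prob {\<omega> \<in> space M. t < hit_area \<omega>}"
  have T: "has_bochner_integral lborel (\<lambda>t. indicator {0<..} t *\<^sub>R (exp (- q * t) * ?T t)) (Re (1 - airy (of_real ((p * q) powr (1 / p))) / airy 0) / q)"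
    if q: "q > 0" for q
    using laplace_tail[OF hit_area_measurable hit_area_nonneg[OF x0] q] laplace_hit_area[OF x0 q] x by simp
  have 1: "has_bochner_integral lborel (\<lambda>t. indicator {0<..} t *\<^sub>R (exp (- q * t) * (?T t - tail t))) 0" if q: "q > 0" for q
    using has_bochner_integral_diff[OF T[OF q] tail_laplace[OF q]] by (simp add: right_diff_distrib)
  have 2: "has_bochner_integral lborel (\<lambda>t. indicator {0<..} t *\<^sub>R (exp (- q * t) * (tail t - ?T t))) 0" if q: "q > 0" for q
    using has_bochner_integral_diff[OF tail_laplace[OF q] T[OF q]] by (simp add: right_diff_distrib)
  have "(tail \<longlongrightarrow> tail a) (at a)" using DERIV_isCont[OF tail_has_derivative[OF a]] by (simp add: isCont_def)
  then have G: "(tail \<longlongrightarrow> tail a) (at_right a)" by (rule tendsto_mono[rotated]) (simp add: at_le)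
  have "?T a - tail a \<le> 0"
    by (rule laplace_zero_nonpos[OF 1 a], assumption) (intro tendsto_diff tail_right_continuous(1)[OF hit_area_measurable] G)
  moreover have "tail a - ?T a \<le> 0"
    by (rule laplace_zero_nonpos[OF 2 a], assumption) (intro tendsto_diff tail_right_continuous(1)[OF hit_area_measurable] G)
  ultimately show ?thesis by simp
qed

text \<open>The sign is read off from the probabilistic meaning: \<open>tail\<close> is decreasing
  as a tail probability. The alternating series itself does not show it.\<close>

lemma dens_nonneg:
  assumes x: "x = 1" and t: "t > 0"
  shows "dens t \<ge> 0"
proof (rule ccontr)
  assume "\<not> dens t \<ge> 0"
  then have "- dens t > 0" by simp
  from DERIV_pos_inc_right[OF tail_has_derivative[OF t] this]
  obtain e where e: "e > 0" "\<And>h. 0 < h \<Longrightarrow> h < e \<Longrightarrow> tail t < tail (t + h)" by blast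
  have "tail t < tail (t + e / 2)" using e by simp
  moreover have "tail (t + e / 2) \<le> tail t"
  proof -
    have [measurable]: "hit_area \<in> borel_measurable M" by (rule hit_area_measurable)
    have "prob {\<omega> \<in> space M. t + e / 2 < hit_area \<omega>} \<le> prob {\<omega> \<in> space M. t < hit_area \<omega>}"
      using e(1) by (intro finite_measure_mono) auto
    then show ?thesis using t e(1) by (simp add: tail_hit_area[OF x])
  qed
  ultimately show False by simp
qed

text \<open>The probability of area 0 is at most the Laplace transform at every \<open>q\<close>,
  and this tends to 0 as \<open>q\<close> grows because \<open>airy\<close> does. So the law has no
  atom at 0.\<close>

lemma hit_area_pos:
  assumes x: "x > 0" shows "AE \<omega> in M. hit_area \<omega> > 0"
proof -
  have [measurable]: "hit_area \<in> borel_measurable M" by (rule hit_area_measurable)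
  define q where "q n = real n + 1" for n
  have q: "q n > 0" for n by (simp add: q_def add_pos_nonneg)
  have le: "prob {\<omega> \<in> space M. hit_area \<omega> = 0} \<le> Re (airy (of_real (x * (p * q n) powr (1 / p))) / airy 0)" for n
  proof -
    have "prob {\<omega> \<in> space M. hit_area \<omega> = 0} = (\<integral>\<omega>. indicator {\<omega> \<in> space M. hit_area \<omega> = 0} \<omega> \<partial>M)" by simp
    also have "\<dots> \<le> (\<integral>\<omega>. exp (- q n * hit_area \<omega>) \<partial>M)"
    proof (rule integral_mono)
      have "{\<omega> \<in> space M. hit_area \<omega> = 0} \<in> sets M" by measurable
      then show "integrable M (indicat_real {\<omega> \<in> space M. hit_area \<omega> = 0})"
        by (rule integrable_real_indicator) (simp add: less_top[symmetric])
      show "integrable M (\<lambda>\<omega>. exp (- q n * hit_area \<omega>))"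
      proof (rule integrable_const_bound[of _ 1])
        show "AE \<omega> in M. norm (exp (- q n * hit_area \<omega>)) \<le> 1"
          using hit_area_nonneg[OF x] less_imp_le[OF q[of n]] by (intro AE_I2) simp
      qed measurable
      show "indicat_real {\<omega> \<in> space M. hit_area \<omega> = 0} \<omega> \<le> exp (- q n * hit_area \<omega>)" for \<omega>
        by (simp add: indicator_def)
    qed
    also note laplace_hit_area[OF x q]
    finally show ?thesis .
  qed
  have "filterlim (\<lambda>n. x * (p * q n) powr (1 / p)) at_top sequentially"
    unfolding q_def using x p2 by real_asymp
  from airy_tendsto_0[OF this] have "(\<lambda>n. Re (airy (of_real (x * (p * q n) powr (1 / p))) / airy 0)) \<longlonglongrightarrow> Re (0 / airy 0)"
    using airy_coeff_0(2) by (intro tendsto_Re tendsto_divide tendsto_const) (auto simp: airy_0_airy_coeff)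
  then have "prob {\<omega> \<in> space M. hit_area \<omega> = 0} \<le> 0"
    using le by (intro LIMSEQ_le_const) auto
  then have "prob {\<omega> \<in> space M. hit_area \<omega> = 0} = 0" using measure_nonneg[of M] by (simp add: order_antisym)
  then have "AE \<omega> in M. hit_area \<omega> \<noteq> 0" using prob_Collect_eq_0[of "\<lambda>\<omega>. hit_area \<omega> = 0"] by simp
  then show ?thesis using AE_space by eventually_elim (use hit_area_nonneg[OF x] in force)
qed

text \<open>The two measures are compared on open half-lines. For \<open>a > 0\<close> the
  fundamental theorem of calculus applies to \<open>- tail\<close>, which tends to 0 at infinity;
  for \<open>a \<le> 0\<close> both measures live on the positive reals.\<close>

theorem hit_area_density:
  assumes x: "x = 1"
  shows "distr M borel hit_area = density lborel (\<lambda>t. ennreal (indicator {0<..} t *\<^sub>R dens t))"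
proof (rule measure_eqI_lessThan)
  have Wm[measurable]: "hit_area \<in> borel_measurable M" by (rule hit_area_measurable)
  have x0: "x > 0" using x by simp
  have gm[measurable]: "(\<lambda>t. indicator {0<..} t *\<^sub>R dens t) \<in> borel_measurable borel"
    by (rule borel_measurable_continuous_on_indicator) (auto intro!: continuous_at_imp_continuous_on dens_continuous)
  let ?g = "\<lambda>t. indicator {0<..} t *\<^sub>R dens t"
  let ?D = "density lborel (\<lambda>t. ennreal (?g t))"
  interpret d: real_distribution "distr M borel hit_area" by (rule real_distribution_distr) measurable
  show "emeasure (distr M borel hit_area) {t<..} < \<infinity>" for t by (simp add: d.emeasure_finite less_top[symmetric])
  have lim: "((\<lambda>t. - tail t) \<longlongrightarrow> - 0) at_top"
  proof (rule tendsto_minus, rule Lim_transform_eventually[OF tail_right_continuous(2)[OF Wm]])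
    show "\<forall>\<^sub>F t in at_top. prob {\<omega> \<in> space M. t < hit_area \<omega>} = tail t"
      using eventually_gt_at_top[of 0] by eventually_elim (rule tail_hit_area[OF x])
  qed
  have dens: "emeasure ?D {a<..} = (\<integral>\<^sup>+t. ennreal (?g t) * indicator {a<..} t \<partial>lborel)" for a
    by (rule emeasure_density) (simp_all only: measurable_lborel2 sets_lborel measurable_compose[OF gm measurable_ennreal] borel_open open_greaterThan)
  have pos: "emeasure (distr M borel hit_area) {a<..} = emeasure ?D {a<..}" if a: "a > 0" for a
  proof -
    have "emeasure ?D {a<..} = (\<integral>\<^sup>+t. ennreal (?g t) * indicator {a<..} t \<partial>lborel)" by (rule dens)
    also have "\<dots> = (\<integral>\<^sup>+t. ennreal (?g t) * indicator {a..} t \<partial>lborel)"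
      by (rule nn_integral_cong_AE, use AE_lborel_singleton[of a] in eventually_elim) (auto simp: indicator_def)
    also have "\<dots> = ennreal (- 0 - - tail a)"
    proof (rule nn_integral_FTC_atLeast[OF gm _ _ lim])
      fix t assume "a \<le> t"
      then have t: "t > 0" using a by simp
      show "((\<lambda>t. - tail t) has_real_derivative ?g t) (at t)"
        using DERIV_minus[OF tail_has_derivative[OF t]] t by simp
      show "0 \<le> ?g t" using dens_nonneg[OF x t] t by simp
    qed
    also have "\<dots> = emeasure (distr M borel hit_area) {a<..}"
      by (simp add: tail_hit_area[OF x a, symmetric] emeasure_distr emeasure_eq_measure vimage_def Int_def conj_commute)
    finally show ?thesis by simp
  qed
  \<comment> \<open>The derivative of \<open>tail\<close> is available for positive arguments only,
    so the half-line from 0 is exhausted from inside.\<close>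
  have zero: "emeasure (distr M borel hit_area) {0<..} = emeasure ?D {0<..}"
  proof -
    let ?B = "\<lambda>n::nat. {inverse (real (Suc n))<..}"
    have inc: "incseq ?B"
    proof (rule incseq_SucI, rule subsetI)
      fix n and t :: real assume "t \<in> ?B n"
      then have "inverse (real (Suc n)) < t" by (simp only: greaterThan_iff)
      moreover have "inverse (real (Suc (Suc n))) \<le> inverse (real (Suc n))" by (rule le_imp_inverse_le) auto
      ultimately show "t \<in> ?B (Suc n)" unfolding greaterThan_iff by (rule le_less_trans[rotated])
    qed
    have un: "(\<Union>n. ?B n) = {0<..}"
    proof (intro equalityI subsetI)
      fix t :: real assume "t \<in> (\<Union>n. ?B n)"
      then obtain n where "inverse (real (Suc n)) < t" by blast
      moreover have "0 < inverse (real (Suc n))" by simp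
      ultimately show "t \<in> {0<..}" unfolding greaterThan_iff by (rule less_trans[rotated])
    qed (use reals_Archimedean in auto)
    have "emeasure (distr M borel hit_area) (\<Union>n. ?B n) = (SUP n. emeasure (distr M borel hit_area) (?B n))"
      by (rule SUP_emeasure_incseq[symmetric, OF _ inc]) auto
    also have "\<dots> = (SUP n. emeasure ?D (?B n))" by (simp add: pos del: of_nat_Suc)
    also have "\<dots> = emeasure ?D (\<Union>n. ?B n)" by (rule SUP_emeasure_incseq[OF _ inc]) auto
    finally show ?thesis unfolding un .
  qed
  show "emeasure (distr M borel hit_area) {a<..} = emeasure ?D {a<..}" for a
  proof (cases "a > 0")
    case False
    have "emeasure (distr M borel hit_area) {a<..} = emeasure (distr M borel hit_area) {0<..}"
    proof (rule emeasure_eq_AE)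
      have "AE t in distr M borel hit_area. 0 < t" using hit_area_pos[OF x0] by (subst AE_distr_iff) auto
      then show "AE t in distr M borel hit_area. t \<in> {a<..} \<longleftrightarrow> t \<in> {0<..}" by eventually_elim (use False in auto)
    qed auto
    also have "\<dots> = emeasure ?D {a<..}"
      unfolding zero dens by (intro nn_integral_cong) (use False in \<open>auto simp: indicator_def\<close>)
    finally show ?thesis .
  qed (rule pos)
qed simp_all

section \<open>The first zero against the passage\<close>

lemma L_integrable: "\<omega> \<in> space M \<Longrightarrow> integrable lborel (\<lambda>s. indicator {0<..t} s *\<^sub>R L s \<omega>)"
proof (cases "t > 0")
  case True
  assume \<omega>: "\<omega> \<in> space M"
  obtain B where B: "\<And>s. s \<in> {0..t} \<Longrightarrow> \<bar>L s \<omega>\<bar> \<le> B" using cadlag_bounded[OF cad[OF \<omega>], of t] True by auto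
  show ?thesis
    using right_riemann_sums(1)[OF True, of "\<lambda>s. L s \<omega>" B Suc] B cad[OF \<omega>] filterlim_Suc by (auto simp: cadlag_def)
qed simp

lemma area_mono:
  assumes \<omega>: "\<omega> \<in> space M" and "s \<le> t" and L0: "\<And>u. 0 < u \<Longrightarrow> u \<le> t \<Longrightarrow> L u \<omega> \<ge> 0"
  shows "area s \<omega> \<le> area t \<omega>"
  unfolding area_def by (intro integral_mono L_integrable[OF \<omega>]) (use assms in \<open>auto simp: indicator_def\<close>)

text \<open>Lowering the process by a constant changes neither increments nor jumps, only the
  starting point. This makes the Laplace transform of the area available for \<open>L - y\<close> as
  well.\<close>

lemma shifted: "spectrally_positive M p (x - y) (\<lambda>t \<omega>. L t \<omega> - y)"
proof unfold_locales
  fix \<omega> assume \<omega>: "\<omega> \<in> space M"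
  show "L 0 \<omega> - y = x - y" using start[OF \<omega>] by simp
  show "cadlag (\<lambda>t. L t \<omega> - y)" unfolding cadlag_def
  proof (intro conjI allI impI)
    fix t :: real assume "0 \<le> t"
    then show "continuous (at_right t) (\<lambda>t. L t \<omega> - y)" using cad[OF \<omega>] by (intro continuous_intros) (simp add: cadlag_def)
  next
    fix t :: real assume "0 < t"
    then obtain l where "((\<lambda>t. L t \<omega>) \<longlongrightarrow> l) (at_left t)" using cad[OF \<omega>] by (auto simp: cadlag_def)
    then have "((\<lambda>t. L t \<omega> - y) \<longlongrightarrow> l - y) (at_left t)" by (intro tendsto_diff tendsto_const)
    then show "\<exists>l. ((\<lambda>t. L t \<omega> - y) \<longlongrightarrow> l) (at_left t)" by blast
  qed
  show "no_negative_jumps (\<lambda>t. L t \<omega> - y)" unfolding no_negative_jumps_def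
  proof (intro allI impI)
    fix t l :: real assume t: "0 < t" and "((\<lambda>t. L t \<omega> - y) \<longlongrightarrow> l) (at_left t)"
    then have "((\<lambda>t. L t \<omega> - y + y) \<longlongrightarrow> l + y) (at_left t)" by (intro tendsto_add tendsto_const)
    then have "l + y \<le> L t \<omega>" using nnj[OF \<omega>] t by (simp add: no_negative_jumps_def)
    then show "l \<le> L t \<omega> - y" by simp
  qed
next
  fix t :: "nat \<Rightarrow> real" and n assume "0 \<le> t 0" "incseq t"
  then show "indep_vars (\<lambda>_. borel) (\<lambda>i \<omega>. L (t (Suc i)) \<omega> - y - (L (t i) \<omega> - y)) {..<n}" using ind[of t n] by simp
next
  fix s h q :: real assume "0 \<le> s" "0 < h" "0 < q"
  then show "has_bochner_integral M (\<lambda>\<omega>. exp (- q * (L (s + h) \<omega> - y - (L s \<omega> - y)))) (exp (h * q powr (p - 1)))"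
    using lap[of s h q] by simp
qed (use p2 p3 rv in \<open>auto intro: borel_measurable_diff\<close>)

text \<open>The passage time is itself a zero, so the infimum is finite. It is attained, because a
  nonzero value at the infimum would by right-continuity exclude zeros just after it.\<close>

lemma hitting_time_zero_hit:
  assumes x: "x > 0" and \<omega>: "\<omega> \<in> space M" and h: "hit \<omega>"
  obtains T where "hitting_time_zero (\<lambda>t. L t \<omega>) = ereal T" "0 < T" "T \<le> hit_time \<omega>" "L T \<omega> = 0"
proof -
  define Z where "Z = {t. 0 < t \<and> L t \<omega> = 0}"
  have SZ: "hit_time \<omega> \<in> Z" using hit_time_pos[OF x \<omega> h] L_hit_time_eq_0[OF x \<omega> h] by (simp add: Z_def)
  have bdd: "bdd_below Z" by (rule bdd_belowI[of _ 0]) (simp add: Z_def)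
  define T where "T = Inf Z"
  have eq: "hitting_time_zero (\<lambda>t. L t \<omega>) = ereal T"
    unfolding hitting_time_zero_def T_def Z_def[symmetric] using bdd SZ by (subst ereal_Inf') auto
  have T0: "T \<ge> 0" unfolding T_def by (rule cInf_greatest) (use SZ in \<open>auto simp: Z_def\<close>)
  have TS: "T \<le> hit_time \<omega>" unfolding T_def by (rule cInf_lower[OF SZ bdd])
  have LT: "L T \<omega> = 0"
  proof (rule ccontr)
    assume ne: "L T \<omega> \<noteq> 0"
    have "continuous (at_right T) (\<lambda>t. L t \<omega>)" using cad[OF \<omega>] T0 by (simp add: cadlag_def)
    then have "((\<lambda>s. L s \<omega>) \<longlongrightarrow> L T \<omega>) (at_right T)" by (simp add: continuous_within)
    from tendsto_imp_eventually_ne[OF this ne]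
    obtain b where b: "b > T" "\<And>s. T < s \<Longrightarrow> s < b \<Longrightarrow> L s \<omega> \<noteq> 0"
      unfolding eventually_at_right_field by blast
    have "\<exists>s\<in>Z. s < b" using b(1) SZ unfolding T_def by (intro cInf_lessD) auto
    then obtain s where s: "s \<in> Z" "s < b" by blast
    moreover have "T \<le> s" unfolding T_def by (rule cInf_lower[OF s(1) bdd])
    ultimately show False using b(2)[of s] ne by (cases "s = T") (auto simp: Z_def)
  qed
  have "T \<noteq> 0" using LT start[OF \<omega>] x by auto
  then show thesis using that[OF eq _ TS LT] T0 by simp
qed

text \<open>At a zero of \<open>L\<close> the process \<open>L - y\<close> is negative, so its passage below zero precedes the first zero of
  \<open>L\<close>.\<close>

lemma area_bounds:
  assumes x: "x > 0" and \<omega>: "\<omega> \<in> space M" and h: "hit \<omega>" and y: "0 < y"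
  shows "spectrally_positive.hit_area (\<lambda>t \<omega>. L t \<omega> - y) \<omega> \<le> area_until_zero (\<lambda>t. L t \<omega>)"
    and "area_until_zero (\<lambda>t. L t \<omega>) \<le> hit_area \<omega>"
proof -
  interpret y: spectrally_positive M p "x - y" "\<lambda>t \<omega>. L t \<omega> - y" by (rule shifted)
  obtain T where T: "hitting_time_zero (\<lambda>t. L t \<omega>) = ereal T" "0 < T" "T \<le> hit_time \<omega>" "L T \<omega> = 0"
    by (rule hitting_time_zero_hit[OF x \<omega> h])
  have Lnn: "L u \<omega> \<ge> 0" if "0 < u" "u \<le> hit_time \<omega>" for u
    using that L_hit_time_eq_0[OF x \<omega> h] L_nonneg_before[OF \<omega>, of u] by (cases "u = hit_time \<omega>") auto
  have "area_until_zero (\<lambda>t. L t \<omega>) = (LBINT s=ereal 0..ereal T. L s \<omega>)"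
    by (simp add: area_until_zero_def T(1) zero_ereal_def)
  also have "\<dots> = area T \<omega>"
    using T(2) by (subst interval_integral_Ioc) (simp_all add: set_lebesgue_integral_def area_def)
  finally have area: "area_until_zero (\<lambda>t. L t \<omega>) = area T \<omega>" .
  show "area_until_zero (\<lambda>t. L t \<omega>) \<le> hit_area \<omega>"
    unfolding area hit_area_def using h area_mono[OF \<omega> T(3) Lnn] by simp
  have "L T \<omega> - y < 0" using T(4) y by simp
  note hy = y.L_neg_imp_hit[OF \<omega> less_imp_le[OF T(2)] this]
  have "y.hit_area \<omega> = y.area (y.hit_time \<omega>) \<omega>" using hy(1) by (simp add: y.hit_area_def)
  also have "\<dots> \<le> area (y.hit_time \<omega>) \<omega>"
    unfolding y.area_def area_def
    by (intro integral_mono L_integrable[OF \<omega>] y.L_integrable[OF \<omega>]) (use y in \<open>auto simp: indicator_def\<close>)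
  also have "\<dots> \<le> area T \<omega>" by (rule area_mono[OF \<omega> hy(2)]) (use Lnn T(3) in auto)
  finally show "y.hit_area \<omega> \<le> area_until_zero (\<lambda>t. L t \<omega>)" unfolding area .
qed

text \<open>The area up to the first zero lies between the passage area of \<open>L - y\<close> and
  that of \<open>L\<close>. The transforms of these two at \<open>q = 1\<close> differ by values of
  \<open>airy\<close> at nearby arguments, so the expected difference of the exponentials tends to 0
  with \<open>y\<close>, and the sandwich closes almost surely.\<close>

theorem area_eq_hit_area:
  assumes x: "x = 1"
  shows "AE \<omega> in M. area_until_zero (\<lambda>t. L t \<omega>) = hit_area \<omega>"
proof -
  have x0: "x > 0" using x by simp
  \<comment> \<open>The shift by 2 keeps \<open>y m < 1\<close>, so that the lowered process still
    starts above 0.\<close>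
  define y where "y m = inverse (real (m + 2))" for m
  have y: "0 < y m" "y m < 1" for m by (auto simp: y_def inverse_less_1_iff)
  define Wy where "Wy m = spectrally_positive.hit_area (\<lambda>t \<omega>. L t \<omega> - y m)" for m
  have xy: "x - y m > 0" for m using y(2)[of m] x by simp
  have Wm[measurable]: "hit_area \<in> borel_measurable M" by (rule hit_area_measurable)
  have Wym[measurable]: "Wy m \<in> borel_measurable M" for m
    unfolding Wy_def by (rule spectrally_positive.hit_area_measurable[OF shifted])
  have Wy0: "Wy m \<omega> \<ge> 0" if "\<omega> \<in> space M" for m \<omega>
    unfolding Wy_def by (rule spectrally_positive.hit_area_nonneg[OF shifted xy that])
  have iW: "integrable M (\<lambda>\<omega>. exp (- 1 * hit_area \<omega>))"
  proof (rule integrable_const_bound[of _ 1])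
    show "AE \<omega> in M. norm (exp (- 1 * hit_area \<omega>)) \<le> 1" using hit_area_nonneg[OF x0] by (intro AE_I2) simp
  qed measurable
  have iWy: "integrable M (\<lambda>\<omega>. exp (- 1 * Wy m \<omega>))" for m
  proof (rule integrable_const_bound[of _ 1])
    show "AE \<omega> in M. norm (exp (- 1 * Wy m \<omega>)) \<le> 1" using Wy0 by (intro AE_I2) simp
  qed measurable
  define g where "g m \<omega> = exp (- 1 * Wy m \<omega>) - exp (- 1 * hit_area \<omega>)" for m \<omega>
  have Eg: "(\<integral>\<omega>. g m \<omega> \<partial>M) = Re (airy (of_real ((x - y m) * (p * 1) powr (1 / p))) / airy 0) - Re (airy (of_real (x * (p * 1) powr (1 / p))) / airy 0)" for m
  proof -
    have "(\<integral>\<omega>. g m \<omega> \<partial>M) = (\<integral>\<omega>. exp (- 1 * Wy m \<omega>) \<partial>M) - (\<integral>\<omega>. exp (- 1 * hit_area \<omega>) \<partial>M)"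
      unfolding g_def by (rule Bochner_Integration.integral_diff[OF iWy iW])
    then show ?thesis
      using spectrally_positive.laplace_hit_area[OF shifted xy, of 1 m] laplace_hit_area[OF x0, of 1] by (simp add: Wy_def)
  qed
  have "y \<longlonglongrightarrow> 0" unfolding y_def by real_asymp
  then have "(\<lambda>m. complex_of_real ((x - y m) * (p * 1) powr (1 / p))) \<longlonglongrightarrow> of_real ((x - 0) * (p * 1) powr (1 / p))"
    by (intro tendsto_of_real tendsto_mult tendsto_diff tendsto_const)
  moreover have "isCont airy (of_real ((x - 0) * (p * 1) powr (1 / p)))" using airy_has_derivative DERIV_isCont by blast
  ultimately have "(\<lambda>m. airy (of_real ((x - y m) * (p * 1) powr (1 / p)))) \<longlonglongrightarrow> airy (of_real ((x - 0) * (p * 1) powr (1 / p)))"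
    by (rule isCont_tendsto_compose[rotated])
  then have "(\<lambda>m. \<integral>\<omega>. g m \<omega> \<partial>M) \<longlonglongrightarrow> Re (airy (of_real ((x - 0) * (p * 1) powr (1 / p))) / airy 0) - Re (airy (of_real (x * (p * 1) powr (1 / p))) / airy 0)"
    unfolding Eg using airy_coeff_0(2) by (intro tendsto_diff tendsto_Re tendsto_divide tendsto_const) (auto simp: airy_0_airy_coeff)
  then have lim: "(\<lambda>m. \<integral>\<omega>. g m \<omega> \<partial>M) \<longlonglongrightarrow> 0" by simp
  have sandwich: "AE \<omega> in M. (\<forall>m. Wy m \<omega> \<le> area_until_zero (\<lambda>t. L t \<omega>)) \<and> area_until_zero (\<lambda>t. L t \<omega>) \<le> hit_area \<omega>"
    using AE_hit[OF x0] AE_space by eventually_elim (use area_bounds[OF x0 _ _ y(1)] in \<open>auto simp: Wy_def\<close>)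
  then have gnn: "AE \<omega> in M. 0 \<le> g m \<omega>" for m
    by eventually_elim (auto simp: g_def intro: order_trans)
  have "(\<integral>\<^sup>+\<omega>. (INF m. ennreal (g m \<omega>)) \<partial>M) \<le> ennreal (\<integral>\<omega>. g m \<omega> \<partial>M)" for m
  proof -
    have "(\<integral>\<^sup>+\<omega>. (INF m. ennreal (g m \<omega>)) \<partial>M) \<le> (\<integral>\<^sup>+\<omega>. ennreal (g m \<omega>) \<partial>M)"
      by (intro nn_integral_mono INF_lower) simp
    also have "\<dots> = ennreal (\<integral>\<omega>. g m \<omega> \<partial>M)"
      by (rule nn_integral_eq_integral[OF _ gnn]) (unfold g_def, rule Bochner_Integration.integrable_diff[OF iWy iW])
    finally show ?thesis .
  qed
  moreover have "(\<lambda>m. ennreal (\<integral>\<omega>. g m \<omega> \<partial>M)) \<longlonglongrightarrow> ennreal 0" using lim by (rule tendsto_ennrealI)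
  ultimately have "(\<integral>\<^sup>+\<omega>. (INF m. ennreal (g m \<omega>)) \<partial>M) \<le> ennreal 0" by (intro LIMSEQ_le_const) auto
  then have "(\<integral>\<^sup>+\<omega>. (INF m. ennreal (g m \<omega>)) \<partial>M) = 0" by simp
  \<comment> \<open>Working with the infimum over \<open>m\<close> keeps the integrals on measurable
    functions; \<open>area_until_zero\<close>, whose measurability is not established at this point,
    enters only through the pointwise sandwich.\<close>
  then have "AE \<omega> in M. (INF m. ennreal (g m \<omega>)) = 0"
    by (subst (asm) nn_integral_0_iff_AE) (auto simp: g_def)
  with sandwich show ?thesis
  proof eventually_elim
    case (elim \<omega>)
    let ?a = "area_until_zero (\<lambda>t. L t \<omega>)"
    have "ennreal (exp (- ?a) - exp (- hit_area \<omega>)) \<le> (INF m. ennreal (g m \<omega>))"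
      by (intro INF_greatest ennreal_leI) (use elim in \<open>simp add: g_def\<close>)
    then have "exp (- ?a) - exp (- hit_area \<omega>) \<le> 0" using elim by (simp add: ennreal_eq_0_iff)
    then show ?case using elim by simp
  qed
qed

end

section \<open>Passage from the hypotheses to the law of the area up to the first zero\<close>

text \<open>Independence says that the joint law is a product, and laws do not see null sets. The
  empty family is separate because that characterisation is for nonempty index sets.\<close>

lemma (in prob_space) indep_vars_cong_AE:
  assumes X: "indep_vars M' X I" and Y: "\<And>i. i \<in> I \<Longrightarrow> Y i \<in> measurable M (M' i)"
    and eq: "\<And>i. i \<in> I \<Longrightarrow> AE \<omega> in M. X i \<omega> = Y i \<omega>" and I: "finite I"
  shows "indep_vars M' Y I"
proof (cases "I = {}")
  case False
  have Xm: "X i \<in> measurable M (M' i)" if "i \<in> I" for i using X that by (auto simp: indep_vars_def)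
  have "AE \<omega> in M. \<forall>i\<in>I. X i \<omega> = Y i \<omega>" using I eq by (subst AE_finite_all) auto
  then have ae: "AE \<omega> in M. (\<lambda>i\<in>I. Y i \<omega>) = (\<lambda>i\<in>I. X i \<omega>)" by eventually_elim auto
  have "distr M (PiM I M') (\<lambda>\<omega>. \<lambda>i\<in>I. Y i \<omega>) = distr M (PiM I M') (\<lambda>\<omega>. \<lambda>i\<in>I. X i \<omega>)"
    by (intro distr_cong_AE refl ae measurable_restrict Xm Y)
  also have "\<dots> = PiM I (\<lambda>i. distr M (M' i) (X i))"
    using X indep_vars_iff_distr_eq_PiM'[OF False, where M' = M' and X = X] Xm by simp
  also have "\<dots> = PiM I (\<lambda>i. distr M (M' i) (Y i))"
    by (intro PiM_cong refl distr_cong_AE) (use eq Xm Y in auto)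
  finally show ?thesis using indep_vars_iff_distr_eq_PiM'[OF False, where M' = M' and X = Y] Y by simp
next
  case True
  then show ?thesis by (auto simp: indep_vars_def indep_sets_def)
qed

lemma has_bochner_integral_cong_distr:
  fixes f :: "'b \<Rightarrow> real"
  assumes eq: "distr M N X = distr M' N Y" and X: "X \<in> measurable M N" and Y: "Y \<in> measurable M' N"
    and f: "f \<in> borel_measurable N" and i: "has_bochner_integral M' (\<lambda>\<omega>. f (Y \<omega>)) v"
  shows "has_bochner_integral M (\<lambda>\<omega>. f (X \<omega>)) v"
  using i integrable_distr_eq[OF X f] integrable_distr_eq[OF Y f] integral_distr[OF X f] integral_distr[OF Y f]
  by (simp add: has_bochner_integral_iff eq)

text \<open>Stationarity moves the increment to time 0, self-similarity read at the coordinate 1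
  turns it into \<open>h powr (1 / \<alpha>)\<close> times the unit increment, and the normalisation
  is used at \<open>q * h powr (1 / \<alpha>)\<close>.\<close>

lemma strictly_stable_laplace:
  assumes L: "spectrally_positive_stable_from \<alpha> M x L" and \<alpha>: "\<alpha> > 0" and s: "s \<ge> 0" and h: "h > 0" and q: "q > 0"
  shows "has_bochner_integral M (\<lambda>\<omega>. exp (- q * (L (s + h) \<omega> - L s \<omega>))) (exp (h * q powr \<alpha>))"
proof -
  have rv[measurable]: "L t \<in> borel_measurable M" if "t \<ge> 0" for t
    using L that by (simp add: spectrally_positive_stable_from_def levy_process_def)
  have m: "L (s + h) \<in> borel_measurable M" "L s \<in> borel_measurable M" "L h \<in> borel_measurable M"
    "L 0 \<in> borel_measurable M" "L 1 \<in> borel_measurable M"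
    using s h by (auto intro: rv)
  note [measurable] = m
  define r where "r = h powr (1 / \<alpha>)"
  have "distr M borel (\<lambda>\<omega>. L (s + h) \<omega> - L s \<omega>) = distr M borel (\<lambda>\<omega>. L h \<omega> - L 0 \<omega>)"
    using L s h by (simp add: spectrally_positive_stable_from_def levy_process_def)
  also have "\<dots> = distr M borel (\<lambda>\<omega>. r * (L 1 \<omega> - L 0 \<omega>))"
  proof -
    let ?P = "Pi\<^sub>M {0..} (\<lambda>_. borel) :: (real \<Rightarrow> real) measure"
    have c: "(\<lambda>f. f 1) \<in> measurable ?P borel" by (rule measurable_component_singleton) simp
    have m1: "(\<lambda>\<omega>. \<lambda>t\<in>{0..}. L (h * t) \<omega> - L 0 \<omega>) \<in> measurable M ?P"
      using h by (intro measurable_restrict borel_measurable_diff rv) auto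
    have m2: "(\<lambda>\<omega>. \<lambda>t\<in>{0..}. r * (L t \<omega> - L 0 \<omega>)) \<in> measurable M ?P"
      by (intro measurable_restrict borel_measurable_times borel_measurable_diff rv) auto
    have "distr M ?P (\<lambda>\<omega>. \<lambda>t\<in>{0..}. L (h * t) \<omega> - L 0 \<omega>) = distr M ?P (\<lambda>\<omega>. \<lambda>t\<in>{0..}. r * (L t \<omega> - L 0 \<omega>))"
      using L h by (simp add: spectrally_positive_stable_from_def strictly_stable_def r_def)
    then have "distr (distr M ?P (\<lambda>\<omega>. \<lambda>t\<in>{0..}. L (h * t) \<omega> - L 0 \<omega>)) borel (\<lambda>f. f 1)
        = distr (distr M ?P (\<lambda>\<omega>. \<lambda>t\<in>{0..}. r * (L t \<omega> - L 0 \<omega>))) borel (\<lambda>f. f 1)" by simp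
    then show ?thesis by (simp add: distr_distr[OF c m1] distr_distr[OF c m2] comp_def)
  qed
  finally have d: "distr M borel (\<lambda>\<omega>. L (s + h) \<omega> - L s \<omega>) = distr M borel (\<lambda>\<omega>. r * (L 1 \<omega> - L 0 \<omega>))" .
  have "has_bochner_integral M (\<lambda>\<omega>. exp (- (q * r) * (L 1 \<omega> - L 0 \<omega>))) (exp ((q * r) powr \<alpha>))"
    using L q by (simp add: spectrally_positive_stable_from_def r_def)
  also have "(q * r) powr \<alpha> = h * q powr \<alpha>"
    using q h \<alpha> by (simp add: r_def powr_mult powr_powr)
  finally have "has_bochner_integral M (\<lambda>\<omega>. exp (- q * (r * (L 1 \<omega> - L 0 \<omega>)))) (exp (h * q powr \<alpha>))"
    by (simp only: minus_mult_left[symmetric] mult.assoc)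
  then show ?thesis
    by (rule has_bochner_integral_cong_distr[OF d, where f = "\<lambda>u. exp (- q * u)", rotated -1]) measurable
qed

lemma cadlag_const: "cadlag (\<lambda>_. c)"
  by (auto simp: cadlag_def)

lemma no_negative_jumps_const: "no_negative_jumps (\<lambda>_. c)"
  unfolding no_negative_jumps_def by (metis order_refl tendsto_const tendsto_unique trivial_limit_at_left_real)

text \<open>On a null set containing all exceptional outcomes the path is replaced by the constant
  starting value, which trivially has the required path properties. The laws of the increments are
  unaffected.\<close>

lemma spectrally_positive_version:
  assumes L: "spectrally_positive_stable_from \<alpha> M x L" and \<alpha>: "1 < \<alpha>" "\<alpha> < 2"
  obtains L' where "spectrally_positive M (\<alpha> + 1) x L'" "AE \<omega> in M. \<forall>t. L' t \<omega> = L t \<omega>"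
proof -
  interpret prob_space M using L by (simp add: spectrally_positive_stable_from_def levy_process_def)
  have "AE \<omega> in M. cadlag (\<lambda>t. L t \<omega>) \<and> no_negative_jumps (\<lambda>t. L t \<omega>) \<and> L 0 \<omega> = x"
    using L by (auto simp: spectrally_positive_stable_from_def levy_process_def)
  then obtain N where N: "{\<omega> \<in> space M. \<not> (cadlag (\<lambda>t. L t \<omega>) \<and> no_negative_jumps (\<lambda>t. L t \<omega>) \<and> L 0 \<omega> = x)} \<subseteq> N"
    "N \<in> null_sets M" unfolding eventually_ae_filter by blast
  define L' where "L' t \<omega> = (if \<omega> \<in> N then x else L t \<omega>)" for t \<omega>
  have Ns: "N \<in> sets M" using N(2) by auto
  have ae: "AE \<omega> in M. \<forall>t. L' t \<omega> = L t \<omega>"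
    using AE_not_in[OF N(2)] by eventually_elim (simp add: L'_def)
  have rv: "L t \<in> borel_measurable M" if "t \<ge> 0" for t
    using L that by (simp add: spectrally_positive_stable_from_def levy_process_def)
  have rv': "L' t \<in> borel_measurable M" if "t \<ge> 0" for t
    unfolding L'_def using rv[OF that] Ns by (intro measurable_If_set) (auto intro: sets.Int)
  have "spectrally_positive M (\<alpha> + 1) x L'"
  proof unfold_locales
    fix \<omega> assume \<omega>: "\<omega> \<in> space M"
    show "L' 0 \<omega> = x" "cadlag (\<lambda>t. L' t \<omega>)" "no_negative_jumps (\<lambda>t. L' t \<omega>)"
      using N(1) \<omega> by (cases "\<omega> \<in> N"; auto simp: L'_def cadlag_const no_negative_jumps_const)+
  next
    fix t :: "nat \<Rightarrow> real" and n assume t: "0 \<le> t 0" "incseq t"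
    then have t0: "0 \<le> t i" for i using incseqD[OF t(2), of 0 i] by simp
    show "indep_vars (\<lambda>_. borel) (\<lambda>i \<omega>. L' (t (Suc i)) \<omega> - L' (t i) \<omega>) {..<n}"
    proof (rule indep_vars_cong_AE)
      show "indep_vars (\<lambda>_. borel) (\<lambda>i \<omega>. L (t (Suc i)) \<omega> - L (t i) \<omega>) {..<n}"
        using L t by (simp add: spectrally_positive_stable_from_def levy_process_def)
      show "AE \<omega> in M. L (t (Suc i)) \<omega> - L (t i) \<omega> = L' (t (Suc i)) \<omega> - L' (t i) \<omega>" for i
        using ae by eventually_elim simp
    qed (auto intro!: borel_measurable_diff rv' t0)
  next
    fix s h q :: real assume s: "0 \<le> s" "0 < h" "0 < q"
    have "has_bochner_integral M (\<lambda>\<omega>. exp (- q * (L (s + h) \<omega> - L s \<omega>))) (exp (h * q powr \<alpha>))"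
      by (rule strictly_stable_laplace[OF L]) (use s \<alpha> in auto)
    moreover have "has_bochner_integral M (\<lambda>\<omega>. exp (- q * (L (s + h) \<omega> - L s \<omega>))) (exp (h * q powr \<alpha>))
        \<longleftrightarrow> has_bochner_integral M (\<lambda>\<omega>. exp (- q * (L' (s + h) \<omega> - L' s \<omega>))) (exp (h * q powr \<alpha>))"
    proof (rule has_bochner_integral_cong_AE)
      have "L (s + h) \<in> borel_measurable M" "L s \<in> borel_measurable M" "L' (s + h) \<in> borel_measurable M" "L' s \<in> borel_measurable M"
        using s by (auto intro!: rv rv')
      note [measurable] = this
      show "(\<lambda>\<omega>. exp (- q * (L (s + h) \<omega> - L s \<omega>))) \<in> borel_measurable M"
        "(\<lambda>\<omega>. exp (- q * (L' (s + h) \<omega> - L' s \<omega>))) \<in> borel_measurable M" by measurable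
      show "AE \<omega> in M. exp (- q * (L (s + h) \<omega> - L s \<omega>)) = exp (- q * (L' (s + h) \<omega> - L' s \<omega>))"
        using ae by eventually_elim simp
    qed
    ultimately show "has_bochner_integral M (\<lambda>\<omega>. exp (- q * (L' (s + h) \<omega> - L' s \<omega>))) (exp (h * q powr (\<alpha> + 1 - 1)))" by simp
  qed (use \<alpha> in \<open>auto intro: rv'\<close>)
  then show thesis using ae by (rule that)
qed

text \<open>A function equal almost everywhere to a measurable one is measurable for the completion
  and has the same law. This carries the result from \<open>hit_area\<close> over to
  \<open>area_until_zero\<close>.\<close>

lemma distributed_completion_AE:
  assumes f: "f \<in> measurable M N" and eq: "AE \<omega> in M. h \<omega> = f \<omega>" and sp: "\<And>\<omega>. \<omega> \<in> space M \<Longrightarrow> h \<omega> \<in> space N"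
  shows "h \<in> measurable (completion M) N" "distr (completion M) N h = distr M N f"
proof -
  have eq': "AE \<omega> in completion M. h \<omega> = f \<omega>" using eq by (rule AE_completion)
  have f': "f \<in> measurable (completion M) N" using f by (rule measurable_completion)
  show h: "h \<in> measurable (completion M) N"
  proof (rule measurableI)
    fix B assume B: "B \<in> sets N"
    show "h -` B \<inter> space (completion M) \<in> sets (completion M)"
    proof (rule completion.in_sets_AE)
      show "f -` B \<inter> space (completion M) \<in> sets (completion M)" using f' B by (rule measurable_sets)
      show "AE \<omega> in completion M. \<omega> \<in> f -` B \<inter> space (completion M) \<longleftrightarrow> \<omega> \<in> h -` B \<inter> space (completion M)"
        using eq' by eventually_elim simp
    qed simp
  qed (simp add: sp)
  have "distr (completion M) N h = distr (completion M) N f"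
    by (intro distr_cong_AE refl eq' h f')
  then show "distr (completion M) N h = distr M N f" using f by (simp add: distr_completion)
qed

text \<open>The Gamma value in front of the series is the reciprocal of \<open>airy_coeff 0\<close>,
  since \<open>(p - 1) / p = 1 - 1 / p\<close>.\<close>

lemma (in stable_airy) area_density_eq_dens:
  assumes t: "t > 0"
  shows "summable (area_density_term (p - 1) t)" "area_density (p - 1) t = dens t"
proof -
  have s: "area_density_term (p - 1) t sums (airy_coeff 0 * dens t)"
    using dens_sums[OF t] by (simp add: area_density_term_def[abs_def])
  from s show "summable (area_density_term (p - 1) t)" by (rule sums_summable)
  have "Gamma (1 - 1 / p) \<noteq> 0" using airy_coeff_0(2) unfolding airy_coeff_0(1) rGamma_inverse_Gamma by auto
  then have G: "Gamma ((p - 1) / p) * airy_coeff 0 = 1"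
    using p_pos by (simp add: airy_coeff_0(1) rGamma_inverse_Gamma diff_divide_distrib)
  show "area_density (p - 1) t = dens t"
    using G by (simp add: area_density_def sums_unique[OF s, symmetric] mult.assoc[symmetric])
qed

text \<open>\<open>ennreal\<close> sends negative numbers to 0, so nonnegativity is stated as well:
  together with summability it ensures that the series itself, and not a truncation of it, is the
  density.\<close>

theorem corollary3:
  fixes \<alpha> :: real and M :: "'a measure" and L :: "real \<Rightarrow> 'a \<Rightarrow> real"
  assumes "1 < \<alpha>" and "\<alpha> < 2"
    and "spectrally_positive_stable_from \<alpha> M 1 L"
  shows "(\<forall>x>0. summable (area_density_term \<alpha> x)) \<and>
         (\<forall>x>0. 0 \<le> area_density \<alpha> x) \<and>
         distributed (completion M) lborel (\<lambda>\<omega>. area_until_zero (\<lambda>t. L t \<omega>))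
           (\<lambda>x. ennreal (area_density \<alpha> x * indicator {0<..} x))"
proof -
  obtain L' where "spectrally_positive M (\<alpha> + 1) 1 L'" and eq: "AE \<omega> in M. \<forall>t. L' t \<omega> = L t \<omega>"
    using spectrally_positive_version[OF assms(3,1,2)] .
  then interpret spectrally_positive M "\<alpha> + 1" 1 L' by simp
  note g = area_density_eq_dens[simplified]
  have dens: "(\<lambda>x. ennreal (area_density \<alpha> x * indicator {0<..} x)) = (\<lambda>t. ennreal (indicator {0<..} t *\<^sub>R dens t))"
    by (rule ext) (simp add: g(2) indicator_def)
  have "AE \<omega> in M. area_until_zero (\<lambda>t. L t \<omega>) = hit_area \<omega>"
    using area_eq_hit_area[OF refl] eq by eventually_elim simp
  note C = distributed_completion_AE[OF hit_area_measurable this, simplified]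
  have "distributed (completion M) lborel (\<lambda>\<omega>. area_until_zero (\<lambda>t. L t \<omega>))
           (\<lambda>x. ennreal (area_density \<alpha> x * indicator {0<..} x))"
    unfolding distributed_def dens
  proof (intro conjI)
    have "distr (completion M) lborel (\<lambda>\<omega>. area_until_zero (\<lambda>t. L t \<omega>)) = distr (completion M) borel (\<lambda>\<omega>. area_until_zero (\<lambda>t. L t \<omega>))"
      by (rule distr_cong) auto
    then show "distr (completion M) lborel (\<lambda>\<omega>. area_until_zero (\<lambda>t. L t \<omega>)) = density lborel (\<lambda>t. ennreal (indicator {0<..} t *\<^sub>R dens t))"
      using C(2) hit_area_density[OF refl] by simp
    have "(\<lambda>t. indicator {0<..} t *\<^sub>R dens t) \<in> borel_measurable borel"
      by (rule borel_measurable_continuous_on_indicator) (auto intro!: continuous_at_imp_continuous_on dens_continuous)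
    then show "(\<lambda>t. ennreal (indicator {0<..} t *\<^sub>R dens t)) \<in> borel_measurable lborel"
      unfolding measurable_lborel2 by (rule measurable_compose[OF _ measurable_ennreal])
    show "(\<lambda>\<omega>. area_until_zero (\<lambda>t. L t \<omega>)) \<in> measurable (completion M) lborel" using C(1) by simp
  qed
  then show ?thesis using g dens_nonneg[OF refl] by simp
qed

end
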